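(* Let $\eta$ be such that $$\eta\ge\max_{T\in\mathcal{T}_h,\,F\in\mathcal{F}_T}\frac{h_T}{d_{TF}},\qquad\eta\ge\max_{F\in\mathcal{F}_h^{\rm i},\,\mathcal{T}_F=\{T,T'\}}\frac{d_{TF}}{d_{T'F}},\qquad\eta\ge\max_{F\in\mathcal{F}_h}\sum_{G\in\mathcal{G}_F}\theta_F^G|\mathcal{A}_G^{-1}|,$$ where $|\mathcal{A}_G^{-1}|$ is the induced Euclidean norm of $\mathcal{A}_G^{-1}$. Assume that the solution $u\in H^1_0(\Omega)$ of $(\boldsymbol{K}\nabla u,\nabla v)=(f,v)$ for all $v\in H^1_0(\Omega)$ belongs to $C(\overline\Omega)$ and that $u_{|\Omega_i}\in C^2(\overline{\Omega_i})$ for each $i\in\{1,\ldots,N_\Omega\}$. Assume that the MPFA-L/G fluxes $(\mathfrak{F}^c_{T,F})_{T\in\mathcal{T}_h,F\in\mathcal{F}_T}$ (defined in the context) satisfy, for some $\gamma>0$, the coercivity property: for all $v_h\in X_h^c$, $$\sum_{F\in\mathcal{F}_h^{\rm i},\,\mathcal{T}_F=\{T,T'\}}\mathfrak{F}^c_{T,F}(v_h)(v_T-v_{T'})+\sum_{F\in\mathcal{F}_h^{\rm b},\,\mathcal{T}_F=\{T\}}\mathfrak{F}^c_{T,F}(v_h)v_T\ge\gamma\|v_h\|_{1,\mathcal{T}_h,c}^2,$$ and let $u_h\in X_h^c$ be the solution of the MPFA-L/G scheme $$\sum_{F\in\mathcal{F}_T}\mathfrak{F}^c_{T,F}(u_h)=\int_Tf\quad\forall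 T\in\mathcal{T}_h.$$ Then $$\|u_h-I_h^cu\|_{1,\mathcal{T}_h,c}\lesssim\gamma^{-1}\|u\|_{C^2}h,$$ where $\|u\|_{C^2}=\max_{i=1,\ldots,N_\Omega}\|u\|_{C^2(\overline{\Omega_i})}$ and the hidden constant in $\lesssim$ depends only on $\Omega$, $\eta$ and $\boldsymbol{K}$.
   Context: $\Omega\subset\mathbb{R}^d$ ($d\ge1$) is an open bounded connected polytopal domain, $f\in L^2(\Omega)$, $(\cdot,\cdot)$ is the $L^2(\Omega)$ (scalar or vector) inner product. $\boldsymbol{K}:\Omega\to\mathbb{R}^{d\times d}$ is symmetric, uniformly elliptic, and piecewise constant on a finite partition $\{\Omega_i:1\le i\le N_\Omega\}$ of $\Omega$ into polytopes. Mesh. $\mathcal{M}_h=(\mathcal{T}_h,\mathcal{F}_h)$ is a polytopal mesh of $\Omega$: $\mathcal{T}_h$ is the set of (open, disjoint) cells, $\mathcal{F}_h=\mathcal{F}_h^{\rm i}\cup\mathcal{F}_h^{\rm b}$ the set of hyperplanar internal and boundary faces, $h_T$ the diameter of $T$, $h=\max_Th_T$, $\mathcal{F}_T$ the set of faces on $\partial T$, $\mathcal{T}_F$ the set of the one or two cells sharing $F$, $\boldsymbol{n}_{TF}$ the unit normal to $F$ pointing out of $T$. The mesh belongs to a regular family: there is $\varrho\in(0,1)$ (regularity factor), independent of $h$, such that $\mathcal{T}_h$ admits a matching simplicial submesh with $\varrho h_S\le r_S$ for each simplex $S$ (diameter $h_S$, inradius $r_S$) and $\varrho h_T\le h_S$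 if $S\subset T$; hidden constants may, as everywhere in the paper, depend on this regularity factor. Each cell lies in a unique $\Omega_i$, and $\boldsymbol{K}_T=\boldsymbol{K}_{|T}$ is constant with smallest eigenvalue $\underline{\lambda}_T$. Unknowns. $\boldsymbol{x}_T$ is a chosen point in each cell $T$ and $\boldsymbol{x}_F$ is the center of mass of the face $F$; $|F|$ is the $(d-1)$-dimensional measure of $F$; $d_{TF}=(\boldsymbol{x}_F-\boldsymbol{x}_T)\cdot\boldsymbol{n}_{TF}>0$ is the orthogonal distance between $\boldsymbol{x}_T$ and $F$. $X_h^c=\{v_h=(v_T)_{T\in\mathcal{T}_h}:v_T\in\mathbb{R}\}$ with norm $\|v_h\|_{1,\mathcal{T}_h,c}=\big(\sum_{F\in\mathcal{F}_h}\underline{\lambda}_F|F|d_F(\frac{v_T-v_{T'}}{d_F})^2\big)^{1/2}$, where for $F\in\mathcal{F}_h^{\rm i}$ with $\mathcal{T}_F=\{T,T'\}$, $\underline{\lambda}_F=\min(\underline{\lambda}_T,\underline{\lambda}_{T'})$ and $d_F=d_{TF}+d_{T'F}$, and for $F\in\mathcal{F}_h^{\rm b}$ with $\mathcal{T}_F=\{T\}$, $\underline{\lambda}_F=\underline{\lambda}_T$, $d_F=d_{TF}$, $v_{T'}=0$. $I_h^cu=(u(\boldsymbol{x}_T))_{T\in\mathcal{T}_h}$. MPFA-L/G fluxes. A group of faces $G$ is any set of $d$ faces that belong to the same cell and share the same vertex; for each group $G$ one fixes a cell $T_G$ whose boundary contains all faces of $G$. Let $\mathcal{T}_G$ be the set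 of cells having at least one face in $G$. Group gradients $(\nabla_{\mathcal D}v_h)_T^{G,F}\in\mathbb{R}^d$, for $T\in\mathcal{T}_G$ and $F\in\mathcal{F}_T\cap G$, are defined by imposing: the gradients attached to $T_G$ do not depend on the face, $(\nabla_{\mathcal D}v_h)_{T_G}^{G,F}=(\nabla_{\mathcal D}v_h)_{T_G}^{G}$ for all $F\in G$; and for every $F\in G$, the affine functions having these gradients on the cells adjacent to $F$ and taking the values $v_T$ at $\boldsymbol{x}_T$ have continuous values and continuous normal fluxes (through $\boldsymbol{K}$) across $F$ if $F$ is internal, and the affine function on $T_G$ vanishes at $\boldsymbol{x}_F$ if $F$ is a boundary face. Equivalently, $\mathcal{A}_G(\nabla_{\mathcal D}v_h)_{T_G}^G=\mathcal{B}_G(v_h)$, where $\mathcal{A}_G\in\mathbb{R}^{d\times d}$ has one row per face $F\in G$ and $\mathcal{B}_G(v_h)\in\mathbb{R}^d$ one entry per face, given by: for $F\in G\cap\mathcal{F}_h^{\rm i}$, with $T$ the cell on the other side of $F$ from $T_G$, row $\big(\frac{\boldsymbol{K}_T\boldsymbol{n}_{TF}\cdot\boldsymbol{n}_{TF}}{d_{TF}}(\boldsymbol{x}_T-\boldsymbol{x}_{T_G})+\boldsymbol{K}_{T_G}\boldsymbol{n}_{T_GF}+\boldsymbol{K}_T\boldsymbol{n}_{TF}\big)^t$ and entry $\frac{\boldsymbol{K}_T\boldsymbol{n}_{TF}\cdot\boldsymbol{n}_{TF}}{d_{TF}}(v_T-v_{T_G})$; for $F\in G\cap\mathcal{F}_h^{\rm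 b}$, row $\big(\frac{\boldsymbol{K}_{T_G}\boldsymbol{n}_{T_GF}\cdot\boldsymbol{n}_{T_GF}}{d_{T_GF}}(\boldsymbol{x}_F-\boldsymbol{x}_{T_G})\big)^t$ and entry $\frac{\boldsymbol{K}_{T_G}\boldsymbol{n}_{T_GF}\cdot\boldsymbol{n}_{T_GF}}{d_{T_GF}}(-v_{T_G})$. For the other cell $T$ of an internal face $F\in G$, continuity of values gives $(\nabla_{\mathcal D}v_h)_T^{G,F}=(\nabla_{\mathcal D}v_h)_{T_G}^{G}+\frac{(\nabla_{\mathcal D}v_h)_{T_G}^{G}\cdot(\boldsymbol{x}_T-\boldsymbol{x}_{T_G})-(v_T-v_{T_G})}{d_{TF}}\boldsymbol{n}_{TF}$. For a face $F$, $\mathcal{G}_F$ is the set of groups $G$ containing $F$ such that $\mathcal{A}_G$ is invertible; it is assumed that $\mathcal{G}_F\ne\emptyset$ for all $F\in\mathcal{F}_h$. The fluxes are $$\mathfrak{F}^c_{T,F}(v_h)=\sum_{G\in\mathcal{G}_F}\theta_F^G\,\mathfrak{F}^{c,G}_{T,F}(v_h),\qquad\mathfrak{F}^{c,G}_{T,F}(v_h)=-|F|\boldsymbol{K}_T(\nabla_{\mathcal D}v_h)_T^{G,F}\cdot\boldsymbol{n}_{TF},$$ where $(\theta_F^G)_{G\in\mathcal{G}_F}$ are the coefficients of a convex combination (the L-scheme corresponds to one non-zero coefficient per face, the G-scheme to general coefficients). *)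

theory Defs
  imports "HOL-Analysis.Analysis"
begin

section \<open>Derivatives, regularity classes and Sobolev spaces\<close>

text \<open>The list of indices is a multi-index: \<open>iter_partial [i, j] f\<close> is
  \<open>\<partial>\<^sub>i \<partial>\<^sub>j f\<close>. Only the values of \<open>f\<close> near \<open>x\<close> matter.\<close>

primrec iter_partial :: "'n::finite list \<Rightarrow> (real^'n \<Rightarrow> real) \<Rightarrow> real^'n \<Rightarrow> real" where
  "iter_partial [] f = f"
| "iter_partial (i # is) f = (\<lambda>x. frechet_derivative (iter_partial is f) (at x) (axis i 1))"

definition grad :: "(real^'n::finite \<Rightarrow> real) \<Rightarrow> real^'n \<Rightarrow> real^'n" where
  "grad f x = (\<chi> i. iter_partial [i] f x)"

text \<open>\<open>C\<^sup>k\<close> regularity on an open set.\<close>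

definition Ck_on :: "nat \<Rightarrow> (real^'n::finite) set \<Rightarrow> (real^'n \<Rightarrow> real) \<Rightarrow> bool" where
  "Ck_on k S f \<longleftrightarrow>
     (\<forall>is. length is < k \<longrightarrow> (\<forall>x\<in>S. iter_partial is f differentiable at x)) \<and>
     (\<forall>is. length is \<le> k \<longrightarrow> continuous_on S (iter_partial is f))"

text \<open>\<open>f\<close>, restricted to the open set \<open>S\<close>, is in \<open>C\<^sup>k\<close> of the closure of \<open>S\<close>:
  all derivatives up to order \<open>k\<close> extend continuously to the closure. By this continuity
  the supremum over \<open>S\<close> in the norm is the one over the closure.\<close>

definition Ck_closure :: "nat \<Rightarrow> (real^'n::finite) set \<Rightarrow> (real^'n \<Rightarrow> real) \<Rightarrow> bool" where
  "Ck_closure k S f \<longleftrightarrow> Ck_on k S f \<and>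
     (\<forall>is. length is \<le> k \<longrightarrow>
        (\<exists>g. continuous_on (closure S) g \<and> (\<forall>x\<in>S. g x = iter_partial is f x)))"

definition Ck_norm :: "nat \<Rightarrow> (real^'n::finite) set \<Rightarrow> (real^'n \<Rightarrow> real) \<Rightarrow> real" where
  "Ck_norm k S f = Sup {\<bar>iter_partial is f x\<bar> | is x. length is \<le> k \<and> x \<in> S}"

definition test_function :: "(real^'n::finite) set \<Rightarrow> (real^'n \<Rightarrow> real) \<Rightarrow> bool" where
  "test_function \<Omega> \<phi> \<longleftrightarrow> (\<forall>k. Ck_on k UNIV \<phi>) \<and>
     compact (closure {x. \<phi> x \<noteq> 0}) \<and> closure {x. \<phi> x \<noteq> 0} \<subseteq> \<Omega>"

definition L2_on :: "(real^'n::finite) set \<Rightarrow> (real^'n \<Rightarrow> 'b::euclidean_space) \<Rightarrow> bool" where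
  "L2_on \<Omega> f \<longleftrightarrow> f \<in> borel_measurable (lebesgue_on \<Omega>) \<and>
     integrable (lebesgue_on \<Omega>) (\<lambda>x. (norm (f x))\<^sup>2)"

definition has_weak_gradient ::
    "(real^'n::finite) set \<Rightarrow> (real^'n \<Rightarrow> real) \<Rightarrow> (real^'n \<Rightarrow> real^'n) \<Rightarrow> bool" where
  "has_weak_gradient \<Omega> u g \<longleftrightarrow> (\<forall>\<phi> i. test_function \<Omega> \<phi> \<longrightarrow>
     (\<integral>x. u x * iter_partial [i] \<phi> x \<partial>(lebesgue_on \<Omega>)) = - (\<integral>x. g x $ i * \<phi> x \<partial>(lebesgue_on \<Omega>)))"

definition in_H1 :: "(real^'n::finite) set \<Rightarrow> (real^'n \<Rightarrow> real) \<Rightarrow> bool" where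
  "in_H1 \<Omega> u \<longleftrightarrow> L2_on \<Omega> u \<and> (\<exists>g. L2_on \<Omega> g \<and> has_weak_gradient \<Omega> u g)"

text \<open>The weak gradient is determined almost everywhere only; a representative is chosen.\<close>

definition weak_grad :: "(real^'n::finite) set \<Rightarrow> (real^'n \<Rightarrow> real) \<Rightarrow> real^'n \<Rightarrow> real^'n" where
  "weak_grad \<Omega> u = (SOME g. L2_on \<Omega> g \<and> has_weak_gradient \<Omega> u g)"

text \<open>\<open>H\<^sup>1\<^sub>0\<close> is the closure of the test functions in \<open>H\<^sup>1\<close>.\<close>

definition in_H10 :: "(real^'n::finite) set \<Rightarrow> (real^'n \<Rightarrow> real) \<Rightarrow> bool" where
  "in_H10 \<Omega> u \<longleftrightarrow> in_H1 \<Omega> u \<and>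
     (\<exists>\<phi>::nat \<Rightarrow> real^'n \<Rightarrow> real. (\<forall>n. test_function \<Omega> (\<phi> n)) \<and>
        (\<lambda>n. (\<integral>x. (\<phi> n x - u x)\<^sup>2 \<partial>(lebesgue_on \<Omega>)) +
             (\<integral>x. (norm (grad (\<phi> n) x - weak_grad \<Omega> u x))\<^sup>2 \<partial>(lebesgue_on \<Omega>)))
        \<longlonglongrightarrow> 0)"

section \<open>The domain and the diffusion problem\<close>

text \<open>A polytope is a (not necessarily convex) nonempty connected set that is the interior of a
  finite union of closed simplices; in particular it is open and bounded.\<close>

definition polytopal :: "(real^'n::finite) set \<Rightarrow> bool" where
  "polytopal D \<longleftrightarrow> D \<noteq> {} \<and> connected D \<and>
     (\<exists>\<S>. finite \<S> \<and> (\<forall>S\<in>\<S>. int CARD('n) simplex S) \<and> D = interior (\<Union>\<S>))"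

definition polytopal_partition :: "(real^'n::finite) set \<Rightarrow> (real^'n) set set \<Rightarrow> bool" where
  "polytopal_partition \<Omega> \<P> \<longleftrightarrow> finite \<P> \<and> (\<forall>P\<in>\<P>. polytopal P \<and> P \<subseteq> \<Omega>) \<and>
     pairwise disjnt \<P> \<and> closure \<Omega> = (\<Union>P\<in>\<P>. closure P)"

definition elliptic_tensor :: "(real^'n::finite) set \<Rightarrow> (real^'n \<Rightarrow> real^'n^'n) \<Rightarrow> bool" where
  "elliptic_tensor \<Omega> K \<longleftrightarrow> (\<forall>x\<in>\<Omega>. transpose (K x) = K x) \<and>
     (\<exists>l>0. \<exists>m. \<forall>x\<in>\<Omega>. \<forall>\<xi>. l * (norm \<xi>)\<^sup>2 \<le> (K x *v \<xi>) \<bullet> \<xi> \<and> (K x *v \<xi>) \<bullet> \<xi> \<le> m * (norm \<xi>)\<^sup>2)"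

definition weak_solution :: "(real^'n::finite) set \<Rightarrow> (real^'n \<Rightarrow> real^'n^'n) \<Rightarrow>
    (real^'n \<Rightarrow> real) \<Rightarrow> (real^'n \<Rightarrow> real) \<Rightarrow> bool" where
  "weak_solution \<Omega> K f u \<longleftrightarrow> in_H10 \<Omega> u \<and> (\<forall>v. in_H10 \<Omega> v \<longrightarrow>
     (\<integral>x. (K x *v weak_grad \<Omega> u x) \<bullet> weak_grad \<Omega> v x \<partial>(lebesgue_on \<Omega>)) =
     (\<integral>x. f x * v x \<partial>(lebesgue_on \<Omega>)))"

definition C2_norm :: "(real^'n::finite) set set \<Rightarrow> (real^'n \<Rightarrow> real) \<Rightarrow> real" where
  "C2_norm \<P> u = Max ((\<lambda>P. Ck_norm 2 P u) ` \<P>)"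

section \<open>Polytopal meshes\<close>

definition faces_of_cell :: "(real^'n::finite) set set \<Rightarrow> (real^'n) set \<Rightarrow> (real^'n) set set" where
  "faces_of_cell \<F> T = {F\<in>\<F>. F \<subseteq> frontier T}"

definition cells_of_face :: "(real^'n::finite) set set \<Rightarrow> (real^'n) set \<Rightarrow> (real^'n) set set" where
  "cells_of_face \<T> F = {T\<in>\<T>. F \<subseteq> frontier T}"

text \<open>\<open>n\<close> is the unit normal to \<open>F\<close> pointing out of \<open>T\<close>. The local condition is asked on a dense
  subset of the face only, since a nonconvex cell may touch its own face from the
  other side at exceptional points.\<close>

definition outward_normal :: "(real^'n::finite) set \<Rightarrow> (real^'n) set \<Rightarrow> real^'n \<Rightarrow> bool" where
  "outward_normal T F n \<longleftrightarrow> norm n = 1 \<and> (\<forall>x\<in>F. \<forall>y\<in>F. n \<bullet> x = n \<bullet> y) \<and>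
     F \<subseteq> closure {x\<in>F. \<exists>e>0. \<forall>t. 0 < t \<and> t < e \<longrightarrow> x - t *\<^sub>R n \<in> T \<and> x + t *\<^sub>R n \<notin> T}"

definition normal :: "(real^'n::finite) set \<Rightarrow> (real^'n) set \<Rightarrow> real^'n" where
  "normal T F = (THE n. outward_normal T F n)"

text \<open>Cells are open, faces are relatively open in a hyperplane.\<close>

definition polytopal_mesh ::
    "(real^'n::finite) set \<Rightarrow> (real^'n) set set \<Rightarrow> (real^'n) set set \<Rightarrow> bool" where
  "polytopal_mesh \<Omega> \<T> \<F> \<longleftrightarrow> polytopal_partition \<Omega> \<T> \<and>
     finite \<F> \<and> pairwise disjnt \<F> \<and>
     (\<forall>F\<in>\<F>. F \<noteq> {} \<and> (\<exists>n c. n \<noteq> 0 \<and> openin (top_of_set {x. n \<bullet> x = c}) F)) \<and>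
     (\<forall>T\<in>\<T>. frontier T = (\<Union>F\<in>faces_of_cell \<F> T. closure F)) \<and>
     (\<forall>T\<in>\<T>. \<forall>F\<in>faces_of_cell \<F> T. \<exists>n. outward_normal T F n) \<and>
     (\<forall>F\<in>\<F>. card (cells_of_face \<T> F) = 2 \<or>
             card (cells_of_face \<T> F) = 1 \<and> F \<subseteq> frontier \<Omega>)"

text \<open>The simplices of the submesh are closed; the simplicial faces are compared with the mesh
  faces through their relative interiors.\<close>

definition matching_simplicial_submesh ::
    "(real^'n::finite) set set \<Rightarrow> (real^'n) set set \<Rightarrow> (real^'n) set set \<Rightarrow> bool" where
  "matching_simplicial_submesh \<T> \<F> \<S> \<longleftrightarrow>
     finite \<S> \<and> (\<forall>S\<in>\<S>. int CARD('n) simplex S) \<and>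
     (\<forall>S\<in>\<S>. \<forall>S'\<in>\<S>. (S \<inter> S') face_of S) \<and>
     (\<forall>S\<in>\<S>. \<exists>!T. T \<in> \<T> \<and> S \<subseteq> closure T) \<and>
     (\<forall>T\<in>\<T>. closure T = \<Union>{S\<in>\<S>. S \<subseteq> closure T}) \<and>
     (\<forall>S\<in>\<S>. \<forall>\<sigma>. \<sigma> facet_of S \<longrightarrow>
        (\<forall>F\<in>\<F>. rel_interior \<sigma> \<inter> F = {} \<or> rel_interior \<sigma> \<subseteq> F))"

definition inradius :: "(real^'n::finite) set \<Rightarrow> real" where
  "inradius S = Sup {r. \<exists>x. ball x r \<subseteq> S}"

definition regular_mesh :: "real \<Rightarrow> (real^'n::finite) set set \<Rightarrow> (real^'n) set set \<Rightarrow> bool" where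
  "regular_mesh \<rho> \<T> \<F> \<longleftrightarrow> (\<exists>\<S>. matching_simplicial_submesh \<T> \<F> \<S> \<and>
     (\<forall>S\<in>\<S>. \<rho> * diameter S \<le> inradius S) \<and>
     (\<forall>T\<in>\<T>. \<forall>S\<in>\<S>. S \<subseteq> closure T \<longrightarrow> \<rho> * diameter T \<le> diameter S))"

definition mesh_size :: "(real^'n::finite) set set \<Rightarrow> real" where
  "mesh_size \<T> = Max (diameter ` \<T>)"

definition inner_faces :: "(real^'n::finite) set set \<Rightarrow> (real^'n) set set \<Rightarrow> (real^'n) set set" where
  "inner_faces \<T> \<F> = {F\<in>\<F>. card (cells_of_face \<T> F) = 2}"

definition boundary_faces :: "(real^'n::finite) set set \<Rightarrow> (real^'n) set set \<Rightarrow> (real^'n) set set" where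
  "boundary_faces \<T> \<F> = {F\<in>\<F>. card (cells_of_face \<T> F) = 1}"

text \<open>The cell on the other side of an internal face.\<close>

definition other_cell :: "(real^'n::finite) set set \<Rightarrow> (real^'n) set \<Rightarrow> (real^'n) set \<Rightarrow> (real^'n) set" where
  "other_cell \<T> F T = (THE T'. T' \<in> cells_of_face \<T> F \<and> T' \<noteq> T)"

text \<open>Writing the one or two cells of a face as \<open>T\<close> (and \<open>T'\<close>) picks an ordering of an unordered
  pair; this is the cell playing the role of \<open>T\<close>. The quantities below do not depend on
  the choice, because the fluxes are conservative.\<close>

definition first_cell :: "(real^'n::finite) set set \<Rightarrow> (real^'n) set \<Rightarrow> (real^'n) set" where
  "first_cell \<T> F = (SOME T. T \<in> cells_of_face \<T> F)"

text \<open>The \<open>(d-1)\<close>-dimensional Lebesgue measure on the hyperplane \<open>H\<close> that contains \<open>F\<close>: the image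
  of the Lebesgue measure of the slab of unit width centred at \<open>H\<close> under the orthogonal
  projection onto \<open>H\<close>. For \<open>d = 1\<close> it is the Dirac mass at the point \<open>F\<close>.\<close>

definition surface_measure :: "(real^'n::finite) set \<Rightarrow> (real^'n) measure" where
  "surface_measure F =
     (let n = (SOME n. norm n = 1 \<and> (\<forall>x\<in>F. \<forall>y\<in>F. n \<bullet> x = n \<bullet> y)); z = (SOME z. z \<in> F)
      in distr (restrict_space lborel {y. \<bar>n \<bullet> (y - z)\<bar> \<le> 1/2}) borel
               (\<lambda>y. y - (n \<bullet> (y - z)) *\<^sub>R n))"

definition face_area :: "(real^'n::finite) set \<Rightarrow> real" where
  "face_area F = measure (surface_measure F) F"

definition face_center :: "(real^'n::finite) set \<Rightarrow> real^'n" where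
  "face_center F = (1 / face_area F) *\<^sub>R (LINT x:F|surface_measure F. x)"

text \<open>A vertex of a face \<open>F\<close>: a point of its closure near which the closure is invariant under small
  translations in no direction. For a convex face these are the extreme points.\<close>

definition face_vertex :: "(real^'n::finite) set \<Rightarrow> real^'n \<Rightarrow> bool" where
  "face_vertex F s \<longleftrightarrow> s \<in> closure F \<and>
     \<not> (\<exists>v. v \<noteq> 0 \<and> (\<exists>e>0. \<forall>x\<in>ball s e. \<forall>t. \<bar>t\<bar> < e \<longrightarrow>
            (x \<in> closure F \<longleftrightarrow> x + t *\<^sub>R v \<in> closure F)))"

text \<open>A group: as many faces of one cell as the space dimension, sharing a vertex of the mesh.\<close>

definition face_group :: "(real^'n::finite) set set \<Rightarrow> (real^'n) set set \<Rightarrow> (real^'n) set set \<Rightarrow> bool" where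
  "face_group \<T> \<F> G \<longleftrightarrow> card G = CARD('n) \<and> (\<exists>T\<in>\<T>. G \<subseteq> faces_of_cell \<F> T) \<and>
     (\<exists>s. (\<exists>F\<in>\<F>. face_vertex F s) \<and> (\<forall>F\<in>G. s \<in> closure F))"

section \<open>MPFA-L/G fluxes\<close>

record ('n::finite) mpfa =
  cells :: "(real^'n) set set"
  faces :: "(real^'n) set set"
  cell_point :: "(real^'n) set \<Rightarrow> real^'n"            \<comment> \<open>\<open>x\<^sub>T\<close>\<close>
  group_cell :: "(real^'n) set set \<Rightarrow> (real^'n) set"  \<comment> \<open>\<open>T\<^sub>G\<close>\<close>
  weight :: "(real^'n) set \<Rightarrow> (real^'n) set set \<Rightarrow> real" \<comment> \<open>\<open>\<theta>\<^sub>F\<^sup>G\<close>\<close>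

definition cell_tensor :: "(real^'n::finite \<Rightarrow> real^'n^'n) \<Rightarrow> (real^'n) set \<Rightarrow> real^'n^'n" where
  "cell_tensor K T = (THE A. \<forall>x\<in>T. K x = A)"

definition cell_dist :: "('n::finite) mpfa \<Rightarrow> (real^'n) set \<Rightarrow> (real^'n) set \<Rightarrow> real" where
  "cell_dist M T F = (face_center F - cell_point M T) \<bullet> normal T F"

definition min_eigenvalue :: "real^'n^'n::finite \<Rightarrow> real" where
  "min_eigenvalue A = Min {l. \<exists>v. v \<noteq> 0 \<and> A *v v = l *\<^sub>R v}"

definition normal_conductivity ::
    "('n::finite) mpfa \<Rightarrow> (real^'n \<Rightarrow> real^'n^'n) \<Rightarrow> (real^'n) set \<Rightarrow> (real^'n) set \<Rightarrow> real" where
  "normal_conductivity M K T F =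
     ((cell_tensor K T *v normal T F) \<bullet> normal T F) / cell_dist M T F"

definition group_row ::
    "('n::finite) mpfa \<Rightarrow> (real^'n \<Rightarrow> real^'n^'n) \<Rightarrow> (real^'n) set set \<Rightarrow> (real^'n) set \<Rightarrow> real^'n" where
  "group_row M K G F = (let T0 = group_cell M G in
     if F \<in> inner_faces (cells M) (faces M) then
       let T = other_cell (cells M) F T0 in
         normal_conductivity M K T F *\<^sub>R (cell_point M T - cell_point M T0)
         + cell_tensor K T0 *v normal T0 F + cell_tensor K T *v normal T F
     else normal_conductivity M K T0 F *\<^sub>R (face_center F - cell_point M T0))"

definition group_entry :: "('n::finite) mpfa \<Rightarrow> (real^'n \<Rightarrow> real^'n^'n) \<Rightarrow>
    ((real^'n) set \<Rightarrow> real) \<Rightarrow> (real^'n) set set \<Rightarrow> (real^'n) set \<Rightarrow> real" where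
  "group_entry M K v G F = (let T0 = group_cell M G in
     if F \<in> inner_faces (cells M) (faces M) then
       let T = other_cell (cells M) F T0 in normal_conductivity M K T F * (v T - v T0)
     else normal_conductivity M K T0 F * (- v T0))"

text \<open>An arbitrary numbering of the faces of a group by the coordinate indices. Changing it permutes
  the rows of the system, which affects neither its solution nor the norm of the
  inverse of the matrix.\<close>

definition group_enum :: "(real^'n::finite) set set \<Rightarrow> 'n \<Rightarrow> (real^'n) set" where
  "group_enum G = (SOME e. bij_betw e UNIV G)"

definition group_matrix ::
    "('n::finite) mpfa \<Rightarrow> (real^'n \<Rightarrow> real^'n^'n) \<Rightarrow> (real^'n) set set \<Rightarrow> real^'n^'n" where
  "group_matrix M K G = (\<chi> i. group_row M K G (group_enum G i))"

definition group_rhs :: "('n::finite) mpfa \<Rightarrow> (real^'n \<Rightarrow> real^'n^'n) \<Rightarrow>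
    ((real^'n) set \<Rightarrow> real) \<Rightarrow> (real^'n) set set \<Rightarrow> real^'n" where
  "group_rhs M K v G = (\<chi> i. group_entry M K v G (group_enum G i))"

definition main_gradient :: "('n::finite) mpfa \<Rightarrow> (real^'n \<Rightarrow> real^'n^'n) \<Rightarrow>
    ((real^'n) set \<Rightarrow> real) \<Rightarrow> (real^'n) set set \<Rightarrow> real^'n" where
  "main_gradient M K v G = matrix_inv (group_matrix M K G) *v group_rhs M K v G"

text \<open>The gradient attached to the cell \<open>T\<close> and the face \<open>F\<close> of the group \<open>G\<close>. The lemmas below check
  the conditions that characterize these gradients.\<close>

definition group_gradient :: "('n::finite) mpfa \<Rightarrow> (real^'n \<Rightarrow> real^'n^'n) \<Rightarrow>
    ((real^'n) set \<Rightarrow> real) \<Rightarrow> (real^'n) set set \<Rightarrow> (real^'n) set \<Rightarrow> (real^'n) set \<Rightarrow> real^'n" where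
  "group_gradient M K v G T F = (let T0 = group_cell M G; g = main_gradient M K v G in
     if T = T0 then g
     else g + ((g \<bullet> (cell_point M T - cell_point M T0) - (v T - v T0)) / cell_dist M T F)
                *\<^sub>R normal T F)"

text \<open>Continuity of the values of the affine reconstructions at the points \<open>y\<close> of the hyperplane of a
  face, their vanishing at the center of a boundary face, and continuity of the normal fluxes.\<close>

lemma group_gradient_value:
  assumes "T0 = group_cell M G" and "cell_dist M T F \<noteq> 0"
    and "normal T F \<bullet> (y - face_center F) = 0"
  shows "v T + group_gradient M K v G T F \<bullet> (y - cell_point M T) =
         v T0 + group_gradient M K v G T0 F \<bullet> (y - cell_point M T0)"
proof -
  have "normal T F \<bullet> (y - cell_point M T) = cell_dist M T F"
    using assms(3) by (simp add: cell_dist_def inner_diff_right inner_diff_left inner_commute)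
  then have n: "normal T F \<bullet> y - normal T F \<bullet> cell_point M T = cell_dist M T F"
    by (simp add: inner_diff_right)
  define c where "c = (main_gradient M K v G \<bullet> (cell_point M T - cell_point M T0) - (v T - v T0))
                        / cell_dist M T F"
  have c: "c * cell_dist M T F =
      main_gradient M K v G \<bullet> cell_point M T - main_gradient M K v G \<bullet> cell_point M T0 - (v T - v T0)"
    using assms(2) by (simp add: c_def inner_diff_right)
  show ?thesis
  proof (cases "T = T0")
    case False
    then have "group_gradient M K v G T F = main_gradient M K v G + c *\<^sub>R normal T F"
      and "group_gradient M K v G T0 F = main_gradient M K v G"
      using assms(1) by (simp_all add: group_gradient_def Let_def c_def)
    then show ?thesis
      using c[folded n] by (simp add: inner_add_left inner_diff_right algebra_simps)
  qed simp
qed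

lemma group_row_equation:
  assumes "card G = CARD('n)" and "F \<in> G" and "invertible (group_matrix M K G)"
  shows "group_row M K G F \<bullet> main_gradient (M :: ('n::finite) mpfa) K v G = group_entry M K v G F"
proof -
  have "finite G" using assms(1) by (metis card.infinite finite_UNIV_card_ge_0 finite less_irrefl)
  then have "\<exists>e. bij_betw e (UNIV :: 'n set) G"
    using assms(1) by (simp add: finite_same_card_bij)
  then have "bij_betw (group_enum G) UNIV G"
    unfolding group_enum_def by (rule someI_ex)
  then obtain i where i: "group_enum G i = F"
    using assms(2) unfolding bij_betw_def by (metis imageE)
  have "group_matrix M K G ** matrix_inv (group_matrix M K G) = mat 1"
    using assms(3) unfolding invertible_def matrix_inv_def by (metis (mono_tags, lifting) someI_ex)
  then have "group_matrix M K G *v main_gradient M K v G = group_rhs M K v G"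
    by (simp add: main_gradient_def matrix_vector_mul_assoc)
  then have "(group_matrix M K G *v main_gradient M K v G) $ i = group_rhs M K v G $ i"
    by simp
  then show ?thesis
    by (simp add: matrix_vector_mul_component group_matrix_def group_rhs_def i)
qed

lemma group_gradient_boundary:
  assumes "card G = CARD('n)" and "F \<in> G" and "invertible (group_matrix M K G)"
    and "F \<notin> inner_faces (cells M) (faces M)"
    and "T0 = group_cell M G" and "normal_conductivity M K T0 F \<noteq> 0"
  shows "v T0 + group_gradient (M :: ('n::finite) mpfa) K v G T0 F
                  \<bullet> (face_center F - cell_point M T0) = 0"
proof -
  have "normal_conductivity M K T0 F * (main_gradient M K v G \<bullet> (face_center F - cell_point M T0)) =
        normal_conductivity M K T0 F * (- v T0)"
    using group_row_equation[OF assms(1-3), of v] assms(4,5)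
    by (simp add: group_row_def group_entry_def Let_def inner_commute)
  then have "main_gradient M K v G \<bullet> (face_center F - cell_point M T0) = - v T0"
    using assms(6) mult_left_cancel by blast
  then show ?thesis
    using assms(5) by (simp add: group_gradient_def Let_def)
qed

lemma group_gradient_flux:
  assumes "card G = CARD('n)" and "F \<in> G" and "invertible (group_matrix M K G)"
    and "F \<in> inner_faces (cells M) (faces M)"
    and T0: "T0 = group_cell M G" and T: "T = other_cell (cells M) F T0" and "T \<noteq> T0"
    and sym: "transpose (cell_tensor K T) = cell_tensor K T"
      "transpose (cell_tensor K T0) = cell_tensor K T0"
  shows "(cell_tensor K T *v group_gradient (M :: ('n::finite) mpfa) K v G T F) \<bullet> normal T F
       + (cell_tensor K T0 *v group_gradient M K v G T0 F) \<bullet> normal T0 F = 0"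
proof -
  have dot: "(A *v x) \<bullet> n = (A *v n) \<bullet> x" if "transpose A = A" for A :: "real^'n^'n" and x n
    by (metis dot_lmul_matrix inner_commute that vector_transpose_matrix)
  show ?thesis
    using group_row_equation[OF assms(1-3), of v] assms(4,7)
    by (simp add: T0[symmetric] T[symmetric] group_row_def group_entry_def group_gradient_def Let_def
        dot[OF sym(1)] dot[OF sym(2)] normal_conductivity_def inner_add_left inner_add_right
        inner_diff_right inner_commute[of _ "main_gradient M K v G"] diff_divide_distrib add_divide_distrib algebra_simps)
qed

definition groups_of_face :: "('n::finite) mpfa \<Rightarrow> (real^'n \<Rightarrow> real^'n^'n) \<Rightarrow> (real^'n) set \<Rightarrow>
    (real^'n) set set set" where
  "groups_of_face M K F =
     {G. face_group (cells M) (faces M) G \<and> F \<in> G \<and> invertible (group_matrix M K G)}"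

definition flux :: "('n::finite) mpfa \<Rightarrow> (real^'n \<Rightarrow> real^'n^'n) \<Rightarrow>
    ((real^'n) set \<Rightarrow> real) \<Rightarrow> (real^'n) set \<Rightarrow> (real^'n) set \<Rightarrow> real" where
  "flux M K v T F = (\<Sum>G\<in>groups_of_face M K F. weight M F G *
     (- face_area F * ((cell_tensor K T *v group_gradient M K v G T F) \<bullet> normal T F)))"

section \<open>The discrete norm and the discretization data\<close>

definition face_eigenvalue ::
    "('n::finite) mpfa \<Rightarrow> (real^'n \<Rightarrow> real^'n^'n) \<Rightarrow> (real^'n) set \<Rightarrow> real" where
  "face_eigenvalue M K F = Min ((\<lambda>T. min_eigenvalue (cell_tensor K T)) ` cells_of_face (cells M) F)"

definition face_dist :: "('n::finite) mpfa \<Rightarrow> (real^'n) set \<Rightarrow> real" where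
  "face_dist M F = (\<Sum>T\<in>cells_of_face (cells M) F. cell_dist M T F)"

text \<open>\<open>v\<^sub>T - v\<^sub>T\<^sub>'\<close>, with \<open>v\<^sub>T\<^sub>' = 0\<close> for a boundary face. Elements of the discrete space are functions
  on sets of which only the values at the cells of the mesh matter.\<close>

definition jump :: "('n::finite) mpfa \<Rightarrow> ((real^'n) set \<Rightarrow> real) \<Rightarrow> (real^'n) set \<Rightarrow> real" where
  "jump M v F = (let T = first_cell (cells M) F in
     if F \<in> inner_faces (cells M) (faces M) then v T - v (other_cell (cells M) F T) else v T)"

definition discrete_norm :: "('n::finite) mpfa \<Rightarrow> (real^'n \<Rightarrow> real^'n^'n) \<Rightarrow>
    ((real^'n) set \<Rightarrow> real) \<Rightarrow> real" where
  "discrete_norm M K v = sqrt (\<Sum>F\<in>faces M.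
     face_eigenvalue M K F * face_area F * face_dist M F * (jump M v F / face_dist M F)\<^sup>2)"

definition mpfa_data :: "real \<Rightarrow> (real^'n::finite) set \<Rightarrow> (real^'n) set set \<Rightarrow>
    (real^'n \<Rightarrow> real^'n^'n) \<Rightarrow> 'n mpfa \<Rightarrow> bool" where
  "mpfa_data \<rho> \<Omega> \<P> K M \<longleftrightarrow>
     polytopal_mesh \<Omega> (cells M) (faces M) \<and> regular_mesh \<rho> (cells M) (faces M) \<and>
     (\<forall>T\<in>cells M. \<exists>!P. P \<in> \<P> \<and> T \<subseteq> P) \<and>
     (\<forall>T\<in>cells M. cell_point M T \<in> T) \<and>
     (\<forall>T\<in>cells M. \<forall>F\<in>faces_of_cell (faces M) T. cell_dist M T F > 0) \<and>
     (\<forall>G. face_group (cells M) (faces M) G \<longrightarrow>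
        group_cell M G \<in> cells M \<and> G \<subseteq> faces_of_cell (faces M) (group_cell M G)) \<and>
     (\<forall>F\<in>faces M. groups_of_face M K F \<noteq> {} \<and> (\<forall>G\<in>groups_of_face M K F. weight M F G \<ge> 0) \<and>
        (\<Sum>G\<in>groups_of_face M K F. weight M F G) = 1)"

definition coercive_fluxes :: "real \<Rightarrow> ('n::finite) mpfa \<Rightarrow> (real^'n \<Rightarrow> real^'n^'n) \<Rightarrow> bool" where
  "coercive_fluxes \<gamma> M K \<longleftrightarrow> (\<forall>v.
     (\<Sum>F\<in>inner_faces (cells M) (faces M). flux M K v (first_cell (cells M) F) F *
        (v (first_cell (cells M) F) - v (other_cell (cells M) F (first_cell (cells M) F)))) +
     (\<Sum>F\<in>boundary_faces (cells M) (faces M).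
        flux M K v (first_cell (cells M) F) F * v (first_cell (cells M) F))
     \<ge> \<gamma> * (discrete_norm M K v)\<^sup>2)"

definition mpfa_solution :: "('n::finite) mpfa \<Rightarrow> (real^'n \<Rightarrow> real^'n^'n) \<Rightarrow> (real^'n \<Rightarrow> real) \<Rightarrow>
    ((real^'n) set \<Rightarrow> real) \<Rightarrow> bool" where
  "mpfa_solution M K f uh \<longleftrightarrow> (\<forall>T\<in>cells M.
     (\<Sum>F\<in>faces_of_cell (faces M) T. flux M K uh T F) = (\<integral>x. f x \<partial>(lebesgue_on T)))"

end

theory Submission
  imports Defs
begin

text \<open>Let \<open>\<Phi>\<close> be the fluxes of the exact solution through the faces. Testing the weak equation with
  bumps that concentrate at a point of a face shows that \<open>u\<close> vanishes on the boundary and that the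
  normal component of \<open>K \<nabla> u\<close> does not jump, so \<open>\<Phi>\<close> is conservative. A cell is star-shaped with
  respect to a ball around \<open>x\<^sub>T\<close>, because \<open>x\<^sub>T\<close> lies on the inner side of every face; its
  decomposition into pyramids over the faces yields the divergence theorem, hence the balance of
  \<open>\<Phi>\<close> over the cell, and the bound of the sum of all \<open>|F| d\<^sub>F\<close> by \<open>d |\<Omega>|\<close>.

  By Taylor expansion, the gradient of \<open>u\<close> at the point of \<open>T\<^sub>G\<close> satisfies the linear system of
  the group \<open>G\<close> with a residual of order \<open>h\<close>. Multiplying by the inverse matrices and averaging with
  the weights \<open>\<theta>\<close>, the fluxes of the interpolant differ from \<open>\<Phi>\<close> by a multiple of \<open>|F| h\<close>. Both
  fluxes being conservative, summation by parts turns the coercivity applied to the error into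
  a sum over the faces, and the Cauchy-Schwarz inequality finishes the proof.\<close>

section \<open>Smooth bumps\<close>

text \<open>A cell may be nonconvex, and its outward normals are characterized on a dense part of
  each face only, so no smoothness of the boundary is at hand. Everything that concerns faces is
  therefore done off the union \<open>Z\<close> of the codimension-two faces of the submesh. This
  set is small in the two senses that matter. It is null for the surface measure of each face, so
  generic face points are dense and identities extend by continuity. And it lies in finitely many
  hyperplanes through any prescribed point, so almost every ray from that point misses it, which
  gives star-shapedness and the decomposition into pyramids. Boundary values and continuity of
  fluxes are pointwise statements obtained by blow-up, and no trace theory enters. Two features of
  the scheme keep the constants under control. Each group flux is conservative, so it is estimated
  only in \<open>group_cell\<close>, where the gradient solves the linear system. And the bound of
  the residual is the same for all groups, so the weights can be averaged before the inverse norms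
  are bounded.\<close>

definition flat :: "nat \<Rightarrow> real \<Rightarrow> real" where
  "flat k x = (if x > 0 then exp (- 1 / x) / x ^ k else 0)"

lemma flat_nonneg: "flat k x \<ge> 0"
  by (simp add: flat_def)

lemma flat_eq_0: "x \<le> 0 \<Longrightarrow> flat k x = 0"
  by (simp add: flat_def)

lemma flat_pos: "x > 0 \<Longrightarrow> flat k x > 0"
  by (simp add: flat_def)

lemma flat_0_le_1: "flat 0 x \<le> 1"
  by (simp add: flat_def)

lemma flat_tendsto_0: "(flat k \<longlongrightarrow> 0) (at 0)"
proof -
  have "((\<lambda>x. inverse x ^ k / exp (inverse x)) \<longlongrightarrow> 0) (at_right (0::real))"
    by (rule filterlim_compose[OF tendsto_power_div_exp_0 filterlim_inverse_at_top_right])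
  moreover have "eventually (\<lambda>x. inverse x ^ k / exp (inverse x) = flat k x) (at_right (0::real))"
    by (auto simp: flat_def eventually_at_filter exp_minus inverse_eq_divide power_one_over field_simps)
  ultimately have R: "(flat k \<longlongrightarrow> 0) (at_right 0)"
    by (rule Lim_transform_eventually)
  have "eventually (\<lambda>x. 0 = flat k x) (at_left (0::real))"
    by (auto simp: flat_def eventually_at_filter)
  then have L: "(flat k \<longlongrightarrow> 0) (at_left 0)"
    by (rule Lim_transform_eventually[OF tendsto_const])
  show ?thesis
    using L R filterlim_split_at by blast
qed

text \<open>The power of \<open>x\<close> in the denominator is carried along because
  differentiation then maps the family into its own span. At 0 the difference quotient of
  \<open>flat k\<close> is \<open>flat (Suc k)\<close>, which tends to 0.\<close>

lemma flat_has_derivative: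
  "(flat k has_real_derivative flat (k + 2) x - of_nat k * flat (k + 1) x) (at x)"
proof -
  consider "x > 0" | "x < 0" | "x = 0"
    by linarith
  then show ?thesis
  proof cases
    case 1
    \<comment> \<open>For \<open>k = 0\<close> the truncated exponent \<open>k - Suc 0\<close>
      breaks the identity of powers, but the factor \<open>of_nat k\<close> vanishes.\<close>
    have k: "of_nat k * (x ^ (k - Suc 0) * x) = of_nat k * x ^ k"
      by (cases k) simp_all
    have "((\<lambda>y. exp (- 1 / y) / y ^ k) has_real_derivative
        flat (k + 2) x - of_nat k * flat (k + 1) x) (at x)"
      apply (insert 1)
      apply (rule derivative_eq_intros refl | simp)+
      using k apply (simp add: flat_def divide_simps power2_eq_square)
      apply (simp add: algebra_simps power_add eq_commute[of "x ^ k"])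
      done
    then show ?thesis
      by (rule has_field_derivative_transform_within_open[where S = "{0<..}"])
        (use 1 in \<open>auto simp: flat_def\<close>)
  next
    case 2
    have "((\<lambda>y. 0) has_real_derivative flat (k + 2) x - of_nat k * flat (k + 1) x) (at x)"
      using 2 by (simp add: flat_def)
    then show ?thesis
      by (rule has_field_derivative_transform_within_open[where S = "{..<0}"])
        (use 2 in \<open>auto simp: flat_def\<close>)
  next
    case 3
    have "\<forall>\<^sub>F h in at 0. flat (Suc k) h = (flat k (0 + h) - flat k 0) / h"
      by (auto simp: flat_def eventually_at_filter)
    then have "((\<lambda>h. (flat k (0 + h) - flat k 0) / h) \<longlongrightarrow> 0) (at 0)"
      by (rule Lim_transform_eventually[OF flat_tendsto_0])
    then show ?thesis
      using 3 by (simp add: DERIV_def flat_eq_0)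
  qed
qed

text \<open>This class contains the bump functions and is closed under partial derivatives.\<close>

inductive elem_smooth :: "(real^'n::finite \<Rightarrow> real) \<Rightarrow> bool" where
  const: "elem_smooth (\<lambda>x. c)"
| coord: "elem_smooth (\<lambda>x. x $ i)"
| add: "elem_smooth p \<Longrightarrow> elem_smooth q \<Longrightarrow> elem_smooth (\<lambda>x. p x + q x)"
| mult: "elem_smooth p \<Longrightarrow> elem_smooth q \<Longrightarrow> elem_smooth (\<lambda>x. p x * q x)"
| flat: "elem_smooth p \<Longrightarrow> elem_smooth (\<lambda>x. flat k (p x))"

text \<open>Membership in the class is asserted for the derivative in each fixed direction, so the
  statement can be iterated and smoothness of all orders follows at once.\<close>

lemma elem_smooth_derivative:
  assumes "elem_smooth (p :: real^'n::finite \<Rightarrow> real)"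
  shows "\<exists>p'. (\<forall>x. (p has_derivative p' x) (at x)) \<and> (\<forall>h. elem_smooth (\<lambda>x. p' x h))"
  using assms
proof induction
  case (const c)
  have "\<forall>x. ((\<lambda>x::real^'n. c) has_derivative (\<lambda>h. 0)) (at x)"
    by simp
  then show ?case
    using elem_smooth.const[of 0] by (intro exI[of _ "\<lambda>x h. 0"]) blast
next
  case (coord i)
  have "\<forall>x. ((\<lambda>x::real^'n. x $ i) has_derivative (\<lambda>h. h $ i)) (at x)"
    by (simp add: bounded_linear_imp_has_derivative bounded_linear_vec_nth)
  then show ?case
    using elem_smooth.const by (intro exI[of _ "\<lambda>x h. h $ i"]) blast
next
  case (add p q)
  then obtain p' q' where *: "\<forall>x. (p has_derivative p' x) (at x)" "\<forall>h. elem_smooth (\<lambda>x. p' x h)"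
    "\<forall>x. (q has_derivative q' x) (at x)" "\<forall>h. elem_smooth (\<lambda>x. q' x h)"
    by blast
  then have "\<forall>x. ((\<lambda>x. p x + q x) has_derivative (\<lambda>h. p' x h + q' x h)) (at x)"
    by (blast intro: has_derivative_add)
  then show ?case
    by (intro exI[of _ "\<lambda>x h. p' x h + q' x h"]) (use * elem_smooth.add in blast)
next
  case (mult p q)
  then obtain p' q' where *: "\<forall>x. (p has_derivative p' x) (at x)" "\<forall>h. elem_smooth (\<lambda>x. p' x h)"
    "\<forall>x. (q has_derivative q' x) (at x)" "\<forall>h. elem_smooth (\<lambda>x. q' x h)"
    by blast
  then have "\<forall>x. ((\<lambda>x. p x * q x) has_derivative (\<lambda>h. p x * q' x h + p' x h * q x)) (at x)"
    by (blast intro: has_derivative_mult)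
  moreover have "\<forall>h. elem_smooth (\<lambda>x. p x * q' x h + p' x h * q x)"
    using * mult by (intro allI elem_smooth.add elem_smooth.mult) auto
  ultimately show ?case
    by (intro exI[of _ "\<lambda>x h. p x * q' x h + p' x h * q x"]) blast
next
  case (flat p k)
  then obtain p' where *: "\<forall>x. (p has_derivative p' x) (at x)" "\<forall>h. elem_smooth (\<lambda>x. p' x h)"
    by blast
  define D where "D x h = (flat (k + 2) (p x) + (- of_nat k) * flat (k + 1) (p x)) * p' x h" for x h
  have "((\<lambda>x. flat k (p x)) has_derivative D x) (at x)" for x
    using has_derivative_compose[OF *(1)[rule_format, of x]
        flat_has_derivative[of k "p x", unfolded has_field_derivative_def]]
    by (simp add: D_def[abs_def])
  moreover have "\<forall>h. elem_smooth (\<lambda>x. D x h)"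
    unfolding D_def using * flat(1)
    by (intro allI elem_smooth.add elem_smooth.mult elem_smooth.flat elem_smooth.const) auto
  ultimately show ?case
    by blast
qed

lemma elem_smooth_iter_partial:
  assumes "elem_smooth p"
  shows "elem_smooth (iter_partial is p)"
proof (induction "is")
  case Nil
  then show ?case using assms by simp
next
  case (Cons i "is")
  obtain p' where p': "\<forall>x. (iter_partial is p has_derivative p' x) (at x)"
    "\<forall>h. elem_smooth (\<lambda>x. p' x h)"
    using elem_smooth_derivative[OF Cons.IH] by blast
  then have "frechet_derivative (iter_partial is p) (at x) = p' x" for x
    by (simp add: frechet_derivative_at[symmetric])
  then show ?case
    using p'(2) by simp
qed

lemma elem_smooth_differentiable: "elem_smooth p \<Longrightarrow> p differentiable at x"
  using elem_smooth_derivative unfolding differentiable_def by blast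

lemma elem_smooth_Ck_on: "elem_smooth p \<Longrightarrow> Ck_on k S p"
  unfolding Ck_on_def
  by (blast intro: elem_smooth_differentiable elem_smooth_iter_partial continuous_at_imp_continuous_on
      differentiable_imp_continuous_within)

lemma elem_smooth_sum:
  "finite I \<Longrightarrow> (\<And>i. i \<in> I \<Longrightarrow> elem_smooth (p i)) \<Longrightarrow> elem_smooth (\<lambda>x. \<Sum>i\<in>I. p i x)"
  by (induction I rule: finite_induct) (auto intro: elem_smooth.intros)

lemma elem_smooth_prod:
  "finite I \<Longrightarrow> (\<And>i. i \<in> I \<Longrightarrow> elem_smooth (p i)) \<Longrightarrow> elem_smooth (\<lambda>x. \<Prod>i\<in>I. p i x)"
  by (induction I rule: finite_induct) (auto intro: elem_smooth.intros)

text \<open>The parameter \<open>c\<close> sharpens the bump: \<open>c = 1\<close> is the profile of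
  the blow-up, while \<open>c\<close> tending to infinity yields the indicator of the ball. The
  squared norm keeps the function smooth at the center.\<close>

definition bump :: "real \<Rightarrow> real^'n::finite \<Rightarrow> real \<Rightarrow> real^'n \<Rightarrow> real" where
  "bump c z r x = flat 0 (c * (1 - (norm (x - z))\<^sup>2 / r\<^sup>2))"

lemma bump_bounds: "0 \<le> bump c z r x" "bump c z r x \<le> 1"
  by (simp_all add: bump_def flat_nonneg flat_0_le_1)

lemma bump_eq_0: "c \<ge> 0 \<Longrightarrow> r > 0 \<Longrightarrow> norm (x - z) \<ge> r \<Longrightarrow> bump c z r x = 0"
  by (simp add: bump_def flat_eq_0 mult_nonneg_nonpos power_mono)

lemma elem_smooth_bump: "elem_smooth (bump c z r)"
proof -
  have "(norm (x - z))\<^sup>2 = (\<Sum>i\<in>UNIV. (x $ i + (- (z $ i))) * (x $ i + (- (z $ i))))" for x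
    by (simp add: norm_vec_def L2_set_def power2_eq_square sum_nonneg)
  then have "bump c z r = (\<lambda>x. flat 0 (c * (1 + (- 1 / r\<^sup>2) *
      (\<Sum>i\<in>UNIV. (x $ i + (- (z $ i))) * (x $ i + (- (z $ i)))))))"
    by (auto simp: bump_def)
  then show ?thesis
    by (simp only:) (intro elem_smooth.intros elem_smooth_sum finite)
qed

lemma bump_has_derivative:
  "(bump c z r has_derivative (\<lambda>h. flat 2 (c * (1 - (norm (x - z))\<^sup>2 / r\<^sup>2)) *
     (- 2 * c / r\<^sup>2 * ((x - z) \<bullet> h)))) (at x)"
proof -
  have "((\<lambda>x. c - c * inverse (r\<^sup>2) * ((x - z) \<bullet> (x - z))) has_derivative
      (\<lambda>h. - 2 * c / r\<^sup>2 * ((x - z) \<bullet> h))) (at x)"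
    by (rule derivative_eq_intros refl | simp add: inner_commute divide_inverse fun_eq_iff algebra_simps)+
  then have 1: "((\<lambda>x. c * (1 - (norm (x - z))\<^sup>2 / r\<^sup>2)) has_derivative
      (\<lambda>h. - 2 * c / r\<^sup>2 * ((x - z) \<bullet> h))) (at x)"
    by (simp add: power2_norm_eq_inner divide_inverse algebra_simps)
  show ?thesis
    using has_derivative_compose[OF 1 flat_has_derivative[of 0, unfolded has_field_derivative_def]]
    by (simp add: bump_def[abs_def] numeral_2_eq_2)
qed

lemma bump_tendsto: "r > 0 \<Longrightarrow> (\<lambda>k. bump (real k) z r x) \<longlonglongrightarrow> indicator (ball z r) x"
proof (cases "x \<in> ball z r")
  case True
  then have "norm (x - z) < r"
    by (simp add: dist_norm norm_minus_commute)
  then have "(norm (x - z))\<^sup>2 / r\<^sup>2 < 1"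
    by (simp add: power_strict_mono divide_less_eq_1)
  then obtain t where t: "t > 0" "t = 1 - (norm (x - z))\<^sup>2 / r\<^sup>2"
    by simp
  have "(\<lambda>k. exp (- (1 / t) * (1 / real k))) \<longlonglongrightarrow> exp (- (1 / t) * 0)"
    by (intro tendsto_intros lim_1_over_n)
  \<comment> \<open>At \<open>k = 0\<close> the bump is identically 0 whereas the formula gives 1,
    hence only eventual equality.\<close>
  moreover have "eventually (\<lambda>k. exp (- (1 / t) * (1 / real k)) = bump (real k) z r x) sequentially"
    using eventually_gt_at_top[of "0::nat"]
    by (rule eventually_mono) (use t(1) in \<open>simp add: bump_def flat_def t(2)[symmetric] mult.commute\<close>)
  ultimately show ?thesis
    using True Lim_transform_eventually by fastforce
next
  case False
  then show "r > 0 \<Longrightarrow> ?thesis"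
    by (simp add: bump_eq_0 dist_norm norm_minus_commute)
qed

lemma test_functionI:
  assumes "elem_smooth p" and "closed Q" "bounded Q" "Q \<subseteq> D" and "\<And>x. x \<notin> Q \<Longrightarrow> p x = 0"
  shows "test_function D p"
proof -
  have *: "closure {x. p x \<noteq> 0} \<subseteq> Q"
    by (rule closure_minimal) (use assms in auto)
  then have "compact (closure {x. p x \<noteq> 0})"
    by (meson assms(3) bounded_subset closed_closure compact_eq_bounded_closed)
  then show ?thesis
    using * assms elem_smooth_Ck_on by (auto simp: test_function_def)
qed

lemma test_function_bump:
  "c \<ge> 0 \<Longrightarrow> r > 0 \<Longrightarrow> cball z r \<subseteq> D \<Longrightarrow> test_function D (bump c z r)"
  by (rule test_functionI[where Q = "cball z r"])
    (auto simp: elem_smooth_bump bump_eq_0 dist_norm norm_minus_commute)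

section \<open>Integration by parts with compactly supported factors\<close>

lemma lborel_integrable_translation:
  fixes f :: "'a::euclidean_space \<Rightarrow> real"
  assumes "integrable lborel f"
  shows "integrable lborel (\<lambda>x. f (x + c))" "(\<integral>x. f (x + c) \<partial>lborel) = (\<integral>x. f x \<partial>lborel)"
proof -
  have m: "f \<in> borel_measurable borel"
    using borel_measurable_integrable[OF assms] by simp
  have "integrable (distr lborel borel ((+) c)) f"
    using assms by (simp add: lborel_distr_plus)
  then show "integrable lborel (\<lambda>x. f (x + c))"
    using m by (subst (asm) integrable_distr_eq) (auto simp: add.commute)
  have "(\<integral>x. f x \<partial>lborel) = (\<integral>x. f x \<partial>(distr lborel borel ((+) c)))"
    by (simp add: lborel_distr_plus)
  also have "\<dots> = (\<integral>x. f (c + x) \<partial>lborel)"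
    using m by (subst integral_distr) auto
  finally show "(\<integral>x. f (x + c) \<partial>lborel) = (\<integral>x. f x \<partial>lborel)"
    by (simp add: add.commute)
qed

lemma lborel_integrable_bounded_support:
  fixes f :: "'a::euclidean_space \<Rightarrow> real"
  assumes "f \<in> borel_measurable borel" "bounded Q" "\<And>x. x \<notin> Q \<Longrightarrow> f x = 0" "\<And>x. \<bar>f x\<bar> \<le> B"
  shows "integrable lborel f"
proof -
  obtain a where "Q \<subseteq> cball 0 a"
    using assms(2) by (auto simp: bounded_iff subset_iff)
  then show ?thesis
    by (intro integrableI_bounded_set[where A = "cball 0 a" and B = B])
      (use assms emeasure_lborel_cball_finite in \<open>auto simp: subset_iff\<close>)
qed

text \<open>The difference quotients have integral zero by translation invariance and converge dominatedly.\<close>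

lemma integral_directional_derivative_eq_0:
  fixes g g' :: "'a::euclidean_space \<Rightarrow> real"
  assumes g: "integrable lborel g" and meas: "g' \<in> borel_measurable borel"
    and Q: "bounded Q" "\<And>x. x \<notin> Q \<Longrightarrow> g x = 0"
    and lip: "h0 > 0" "\<And>x h. 0 < h \<Longrightarrow> h < h0 \<Longrightarrow> \<bar>g (x + h *\<^sub>R e) - g x\<bar> \<le> L * h"
    and der: "AE x in lborel. ((\<lambda>h. g (x + h *\<^sub>R e)) has_real_derivative g' x) (at 0)"
  shows "integrable lborel g'" "(\<integral>x. g' x \<partial>lborel) = 0"
proof -
  have [measurable]: "g \<in> borel_measurable borel"
    using borel_measurable_integrable[OF g] by simp
  \<comment> \<open>The offset 2 in the divisor makes already the first step strictly smaller than
    \<open>h0\<close>, as the Lipschitz bound demands.\<close>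
  define s where "s k = h0 / real (k + 2)" for k
  have s: "s k > 0" "s k < h0" for k
    using lip(1) by (auto simp: s_def field_simps add_pos_nonneg)
  define q where "q k x = (g (x + s k *\<^sub>R e) - g x) / s k" for k x
  obtain a where a: "Q \<subseteq> cball 0 a"
    using Q(1) by (auto simp: bounded_iff subset_iff)
  \<comment> \<open>If the difference quotient at \<open>x\<close> is nonzero, then \<open>x\<close>
    or its translate lies in \<open>Q\<close>. Hence one ball, enlarged by the longest step,
    contains all supports, and a constant on it dominates.\<close>
  define w where "w x = L * indicator (cball (0::'a) (a + h0 * norm e)) x" for x
  have w: "integrable lborel w"
    unfolding w_def
    by (intro integrable_mult_right integrable_real_indicator)
      (simp_all add: emeasure_lborel_cball_finite[unfolded infinity_ennreal_def])
  have L: "0 \<le> L"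
    using lip(2)[of "h0 / 2" undefined] lip(1)
    by (metis abs_ge_zero field_sum_of_halves half_gt_zero_iff less_add_same_cancel1 mult_less_0_iff not_less order_trans)
  have bound: "norm (q k x) \<le> w x" for k x
  proof (cases "x \<in> cball 0 (a + h0 * norm e)")
    case True
    have "\<bar>g (x + s k *\<^sub>R e) - g x\<bar> / s k \<le> L"
      using lip(2)[OF s, of x] s(1)[of k] by (simp add: divide_le_eq)
    then show ?thesis
      using True s(1)[of k] by (simp add: q_def w_def)
  next
    case False
    have "norm x - s k * norm e \<le> norm (x + s k *\<^sub>R e)"
      using norm_triangle_ineq2[of x "- (s k *\<^sub>R e)"] s(1)[of k] by simp
    moreover have "s k * norm e \<le> h0 * norm e"
      using s(2)[of k] by (simp add: mult_right_mono)
    ultimately have "x + s k *\<^sub>R e \<notin> cball 0 a" "x \<notin> cball 0 a"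
      using False lip(1) by (auto simp: not_le intro: order.strict_trans1[of a "a + h0 * norm e"])
    then have "g (x + s k *\<^sub>R e) = 0" "g x = 0"
      using a Q(2) by blast+
    then show ?thesis
      using False by (simp add: q_def w_def)
  qed
  have "s \<longlonglongrightarrow> 0"
    unfolding s_def using LIMSEQ_ignore_initial_segment[OF lim_const_over_n[of h0], of 2] by simp
  then have s0: "filterlim s (at 0) sequentially"
    using s(1) by (auto simp: filterlim_at less_imp_neq[symmetric])
  have lim: "AE x in lborel. (\<lambda>k. q k x) \<longlonglongrightarrow> g' x"
    using der
  proof eventually_elim
    case (elim x)
    then have "((\<lambda>h. (g (x + h *\<^sub>R e) - g x) / h) \<longlongrightarrow> g' x) (at 0)"
      by (simp add: DERIV_def)
    then show ?case
      unfolding q_def by (rule filterlim_compose[OF _ s0])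
  qed
  have [measurable]: "q k \<in> borel_measurable borel" for k
    unfolding q_def by measurable
  show "integrable lborel g'"
    by (rule integrable_dominated_convergence[of g' lborel q w]) (use w lim bound meas in auto)
  have "(\<lambda>k. \<integral>x. q k x \<partial>lborel) \<longlonglongrightarrow> (\<integral>x. g' x \<partial>lborel)"
    by (rule integral_dominated_convergence[of g' lborel q w]) (use w lim bound meas in auto)
  moreover have "(\<integral>x. q k x \<partial>lborel) = 0" for k
    unfolding q_def
    using lborel_integrable_translation[OF g, of "s k *\<^sub>R e"] g by simp
  ultimately show "(\<integral>x. g' x \<partial>lborel) = 0"
    by (simp add: LIMSEQ_const_iff)
qed

text \<open>The preceding lemma is applied to the product of \<open>q\<close> and \<open>v\<close>,
  extended by zero. The factors play different roles: \<open>q\<close> is regular inside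
  \<open>D\<close> and need not extend to its boundary, whereas \<open>v\<close> is compactly
  supported and merely Lipschitz and differentiable almost everywhere, as the cutoffs of the
  divergence theorem are.\<close>

lemma integral_by_parts_compact_support:
  fixes q v :: "'a::euclidean_space \<Rightarrow> real" and Dq Dv :: "'a \<Rightarrow> 'a"
  assumes D: "open D" and Q: "compact Q" "Q \<subseteq> D"
    and q: "\<And>x. x \<in> D \<Longrightarrow> (q has_derivative (\<lambda>h. Dq x \<bullet> h)) (at x)"
      "continuous_on D Dq" "\<And>x. x \<in> D \<Longrightarrow> \<bar>q x\<bar> \<le> B" "\<And>x. x \<in> D \<Longrightarrow> norm (Dq x) \<le> B"
    and v: "\<And>x y. \<bar>v x - v y\<bar> \<le> L * norm (x - y)" "\<And>x. x \<notin> Q \<Longrightarrow> v x = 0"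
      "AE x in lborel. x \<in> D \<longrightarrow> (v has_derivative (\<lambda>h. Dv x \<bullet> h)) (at x)"
      "Dv \<in> borel_measurable borel"
  shows "integrable lborel (\<lambda>x. indicator D x * (q x * (Dv x \<bullet> e)))"
    "integrable lborel (\<lambda>x. indicator D x * ((Dq x \<bullet> e) * v x))"
    "(\<integral>x. indicator D x * (q x * (Dv x \<bullet> e)) \<partial>lborel) =
      - (\<integral>x. indicator D x * ((Dq x \<bullet> e) * v x) \<partial>lborel)"
proof -
  have qcont: "continuous_on D q"
    using q(1) by (meson D continuous_at_imp_continuous_on has_derivative_continuous)
  have L: "L \<ge> 0"
    using v(1)[of "SOME b. b \<in> Basis" 0] by (smt (verit) SOME_Basis norm_Basis diff_zero mult_cancel_left1)
  have vcont: "continuous_on UNIV v"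
    by (rule lipschitz_on_continuous_on[of L])
      (use v(1) L in \<open>auto simp: lipschitz_on_def dist_norm\<close>)
  have [measurable]: "v \<in> borel_measurable borel" "Dv \<in> borel_measurable borel"
    using vcont v(4) by (auto intro: borel_measurable_continuous_onI)
  have [measurable]: "D \<in> sets borel"
    using D by simp
  define qD where "qD x = indicator D x *\<^sub>R q x" for x
  define DqD where "DqD x = indicator D x *\<^sub>R Dq x" for x
  have [measurable]: "qD \<in> borel_measurable borel" "DqD \<in> borel_measurable borel"
    unfolding qD_def[abs_def] DqD_def[abs_def]
    by (rule borel_measurable_continuous_on_indicator; use qcont q(2) D in simp)+
  have "bounded (v ` Q)"
    by (intro compact_imp_bounded compact_continuous_image continuous_on_subset[OF vcont] Q) auto
  then obtain M' where M': "\<And>x. x \<in> Q \<Longrightarrow> \<bar>v x\<bar> \<le> M'"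
    by (auto simp: bounded_iff)
  define M where "M = max 0 M'"
  have M: "\<bar>v x\<bar> \<le> M" for x
    using M'[of x] v(2)[of x] by (cases "x \<in> Q") (auto simp: M_def)
  have M0: "M \<ge> 0"
    using M[of undefined] by linarith
  have B0: "B \<ge> 0" if "x \<in> D" for x
    using q(4)[OF that] norm_ge_zero order_trans by blast
  obtain \<epsilon> where \<epsilon>: "\<epsilon> > 0" "(\<Union>x\<in>Q. ball x \<epsilon>) \<subseteq> D"
    using compact_subset_open_imp_ball_epsilon_subset[OF Q(1) D Q(2)] .
  define g where "g x = qD x * v x" for x
  define g' where "g' x = qD x * (Dv x \<bullet> e) + (DqD x \<bullet> e) * v x" for x
  have g0: "g x = 0" if "x \<notin> Q" for x
    using v(2)[OF that] by (simp add: g_def)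
  have bQ: "bounded Q"
    using Q(1) compact_imp_bounded by blast
  have gint: "integrable lborel g"
  proof (rule lborel_integrable_bounded_support[OF _ bQ g0])
    show "\<bar>g x\<bar> \<le> \<bar>B\<bar> * M" for x
      unfolding g_def abs_mult
      by (rule mult_mono) (use q(3) M B0 in \<open>auto simp: qD_def indicator_def\<close>)
  qed (simp_all add: g_def[abs_def])
  \<comment> \<open>Steps shorter than \<open>h0\<close> move points by less than \<epsilon>; the
    summand 1 covers \<open>e = 0\<close>.\<close>
  define h0 where "h0 = \<epsilon> / (norm e + 1)"
  have h0: "h0 > 0"
    using \<epsilon> by (simp add: h0_def add_nonneg_pos)
  have lip: "\<bar>g (x + h *\<^sub>R e) - g x\<bar> \<le> ((\<bar>B\<bar> * L + M * \<bar>B\<bar>) * norm e) * h" if h: "0 < h" "h < h0" for x h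
  proof (cases "x \<in> Q \<or> x + h *\<^sub>R e \<in> Q")
    case True
    have "h * norm e < \<epsilon>"
    proof -
      have "h * norm e \<le> h * (norm e + 1)"
        using h by simp
      also have "\<dots> < h0 * (norm e + 1)"
        using h by (simp add: add_nonneg_pos)
      finally show ?thesis
        by (simp add: h0_def add_nonneg_eq_0_iff)
    qed
    \<comment> \<open>\<open>D\<close> need not be convex, but both end points lie in one ball
      inside \<open>D\<close>, where the mean value inequality applies to \<open>q\<close>.\<close>
    then obtain z where z: "z \<in> Q" "x \<in> ball z \<epsilon>" "x + h *\<^sub>R e \<in> ball z \<epsilon>"
      using True \<epsilon>(1) h(1) by (auto simp: dist_norm)
    then have ballD: "ball z \<epsilon> \<subseteq> D"
      using \<epsilon>(2) by blast
    have "norm (q (x + h *\<^sub>R e) - q x) \<le> \<bar>B\<bar> * norm (x + h *\<^sub>R e - x)"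
    proof (rule differentiable_bound[OF convex_ball[of z \<epsilon>]])
      show "(q has_derivative (\<lambda>h. Dq y \<bullet> h)) (at y within ball z \<epsilon>)" if "y \<in> ball z \<epsilon>" for y
        using q(1) ballD that has_derivative_at_withinI by blast
      show "onorm (\<lambda>h. Dq y \<bullet> h) \<le> \<bar>B\<bar>" if "y \<in> ball z \<epsilon>" for y
      proof (rule onorm_bound)
        show "norm (Dq y \<bullet> h) \<le> \<bar>B\<bar> * norm h" for h
          using q(4)[of y] ballD that Cauchy_Schwarz_ineq2[of "Dq y" h]
          by (smt (verit) mult_right_mono norm_ge_zero real_norm_def subset_iff)
      qed simp
    qed (use z in auto)
    then have 1: "\<bar>q (x + h *\<^sub>R e) - q x\<bar> \<le> \<bar>B\<bar> * (h * norm e)"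
      using h(1) by simp
    have 2: "\<bar>v (x + h *\<^sub>R e) - v x\<bar> \<le> L * (h * norm e)"
      using v(1)[of "x + h *\<^sub>R e" x] h(1) by simp
    have D12: "x \<in> D" "x + h *\<^sub>R e \<in> D"
      using z ballD by auto
    then have "g (x + h *\<^sub>R e) - g x
        = q (x + h *\<^sub>R e) * (v (x + h *\<^sub>R e) - v x) + v x * (q (x + h *\<^sub>R e) - q x)"
      by (simp add: g_def qD_def algebra_simps)
    also have "\<bar>\<dots>\<bar> \<le> \<bar>B\<bar> * (L * (h * norm e)) + M * (\<bar>B\<bar> * (h * norm e))"
      by (rule order_trans[OF abs_triangle_ineq], unfold abs_mult, intro add_mono mult_mono)
        (use 1 2 M M0 q(3)[OF D12(2)] B0[OF D12(1)] L h in auto)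
    finally show ?thesis
      by (simp add: algebra_simps)
  next
    case False
    then show ?thesis
      using g0 L M0 h by simp
  qed
  have der: "AE x in lborel. ((\<lambda>h. g (x + h *\<^sub>R e)) has_real_derivative g' x) (at 0)"
    using v(3)
  proof eventually_elim
    case (elim x)
    have line: "((\<lambda>h. x + h *\<^sub>R e) has_derivative (\<lambda>h. h *\<^sub>R e)) (at 0)"
      by (auto intro!: derivative_eq_intros)
    show ?case
    proof (cases "x \<in> D")
      case True
      have "((\<lambda>y. q y * v y) has_derivative (\<lambda>h. q x * (Dv x \<bullet> h) + (Dq x \<bullet> h) * v x)) (at x)"
        using has_derivative_mult[OF q(1)[OF True] elim[rule_format, OF True]] .
      then have "(g has_derivative (\<lambda>h. q x * (Dv x \<bullet> h) + (Dq x \<bullet> h) * v x)) (at x)"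
        by (rule has_derivative_transform_within_open[OF _ D True]) (simp add: g_def qD_def)
      then have "((\<lambda>h. g (x + h *\<^sub>R e)) has_derivative
          (\<lambda>h. q x * (Dv x \<bullet> (h *\<^sub>R e)) + (Dq x \<bullet> (h *\<^sub>R e)) * v x)) (at 0)"
        using has_derivative_compose[OF line, of g] by (simp del: inner_scaleR_right)
      moreover have "(\<lambda>h. q x * (Dv x \<bullet> (h *\<^sub>R e)) + (Dq x \<bullet> (h *\<^sub>R e)) * v x) = (*) (g' x)"
        using True by (auto simp: g'_def qD_def DqD_def algebra_simps)
      ultimately show ?thesis
        by (simp add: has_field_derivative_def)
    next
      case False
      \<comment> \<open>Nothing is known of \<open>q\<close> off \<open>D\<close>, but such an
        \<open>x\<close> is off the closed set \<open>Q\<close> as well, so the product is zero near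
        \<open>x\<close>.\<close>
      then have x: "x \<in> - Q" and oQ: "open (- Q)"
        using Q by (auto simp: compact_imp_closed open_Compl)
      have "((\<lambda>y. 0) has_derivative (\<lambda>h. 0)) (at x)"
        by simp
      then have "(g has_derivative (\<lambda>h. 0)) (at x)"
        by (rule has_derivative_transform_within_open[OF _ oQ x]) (simp add: g0)
      then have "((\<lambda>h. g (x + h *\<^sub>R e)) has_derivative (\<lambda>h. 0)) (at 0)"
        using has_derivative_compose[OF line, of g] by simp
      moreover have "(\<lambda>h. 0) = (*) (g' x)"
        using False by (auto simp: g'_def qD_def DqD_def)
      ultimately show ?thesis
        by (simp add: has_field_derivative_def)
    qed
  qed
  have g'm: "g' \<in> borel_measurable borel"
    unfolding g'_def[abs_def] by measurable
  note * = integral_directional_derivative_eq_0[OF gint g'm bQ g0 h0 lip der]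
  show i2: "integrable lborel (\<lambda>x. indicator D x * ((Dq x \<bullet> e) * v x))"
  proof (rule lborel_integrable_bounded_support[OF _ bQ])
    have "(\<lambda>x. (DqD x \<bullet> e) * v x) \<in> borel_measurable borel"
      by measurable
    then show "(\<lambda>x. indicator D x * ((Dq x \<bullet> e) * v x)) \<in> borel_measurable borel"
      by (simp add: DqD_def[abs_def] mult.assoc)
    show "\<bar>indicator D x * ((Dq x \<bullet> e) * v x)\<bar> \<le> (\<bar>B\<bar> * norm e) * M" for x
    proof (cases "x \<in> D")
      case True
      have "\<bar>Dq x \<bullet> e\<bar> \<le> \<bar>B\<bar> * norm e"
        using q(4)[OF True] Cauchy_Schwarz_ineq2[of "Dq x" e]
        by (smt (verit) mult_right_mono norm_ge_zero)
      then show ?thesis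
        using mult_mono[OF _ M[of x]] M0 True by (simp add: abs_mult)
    qed (use M0 in auto)
  qed (use v(2) in simp)
  have eq: "indicator D x * (q x * (Dv x \<bullet> e)) = g' x - indicator D x * ((Dq x \<bullet> e) * v x)" for x
    by (simp add: g'_def qD_def DqD_def algebra_simps)
  show "integrable lborel (\<lambda>x. indicator D x * (q x * (Dv x \<bullet> e)))"
    unfolding eq using *(1) i2 by simp
  show "(\<integral>x. indicator D x * (q x * (Dv x \<bullet> e)) \<partial>lborel) =
      - (\<integral>x. indicator D x * ((Dq x \<bullet> e) * v x) \<partial>lborel)"
    unfolding eq using * i2 by simp
qed

section \<open>Test functions and weak gradients\<close>

lemma integral_lebesgue_on_subset:
  fixes f :: "'a::euclidean_space \<Rightarrow> real"
  assumes "D \<in> sets lebesgue" "D' \<in> sets lebesgue" "D' \<subseteq> D" "\<And>x. x \<in> D - D' \<Longrightarrow> f x = 0"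
  shows "(\<integral>x. f x \<partial>lebesgue_on D) = (\<integral>x. f x \<partial>lebesgue_on D')"
proof -
  have "indicator D x *\<^sub>R f x = indicator D' x *\<^sub>R f x" for x
    using assms(3,4) by (auto simp: indicator_def)
  then have "(\<integral>x. indicator D x *\<^sub>R f x \<partial>lebesgue) = (\<integral>x. indicator D' x *\<^sub>R f x \<partial>lebesgue)"
    by (simp only:)
  then show ?thesis
    using assms(1,2) by (simp add: integral_restrict_space)
qed

lemma integrable_lebesgue_on_subset:
  fixes f :: "'a::euclidean_space \<Rightarrow> real"
  assumes "integrable (lebesgue_on D) f" "D \<in> sets lebesgue" "D' \<in> sets lebesgue" "D' \<subseteq> D"
  shows "integrable (lebesgue_on D') f"
proof -
  have "integrable lebesgue (\<lambda>x. indicator D' x *\<^sub>R (indicator D x *\<^sub>R f x))"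
    by (intro integrable_mult_indicator assms(3) integrable_restrict_space[THEN iffD1] assms(1)) (use assms(2) in simp)
  moreover have "indicator D' x *\<^sub>R (indicator D x *\<^sub>R f x) = indicator D' x *\<^sub>R f x" for x
    using assms(4) by (auto simp: indicator_def)
  ultimately show ?thesis
    using assms(3) by (simp only: integrable_restrict_space[of D' lebesgue f] space_lebesgue_on Int_UNIV_right space_completion space_lborel sets.Int_space_eq2 space_borel)
qed

lemma lebesgue_on_lborel:
  fixes f :: "'a::euclidean_space \<Rightarrow> real"
  assumes "D \<in> sets borel" "(\<lambda>x. indicator D x * f x) \<in> borel_measurable borel"
  shows "integrable (lebesgue_on D) f \<longleftrightarrow> integrable lborel (\<lambda>x. indicator D x * f x)"
    "(\<integral>x. f x \<partial>lebesgue_on D) = (\<integral>x. indicator D x * f x \<partial>lborel)"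
proof -
  have D: "D \<in> sets lebesgue" using assms(1) by simp
  show "integrable (lebesgue_on D) f \<longleftrightarrow> integrable lborel (\<lambda>x. indicator D x * f x)"
    using D assms(2) by (simp add: integrable_restrict_space integrable_completion)
  show "(\<integral>x. f x \<partial>lebesgue_on D) = (\<integral>x. indicator D x * f x \<partial>lborel)"
    using D assms(2) by (simp add: integral_restrict_space integral_completion)
qed

lemma elem_smooth_continuous: "elem_smooth p \<Longrightarrow> continuous_on S p"
  by (simp add: continuous_at_imp_continuous_on differentiable_imp_continuous_within elem_smooth_differentiable)

section \<open>The fundamental lemma of the calculus of variations\<close>

lemma open_eq_countable_balls:
  fixes U :: "'a::euclidean_space set"
  assumes "open U" "U \<noteq> {}"
  obtains z :: "nat \<Rightarrow> 'a" and r where "\<And>j. r j > 0" "\<And>j. cball (z j) (r j) \<subseteq> U" "U = (\<Union>j. ball (z j) (r j))"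
proof -
  let ?B = "{ball z r | z r. r > 0 \<and> cball z r \<subseteq> U}"
  obtain B where B: "B \<subseteq> ?B" "countable B" "\<Union>B = \<Union>?B"
    using Lindelof_openin[of ?B UNIV] by auto
  have U: "\<Union>?B = U"
  proof
    show "U \<subseteq> \<Union>?B"
    proof
      fix x assume "x \<in> U"
      then obtain e where "e > 0" "cball x e \<subseteq> U"
        using assms(1) open_contains_cball by blast
      then have "ball x e \<in> ?B" "x \<in> ball x e"
        by auto
      then show "x \<in> \<Union>?B"
        by blast
    qed
    show "\<Union>?B \<subseteq> U"
      using ball_subset_cball by blast
  qed
  then have "B \<noteq> {}"
    using B(3) assms(2) by auto
  define e where "e = from_nat_into B"
  have e: "range e = B"
    using \<open>B \<noteq> {}\<close> B(2) by (simp add: e_def range_from_nat_into)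
  have "\<forall>j. \<exists>z r. e j = ball z r \<and> r > 0 \<and> cball z r \<subseteq> U"
    using e B(1) by blast
  then obtain z r where zr: "\<And>j. e j = ball (z j) (r j) \<and> r j > 0 \<and> cball (z j) (r j) \<subseteq> U"
    by metis
  show ?thesis
  proof (rule that[of r z])
    show "U = (\<Union>j. ball (z j) (r j))"
    proof -
      have "(\<Union>j. ball (z j) (r j)) = \<Union>(range e)"
        using zr by simp
      then show ?thesis
        using e B(3) U by simp
    qed
  qed (use zr in auto)
qed

text \<open>\<open>U\<close> is a countable union of balls. One minus the product of the complements
  of the first \<open>k\<close> bumps is a smooth substitute for the union of \<open>k\<close>
  balls, and taking \<open>real k\<close> also as sharpness lets a single limit exhaust
  \<open>U\<close>.\<close>

lemma test_functions_approximate_indicator: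
  fixes U :: "(real^'n::finite) set"
  assumes "open U"
  obtains \<phi> where "\<And>k. test_function U (\<phi> k)" "\<And>k x. \<bar>\<phi> k x\<bar> \<le> 1"
    "\<And>k. \<phi> k \<in> borel_measurable borel" "\<And>x. (\<lambda>k. \<phi> k x) \<longlonglongrightarrow> indicator U x"
proof (cases "U = {}")
  case True
  show ?thesis
    by (rule that[of "\<lambda>k x. 0"])
      (auto simp: True intro!: test_functionI[where Q = "{}"] elem_smooth.const)
next
  case False
  obtain z r where zr: "\<And>j::nat. r j > 0" "\<And>j. cball (z j) (r j) \<subseteq> U" "U = (\<Union>j. ball (z j) (r j))"
    by (rule open_eq_countable_balls[OF assms False]) (rule that, assumption+)
  define \<phi> where "\<phi> k x = 1 + (-1) * (\<Prod>j<k. 1 + (-1) * bump (real k) (z j) (r j) x)" for k x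
  have fac: "0 \<le> 1 + (-1) * bump (real k) (z j) (r j) x" "1 + (-1) * bump (real k) (z j) (r j) x \<le> 1" for k j x
    using bump_bounds[of "real k" "z j" "r j" x] by auto
  have prod: "0 \<le> (\<Prod>j\<in>J. 1 + (-1) * bump (real k) (z j) (r j) x)" 
    "(\<Prod>j\<in>J. 1 + (-1) * bump (real k) (z j) (r j) x) \<le> 1" for k x J
    using fac by (auto intro!: prod_nonneg prod_le_1)
  have es: "elem_smooth (\<phi> k)" for k
    unfolding \<phi>_def by (intro elem_smooth.intros elem_smooth_prod elem_smooth_bump finite_lessThan)
  show ?thesis
  proof (rule that)
    show "test_function U (\<phi> k)" for k
    proof (rule test_functionI[OF es])
      show "closed (\<Union>j<k. cball (z j) (r j))"
        by (intro closed_UN) auto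
      show "bounded (\<Union>j<k. cball (z j) (r j))"
        by (intro bounded_UN) auto
      show "(\<Union>j<k. cball (z j) (r j)) \<subseteq> U"
        using zr(2) by blast
      fix x assume "x \<notin> (\<Union>j<k. cball (z j) (r j))"
      then have "bump (real k) (z j) (r j) x = 0" if "j < k" for j
        using that zr(1)[of j] by (intro bump_eq_0) (auto simp: dist_norm norm_minus_commute not_le less_imp_le)
      then show "\<phi> k x = 0"
        by (simp add: \<phi>_def)
    qed
    show "\<bar>\<phi> k x\<bar> \<le> 1" for k x
      using prod[of k x "{..<k}"] unfolding \<phi>_def by auto
    show "\<phi> k \<in> borel_measurable borel" for k
      using elem_smooth_continuous[OF es] by (rule borel_measurable_continuous_onI)
    fix x
    show "(\<lambda>k. \<phi> k x) \<longlonglongrightarrow> indicator U x"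
    proof (cases "x \<in> U")
      case True
      then obtain j where j: "x \<in> ball (z j) (r j)"
        using zr(3) by blast
      \<comment> \<open>The factor of a ball that contains \<open>x\<close> tends to 0, and all
        other factors are at most 1.\<close>
      have "(\<lambda>k. \<Prod>i<k. 1 + (-1) * bump (real k) (z i) (r i) x) \<longlonglongrightarrow> 0"
      proof (rule tendsto_sandwich)
        show "\<forall>\<^sub>F k in sequentially. 0 \<le> (\<Prod>i<k. 1 + (-1) * bump (real k) (z i) (r i) x)"
          using prod by (intro always_eventually allI) blast
        show "\<forall>\<^sub>F k in sequentially. (\<Prod>i<k. 1 + (-1) * bump (real k) (z i) (r i) x)
            \<le> 1 + (-1) * bump (real k) (z j) (r j) x"
          using eventually_gt_at_top[of j]
        proof eventually_elim
          case (elim k)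
          have eq: "(\<Prod>i<k. 1 + (-1) * bump (real k) (z i) (r i) x) =
              (1 + (-1) * bump (real k) (z j) (r j) x) *
              (\<Prod>i\<in>{..<k} - {j}. 1 + (-1) * bump (real k) (z i) (r i) x)"
            using elim by (intro prod.remove) auto
          show ?case
            unfolding eq by (rule mult_left_le[OF prod(2) fac(1)])
        qed
        show "(\<lambda>k. 1 + (-1) * bump (real k) (z j) (r j) x) \<longlonglongrightarrow> 0"
          using tendsto_add[OF tendsto_const[of 1] tendsto_mult[OF tendsto_const[of "-1"] bump_tendsto[OF zr(1)[of j], of "z j" x]]] j
          by simp
      qed simp
      then have "(\<lambda>k. \<phi> k x) \<longlonglongrightarrow> 1 + (-1) * 0"
        unfolding \<phi>_def by (intro tendsto_intros)
      then show ?thesis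
        using True by simp
    next
      case False
      then have "bump (real k) (z j) (r j) x = 0" for j k
        using zr by (intro bump_eq_0) (auto simp: dist_norm norm_minus_commute not_less)
      then show ?thesis
        using False by (simp add: \<phi>_def)
    qed
  qed
qed

lemma test_function_mono: "test_function D \<phi> \<Longrightarrow> D \<subseteq> D' \<Longrightarrow> test_function D' \<phi>"
  by (auto simp: test_function_def)

lemma integral_open_eq_0_if_test_functions:
  fixes D :: "(real^'n::finite) set"
  assumes "open D" "integrable (lebesgue_on D) f" "open U" "U \<subseteq> D"
    and "\<And>\<phi>. test_function D \<phi> \<Longrightarrow> (\<integral>x. f x * \<phi> x \<partial>lebesgue_on D) = 0"
  shows "(\<integral>x. f x * indicator U x \<partial>lebesgue_on D) = 0"
proof -
  obtain \<phi> where \<phi>: "\<And>k. test_function U (\<phi> k)" "\<And>k x. \<bar>\<phi> k x\<bar> \<le> 1"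
    "\<And>k. \<phi> k \<in> borel_measurable borel" "\<And>x. (\<lambda>k. \<phi> k x) \<longlonglongrightarrow> indicator U x"
    by (rule test_functions_approximate_indicator[OF assms(3)]) (rule that, assumption+)
  have m: "\<phi> k \<in> borel_measurable (lebesgue_on D)" for k
    using \<phi>(3)[of k] by (simp add: measurable_completion measurable_restrict_space1)
  have mU: "(indicator U :: _ \<Rightarrow> real) \<in> borel_measurable (lebesgue_on D)"
    using assms(3) by (intro measurable_restrict_space1 measurable_completion) auto
  have mf: "f \<in> borel_measurable (lebesgue_on D)"
    using assms(2) by blast
  have "(\<lambda>k. \<integral>x. f x * \<phi> k x \<partial>lebesgue_on D) \<longlonglongrightarrow> (\<integral>x. f x * indicator U x \<partial>lebesgue_on D)"
  proof (rule integral_dominated_convergence[where w = "\<lambda>x. \<bar>f x\<bar>"])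
    show "AE x in lebesgue_on D. (\<lambda>k. f x * \<phi> k x) \<longlonglongrightarrow> f x * indicator U x"
      by (intro AE_I2 tendsto_mult tendsto_const \<phi>(4))
    show "AE x in lebesgue_on D. norm (f x * \<phi> k x) \<le> \<bar>f x\<bar>" for k
      using \<phi>(2) by (intro AE_I2) (simp add: abs_mult mult_left_le)
  qed (use m mU mf assms(2) in auto)
  moreover have "(\<integral>x. f x * \<phi> k x \<partial>lebesgue_on D) = 0" for k
    using assms(4,5) \<phi>(1) test_function_mono by blast
  ultimately show ?thesis
    by (simp add: LIMSEQ_const_iff)
qed

text \<open>Outer regularity: finite intersections of open supersets whose excess measure is below
  \<open>inverse (real (Suc n))\<close> decrease to \<open>A\<close> up to a null set, and dominated
  convergence transfers the vanishing integrals.\<close>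

lemma integral_set_eq_0_if_open_sets:
  fixes D :: "'a::euclidean_space set"
  assumes "open D" "integrable (lebesgue_on D) f" and A: "A \<in> sets lebesgue" "A \<subseteq> D"
    and 0: "\<And>U. open U \<Longrightarrow> U \<subseteq> D \<Longrightarrow> (\<integral>x. f x * indicator U x \<partial>lebesgue_on D) = (0::real)"
  shows "(\<integral>x. f x * indicator A x \<partial>lebesgue_on D) = 0"
proof -
  have "\<exists>T. open T \<and> A \<subseteq> T \<and> T - A \<in> lmeasurable \<and> emeasure lebesgue (T - A) < ennreal (inverse (real (Suc n)))" for n
    using sets_lebesgue_outer_open[OF A(1), of "inverse (real (Suc n))"] by (metis inverse_positive_iff_positive of_nat_0_less_iff zero_less_Suc)
  then obtain T where T: "\<And>n. open (T n)" "\<And>n. A \<subseteq> T n" "\<And>n. T n - A \<in> lmeasurable"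
    "\<And>n. emeasure lebesgue (T n - A) < ennreal (inverse (real (Suc n)))"
    by metis
  define U where "U n = D \<inter> (\<Inter>j\<le>n. T j)" for n
  have U: "open (U n)" "U n \<subseteq> D" "A \<subseteq> U n" for n
    using T A(2) assms(1) by (auto simp: U_def)
  have Tm: "T n \<in> sets lebesgue" for n
    using T(1)[of n] by (simp add: borel_open)
  have null: "(\<Inter>n. T n) - A \<in> null_sets lebesgue"
  proof (rule null_setsI)
    show "(\<Inter>n. T n) - A \<in> sets lebesgue"
      using Tm A by (intro sets.Diff sets.countable_INT) auto
    have "emeasure lebesgue ((\<Inter>n. T n) - A) \<le> ennreal (inverse (real (Suc n)))" for n
    proof -
      have "emeasure lebesgue ((\<Inter>n. T n) - A) \<le> emeasure lebesgue (T n - A)"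
        using Tm A by (intro emeasure_mono) auto
      then show ?thesis
        using T(4)[of n] by simp
    qed
    moreover have "(\<lambda>n. ennreal (inverse (real (Suc n)))) \<longlonglongrightarrow> ennreal 0"
      by (intro tendsto_ennrealI LIMSEQ_inverse_real_of_nat)
    ultimately have "emeasure lebesgue ((\<Inter>n. T n) - A) \<le> ennreal 0"
      by (intro LIMSEQ_le_const) auto
    then show "emeasure lebesgue ((\<Inter>n. T n) - A) = 0"
      by simp
  qed
  have AE: "AE x in lebesgue_on D. (\<lambda>n. indicator (U n) x) \<longlonglongrightarrow> (indicator A x :: real)"
  proof -
    have "AE x in lebesgue. x \<notin> (\<Inter>n. T n) - A"
      by (rule AE_not_in[OF null])
    then have "AE x in lebesgue. x \<in> D \<longrightarrow> (\<lambda>n. indicator (U n) x) \<longlonglongrightarrow> (indicator A x :: real)"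
    proof eventually_elim
      case (elim x)
      show ?case
      proof
        assume "x \<in> D"
        show "(\<lambda>n. indicator (U n) x) \<longlonglongrightarrow> (indicator A x :: real)"
        proof (cases "x \<in> A")
          case True
          then show ?thesis using U(3) by (simp add: indicator_def subset_iff)
        next
          case False
          then obtain N where N: "x \<notin> T N"
            using elim by blast
          have "\<forall>\<^sub>F n in sequentially. indicator (U n) x = (0::real)"
            by (rule eventually_mono[OF eventually_ge_at_top[of N]]) (use N in \<open>auto simp: U_def indicator_def\<close>)
          then show ?thesis
            using False by (simp add: tendsto_eventually)
        qed
      qed
    qed
    then show ?thesis
      using assms(1) by (subst AE_restrict_space_iff) auto
  qed
  have mU: "(indicator (U n) :: _ \<Rightarrow> real) \<in> borel_measurable (lebesgue_on D)" for n
    using U(1)[of n] by (intro measurable_restrict_space1 measurable_completion) auto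
  have mA: "(indicator A :: _ \<Rightarrow> real) \<in> borel_measurable (lebesgue_on D)"
    using A(1) by (intro measurable_restrict_space1) auto
  have mf: "f \<in> borel_measurable (lebesgue_on D)"
    using assms(2) by blast
  have "(\<lambda>n. \<integral>x. f x * indicator (U n) x \<partial>lebesgue_on D) \<longlonglongrightarrow> (\<integral>x. f x * indicator A x \<partial>lebesgue_on D)"
  proof (rule integral_dominated_convergence[where w = "\<lambda>x. \<bar>f x\<bar>"])
    show "AE x in lebesgue_on D. (\<lambda>n. f x * indicator (U n) x) \<longlonglongrightarrow> f x * indicator A x"
      using AE by eventually_elim (intro tendsto_mult tendsto_const)
    show "AE x in lebesgue_on D. norm (f x * indicator (U n) x) \<le> \<bar>f x\<bar>" for n
      by (intro AE_I2) (simp add: abs_mult indicator_def)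
  qed (use mU mA mf assms(2) in auto)
  then show ?thesis
    using 0[OF U(1,2)] by (simp add: LIMSEQ_const_iff)
qed

text \<open>The integrals over all measurable subsets vanish, in particular over the two sets where
  \<open>f\<close> has a fixed sign and nothing can cancel.\<close>

lemma AE_eq_0_if_test_functions:
  fixes D :: "(real^'n::finite) set"
  assumes "open D" "integrable (lebesgue_on D) f"
    and "\<And>\<phi>. test_function D \<phi> \<Longrightarrow> (\<integral>x. f x * \<phi> x \<partial>lebesgue_on D) = 0"
  shows "AE x in lebesgue_on D. f x = 0"
proof -
  have 0: "(\<integral>x. f x * indicator A x \<partial>lebesgue_on D) = 0" if "A \<in> sets lebesgue" "A \<subseteq> D" for A
    using integral_set_eq_0_if_open_sets[OF assms(1,2) that]
      integral_open_eq_0_if_test_functions[OF assms(1,2) _ _ assms(3)] by blast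
  have mf: "f \<in> borel_measurable (lebesgue_on D)"
    using assms(2) by blast
  have pm: "{x \<in> D. f x > 0} \<in> sets lebesgue" "{x \<in> D. f x < 0} \<in> sets lebesgue"
  proof -
    have "D \<in> sets lebesgue"
      using assms(1) by (simp add: borel_open)
    moreover have "{x \<in> space (lebesgue_on D). f x > 0} \<in> sets (lebesgue_on D)"
      "{x \<in> space (lebesgue_on D). f x < 0} \<in> sets (lebesgue_on D)"
      using mf by measurable
    ultimately show "{x \<in> D. f x > 0} \<in> sets lebesgue" "{x \<in> D. f x < 0} \<in> sets lebesgue"
      by (auto simp: sets_restrict_space_iff space_restrict_space)
  qed
  have ind: "integrable (lebesgue_on D) (\<lambda>x. f x * indicator A x)" if "A \<in> sets lebesgue" "A \<subseteq> D" for A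
    using integrable_mult_indicator[OF _ assms(2), of A] that assms(1)
    by (simp add: sets_restrict_space_iff borel_open mult.commute)
  have "AE x in lebesgue_on D. f x * indicator {x \<in> D. f x > 0} x = 0"
    using integral_nonneg_eq_0_iff_AE[OF ind[OF pm(1)]] 0[OF pm(1)] by (auto simp: indicator_def)
  moreover have "AE x in lebesgue_on D. - (f x * indicator {x \<in> D. f x < 0} x) = 0"
    using integral_nonneg_eq_0_iff_AE[OF integrable_minus[OF ind[OF pm(2)]]] 0[OF pm(2)]
    by (auto simp: indicator_def)
  moreover have "AE x in lebesgue_on D. x \<in> D"
    by (rule AE_I2) (simp add: space_restrict_space)
  ultimately show ?thesis
    by eventually_elim (auto simp: indicator_def not_less split: if_splits intro: antisym)
qed

lemma lebesgue_measurable_AE: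
  fixes f g :: "'a::euclidean_space \<Rightarrow> real"
  assumes "f \<in> borel_measurable lebesgue" "AE x in lebesgue. f x = g x"
  shows "g \<in> borel_measurable lebesgue"
proof (rule measurableI)
  fix S :: "real set" assume "S \<in> sets borel"
  then have "f -` S \<in> sets lebesgue"
    using measurable_sets[OF assms(1)] by simp
  moreover have "AE x in lebesgue. x \<in> f -` S \<longleftrightarrow> x \<in> g -` S"
    using assms(2) by eventually_elim simp
  ultimately show "g -` S \<inter> space lebesgue \<in> sets lebesgue"
    using completion.in_sets_AE[of "f -` S" "g -` S" lborel] by simp
qed simp

text \<open>Measurability of \<open>g\<close> is inherited through completeness of the measure. This
  admits integrands such as the product of \<open>K\<close> with a chosen \<open>weak_grad\<close>,
  for which it would otherwise have to be proved separately.\<close>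

lemma lebesgue_on_cong_AE:
  fixes f g :: "'a::euclidean_space \<Rightarrow> real"
  assumes D: "D \<in> sets lebesgue" and f: "f \<in> borel_measurable (lebesgue_on D)"
    and eq: "AE x in lebesgue_on D. f x = g x"
  shows "(\<integral>x. f x \<partial>lebesgue_on D) = (\<integral>x. g x \<partial>lebesgue_on D)"
proof -
  have D': "D \<inter> space lebesgue \<in> sets lebesgue"
    using D by simp
  have 1: "(\<lambda>x. indicator D x *\<^sub>R f x) \<in> borel_measurable lebesgue"
    using f borel_measurable_restrict_space_iff[OF D', of f] by simp
  have 2: "AE x in lebesgue. indicator D x *\<^sub>R f x = indicator D x *\<^sub>R g x"
    using eq AE_restrict_space_iff[OF D', of "\<lambda>x. f x = g x"] by (auto elim!: eventually_mono)
  have "(\<integral>x. indicator D x *\<^sub>R f x \<partial>lebesgue) = (\<integral>x. indicator D x *\<^sub>R g x \<partial>lebesgue)"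
    by (rule integral_cong_AE[OF 1 lebesgue_measurable_AE[OF 1 2] 2])
  then show ?thesis
    by (simp only: integral_restrict_space[OF D'])
qed

lemma grad_has_derivative:
  assumes "f differentiable at x"
  shows "(f has_derivative (\<lambda>h. grad f x \<bullet> h)) (at x)"
proof -
  let ?D = "frechet_derivative f (at x)"
  have D: "(f has_derivative ?D) (at x)"
    using assms frechet_derivative_works by blast
  then have "linear ?D"
    using has_derivative_linear by blast
  then have "?D h = grad f x \<bullet> h" for h
  proof -
    have "?D h = ?D (\<Sum>i\<in>UNIV. (h $ i) *\<^sub>R axis i 1)"
      using basis_expansion[of h] by (simp add: scalar_mult_eq_scaleR)
    also have "\<dots> = (\<Sum>i\<in>UNIV. (h $ i) * ?D (axis i 1))"
      using \<open>linear ?D\<close> by (simp add: linear_sum linear_scale)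
    also have "\<dots> = grad f x \<bullet> h"
      by (simp add: grad_def inner_vec_def mult.commute)
    finally show ?thesis .
  qed
  then have "?D = (\<lambda>h. grad f x \<bullet> h)"
    by (rule ext)
  then show ?thesis
    using D by simp
qed

lemma grad_eqI: "(f has_derivative (\<lambda>h. d \<bullet> h)) (at x) \<Longrightarrow> grad f x = d"
  by (drule frechet_derivative_at[symmetric]) (simp add: grad_def vec_eq_iff inner_axis)

lemma continuous_on_grad: "Ck_on k S f \<Longrightarrow> k \<ge> 1 \<Longrightarrow> continuous_on S (grad f)"
proof -
  assume "Ck_on k S f" "k \<ge> 1"
  then have "continuous_on S (iter_partial [i] f)" for i
    unfolding Ck_on_def by (auto simp del: iter_partial.simps)
  then show ?thesis
    unfolding grad_def by (intro continuous_on_vec_lambda)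
qed

text \<open>What integration by parts asks of the factor without compact support. The bounds make
  the products integrable although nothing is required at the boundary of \<open>D\<close>.\<close>

definition bounded_C1 :: "(real^'n::finite) set \<Rightarrow> (real^'n \<Rightarrow> real) \<Rightarrow> bool" where
  "bounded_C1 D q \<longleftrightarrow> (\<forall>x\<in>D. q differentiable at x) \<and> continuous_on D (grad q) \<and>
     (\<exists>B. \<forall>x\<in>D. \<bar>q x\<bar> \<le> B \<and> norm (grad q x) \<le> B)"

lemma bounded_C1_subset: "bounded_C1 D q \<Longrightarrow> D' \<subseteq> D \<Longrightarrow> bounded_C1 D' q"
  unfolding bounded_C1_def using continuous_on_subset by blast

lemma bounded_C1_continuous: "bounded_C1 D q \<Longrightarrow> continuous_on D q"
  unfolding bounded_C1_def
  by (simp add: continuous_at_imp_continuous_on differentiable_imp_continuous_within)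

lemma test_function_facts:
  fixes \<phi> :: "real^'n::finite \<Rightarrow> real"
  assumes "test_function D \<phi>"
  obtains Q L where "compact Q" "Q \<subseteq> D" "\<And>x. x \<notin> Q \<Longrightarrow> \<phi> x = 0" "\<And>x. x \<notin> Q \<Longrightarrow> grad \<phi> x = 0"
    "\<And>x y. \<bar>\<phi> x - \<phi> y\<bar> \<le> L * norm (x - y)" "bounded_C1 UNIV \<phi>"
proof -
  define Q where "Q = closure {x. \<phi> x \<noteq> 0}"
  have Q: "compact Q" "Q \<subseteq> D"
    using assms by (auto simp: test_function_def Q_def)
  have Q0: "\<phi> x = 0" if "x \<notin> Q" for x
    using that closure_subset[of "{x. \<phi> x \<noteq> 0}"] by (auto simp: Q_def)
  have Ck: "Ck_on 1 UNIV \<phi>"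
    using assms by (simp add: test_function_def)
  have diff: "\<phi> differentiable at x" for x
  proof -
    have "iter_partial [] \<phi> differentiable at x"
      using Ck unfolding Ck_on_def by blast
    then show ?thesis by simp
  qed
  have cg: "continuous_on UNIV (grad \<phi>)"
    using continuous_on_grad[OF Ck] by simp
  have c: "continuous_on UNIV \<phi>"
    using diff by (simp add: continuous_at_imp_continuous_on differentiable_imp_continuous_within)
  have Qg: "grad \<phi> x = 0" if "x \<notin> Q" for x
  proof (rule grad_eqI)
    have "((\<lambda>x. 0) has_derivative (\<lambda>h. 0 \<bullet> h)) (at x)"
      by simp
    then show "(\<phi> has_derivative (\<lambda>h. 0 \<bullet> h)) (at x)"
      by (rule has_derivative_transform_within_open[where s = "- Q"])
        (use Q that Q0 in \<open>auto simp: compact_imp_closed open_Compl\<close>)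
  qed
  have "bounded (grad \<phi> ` Q)" "bounded (\<phi> ` Q)"
    by (intro compact_imp_bounded compact_continuous_image continuous_on_subset[OF cg]
        continuous_on_subset[OF c] Q; simp)+
  then obtain B1 B2 where B: "\<And>x. x \<in> Q \<Longrightarrow> norm (grad \<phi> x) \<le> B1" "\<And>x. x \<in> Q \<Longrightarrow> \<bar>\<phi> x\<bar> \<le> B2"
    by (auto simp: bounded_iff)
  define B where "B = max 0 (max B1 B2)"
  have B': "norm (grad \<phi> x) \<le> B" "\<bar>\<phi> x\<bar> \<le> B" for x
    using B[of x] Q0[of x] Qg[of x] by (cases "x \<in> Q"; simp add: B_def le_max_iff_disj)+
  have lip: "\<bar>\<phi> x - \<phi> y\<bar> \<le> B * norm (x - y)" for x y
  proof -
    have "norm (\<phi> x - \<phi> y) \<le> B * norm (x - y)"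
    proof (rule differentiable_bound[of UNIV])
      show "(\<phi> has_derivative (\<lambda>h. grad \<phi> x \<bullet> h)) (at x within UNIV)" for x
        using grad_has_derivative[OF diff] .
      show "onorm (\<lambda>h. grad \<phi> x \<bullet> h) \<le> B" for x
      proof (rule onorm_bound)
        show "norm (grad \<phi> x \<bullet> h) \<le> B * norm h" for h
          using Cauchy_Schwarz_ineq2[of "grad \<phi> x" h] mult_right_mono[OF B'(1)[of x], of "norm h"]
          by simp
      qed (simp add: B_def)
    qed auto
    then show ?thesis by simp
  qed
  have "bounded_C1 UNIV \<phi>"
    using diff cg B' by (auto simp: bounded_C1_def)
  then show ?thesis
    using that[OF Q Q0 Qg lip] by blast
qed

lemma test_function_by_parts:
  fixes \<phi> q :: "real^'n::finite \<Rightarrow> real"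
  assumes D: "open D" and q: "bounded_C1 D q" and \<phi>: "test_function D \<phi>"
  shows "integrable (lebesgue_on D) (\<lambda>x. q x * (grad \<phi> x \<bullet> e))"
    "integrable (lebesgue_on D) (\<lambda>x. (grad q x \<bullet> e) * \<phi> x)"
    "(\<integral>x. q x * (grad \<phi> x \<bullet> e) \<partial>lebesgue_on D) = - (\<integral>x. (grad q x \<bullet> e) * \<phi> x \<partial>lebesgue_on D)"
proof -
  obtain Q L where Q: "compact Q" "Q \<subseteq> D" "\<And>x. x \<notin> Q \<Longrightarrow> \<phi> x = 0"
    and L: "\<And>x y. \<bar>\<phi> x - \<phi> y\<bar> \<le> L * norm (x - y)" and C1: "bounded_C1 UNIV \<phi>"
    by (rule test_function_facts[OF \<phi>]) (rule that, assumption+)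
  obtain B where B: "\<And>x. x \<in> D \<Longrightarrow> \<bar>q x\<bar> \<le> B" "\<And>x. x \<in> D \<Longrightarrow> norm (grad q x) \<le> B"
    using q unfolding bounded_C1_def by blast
  have dq: "(q has_derivative (\<lambda>h. grad q x \<bullet> h)) (at x)" if "x \<in> D" for x
    using q that grad_has_derivative unfolding bounded_C1_def by blast
  have d\<phi>: "AE x in lborel. x \<in> D \<longrightarrow> (\<phi> has_derivative (\<lambda>h. grad \<phi> x \<bullet> h)) (at x)"
    using C1 grad_has_derivative unfolding bounded_C1_def by (intro AE_I2) blast
  have mg: "grad \<phi> \<in> borel_measurable borel"
    using C1 unfolding bounded_C1_def by (blast intro: borel_measurable_continuous_onI)
  have cq: "continuous_on D (grad q)"
    using q unfolding bounded_C1_def by blast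
  note * = integral_by_parts_compact_support[OF D Q(1,2) dq cq B L Q(3) d\<phi> mg, of e]
  have D': "D \<in> sets borel"
    using D by simp
  have m: "(\<lambda>x. indicator D x * (q x * (grad \<phi> x \<bullet> e))) \<in> borel_measurable borel"
    "(\<lambda>x. indicator D x * ((grad q x \<bullet> e) * \<phi> x)) \<in> borel_measurable borel"
    using *(1,2)[THEN borel_measurable_integrable] by simp_all
  show "integrable (lebesgue_on D) (\<lambda>x. q x * (grad \<phi> x \<bullet> e))"
    "integrable (lebesgue_on D) (\<lambda>x. (grad q x \<bullet> e) * \<phi> x)"
    "(\<integral>x. q x * (grad \<phi> x \<bullet> e) \<partial>lebesgue_on D) = - (\<integral>x. (grad q x \<bullet> e) * \<phi> x \<partial>lebesgue_on D)"
    using * lebesgue_on_lborel[OF D' m(1)] lebesgue_on_lborel[OF D' m(2)] by simp_all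
qed

lemma integrable_bounded_continuous:
  fixes f :: "'a::euclidean_space \<Rightarrow> 'b::euclidean_space"
  assumes "open D" "bounded D" "continuous_on D f" "\<And>x. x \<in> D \<Longrightarrow> norm (f x) \<le> B"
  shows "integrable (lebesgue_on D) f"
proof (rule integrableI_bounded_set[where A = D and B = B])
  have D: "D \<in> sets lebesgue"
    using assms(1) by (simp add: borel_open)
  then show "D \<in> sets (lebesgue_on D)"
    by (simp add: sets_restrict_space_iff)
  show "f \<in> borel_measurable (lebesgue_on D)"
    using continuous_imp_measurable_on_sets_lebesgue[OF assms(3) D] .
  have "D \<in> lmeasurable"
    using assms(1,2) by (simp add: lmeasurable_open)
  then have "emeasure lebesgue D \<noteq> top"
    by (rule fmeasurableD2)
  moreover have "emeasure (lebesgue_on D) D = emeasure lebesgue D"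
    by (rule emeasure_restrict_space) (use D in auto)
  ultimately show "emeasure (lebesgue_on D) D < \<infinity>"
    by (simp only: top.not_eq_extremum infinity_ennreal_def)
qed (use assms(4) in \<open>auto intro!: AE_I2 simp: space_restrict_space\<close>)

lemma L2_on_integrable_component:
  fixes g :: "real^'n::finite \<Rightarrow> 'b::euclidean_space"
  assumes "open D" "bounded D" "L2_on D g" "norm b \<le> 1"
  shows "integrable (lebesgue_on D) (\<lambda>x. g x \<bullet> b)"
proof (rule Bochner_Integration.integrable_bound)
  have "integrable (lebesgue_on D) (\<lambda>x. 1 :: real)"
    by (rule integrable_bounded_continuous[OF assms(1,2)]) auto
  then show "integrable (lebesgue_on D) (\<lambda>x. 1 + (norm (g x))\<^sup>2)"
    using assms(3) by (auto simp: L2_on_def)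
  have [measurable]: "g \<in> borel_measurable (lebesgue_on D)"
    using assms(3) by (auto simp: L2_on_def)
  show "(\<lambda>x. g x \<bullet> b) \<in> borel_measurable (lebesgue_on D)"
    by measurable
  have "\<bar>g x \<bullet> b\<bar> \<le> 1 + (norm (g x))\<^sup>2" for x
  proof -
    have "\<bar>g x \<bullet> b\<bar> \<le> norm (g x) * 1"
      using Cauchy_Schwarz_ineq2[of "g x" b] mult_left_mono[OF assms(4), of "norm (g x)"] by simp
    also have "\<dots> \<le> 1 + (norm (g x))\<^sup>2"
      using zero_le_power2[of "norm (g x) - 1"] zero_le_power2[of "norm (g x)"] norm_ge_zero[of "g x"]
      unfolding power2_diff power_one by linarith
    finally show ?thesis .
  qed
  then show "AE x in lebesgue_on D. norm (g x \<bullet> b) \<le> norm (1 + (norm (g x))\<^sup>2)"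
    by (intro AE_I2) (smt (verit, best) real_norm_def)
qed

lemma integrable_mult_bounded_continuous:
  fixes f q :: "'a::euclidean_space \<Rightarrow> real"
  assumes "open D" "integrable (lebesgue_on D) f" "continuous_on D q" "\<And>x. x \<in> D \<Longrightarrow> \<bar>q x\<bar> \<le> B"
  shows "integrable (lebesgue_on D) (\<lambda>x. f x * q x)"
proof (rule Bochner_Integration.integrable_bound)
  have D: "D \<in> sets lebesgue"
    using assms(1) by (simp add: borel_open)
  show "integrable (lebesgue_on D) (\<lambda>x. f x * B)"
    using assms(2) by simp
  have [measurable]: "q \<in> borel_measurable (lebesgue_on D)"
    using continuous_imp_measurable_on_sets_lebesgue[OF assms(3) D] .
  have [measurable]: "f \<in> borel_measurable (lebesgue_on D)"
    using assms(2) by blast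
  show "(\<lambda>x. f x * q x) \<in> borel_measurable (lebesgue_on D)"
    by measurable
  show "AE x in lebesgue_on D. norm (f x * q x) \<le> norm (f x * B)"
  proof (rule AE_I2)
    fix x assume "x \<in> space (lebesgue_on D)"
    then have "\<bar>q x\<bar> \<le> \<bar>B\<bar>"
      using assms(4)[of x] by (simp add: space_restrict_space)
    then show "norm (f x * q x) \<le> norm (f x * B)"
      by (simp add: abs_mult mult_left_mono)
  qed
qed

text \<open>A test function of \<open>D'\<close> is one of \<open>D\<close>, so the weak identity
  localizes to \<open>D'\<close>, where classical integration by parts has the same left-hand side;
  the fundamental lemma concludes. For the exact solution, \<open>D'\<close> is a single cell, since
  \<open>u\<close> need not be differentiable across faces.\<close>

lemma weak_gradient_AE_eq_grad:
  fixes u :: "real^'n::finite \<Rightarrow> real"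
  assumes D: "open D" "bounded D" and g: "L2_on D g" "has_weak_gradient D u g"
    and D': "open D'" "D' \<subseteq> D" and u: "bounded_C1 D' u"
  shows "AE x in lebesgue_on D'. g x = grad u x"
proof -
  have leb: "D \<in> sets lebesgue" "D' \<in> sets lebesgue"
    using D D' by (simp_all add: borel_open)
  have bD': "bounded D'"
    using D(2) D'(2) bounded_subset by blast
  obtain B where B: "\<And>x. x \<in> D' \<Longrightarrow> norm (grad u x) \<le> B"
    using u unfolding bounded_C1_def by blast
  have cu: "continuous_on D' (grad u)"
    using u unfolding bounded_C1_def by blast
  have "AE x in lebesgue_on D'. (g x - grad u x) $ i = 0" for i
  proof (rule AE_eq_0_if_test_functions[OF D'(1)])
    have ig: "integrable (lebesgue_on D') (\<lambda>x. g x $ i)"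
      using integrable_lebesgue_on_subset[OF L2_on_integrable_component[OF D g(1), of "axis i 1"] leb D'(2)]
      by (simp add: inner_axis)
    have iu: "integrable (lebesgue_on D') (\<lambda>x. grad u x $ i)"
    proof (rule integrable_bounded_continuous[OF D'(1) bD'])
      show "continuous_on D' (\<lambda>x. grad u x $ i)"
        using cu by (intro continuous_on_component)
      show "norm (grad u x $ i) \<le> B" if "x \<in> D'" for x
        using B[OF that] component_le_norm_cart[of "grad u x" i] by simp
    qed
    show "integrable (lebesgue_on D') (\<lambda>x. (g x - grad u x) $ i)"
      using ig iu by simp
    fix \<phi> assume \<phi>: "test_function D' \<phi>"
    obtain Q where Q: "Q \<subseteq> D'" "\<And>x. x \<notin> Q \<Longrightarrow> \<phi> x = 0" "\<And>x. x \<notin> Q \<Longrightarrow> grad \<phi> x = 0"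
      and C1: "bounded_C1 UNIV \<phi>"
      by (rule test_function_facts[OF \<phi>]) (rule that, assumption+)
    obtain B' where B': "\<And>x. \<bar>\<phi> x\<bar> \<le> B'"
      using C1 unfolding bounded_C1_def by blast
    have c\<phi>: "continuous_on S \<phi>" for S
      using bounded_C1_continuous[OF C1] continuous_on_subset by blast
    have off: "\<phi> x = 0" "grad \<phi> x = 0" if "x \<in> D - D'" for x
      using Q that by blast+
    have "(\<integral>x. u x * iter_partial [i] \<phi> x \<partial>lebesgue_on D) = - (\<integral>x. g x $ i * \<phi> x \<partial>lebesgue_on D)"
      using g(2) test_function_mono[OF \<phi> D'(2)] unfolding has_weak_gradient_def by blast
    moreover have "iter_partial [i] \<phi> x = grad \<phi> x \<bullet> axis i 1" for x
      by (simp add: grad_def inner_axis)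
    ultimately have "(\<integral>x. u x * (grad \<phi> x \<bullet> axis i 1) \<partial>lebesgue_on D) = - (\<integral>x. g x $ i * \<phi> x \<partial>lebesgue_on D)"
      by simp
    moreover have "(\<integral>x. u x * (grad \<phi> x \<bullet> axis i 1) \<partial>lebesgue_on D) =
        (\<integral>x. u x * (grad \<phi> x \<bullet> axis i 1) \<partial>lebesgue_on D')"
      by (rule integral_lebesgue_on_subset[OF leb D'(2)]) (simp add: off)
    moreover have "(\<integral>x. g x $ i * \<phi> x \<partial>lebesgue_on D) = (\<integral>x. g x $ i * \<phi> x \<partial>lebesgue_on D')"
      by (rule integral_lebesgue_on_subset[OF leb D'(2)]) (simp add: off)
    ultimately have "(\<integral>x. g x $ i * \<phi> x \<partial>lebesgue_on D') = (\<integral>x. grad u x $ i * \<phi> x \<partial>lebesgue_on D')"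
      using test_function_by_parts(3)[OF D'(1) u \<phi>, of "axis i 1"] by (simp add: inner_axis)
    moreover have "integrable (lebesgue_on D') (\<lambda>x. g x $ i * \<phi> x)"
      "integrable (lebesgue_on D') (\<lambda>x. grad u x $ i * \<phi> x)"
      using integrable_mult_bounded_continuous[OF D'(1) ig c\<phi> B']
        integrable_mult_bounded_continuous[OF D'(1) iu c\<phi> B'] by auto
    ultimately show "(\<integral>x. (g x - grad u x) $ i * \<phi> x \<partial>lebesgue_on D') = 0"
      by (simp add: left_diff_distrib)
  qed
  then have "AE x in lebesgue_on D'. \<forall>i. (g x - grad u x) $ i = 0"
    by (simp add: AE_all_countable)
  then show ?thesis
    by eventually_elim (simp add: vec_eq_iff)
qed

lemma L2_on_bounded_continuous:
  fixes f :: "real^'n::finite \<Rightarrow> 'b::euclidean_space"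
  assumes "open D" "bounded D" "continuous_on D f" "\<And>x. x \<in> D \<Longrightarrow> norm (f x) \<le> B"
  shows "L2_on D f"
  unfolding L2_on_def
proof
  show "f \<in> borel_measurable (lebesgue_on D)"
    using assms(1) by (intro continuous_imp_measurable_on_sets_lebesgue[OF assms(3)]) (simp add: borel_open)
  show "integrable (lebesgue_on D) (\<lambda>x. (norm (f x))\<^sup>2)"
    by (rule integrable_bounded_continuous[OF assms(1,2), where B = "B\<^sup>2"])
      (use assms(3,4) in \<open>auto intro!: continuous_intros power_mono\<close>)
qed

lemma weak_grad_of_H1:
  assumes "in_H1 D u"
  shows "L2_on D (weak_grad D u)" "has_weak_gradient D u (weak_grad D u)"
proof -
  have ex: "\<exists>g. L2_on D g \<and> has_weak_gradient D u g"
    using assms by (simp add: in_H1_def)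
  show "L2_on D (weak_grad D u)"
    unfolding weak_grad_def using someI_ex[OF ex] by (rule conjunct1)
  show "has_weak_gradient D u (weak_grad D u)"
    unfolding weak_grad_def using someI_ex[OF ex] by (rule conjunct2)
qed

lemma test_function_weak_gradient:
  fixes \<phi> :: "real^'n::finite \<Rightarrow> real"
  assumes D: "open D" "bounded D" and \<phi>: "test_function D \<phi>"
  shows "in_H10 D \<phi>" "AE x in lebesgue_on D. weak_grad D \<phi> x = grad \<phi> x"
proof -
  obtain Q where C1: "bounded_C1 UNIV \<phi>" and Q: "Q \<subseteq> D"
    by (rule test_function_facts[OF \<phi>]) (rule that, assumption+)
  have C1D: "bounded_C1 D \<phi>"
    using bounded_C1_subset[OF C1] by blast
  then obtain B where B: "\<And>x. x \<in> D \<Longrightarrow> \<bar>\<phi> x\<bar> \<le> B" "\<And>x. x \<in> D \<Longrightarrow> norm (grad \<phi> x) \<le> B"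
    unfolding bounded_C1_def by blast
  have cg: "continuous_on D (grad \<phi>)"
    using C1D unfolding bounded_C1_def by blast
  have L2: "L2_on D \<phi>" "L2_on D (grad \<phi>)"
    using L2_on_bounded_continuous[OF D bounded_C1_continuous[OF C1D]] B
      L2_on_bounded_continuous[OF D cg] by auto
  have wg: "has_weak_gradient D \<phi> (grad \<phi>)"
    unfolding has_weak_gradient_def
  proof (intro allI impI)
    fix \<psi> i assume "test_function D \<psi>"
    from test_function_by_parts(3)[OF D(1) C1D this, of "axis i 1"]
    show "(\<integral>x. \<phi> x * iter_partial [i] \<psi> x \<partial>lebesgue_on D) = - (\<integral>x. grad \<phi> x $ i * \<psi> x \<partial>lebesgue_on D)"
      by (simp add: inner_axis grad_def)
  qed
  have H1: "in_H1 D \<phi>"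
    using L2 wg by (auto simp: in_H1_def)
  show AE: "AE x in lebesgue_on D. weak_grad D \<phi> x = grad \<phi> x"
    by (rule weak_gradient_AE_eq_grad[OF D weak_grad_of_H1[OF H1] D(1) subset_refl C1D])
  have Dl: "D \<in> sets lebesgue"
    using D by (simp add: borel_open)
  have "(\<integral>x. (norm (grad \<phi> x - weak_grad D \<phi> x))\<^sup>2 \<partial>lebesgue_on D) = (\<integral>x. 0 \<partial>lebesgue_on D)"
  proof (rule lebesgue_on_cong_AE[OF Dl, symmetric])
    show "AE x in lebesgue_on D. 0 = (norm (grad \<phi> x - weak_grad D \<phi> x))\<^sup>2"
      using AE by eventually_elim simp
  qed simp
  \<comment> \<open>The constant sequence approximates: its gradient distance vanishes because the
    chosen weak gradient agrees almost everywhere with the classical one.\<close>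
  then show "in_H10 D \<phi>"
    unfolding in_H10_def
    apply (intro conjI)
     apply (rule H1)
    apply (rule exI[of _ "\<lambda>n. \<phi>"])
    apply (simp only: \<phi>)
    apply simp
    done
qed

section \<open>The weak solution on the cells\<close>

lemma bounded_C1_sum:
  assumes "finite I" "\<And>i. i \<in> I \<Longrightarrow> bounded_C1 D (q i)"
  shows "bounded_C1 D (\<lambda>x. \<Sum>i\<in>I. c i * q i x)"
proof -
  define g where "g x = (\<Sum>i\<in>I. c i *\<^sub>R grad (q i) x)" for x
  have d: "((\<lambda>x. \<Sum>i\<in>I. c i * q i x) has_derivative (\<lambda>h. g x \<bullet> h)) (at x)" if "x \<in> D" for x
  proof -
    have "(q i has_derivative (\<lambda>h. grad (q i) x \<bullet> h)) (at x)" if "i \<in> I" for i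
      using assms(2)[OF that] \<open>x \<in> D\<close> grad_has_derivative unfolding bounded_C1_def by blast
    then have "((\<lambda>x. \<Sum>i\<in>I. c i * q i x) has_derivative (\<lambda>h. \<Sum>i\<in>I. c i * (grad (q i) x \<bullet> h))) (at x)"
      by (intro has_derivative_sum has_derivative_mult_right)
    then show ?thesis
      by (simp add: g_def inner_sum_left)
  qed
  have g: "grad (\<lambda>x. \<Sum>i\<in>I. c i * q i x) x = g x" if "x \<in> D" for x
    using grad_eqI[OF d[OF that]] .
  have "continuous_on D g"
    unfolding g_def using assms(2) unfolding bounded_C1_def by (intro continuous_intros) blast
  then have cg: "continuous_on D (grad (\<lambda>x. \<Sum>i\<in>I. c i * q i x))"
    using g by (simp cong: continuous_on_cong)
  have "\<forall>i\<in>I. \<exists>B. \<forall>x\<in>D. \<bar>q i x\<bar> \<le> B \<and> norm (grad (q i) x) \<le> B"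
    using assms(2) unfolding bounded_C1_def by blast
  then obtain B where B: "\<And>i x. i \<in> I \<Longrightarrow> x \<in> D \<Longrightarrow> \<bar>q i x\<bar> \<le> B i \<and> norm (grad (q i) x) \<le> B i"
    by metis
  have "\<bar>\<Sum>i\<in>I. c i * q i x\<bar> \<le> (\<Sum>i\<in>I. \<bar>c i\<bar> * B i) \<and>
      norm (grad (\<lambda>x. \<Sum>i\<in>I. c i * q i x) x) \<le> (\<Sum>i\<in>I. \<bar>c i\<bar> * B i)" if "x \<in> D" for x
  proof
    show "\<bar>\<Sum>i\<in>I. c i * q i x\<bar> \<le> (\<Sum>i\<in>I. \<bar>c i\<bar> * B i)"
      by (rule order_trans[OF sum_abs]) (use B[OF _ that] in \<open>auto simp: abs_mult intro!: sum_mono mult_left_mono\<close>)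
    show "norm (grad (\<lambda>x. \<Sum>i\<in>I. c i * q i x) x) \<le> (\<Sum>i\<in>I. \<bar>c i\<bar> * B i)"
      unfolding g[OF that] g_def
      by (rule sum_norm_le) (use B[OF _ that] in \<open>auto intro!: mult_left_mono\<close>)
  qed
  then show ?thesis
    using d cg unfolding bounded_C1_def differentiable_def by blast
qed

lemma tendsto_integral_if_L2_tendsto_0:
  fixes t :: "nat \<Rightarrow> 'a \<Rightarrow> real"
  assumes fin: "finite_measure M" and p: "p \<in> borel_measurable M" "\<And>x. \<bar>p x\<bar> \<le> B"
    and t: "\<And>n. t n \<in> borel_measurable M" "\<And>n. integrable M (\<lambda>x. (t n x)\<^sup>2)"
    and lim: "(\<lambda>n. \<integral>x. (t n x)\<^sup>2 \<partial>M) \<longlonglongrightarrow> 0"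
  shows "integrable M (\<lambda>x. p x * t n x)" "(\<lambda>n. \<integral>x. p x * t n x \<partial>M) \<longlonglongrightarrow> 0"
proof -
  interpret finite_measure M by fact
  have B: "B \<ge> 0" using p(2)[of undefined] by linarith
  define m where "m = measure M (space M)"
  \<comment> \<open>A Young inequality stands in for Cauchy-Schwarz. The free parameter
    \<open>e\<close> is later taken so small that the first term contributes at most
    \<open>r / 2\<close>, and only then \<open>n\<close> is taken large.\<close>
  have pt: "\<bar>p x * t n x\<bar> \<le> B * (e + (t n x)\<^sup>2 / e)" if "e > 0" for x n e
  proof -
    have "2 * (\<bar>t n x\<bar> * e) \<le> e\<^sup>2 + (t n x)\<^sup>2"
      using zero_le_power2[of "e - \<bar>t n x\<bar>"] by (simp add: power2_diff mult_ac)
    moreover have "0 \<le> \<bar>t n x\<bar> * e"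
      using that by simp
    ultimately have "\<bar>t n x\<bar> * e \<le> e\<^sup>2 + (t n x)\<^sup>2"
      by linarith
    then have "\<bar>t n x\<bar> \<le> e + (t n x)\<^sup>2 / e"
      using that by (simp add: field_simps power2_eq_square)
    then show ?thesis
      unfolding abs_mult using p(2)[of x] B by (intro mult_mono) auto
  qed
  have ib: "integrable M (\<lambda>x. B * (e + (t n x)\<^sup>2 / e))" for n e
    using t(2) by (intro integrable_mult_right integrable_add integrable_divide) auto
  show ipt: "integrable M (\<lambda>x. p x * t n x)" for n
    by (rule Bochner_Integration.integrable_bound[OF ib[of 1 n]])
      (use p(1) t(1) pt[of 1 _ n] in \<open>auto intro!: AE_I2 intro: order_trans[OF _ abs_ge_self]\<close>)
  have est: "\<bar>\<integral>x. p x * t n x \<partial>M\<bar> \<le> B * (e * m + (\<integral>x. (t n x)\<^sup>2 \<partial>M) / e)" if "e > 0" for e n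
  proof -
    have "\<bar>\<integral>x. p x * t n x \<partial>M\<bar> \<le> (\<integral>x. \<bar>p x * t n x\<bar> \<partial>M)"
      by (rule integral_abs_bound)
    also have "\<dots> \<le> (\<integral>x. B * (e + (t n x)\<^sup>2 / e) \<partial>M)"
      by (rule integral_mono) (use ipt ib pt[OF that] in auto)
    also have "\<dots> = B * (e * m + (\<integral>x. (t n x)\<^sup>2 \<partial>M) / e)"
      using t(2) by (simp add: m_def mult.commute)
    finally show ?thesis .
  qed
  show "(\<lambda>n. \<integral>x. p x * t n x \<partial>M) \<longlonglongrightarrow> 0"
  proof (rule LIMSEQ_I)
    fix r :: real assume r: "0 < r"
    have m: "m \<ge> 0" by (simp add: m_def)
    define e where "e = r / (2 * (B * m + 1))"
    have pos: "0 < B * m + 1" using B m by (simp add: add_nonneg_pos)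
    have e: "e > 0" using r pos by (simp add: e_def)
    have "B * (e * m) = r * (B * m) / (2 * (B * m + 1))"
      by (simp add: e_def)
    also have "\<dots> \<le> r / 2"
      using pos r by (simp add: divide_le_eq field_simps)
    finally have 1: "B * (e * m) \<le> r / 2" .
    have "0 < r * e / (2 * (B + 1))"
      using r e B by (simp add: add_nonneg_pos)
    then obtain N where N: "\<And>n. n \<ge> N \<Longrightarrow> \<bar>\<integral>x. (t n x)\<^sup>2 \<partial>M\<bar> < r * e / (2 * (B + 1))"
      using LIMSEQ_D[OF lim] by (metis diff_zero real_norm_def)
    have "norm ((\<integral>x. p x * t n x \<partial>M) - 0) < r" if "n \<ge> N" for n
    proof -
      define a where "a = (\<integral>x. (t n x)\<^sup>2 \<partial>M)"
      have "a \<ge> 0" by (simp add: a_def)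
      moreover have a: "a < r * e / (2 * (B + 1))"
        using N[OF that] by (simp add: a_def)
      ultimately have "B * (a / e) \<le> (B + 1) * (a / e)"
        using e B by (intro mult_right_mono) auto
      also have "\<dots> < r / 2"
        using a e B by (simp add: field_simps)
      finally have "B * (a / e) < r / 2" .
      then show ?thesis
        using est[OF e, of n] 1 unfolding a_def[symmetric] distrib_left diff_0_right real_norm_def by linarith
    qed
    then show "\<exists>no. \<forall>n\<ge>no. norm ((\<integral>x. p x * t n x \<partial>M) - 0) < r"
      by blast
  qed
qed

lemma square_integrable_diff:
  fixes f g :: "'a \<Rightarrow> 'b::euclidean_space"
  assumes "f \<in> borel_measurable M" "g \<in> borel_measurable M"
    "integrable M (\<lambda>x. (norm (f x))\<^sup>2)" "integrable M (\<lambda>x. (norm (g x))\<^sup>2)"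
  shows "integrable M (\<lambda>x. (norm (f x - g x))\<^sup>2)"
proof (rule Bochner_Integration.integrable_bound)
  show "integrable M (\<lambda>x. 2 * (norm (f x))\<^sup>2 + 2 * (norm (g x))\<^sup>2)"
    using assms by simp
  show "(\<lambda>x. (norm (f x - g x))\<^sup>2) \<in> borel_measurable M"
    using assms by measurable
  have "(norm (f x - g x))\<^sup>2 \<le> 2 * (norm (f x))\<^sup>2 + 2 * (norm (g x))\<^sup>2" for x
  proof -
    have "(norm (f x - g x))\<^sup>2 \<le> (norm (f x) + norm (g x))\<^sup>2"
      by (intro power_mono norm_triangle_ineq4) simp
    also have "\<dots> \<le> 2 * (norm (f x))\<^sup>2 + 2 * (norm (g x))\<^sup>2"
      using zero_le_power2[of "norm (f x) - norm (g x)"] by (simp add: power2_diff power2_sum)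
    finally show ?thesis .
  qed
  then show "AE x in M. norm ((norm (f x - g x))\<^sup>2) \<le> norm (2 * (norm (f x))\<^sup>2 + 2 * (norm (g x))\<^sup>2)"
    by (intro AE_I2) simp
qed

lemma finite_measure_lebesgue_on:
  assumes "open D" "bounded D"
  shows "finite_measure (lebesgue_on D)"
  by (rule finite_measure_lebesgue_on) (simp add: assms lmeasurable_open)

text \<open>Here \<psi> may be nonzero on the boundary. The identity holds for the approximating
  test functions in place of \<open>u\<close> and survives the limit; this is the form in which the
  zero boundary values of \<open>u\<close> are exploited.\<close>

lemma in_H10_by_parts:
  fixes u :: "real^'n::finite \<Rightarrow> real"
  assumes D: "open D" "bounded D" and u: "in_H10 D u" and \<psi>: "bounded_C1 UNIV \<psi>"
  shows "(\<integral>x. (grad \<psi> x \<bullet> axis i 1) * u x \<partial>lebesgue_on D) = - (\<integral>x. \<psi> x * weak_grad D u x $ i \<partial>lebesgue_on D)"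
proof -
  let ?M = "lebesgue_on D"
  have H1: "in_H1 D u"
    using u by (simp add: in_H10_def)
  have L2: "L2_on D u" "L2_on D (weak_grad D u)"
    using H1 weak_grad_of_H1[OF H1] by (auto simp: in_H1_def)
  have fin: "finite_measure ?M"
    by (rule finite_measure_lebesgue_on[OF D])
  obtain \<phi> where \<phi>: "\<And>n. test_function D (\<phi> n)" and lim:
    "(\<lambda>n. (\<integral>x. (\<phi> n x - u x)\<^sup>2 \<partial>?M) + (\<integral>x. (norm (grad (\<phi> n) x - weak_grad D u x))\<^sup>2 \<partial>?M)) \<longlonglongrightarrow> 0"
    using u unfolding in_H10_def by blast
  have Dl: "D \<in> sets lebesgue"
    using D by (simp add: borel_open)
  have C1: "bounded_C1 UNIV (\<phi> n)" for n
    by (rule test_function_facts[OF \<phi>[of n]])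
  have L2\<phi>: "L2_on D (\<phi> n)" "L2_on D (grad (\<phi> n))" for n
  proof -
    have b: "bounded_C1 D (\<phi> n)" using bounded_C1_subset[OF C1] by blast
    then obtain B where "\<And>x. x \<in> D \<Longrightarrow> \<bar>\<phi> n x\<bar> \<le> B" "\<And>x. x \<in> D \<Longrightarrow> norm (grad (\<phi> n) x) \<le> B"
      unfolding bounded_C1_def by blast
    then show "L2_on D (\<phi> n)" "L2_on D (grad (\<phi> n))"
      using L2_on_bounded_continuous[OF D bounded_C1_continuous[OF b]]
        L2_on_bounded_continuous[OF D, of "grad (\<phi> n)" B] b unfolding bounded_C1_def by auto
  qed
  have 1: "(\<lambda>n. \<integral>x. (\<phi> n x - u x)\<^sup>2 \<partial>?M) \<longlonglongrightarrow> 0"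
    by (rule tendsto_sandwich[OF _ _ tendsto_const lim]) auto
  have 2: "(\<lambda>n. \<integral>x. (norm (grad (\<phi> n) x - weak_grad D u x))\<^sup>2 \<partial>?M) \<longlonglongrightarrow> 0"
    by (rule tendsto_sandwich[OF _ _ tendsto_const lim]) auto
  obtain B where B: "\<And>x. \<bar>\<psi> x\<bar> \<le> B" "\<And>x. norm (grad \<psi> x) \<le> B"
    using \<psi> unfolding bounded_C1_def by blast
  have Bi: "\<bar>grad \<psi> x $ i\<bar> \<le> B" for x
    using B(2)[of x] component_le_norm_cart[of "grad \<psi> x" i] by linarith
  have cg: "continuous_on S (grad \<psi>)" "continuous_on S \<psi>" for S
    using \<psi> bounded_C1_continuous[OF \<psi>] continuous_on_subset unfolding bounded_C1_def by blast+
  have m\<psi>: "\<psi> \<in> borel_measurable ?M" "(\<lambda>x. grad \<psi> x $ i) \<in> borel_measurable ?M"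
    by (intro continuous_imp_measurable_on_sets_lebesgue[OF _ Dl] cg continuous_on_component)+
  have m: "\<phi> n \<in> borel_measurable ?M" "grad (\<phi> n) \<in> borel_measurable ?M"
    "u \<in> borel_measurable ?M" "weak_grad D u \<in> borel_measurable ?M" for n
    using L2 L2\<phi> by (auto simp: L2_on_def)
  have sq1: "integrable ?M (\<lambda>x. (\<phi> n x - u x)\<^sup>2)" for n
    using square_integrable_diff[OF m(1,3)] L2(1) L2\<phi>(1) by (simp add: L2_on_def)
  have sq2: "integrable ?M (\<lambda>x. (norm (grad (\<phi> n) x - weak_grad D u x))\<^sup>2)" for n
    using square_integrable_diff[OF m(2,4)] L2(2) L2\<phi>(2) by (simp add: L2_on_def)
  have comp: "((grad (\<phi> n) x - weak_grad D u x) $ i)\<^sup>2 \<le> (norm (grad (\<phi> n) x - weak_grad D u x))\<^sup>2" for n x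
    using component_le_norm_cart[of "grad (\<phi> n) x - weak_grad D u x" i] by (metis abs_ge_zero power2_abs power_mono)
  have mi: "(\<lambda>x. (grad (\<phi> n) x - weak_grad D u x) $ i) \<in> borel_measurable ?M" for n
  proof -
    have "(\<lambda>x. (grad (\<phi> n) x - weak_grad D u x) \<bullet> axis i 1) \<in> borel_measurable ?M"
      using m(2)[of n] m(4) by measurable
    then show ?thesis
      by (simp add: inner_axis)
  qed
  have sq3: "integrable ?M (\<lambda>x. ((grad (\<phi> n) x - weak_grad D u x) $ i)\<^sup>2)" for n
    by (rule Bochner_Integration.integrable_bound[OF sq2[of n]])
      (use mi[of n] comp[of n] in \<open>auto intro!: AE_I2\<close>)
  have 3: "(\<lambda>n. \<integral>x. ((grad (\<phi> n) x - weak_grad D u x) $ i)\<^sup>2 \<partial>?M) \<longlonglongrightarrow> 0"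
  proof (rule tendsto_sandwich[OF _ _ tendsto_const 2])
    show "\<forall>\<^sub>F n in sequentially. (\<integral>x. ((grad (\<phi> n) x - weak_grad D u x) $ i)\<^sup>2 \<partial>?M)
        \<le> (\<integral>x. (norm (grad (\<phi> n) x - weak_grad D u x))\<^sup>2 \<partial>?M)"
      by (intro always_eventually allI integral_mono sq2 sq3 comp)
  qed simp
  have md: "(\<lambda>x. \<phi> n x - u x) \<in> borel_measurable ?M" for n
    using m by measurable
  note A = tendsto_integral_if_L2_tendsto_0[OF fin m\<psi>(2) Bi md sq1 1]
  note C = tendsto_integral_if_L2_tendsto_0[OF fin m\<psi>(1) B(1) mi sq3 3]
  have iu: "integrable ?M (\<lambda>x. grad \<psi> x $ i * u x)"
    using integrable_mult_bounded_continuous[OF D(1) L2_on_integrable_component[OF D L2(1), of 1], of "\<lambda>x. grad \<psi> x $ i" B]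
      cg Bi by (simp add: mult.commute continuous_on_component)
  have ig: "integrable ?M (\<lambda>x. \<psi> x * weak_grad D u x $ i)"
    using integrable_mult_bounded_continuous[OF D(1) L2_on_integrable_component[OF D L2(2), of "axis i 1"], of \<psi> B]
      cg B by (simp add: mult.commute inner_axis)
  have "(\<integral>x. grad \<psi> x $ i * (\<phi> n x - u x) \<partial>?M) + (\<integral>x. \<psi> x * (grad (\<phi> n) x - weak_grad D u x) $ i \<partial>?M)
      = - (\<integral>x. grad \<psi> x $ i * u x \<partial>?M) - (\<integral>x. \<psi> x * weak_grad D u x $ i \<partial>?M)" for n
  proof -
    have \<psi>D: "bounded_C1 D \<psi>"
      using bounded_C1_subset[OF \<psi>] by blast
    note P = test_function_by_parts[OF D(1) \<psi>D \<phi>[of n], of "axis i 1", unfolded inner_axis]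
    show ?thesis
      using P iu ig by (simp add: right_diff_distrib)
  qed
  then have "(\<lambda>n. - (\<integral>x. grad \<psi> x $ i * u x \<partial>?M) - (\<integral>x. \<psi> x * weak_grad D u x $ i \<partial>?M)) \<longlonglongrightarrow> 0 + 0"
    using tendsto_add[OF A(2) C(2)] by simp
  then show ?thesis
    by (simp add: LIMSEQ_const_iff inner_axis)
qed

text \<open>The variational side without the geometry of faces: of the mesh it retains open disjoint
  cells that fill the domain up to a null set, with a constant tensor and a regular solution on
  each.\<close>

locale cellwise_solution =
  fixes \<Omega> :: "(real^'n::finite) set" and K :: "real^'n \<Rightarrow> real^'n^'n" and f u :: "real^'n \<Rightarrow> real"
    and \<T> :: "(real^'n) set set" and A :: "(real^'n) set \<Rightarrow> real^'n^'n"
  assumes \<Omega>: "open \<Omega>" "bounded \<Omega>" and fin: "finite \<T>"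
    and cell: "\<And>T. T \<in> \<T> \<Longrightarrow> open T" "\<And>T. T \<in> \<T> \<Longrightarrow> T \<subseteq> \<Omega>" and disj: "pairwise disjnt \<T>"
    and cover: "negligible (\<Omega> - \<Union>\<T>)"
    and K: "\<And>T x. T \<in> \<T> \<Longrightarrow> x \<in> T \<Longrightarrow> K x = A T"
    and u1: "\<And>T. T \<in> \<T> \<Longrightarrow> bounded_C1 T u"
    and u2: "\<And>T i. T \<in> \<T> \<Longrightarrow> bounded_C1 T (\<lambda>x. grad u x $ i)"
    and f: "L2_on \<Omega> f" and sol: "weak_solution \<Omega> K f u"
begin

definition w :: "(real^'n) set \<Rightarrow> real^'n \<Rightarrow> real^'n" where
  "w T x = A T *v grad u x"

definition dw :: "(real^'n) set \<Rightarrow> real^'n \<Rightarrow> real" where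
  "dw T x = (\<Sum>i\<in>UNIV. grad (\<lambda>y. w T y $ i) x $ i)"

lemma \<Omega>_sets: "\<Omega> \<in> sets lebesgue" and cell_sets: "T \<in> \<T> \<Longrightarrow> T \<in> sets lebesgue"
  using \<Omega> cell by (simp_all add: borel_open)

lemma H10: "in_H10 \<Omega> u" and H1: "in_H1 \<Omega> u"
  using sol by (auto simp: weak_solution_def in_H10_def)

lemma weak_grad_u: "AE x in lebesgue_on \<Omega>. \<exists>T\<in>\<T>. x \<in> T \<and> weak_grad \<Omega> u x = grad u x"
proof -
  have "AE x in lebesgue. \<forall>T\<in>\<T>. x \<in> T \<longrightarrow> weak_grad \<Omega> u x = grad u x"
  proof (rule AE_finite_allI[OF fin])
    fix T assume T: "T \<in> \<T>"
    have "AE x in lebesgue_on T. weak_grad \<Omega> u x = grad u x"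
      by (rule weak_gradient_AE_eq_grad[OF \<Omega> weak_grad_of_H1[OF H1] cell[OF T] u1[OF T]])
    then show "AE x in lebesgue. x \<in> T \<longrightarrow> weak_grad \<Omega> u x = grad u x"
      using cell_sets[OF T] by (subst (asm) AE_restrict_space_iff) auto
  qed
  moreover have "AE x in lebesgue. x \<notin> \<Omega> - \<Union>\<T>"
    using cover by (intro AE_not_in) (simp add: negligible_iff_null_sets)
  ultimately have "AE x in lebesgue. x \<in> \<Omega> \<longrightarrow> (\<exists>T\<in>\<T>. x \<in> T \<and> weak_grad \<Omega> u x = grad u x)"
    by eventually_elim blast
  then show ?thesis
    using \<Omega>_sets by (subst AE_restrict_space_iff) auto
qed

text \<open>\<open>V\<close> may be any field that agrees with the cellwise flux wherever
  \<open>grad \<phi>\<close> sees it. The caller can thus take a Borel field supported in one or two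
  cells instead of working with an arbitrary representative of the weak gradient.\<close>

lemma test_equation:
  assumes \<phi>: "test_function \<Omega> \<phi>"
    and V: "\<And>T x. T \<in> \<T> \<Longrightarrow> x \<in> T \<Longrightarrow> V x \<bullet> grad \<phi> x = w T x \<bullet> grad \<phi> x"
    and meas: "(\<lambda>x. V x \<bullet> grad \<phi> x) \<in> borel_measurable (lebesgue_on \<Omega>)"
  shows "(\<integral>x. V x \<bullet> grad \<phi> x \<partial>lebesgue_on \<Omega>) = (\<integral>x. f x * \<phi> x \<partial>lebesgue_on \<Omega>)"
proof -
  have "(\<integral>x. V x \<bullet> grad \<phi> x \<partial>lebesgue_on \<Omega>) =
      (\<integral>x. (K x *v weak_grad \<Omega> u x) \<bullet> weak_grad \<Omega> \<phi> x \<partial>lebesgue_on \<Omega>)"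
  proof (rule lebesgue_on_cong_AE[OF \<Omega>_sets meas])
    show "AE x in lebesgue_on \<Omega>. V x \<bullet> grad \<phi> x = (K x *v weak_grad \<Omega> u x) \<bullet> weak_grad \<Omega> \<phi> x"
      using weak_grad_u test_function_weak_gradient(2)[OF \<Omega> \<phi>]
      by eventually_elim (use V K in \<open>auto simp: w_def\<close>)
  qed
  also have "\<dots> = (\<integral>x. f x * \<phi> x \<partial>lebesgue_on \<Omega>)"
    using sol test_function_weak_gradient(1)[OF \<Omega> \<phi>] by (simp add: weak_solution_def)
  finally show ?thesis .
qed

lemma w_C1: "T \<in> \<T> \<Longrightarrow> bounded_C1 T (\<lambda>x. w T x $ i)"
  unfolding w_def matrix_vector_mult_def by (simp, rule bounded_C1_sum) (auto intro: u2)

lemma w_continuous: "T \<in> \<T> \<Longrightarrow> continuous_on T (w T)"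
proof -
  assume "T \<in> \<T>"
  then have "continuous_on T (\<lambda>x. \<chi> i. w T x $ i)"
    by (intro continuous_on_vec_lambda bounded_C1_continuous[OF w_C1])
  then show ?thesis
    by simp
qed

lemma dw_continuous: "T \<in> \<T> \<Longrightarrow> continuous_on T (dw T)"
  unfolding dw_def using w_C1 unfolding bounded_C1_def
  by (intro continuous_on_sum continuous_on_component) blast

lemma dw_bounded:
  assumes "T \<in> \<T>"
  obtains B where "\<And>x. x \<in> T \<Longrightarrow> \<bar>dw T x\<bar> \<le> B"
proof -
  have "\<forall>i. \<exists>B. \<forall>x\<in>T. norm (grad (\<lambda>x. w T x $ i) x) \<le> B"
    using w_C1[OF assms] unfolding bounded_C1_def by blast
  then obtain B where B: "\<And>i x. x \<in> T \<Longrightarrow> norm (grad (\<lambda>x. w T x $ i) x) \<le> B i"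
    by metis
  show ?thesis
  proof (rule that)
    fix x assume x: "x \<in> T"
    show "\<bar>dw T x\<bar> \<le> (\<Sum>i\<in>UNIV. B i)"
      unfolding dw_def
    proof (rule order_trans[OF sum_abs sum_mono])
      fix i
      show "\<bar>grad (\<lambda>y. w T y $ i) x $ i\<bar> \<le> B i"
        using B[OF x, of i] component_le_norm_cart[of "grad (\<lambda>y. w T y $ i) x" i] by linarith
    qed
  qed
qed

lemma f_integrable: "integrable (lebesgue_on \<Omega>) f"
  using L2_on_integrable_component[OF \<Omega> f, of 1] by simp

text \<open>Test functions supported in a single cell do not see the jumps of the flux, so
  integration by parts produces no face terms.\<close>

lemma strong_equation:
  assumes T: "T \<in> \<T>"
  shows "AE x in lebesgue_on T. f x = - dw T x"
proof -
  obtain B where B: "\<And>x. x \<in> T \<Longrightarrow> \<bar>dw T x\<bar> \<le> B"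
    using dw_bounded[OF T] by blast
  have bT: "bounded T"
    using \<Omega>(2) cell(2)[OF T] bounded_subset by blast
  have id: "integrable (lebesgue_on T) (dw T)"
    by (rule integrable_bounded_continuous[OF cell(1)[OF T] bT dw_continuous[OF T]]) (use B in auto)
  have iF: "integrable (lebesgue_on T) f"
    by (rule integrable_lebesgue_on_subset[OF f_integrable \<Omega>_sets cell_sets[OF T] cell(2)[OF T]])
  have "AE x in lebesgue_on T. f x + dw T x = 0"
  proof (rule AE_eq_0_if_test_functions[OF cell(1)[OF T]])
    show "integrable (lebesgue_on T) (\<lambda>x. f x + dw T x)"
      using id iF by simp
    fix \<phi> assume \<phi>: "test_function T \<phi>"
    obtain Q where Q: "Q \<subseteq> T" "\<And>x. x \<notin> Q \<Longrightarrow> \<phi> x = 0" "\<And>x. x \<notin> Q \<Longrightarrow> grad \<phi> x = 0"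
      and C1: "bounded_C1 UNIV \<phi>"
      by (rule test_function_facts[OF \<phi>]) (rule that, assumption+)
    obtain B' where B': "\<And>x. \<bar>\<phi> x\<bar> \<le> B'"
      using C1 unfolding bounded_C1_def by blast
    have c\<phi>: "continuous_on S \<phi>" for S
      using bounded_C1_continuous[OF C1] continuous_on_subset by blast
    have cg: "continuous_on S (grad \<phi>)" for S
      using C1 continuous_on_subset unfolding bounded_C1_def by blast
    define V where "V x = indicator T x *\<^sub>R w T x" for x
    have off: "\<phi> x = 0" "grad \<phi> x = 0" if "x \<notin> T" for x
      using Q that by blast+
    have "(\<lambda>x. V x) \<in> borel_measurable borel"
      unfolding V_def using cell(1)[OF T] w_continuous[OF T]
      by (intro borel_measurable_continuous_on_indicator) auto
    then have "(\<lambda>x. V x \<bullet> grad \<phi> x) \<in> borel_measurable borel"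
      using borel_measurable_continuous_onI[OF cg] by measurable
    then have m: "(\<lambda>x. V x \<bullet> grad \<phi> x) \<in> borel_measurable (lebesgue_on \<Omega>)"
      by (intro measurable_restrict_space1 measurable_completion) simp
    have "V x \<bullet> grad \<phi> x = w T' x \<bullet> grad \<phi> x" if "T' \<in> \<T>" "x \<in> T'" for T' x
    proof (cases "x \<in> T")
      case True
      then have "T' = T"
        using disj T that by (auto simp: pairwise_def disjnt_def)
      then show ?thesis
        using True by (simp add: V_def)
    qed (simp add: off)
    then have "(\<integral>x. V x \<bullet> grad \<phi> x \<partial>lebesgue_on \<Omega>) = (\<integral>x. f x * \<phi> x \<partial>lebesgue_on \<Omega>)"
      by (intro test_equation test_function_mono[OF \<phi> cell(2)[OF T]] m) auto
    also have "(\<integral>x. V x \<bullet> grad \<phi> x \<partial>lebesgue_on \<Omega>) = (\<integral>x. V x \<bullet> grad \<phi> x \<partial>lebesgue_on T)"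
      by (rule integral_lebesgue_on_subset[OF \<Omega>_sets cell_sets[OF T] cell(2)[OF T]]) (simp add: off)
    also have "\<dots> = (\<integral>x. (\<Sum>i\<in>UNIV. w T x $ i * (grad \<phi> x \<bullet> axis i 1)) \<partial>lebesgue_on T)"
      by (rule Bochner_Integration.integral_cong) (auto simp: V_def space_restrict_space inner_axis inner_vec_def[of "w T _"])
    also have "\<dots> = (\<Sum>i\<in>UNIV. \<integral>x. w T x $ i * (grad \<phi> x \<bullet> axis i 1) \<partial>lebesgue_on T)"
      by (rule Bochner_Integration.integral_sum) (rule test_function_by_parts(1)[OF cell(1)[OF T] w_C1[OF T] \<phi>])
    also have "\<dots> = - (\<Sum>i\<in>UNIV. \<integral>x. (grad (\<lambda>x. w T x $ i) x \<bullet> axis i 1) * \<phi> x \<partial>lebesgue_on T)"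
      by (simp only: test_function_by_parts(3)[OF cell(1)[OF T] w_C1[OF T] \<phi>] sum_negf)
    also have "\<dots> = - (\<integral>x. (\<Sum>i\<in>UNIV. (grad (\<lambda>x. w T x $ i) x \<bullet> axis i 1) * \<phi> x) \<partial>lebesgue_on T)"
      by (subst Bochner_Integration.integral_sum) (auto intro!: test_function_by_parts(2)[OF cell(1)[OF T] w_C1[OF T] \<phi>])
    also have "\<dots> = - (\<integral>x. dw T x * \<phi> x \<partial>lebesgue_on T)"
      by (simp add: dw_def inner_axis sum_distrib_right)
    also have "(\<integral>x. f x * \<phi> x \<partial>lebesgue_on \<Omega>) = (\<integral>x. f x * \<phi> x \<partial>lebesgue_on T)"
      by (rule integral_lebesgue_on_subset[OF \<Omega>_sets cell_sets[OF T] cell(2)[OF T]]) (simp add: off)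
    finally have "(\<integral>x. f x * \<phi> x \<partial>lebesgue_on T) + (\<integral>x. dw T x * \<phi> x \<partial>lebesgue_on T) = 0"
      by simp
    moreover have "integrable (lebesgue_on T) (\<lambda>x. f x * \<phi> x)" "integrable (lebesgue_on T) (\<lambda>x. dw T x * \<phi> x)"
      using integrable_mult_bounded_continuous[OF cell(1)[OF T] iF c\<phi> B']
        integrable_mult_bounded_continuous[OF cell(1)[OF T] id c\<phi> B'] by auto
    ultimately show "(\<integral>x. (f x + dw T x) * \<phi> x \<partial>lebesgue_on T) = 0"
      by (simp add: distrib_right)
  qed
  then show ?thesis
    by eventually_elim simp
qed

text \<open>By the strong equation the source inherits the bound of the second derivatives. Square
  integrability alone would not give the order \<open>r ^ CARD('n)\<close> that the blow-up
  needs.\<close>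

lemma f_AE_bounded:
  obtains B where "AE x in lebesgue_on \<Omega>. \<bar>f x\<bar> \<le> B"
proof -
  have "\<forall>T\<in>\<T>. \<exists>B. \<forall>x\<in>T. \<bar>dw T x\<bar> \<le> B"
    using dw_bounded by metis
  then obtain B where B: "\<And>T x. T \<in> \<T> \<Longrightarrow> x \<in> T \<Longrightarrow> \<bar>dw T x\<bar> \<le> B T"
    by metis
  have "AE x in lebesgue. \<forall>T\<in>\<T>. x \<in> T \<longrightarrow> f x = - dw T x"
  proof (rule AE_finite_allI[OF fin])
    fix T assume T: "T \<in> \<T>"
    show "AE x in lebesgue. x \<in> T \<longrightarrow> f x = - dw T x"
      using strong_equation[OF T] cell_sets[OF T] by (subst (asm) AE_restrict_space_iff) auto
  qed
  moreover have "AE x in lebesgue. x \<notin> \<Omega> - \<Union>\<T>"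
    using cover by (intro AE_not_in) (simp add: negligible_iff_null_sets)
  ultimately have "AE x in lebesgue. x \<in> \<Omega> \<longrightarrow> \<bar>f x\<bar> \<le> Max (insert 0 (B ` \<T>))"
  proof eventually_elim
    case (elim x)
    show ?case
    proof
      assume "x \<in> \<Omega>"
      then obtain T where T: "T \<in> \<T>" "x \<in> T"
        using elim by blast
      then have "\<bar>f x\<bar> \<le> B T"
        using elim B by simp
      also have "\<dots> \<le> Max (insert 0 (B ` \<T>))"
        using fin T by (intro Max_ge) auto
      finally show "\<bar>f x\<bar> \<le> Max (insert 0 (B ` \<T>))" .
    qed
  qed
  then show ?thesis
    using \<Omega>_sets that by (subst (asm) AE_restrict_space_iff[symmetric]) auto
qed

end

section \<open>Blow-up at a point of a hyperplane\<close>

lemma lborel_integral_scale: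
  fixes h :: "'a::euclidean_space \<Rightarrow> real"
  assumes "r > 0" "h \<in> borel_measurable borel"
  shows "(\<integral>x. h x \<partial>lborel) = r ^ DIM('a) * (\<integral>\<xi>. h (z + r *\<^sub>R \<xi>) \<partial>lborel)"
proof -
  have "(\<integral>x. h x \<partial>lborel) = (\<integral>x. h x \<partial>density (distr lborel borel (\<lambda>x. z + r *\<^sub>R x)) (\<lambda>_. ennreal (r ^ DIM('a))))"
    using lborel_affine[of r z] assms(1) by simp
  also have "\<dots> = (\<integral>x. r ^ DIM('a) * h x \<partial>distr lborel borel (\<lambda>x. z + r *\<^sub>R x))"
    using assms by (subst integral_density) auto
  also have "\<dots> = r ^ DIM('a) * (\<integral>\<xi>. h (z + r *\<^sub>R \<xi>) \<partial>lborel)"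
    using assms(2) by (subst integral_distr) auto
  finally show ?thesis .
qed

lemma grad_bump:
  "grad (bump c z r) x = (- 2 * c / r\<^sup>2 * flat 2 (c * (1 - (norm (x - z))\<^sup>2 / r\<^sup>2))) *\<^sub>R (x - z)"
proof (rule grad_eqI)
  have "(\<lambda>h. flat 2 (c * (1 - (norm (x - z))\<^sup>2 / r\<^sup>2)) * (- 2 * c / r\<^sup>2 * ((x - z) \<bullet> h))) =
      (\<lambda>h. (- 2 * c / r\<^sup>2 * flat 2 (c * (1 - (norm (x - z))\<^sup>2 / r\<^sup>2))) *\<^sub>R (x - z) \<bullet> h)"
    by (simp add: fun_eq_iff)
  then show "(bump c z r has_derivative
      (\<lambda>h. (- 2 * c / r\<^sup>2 * flat 2 (c * (1 - (norm (x - z))\<^sup>2 / r\<^sup>2))) *\<^sub>R (x - z) \<bullet> h)) (at x)"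
    using bump_has_derivative[of c z r x] by simp
qed

lemma grad_bump_scale:
  assumes "r > 0"
  shows "grad (bump 1 z r) (z + r *\<^sub>R \<xi>) = (1 / r) *\<^sub>R grad (bump 1 0 1) \<xi>"
  using assms by (simp add: grad_bump power_mult_distrib power2_eq_square)

text \<open>For a unit vector \<open>n\<close>, the divergence theorem on the half-space would give
  \<open>n \<bullet> v\<close> times the integral of the bump over the bounding hyperplane.
  Proportionality to \<open>n \<bullet> v\<close> with a positive factor is all that is
  proved.\<close>

definition half_bump :: "real^'n::finite \<Rightarrow> real^'n \<Rightarrow> real" where
  "half_bump n v = (\<integral>\<xi>. indicator {\<xi>. n \<bullet> \<xi> < 0} \<xi> * (v \<bullet> grad (bump 1 0 1) \<xi>) \<partial>lborel)"

lemma unit_bump_facts: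
  fixes v :: "real^'n::finite"
  shows "(\<lambda>\<xi>. v \<bullet> grad (bump 1 0 1) \<xi>) \<in> borel_measurable borel"
    "A \<in> sets borel \<Longrightarrow> integrable lborel (\<lambda>\<xi>. indicator A \<xi> * (v \<bullet> grad (bump 1 0 1) \<xi>))"
    "integrable lborel (\<lambda>\<xi>. norm (grad (bump 1 0 1) \<xi> :: real^'n))"
    "norm \<xi> \<ge> 1 \<Longrightarrow> grad (bump 1 0 1) \<xi> = (0 :: real^'n)"
proof -
  obtain Q L where L: "\<And>x y :: real^'n. \<bar>bump 1 0 1 x - bump 1 0 1 y\<bar> \<le> L * norm (x - y)"
    and C1: "bounded_C1 UNIV (bump 1 (0 :: real^'n) 1)" and "Q \<subseteq> (UNIV :: (real^'n) set)"
    by (rule test_function_facts[OF test_function_bump[of 1 1 0 UNIV]]) (simp, simp, simp, rule that, assumption+)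
  obtain B where B: "\<And>x :: real^'n. norm (grad (bump 1 0 1) x) \<le> B"
    using C1 unfolding bounded_C1_def by blast
  have [measurable]: "(grad (bump 1 0 1) :: real^'n \<Rightarrow> real^'n) \<in> borel_measurable borel"
    using C1 unfolding bounded_C1_def by (blast intro: borel_measurable_continuous_onI)
  show 0: "grad (bump 1 0 1) \<xi> = (0 :: real^'n)" if "norm \<xi> \<ge> 1" for \<xi>
    using that power_mono[of 1 "norm \<xi>" 2] by (simp add: grad_bump flat_eq_0)
  show m: "(\<lambda>\<xi>. v \<bullet> grad (bump 1 0 1) \<xi>) \<in> borel_measurable borel"
    by measurable
  have vb: "\<bar>v \<bullet> grad (bump 1 0 1) \<xi>\<bar> \<le> norm v * B" for \<xi>
    using Cauchy_Schwarz_ineq2[of v "grad (bump 1 0 1) \<xi>"] mult_left_mono[OF B[of \<xi>], of "norm v"] by simp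
  have B0: "0 \<le> B"
    using B[of 0] norm_ge_zero order_trans by blast
  show "integrable lborel (\<lambda>\<xi>. indicator A \<xi> * (v \<bullet> grad (bump 1 0 1) \<xi>))" if "A \<in> sets borel"
  proof (rule lborel_integrable_bounded_support[where Q = "cball 0 1" and B = "norm v * B"])
    show "(\<lambda>\<xi>. indicator A \<xi> * (v \<bullet> grad (bump 1 0 1) \<xi>)) \<in> borel_measurable borel"
      using that m by measurable
    show "\<bar>indicator A \<xi> * (v \<bullet> grad (bump 1 0 1) \<xi>)\<bar> \<le> norm v * B" for \<xi>
      using vb[of \<xi>] B0 by (simp add: indicator_def)
  qed (auto simp: 0)
  show "integrable lborel (\<lambda>\<xi>. norm (grad (bump 1 0 1) \<xi> :: real^'n))"
    by (rule lborel_integrable_bounded_support[where Q = "cball 0 1" and B = B]) (auto simp: 0 B)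
qed

text \<open>Translation along \<open>v\<close> preserves the half-space, so the bump cut off at the
  hyperplane is still Lipschitz in this direction and its derivative integrates to zero.\<close>

lemma half_bump_tangential:
  fixes n v :: "real^'n::finite"
  assumes "n \<bullet> v = 0"
  shows "half_bump n v = 0"
proof -
  obtain Q L where L: "\<And>x y :: real^'n. \<bar>bump 1 0 1 x - bump 1 0 1 y\<bar> \<le> L * norm (x - y)"
    and C1: "bounded_C1 UNIV (bump 1 (0 :: real^'n) 1)" and "Q \<subseteq> (UNIV :: (real^'n) set)"
    by (rule test_function_facts[OF test_function_bump[of 1 1 0 UNIV]]) (simp, simp, simp, rule that, assumption+)
  have L0: "L \<ge> 0"
    using L[of 0 "axis undefined 1"] by (simp add: norm_axis_1)
  let ?H = "{\<xi>. n \<bullet> \<xi> < 0}"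
  have [measurable]: "?H \<in> sets borel"
    by measurable
  have [measurable]: "(bump 1 0 1 :: real^'n \<Rightarrow> real) \<in> borel_measurable borel"
    using bounded_C1_continuous[OF C1] by (rule borel_measurable_continuous_onI)
  define g where "g \<xi> = indicator ?H \<xi> * bump 1 0 1 \<xi>" for \<xi>
  define g' where "g' \<xi> = indicator ?H \<xi> * (v \<bullet> grad (bump 1 0 1) \<xi>)" for \<xi>
  have Hv: "n \<bullet> (\<xi> + h *\<^sub>R v) < 0 \<longleftrightarrow> n \<bullet> \<xi> < 0" for \<xi> h
    by (simp add: inner_add_right assms)
  have g0: "g \<xi> = 0" if "\<xi> \<notin> cball 0 1" for \<xi>
    using that by (simp add: g_def bump_eq_0)
  have "(\<integral>\<xi>. g' \<xi> \<partial>lborel) = 0"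
  proof (rule integral_directional_derivative_eq_0(2)[where Q = "cball 0 1" and e = v and L = "L * norm v" and ?h0.0 = 1])
    show "integrable lborel g"
      by (rule lborel_integrable_bounded_support[where Q = "cball 0 1" and B = 1])
        (use g0 in \<open>auto simp: g_def[abs_def] indicator_def bump_bounds abs_of_nonneg\<close>)
    show "g' \<in> borel_measurable borel"
      unfolding g'_def[abs_def] using unit_bump_facts(1)[of v] by measurable
    show "\<bar>g (\<xi> + h *\<^sub>R v) - g \<xi>\<bar> \<le> L * norm v * h" if "0 < h" for \<xi> h
      using L[of "\<xi> + h *\<^sub>R v" \<xi>] that L0 by (simp add: g_def Hv indicator_def mult_ac)
    show "AE \<xi> in lborel. ((\<lambda>h. g (\<xi> + h *\<^sub>R v)) has_real_derivative g' \<xi>) (at 0)"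
    proof (rule AE_I2)
      fix \<xi>
      have line: "((\<lambda>h. \<xi> + h *\<^sub>R v) has_derivative (\<lambda>h. h *\<^sub>R v)) (at 0)"
        by (auto intro!: derivative_eq_intros)
      have "(bump 1 0 1 has_derivative (\<lambda>h. grad (bump 1 0 1) \<xi> \<bullet> h)) (at \<xi>)"
        using C1 unfolding bounded_C1_def by (intro grad_has_derivative) auto
      then have "((\<lambda>h. bump 1 0 1 (\<xi> + h *\<^sub>R v)) has_derivative (\<lambda>h. grad (bump 1 0 1) \<xi> \<bullet> (h *\<^sub>R v))) (at 0)"
        using has_derivative_compose[OF line, of "bump 1 0 1" "\<lambda>h. grad (bump 1 0 1) \<xi> \<bullet> h"] by (simp del: inner_scaleR_right)
      then have "((\<lambda>h. indicator ?H \<xi> * bump 1 0 1 (\<xi> + h *\<^sub>R v)) has_derivative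
          (\<lambda>h. indicator ?H \<xi> * (grad (bump 1 0 1) \<xi> \<bullet> (h *\<^sub>R v)))) (at 0)"
        by (rule has_derivative_mult_right)
      moreover have "(\<lambda>h. indicator ?H \<xi> * (grad (bump 1 0 1) \<xi> \<bullet> (h *\<^sub>R v))) = (*) (g' \<xi>)"
        by (auto simp: g'_def inner_commute)
      moreover have "(\<lambda>h. g (\<xi> + h *\<^sub>R v)) = (\<lambda>h. indicator ?H \<xi> * bump 1 0 1 (\<xi> + h *\<^sub>R v))"
        by (auto simp: g_def Hv indicator_def)
      ultimately show "((\<lambda>h. g (\<xi> + h *\<^sub>R v)) has_real_derivative g' \<xi>) (at 0)"
        by (simp add: has_field_derivative_def)
    qed
  qed (use g0 in auto)
  then show ?thesis
    by (simp add: half_bump_def g'_def)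
qed

lemma integral_bump_derivative_eq_0:
  fixes v :: "real^'n::finite"
  shows "(\<integral>\<xi>. v \<bullet> grad (bump 1 0 1) \<xi> \<partial>lborel) = 0"
proof -
  have "half_bump (0 :: real^'n) v = 0" by (simp add: half_bump_def)
  have one: "bounded_C1 (UNIV :: (real^'n) set) (\<lambda>x. 1)"
  proof -
    have "grad (\<lambda>x. 1 :: real) = (\<lambda>x::real^'n. 0)"
      by (intro ext grad_eqI) simp
    then show ?thesis
      by (auto simp: bounded_C1_def)
  qed
  have t: "test_function UNIV (bump 1 (0 :: real^'n) 1)"
    by (rule test_function_bump) auto
  have "(\<integral>x. grad (bump 1 0 1) x \<bullet> v \<partial>lebesgue_on UNIV) = 0"
  proof -
    have "grad (\<lambda>x. 1 :: real) = (\<lambda>x::real^'n. 0)"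
      by (intro ext grad_eqI) simp
    then show ?thesis
      using test_function_by_parts(3)[OF open_UNIV one t, of v] by simp
  qed
  then show ?thesis
    using unit_bump_facts(1)[of v] by (simp add: lebesgue_on_UNIV_eq integral_completion inner_commute)
qed

lemma half_bump_linear:
  "half_bump n (v + c *\<^sub>R v') = half_bump n v + c * half_bump n v'"
proof -
  have H: "{\<xi>. n \<bullet> \<xi> < 0} \<in> sets borel"
    by measurable
  have "half_bump n (v + c *\<^sub>R v') = (\<integral>\<xi>. indicator {\<xi>. n \<bullet> \<xi> < 0} \<xi> * (v \<bullet> grad (bump 1 0 1) \<xi>) +
      c * (indicator {\<xi>. n \<bullet> \<xi> < 0} \<xi> * (v' \<bullet> grad (bump 1 0 1) \<xi>)) \<partial>lborel)"
    unfolding half_bump_def by (rule Bochner_Integration.integral_cong) (auto simp: inner_add_left algebra_simps)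
  also have "\<dots> = half_bump n v + c * half_bump n v'"
    unfolding half_bump_def using unit_bump_facts(2)[OF H] by simp
  finally show ?thesis .
qed

lemma half_bump_normal:
  assumes "norm n = 1"
  shows "half_bump n v = (n \<bullet> v) * half_bump n n"
proof -
  have "n \<bullet> (v + (- (n \<bullet> v)) *\<^sub>R n) = 0"
    using assms by (simp add: inner_diff_right dot_square_norm)
  then have "half_bump n (v + (- (n \<bullet> v)) *\<^sub>R n) = 0"
    by (rule half_bump_tangential)
  then show ?thesis
    by (simp only: half_bump_linear)
qed

text \<open>The bump decreases with the distance from 0, so the integrand is nonnegative, and it is
  positive on an open half ball.\<close>

lemma half_bump_pos:
  fixes n :: "real^'n::finite"
  assumes "norm n = 1"
  shows "half_bump n n > 0"
proof -
  let ?g = "\<lambda>\<xi>. indicator {\<xi>. n \<bullet> \<xi> < 0} \<xi> * (n \<bullet> grad (bump 1 0 1) \<xi>)"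
  have H: "{\<xi>. n \<bullet> \<xi> < 0} \<in> sets borel"
    by measurable
  have g: "n \<bullet> grad (bump 1 0 1) \<xi> = 2 * flat 2 (1 - (norm \<xi>)\<^sup>2) * - (n \<bullet> \<xi>)" for \<xi>
    by (simp add: grad_bump)
  have nn: "?g \<xi> \<ge> 0" for \<xi>
    unfolding g by (auto simp: indicator_def flat_nonneg mult_nonpos_nonneg)
  have "half_bump n n \<noteq> 0"
  proof
    assume "half_bump n n = 0"
    then have "AE \<xi> in lborel. ?g \<xi> = 0"
      using integral_nonneg_eq_0_iff_AE[OF unit_bump_facts(2)[OF H, of n]] nn by (simp add: half_bump_def)
    then obtain N where N: "{\<xi>. ?g \<xi> \<noteq> 0} \<subseteq> N" "N \<in> null_sets lborel"
      by (auto simp: eventually_ae_filter simp del: mult_eq_0_iff)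
    let ?S = "{\<xi>. n \<bullet> \<xi> < 0} \<inter> ball 0 1"
    have "?S \<subseteq> N"
    proof
      fix \<xi> assume x: "\<xi> \<in> ?S"
      then have "(norm \<xi>)\<^sup>2 < 1"
        by (simp add: power_less_one_iff abs_square_less_1)
      then have "?g \<xi> \<noteq> 0"
        using x flat_pos[of "1 - (norm \<xi>)\<^sup>2" 2] unfolding g by simp
      then show "\<xi> \<in> N"
        using N(1) by blast
    qed
    moreover have "open ?S"
      by (intro open_Int open_ball open_halfspace_lt)
    moreover have "(- 1 / 2) *\<^sub>R n \<in> ?S"
      using assms by (simp add: dot_square_norm)
    then have "?S \<noteq> {}"
      by blast
    ultimately have "\<not> negligible ?S"
      by (intro open_not_negligible)
    moreover have "negligible N"
      using N(2) by (simp add: negligible_iff_null_sets null_sets_completionI)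
    ultimately show False
      using \<open>?S \<subseteq> N\<close> negligible_subset by blast
  qed
  moreover have "half_bump n n \<ge> 0"
    unfolding half_bump_def using nn by (intro integral_nonneg_AE AE_I2)
  ultimately show ?thesis by simp
qed

text \<open>If the gradients of concentrating bumps do not see more than \<open>O(r\<^sup>d)\<close> of \<open>V\<close>, then the
  normal component of \<open>V\<close> does not jump: a jump would contribute in the order of \<open>r\<^sup>d\<^sup>-\<^sup>1\<close>.\<close>

lemma normal_jump_eq_0:
  fixes V :: "real^'n::finite \<Rightarrow> real^'n"
  assumes n: "norm n = 1" and V: "V \<in> borel_measurable borel"
    and v0: "\<And>e. e > 0 \<Longrightarrow> \<exists>d>0. \<forall>x\<in>ball z d. n \<bullet> (x - z) < 0 \<longrightarrow> norm (V x - v0) < e"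
    and v1: "\<And>e. e > 0 \<Longrightarrow> \<exists>d>0. \<forall>x\<in>ball z d. n \<bullet> (x - z) > 0 \<longrightarrow> norm (V x - v1) < e"
    and r0: "r0 > 0" and C: "\<And>r. 0 < r \<Longrightarrow> r < r0 \<Longrightarrow>
      \<bar>\<integral>x. V x \<bullet> grad (bump 1 z r) x \<partial>lborel\<bar> \<le> C * r ^ CARD('n)"
  shows "n \<bullet> v0 = n \<bullet> v1"
proof (rule ccontr)
  assume neq: "n \<bullet> v0 \<noteq> n \<bullet> v1"
  define \<gamma> where "\<gamma> = (grad (bump 1 0 1) :: real^'n \<Rightarrow> real^'n)"
  define S where "S = (\<integral>\<xi>. norm (\<gamma> \<xi>) \<partial>lborel)"
  have S: "S \<ge> 0" by (simp add: S_def)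
  define a where "a = \<bar>n \<bullet> v0 - n \<bullet> v1\<bar> * half_bump n n"
  have a: "a > 0"
    using neq half_bump_pos[OF n] by (simp add: a_def)
  \<comment> \<open>Replacing \<open>V\<close> by its one-sided limits then costs less than half of
    \<open>a\<close>, the size of the jump term.\<close>
  define e where "e = a / (4 * (S + 1))"
  have e: "e > 0" using a S by (simp add: e_def)
  have eS: "e * S < a / 2"
  proof -
    have "e * S \<le> e * (S + 1)" using e by simp
    also have "\<dots> = a / 4" using S by (simp add: e_def field_simps)
    finally show ?thesis using a by linarith
  qed
  obtain d0 d1 where d: "d0 > 0" "\<And>x. x \<in> ball z d0 \<Longrightarrow> n \<bullet> (x - z) < 0 \<Longrightarrow> norm (V x - v0) < e"
    "d1 > 0" "\<And>x. x \<in> ball z d1 \<Longrightarrow> n \<bullet> (x - z) > 0 \<Longrightarrow> norm (V x - v1) < e"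
    using v0[OF e] v1[OF e] by blast
  define q where "q = a / (\<bar>C\<bar> + 1)"
  have q: "q > 0"
    using a by (simp add: q_def add_nonneg_pos)
  \<comment> \<open>Staying below \<open>q / 2\<close> brings \<open>C * r\<close> below
    \<open>a / 2\<close>, which contradicts the lower bound; the other minima keep the bump where
    the hypotheses apply.\<close>
  define r where "r = min (min d0 d1) (min r0 q) / 4"
  have r: "r > 0" "r < d0" "r < d1" "r < r0" "r < q / 2"
    using d r0 q by (auto simp: r_def min_def)
  define Vr where "Vr \<xi> = V (z + r *\<^sub>R \<xi>)" for \<xi>
  define V0 where "V0 \<xi> = (if n \<bullet> \<xi> < 0 then v0 else v1)" for \<xi>
  let ?H = "{\<xi>. n \<bullet> \<xi> < 0}"
  have H[measurable]: "?H \<in> sets borel" by measurable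
  have [measurable]: "\<gamma> \<in> borel_measurable borel"
  proof -
    have "(\<lambda>\<xi>. \<gamma> \<xi> \<bullet> i) \<in> borel_measurable borel" for i
      using unit_bump_facts(1)[of i] by (simp add: \<gamma>_def inner_commute)
    then show ?thesis
      by (subst borel_measurable_euclidean_space) blast
  qed
  have [measurable]: "Vr \<in> borel_measurable borel" "V0 \<in> borel_measurable borel"
    unfolding Vr_def[abs_def] V0_def[abs_def] using V by measurable
  have mg: "grad (bump 1 z r) \<in> borel_measurable borel"
  proof -
    have "bounded_C1 UNIV (bump 1 z r)"
      by (rule test_function_facts[OF test_function_bump[of 1 r z UNIV]]) (use r in auto)
    then show ?thesis
      unfolding bounded_C1_def by (blast intro: borel_measurable_continuous_onI)
  qed
  have scale: "(\<integral>x. V x \<bullet> grad (bump 1 z r) x \<partial>lborel) = r ^ CARD('n) * ((1 / r) * (\<integral>\<xi>. Vr \<xi> \<bullet> \<gamma> \<xi> \<partial>lborel))"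
  proof -
    have "(\<lambda>x. V x \<bullet> grad (bump 1 z r) x) \<in> borel_measurable borel"
      using V mg by measurable
    from lborel_integral_scale[OF r(1) this, of z] show ?thesis
      using r(1) by (simp add: grad_bump_scale Vr_def \<gamma>_def)
  qed
  have AE: "AE \<xi> in lborel. n \<bullet> \<xi> \<noteq> 0"
  proof -
    have "negligible {\<xi>. n \<bullet> \<xi> = 0}"
      using n by (intro negligible_hyperplane) auto
    then have "{\<xi>. n \<bullet> \<xi> = 0} \<in> null_sets lborel"
      by (auto simp: negligible_iff_null_sets null_sets_completion_iff)
    from AE_not_in[OF this] show ?thesis by simp
  qed
  have close: "AE \<xi> in lborel. norm ((Vr \<xi> - V0 \<xi>) \<bullet> \<gamma> \<xi>) \<le> e * norm (\<gamma> \<xi>)"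
    using AE
  proof eventually_elim
    case (elim \<xi>)
    show ?case
    proof (cases "norm \<xi> < 1")
      case True
      then have "norm (r *\<^sub>R \<xi>) < r" using r(1) by simp
      then have "z + r *\<^sub>R \<xi> \<in> ball z d0" "z + r *\<^sub>R \<xi> \<in> ball z d1"
        using r by (auto simp: dist_norm simp del: norm_scaleR)
      then have "norm (Vr \<xi> - V0 \<xi>) \<le> e"
        using d(2,4)[of "z + r *\<^sub>R \<xi>"] elim r(1) 
        by (auto simp: Vr_def V0_def mult_pos_neg not_less intro!: less_imp_le)
      then show ?thesis
        using Cauchy_Schwarz_ineq2[of "Vr \<xi> - V0 \<xi>" "\<gamma> \<xi>"] mult_right_mono[of "norm (Vr \<xi> - V0 \<xi>)" e "norm (\<gamma> \<xi>)"]
        by simp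
    next
      case False
      then show ?thesis
        using unit_bump_facts(4)[of \<xi>] by (simp add: \<gamma>_def)
    qed
  qed
  have iS: "integrable lborel (\<lambda>\<xi>. e * norm (\<gamma> \<xi>))"
    unfolding \<gamma>_def by (intro integrable_mult_right unit_bump_facts(3))
  have iD: "integrable lborel (\<lambda>\<xi>. (Vr \<xi> - V0 \<xi>) \<bullet> \<gamma> \<xi>)"
    by (rule Bochner_Integration.integrable_bound[OF iS]) (use close e in \<open>auto elim!: eventually_mono\<close>)
  have D: "\<bar>\<integral>\<xi>. (Vr \<xi> - V0 \<xi>) \<bullet> \<gamma> \<xi> \<partial>lborel\<bar> \<le> e * S"
  proof -
    have "\<bar>\<integral>\<xi>. (Vr \<xi> - V0 \<xi>) \<bullet> \<gamma> \<xi> \<partial>lborel\<bar> \<le> (\<integral>\<xi>. \<bar>(Vr \<xi> - V0 \<xi>) \<bullet> \<gamma> \<xi>\<bar> \<partial>lborel)"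
      by (rule integral_abs_bound)
    also have "\<dots> \<le> (\<integral>\<xi>. e * norm (\<gamma> \<xi>) \<partial>lborel)"
      by (rule integral_mono_AE) (use iD iS close in auto)
    also have "\<dots> = e * S" by (simp add: S_def)
    finally show ?thesis .
  qed
  have U: "integrable lborel (\<lambda>\<xi>. v \<bullet> \<gamma> \<xi>)" for v
    using unit_bump_facts(2)[of UNIV v] by (simp add: \<gamma>_def)
  \<comment> \<open>The constant part \<open>v1\<close> is tested by the whole bump, whose gradient
    integrates to zero; only the difference over the half-space remains.\<close>
  have V0eq: "V0 \<xi> \<bullet> \<gamma> \<xi> = indicator ?H \<xi> * ((v0 - v1) \<bullet> \<gamma> \<xi>) + v1 \<bullet> \<gamma> \<xi>" for \<xi>
    by (simp add: V0_def indicator_def inner_diff_left)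
  have i0: "integrable lborel (\<lambda>\<xi>. V0 \<xi> \<bullet> \<gamma> \<xi>)"
    unfolding V0eq using unit_bump_facts(2)[OF H, of "v0 - v1"] U by (simp add: \<gamma>_def)
  have "(\<integral>\<xi>. V0 \<xi> \<bullet> \<gamma> \<xi> \<partial>lborel) = half_bump n (v0 - v1)"
    using Bochner_Integration.integral_add[OF unit_bump_facts(2)[OF H, of "v0 - v1"] U[of v1, unfolded \<gamma>_def]]
    by (simp add: V0eq[unfolded \<gamma>_def] half_bump_def \<gamma>_def integral_bump_derivative_eq_0)
  then have J: "\<bar>\<integral>\<xi>. V0 \<xi> \<bullet> \<gamma> \<xi> \<partial>lborel\<bar> = a"
    using half_bump_normal[OF n, of "v0 - v1"] half_bump_pos[OF n]
    by (simp add: a_def abs_mult inner_diff_right)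
  have "(\<integral>\<xi>. Vr \<xi> \<bullet> \<gamma> \<xi> \<partial>lborel) = (\<integral>\<xi>. (Vr \<xi> - V0 \<xi>) \<bullet> \<gamma> \<xi> \<partial>lborel) + (\<integral>\<xi>. V0 \<xi> \<bullet> \<gamma> \<xi> \<partial>lborel)"
    using Bochner_Integration.integral_add[OF iD i0] by (simp add: inner_diff_left)
  then have low: "\<bar>\<integral>\<xi>. Vr \<xi> \<bullet> \<gamma> \<xi> \<partial>lborel\<bar> > a / 2"
    using D J eS by linarith
  have "r ^ CARD('n) * ((1 / r) * \<bar>\<integral>\<xi>. Vr \<xi> \<bullet> \<gamma> \<xi> \<partial>lborel\<bar>) \<le> r ^ CARD('n) * C"
    using C[OF r(1,4)] r(1) unfolding scale by (simp add: abs_mult mult.commute)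
  then have "(1 / r) * \<bar>\<integral>\<xi>. Vr \<xi> \<bullet> \<gamma> \<xi> \<partial>lborel\<bar> \<le> C"
    by (rule mult_left_le_imp_le) (use r(1) in simp)
  then have "\<bar>\<integral>\<xi>. Vr \<xi> \<bullet> \<gamma> \<xi> \<partial>lborel\<bar> \<le> C * r"
    using r(1) by (simp add: field_simps)
  also have "\<dots> \<le> (\<bar>C\<bar> + 1) * r"
    using r(1) by (intro mult_right_mono) auto
  also have "\<dots> < a / 2"
    using r(5) by (simp add: q_def field_simps)
  finally show False
    using low by simp
qed

section \<open>The surface measure of a hyperplane\<close>

text \<open>The measure of \<open>surface_measure\<close> with normal and offset made explicit
  instead of chosen; \<open>surface_measure_flat_face\<close> identifies the two.\<close>

definition hyp_measure :: "'a::euclidean_space \<Rightarrow> real \<Rightarrow> 'a measure" where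
  "hyp_measure n c = distr (restrict_space lborel {y. \<bar>n \<bullet> y - c\<bar> \<le> 1/2}) borel (\<lambda>y. y - (n \<bullet> y - c) *\<^sub>R n)"

lemma sets_hyp_measure [measurable_cong, simp]: "sets (hyp_measure n c) = sets borel"
  by (simp add: hyp_measure_def)

lemma space_hyp_measure [simp]: "space (hyp_measure n c) = UNIV"
  by (simp add: hyp_measure_def)

lemma nn_integral_hyp_measure:
  assumes [measurable]: "h \<in> borel_measurable borel"
  shows "(\<integral>\<^sup>+y. h y \<partial>hyp_measure n c) =
    (\<integral>\<^sup>+x. indicator {y. \<bar>n \<bullet> y - c\<bar> \<le> 1/2} x * h (x - (n \<bullet> x - c) *\<^sub>R n) \<partial>lborel)"
proof -
  let ?S = "{y. \<bar>n \<bullet> y - c\<bar> \<le> 1/2}"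
  have S: "?S \<in> sets borel"
    by measurable
  have "(\<integral>\<^sup>+y. h y \<partial>hyp_measure n c) = (\<integral>\<^sup>+x. h (x - (n \<bullet> x - c) *\<^sub>R n) \<partial>restrict_space lborel ?S)"
    unfolding hyp_measure_def
    by (rule nn_integral_distr) (auto intro!: measurable_restrict_space1)
  also have "\<dots> = (\<integral>\<^sup>+x. h (x - (n \<bullet> x - c) *\<^sub>R n) * indicator ?S x \<partial>lborel)"
    using S by (subst nn_integral_restrict_space) auto
  finally show ?thesis
    by (simp add: mult.commute)
qed

lemma hyp_measure_cong_on_hyperplane:
  assumes "norm n = 1" "\<And>y. n \<bullet> y = c \<Longrightarrow> g y = h y"
    "g \<in> borel_measurable borel" "h \<in> borel_measurable borel"
  shows "(\<integral>\<^sup>+y. g y \<partial>hyp_measure n c) = (\<integral>\<^sup>+y. h y \<partial>hyp_measure n c)"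
proof -
  have "n \<bullet> (x - (n \<bullet> x - c) *\<^sub>R n) = c" for x
    using assms(1) by (simp add: inner_diff_right dot_square_norm)
  then show ?thesis
    using assms(2-4) by (simp add: nn_integral_hyp_measure)
qed

lemma nn_integral_lborel_translation:
  fixes f :: "'a::euclidean_space \<Rightarrow> ennreal"
  assumes [measurable]: "f \<in> borel_measurable borel"
  shows "(\<integral>\<^sup>+x. f (x + t) \<partial>lborel) = (\<integral>\<^sup>+x. f x \<partial>lborel)"
proof -
  have "(\<integral>\<^sup>+x. f x \<partial>lborel) = (\<integral>\<^sup>+x. f x \<partial>distr lborel borel ((+) t))"
    by (simp add: lborel_distr_plus)
  also have "\<dots> = (\<integral>\<^sup>+x. f (x + t) \<partial>lborel)"
    by (subst nn_integral_distr) (auto simp: add.commute)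
  finally show ?thesis by simp
qed

lemma nn_integral_lborel_scale:
  fixes f :: "'a::euclidean_space \<Rightarrow> ennreal"
  assumes [measurable]: "f \<in> borel_measurable borel" and "r > 0"
  shows "(\<integral>\<^sup>+x. f x \<partial>lborel) = ennreal (r ^ DIM('a)) * (\<integral>\<^sup>+x. f (t + r *\<^sub>R x) \<partial>lborel)"
proof -
  have "(\<integral>\<^sup>+x. f x \<partial>lborel) = (\<integral>\<^sup>+x. f x \<partial>density (distr lborel borel (\<lambda>x. t + r *\<^sub>R x)) (\<lambda>_. ennreal (r ^ DIM('a))))"
    using lborel_affine[of r t] assms(2) by simp
  also have "\<dots> = (\<integral>\<^sup>+x. ennreal (r ^ DIM('a)) * f x \<partial>distr lborel borel (\<lambda>x. t + r *\<^sub>R x))"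
    by (subst nn_integral_density) auto
  also have "\<dots> = ennreal (r ^ DIM('a)) * (\<integral>\<^sup>+x. f (t + r *\<^sub>R x) \<partial>lborel)"
    by (subst nn_integral_distr) (auto simp: nn_integral_cmult)
  finally show ?thesis .
qed

text \<open>Fubini in the direction of the normal. As the surface measure projects a slab of unit width,
  translation invariance suffices and no product decomposition of the space is needed.\<close>

lemma nn_integral_slices:
  fixes q :: "'a::euclidean_space \<Rightarrow> ennreal"
  assumes n: "norm n = 1" and q[measurable]: "q \<in> borel_measurable borel"
  shows "(\<integral>\<^sup>+x. q x \<partial>lborel) = (\<integral>\<^sup>+s. \<integral>\<^sup>+y. q (y + s *\<^sub>R n) \<partial>hyp_measure n c \<partial>lborel)"
proof -
  let ?S = "\<lambda>t. indicator {-1/2..1/2::real} t :: ennreal"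
  have "\<bar>t\<bar> \<le> 1/2 \<longleftrightarrow> t \<in> {-1/2..1/2}" for t :: real
    by auto
  then have S: "indicator {y. \<bar>n \<bullet> y - c\<bar> \<le> 1/2} x = ?S (n \<bullet> x - c)" for x
    by (simp only: indicator_def mem_Collect_eq)
  have "(\<integral>\<^sup>+s. \<integral>\<^sup>+y. q (y + s *\<^sub>R n) \<partial>hyp_measure n c \<partial>lborel) =
      (\<integral>\<^sup>+s. \<integral>\<^sup>+x. ?S (n \<bullet> x - c) * q (x - (n \<bullet> x - c) *\<^sub>R n + s *\<^sub>R n) \<partial>lborel \<partial>lborel)"
    unfolding S[symmetric] by (subst nn_integral_hyp_measure) auto
  also have "\<dots> = (\<integral>\<^sup>+x. \<integral>\<^sup>+s. ?S (n \<bullet> x - c) * q (x - (n \<bullet> x - c) *\<^sub>R n + s *\<^sub>R n) \<partial>lborel \<partial>lborel)"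
    by (rule lborel_pair.Fubini') measurable
  \<comment> \<open>Translating \<open>s\<close> undoes the projection onto the hyperplane.\<close>
  also have "\<dots> = (\<integral>\<^sup>+x. \<integral>\<^sup>+s. ?S (n \<bullet> x - c) * q (x + s *\<^sub>R n) \<partial>lborel \<partial>lborel)"
  proof (rule nn_integral_cong)
    fix x
    have "(\<integral>\<^sup>+s. ?S (n \<bullet> x - c) * q (x - (n \<bullet> x - c) *\<^sub>R n + s *\<^sub>R n) \<partial>lborel) =
        (\<integral>\<^sup>+s. ?S (n \<bullet> x - c) * q (x - (n \<bullet> x - c) *\<^sub>R n + (s + (n \<bullet> x - c)) *\<^sub>R n) \<partial>lborel)"
      by (rule nn_integral_lborel_translation[symmetric]) measurable
    then show "(\<integral>\<^sup>+s. ?S (n \<bullet> x - c) * q (x - (n \<bullet> x - c) *\<^sub>R n + s *\<^sub>R n) \<partial>lborel) =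
        (\<integral>\<^sup>+s. ?S (n \<bullet> x - c) * q (x + s *\<^sub>R n) \<partial>lborel)"
      by (simp add: algebra_simps)
  qed
  also have "\<dots> = (\<integral>\<^sup>+s. \<integral>\<^sup>+x. ?S (n \<bullet> x - c) * q (x + s *\<^sub>R n) \<partial>lborel \<partial>lborel)"
    by (rule lborel_pair.Fubini'[symmetric]) measurable
  \<comment> \<open>Translating \<open>x\<close> moves \<open>s\<close> from the integrand into the
    slab condition, which as a condition on \<open>s\<close> describes an interval of length
    one.\<close>
  also have "\<dots> = (\<integral>\<^sup>+s. \<integral>\<^sup>+x. ?S (n \<bullet> x - s - c) * q x \<partial>lborel \<partial>lborel)"
  proof (rule nn_integral_cong)
    fix s
    have "(\<integral>\<^sup>+x. ?S (n \<bullet> (x + s *\<^sub>R n) - s - c) * q (x + s *\<^sub>R n) \<partial>lborel) = (\<integral>\<^sup>+x. ?S (n \<bullet> x - s - c) * q x \<partial>lborel)"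
      by (rule nn_integral_lborel_translation[of "\<lambda>x. ?S (n \<bullet> x - s - c) * q x"]) measurable
    then show "(\<integral>\<^sup>+x. ?S (n \<bullet> x - c) * q (x + s *\<^sub>R n) \<partial>lborel) = (\<integral>\<^sup>+x. ?S (n \<bullet> x - s - c) * q x \<partial>lborel)"
      using n by (simp add: inner_add_right dot_square_norm)
  qed
  also have "\<dots> = (\<integral>\<^sup>+x. \<integral>\<^sup>+s. ?S (n \<bullet> x - s - c) * q x \<partial>lborel \<partial>lborel)"
    by (rule lborel_pair.Fubini') measurable
  also have "\<dots> = (\<integral>\<^sup>+x. q x \<partial>lborel)"
  proof (rule nn_integral_cong)
    fix x
    have "?S (n \<bullet> x - s - c) = indicator {n \<bullet> x - c - 1/2 .. n \<bullet> x - c + 1/2} s" for s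
      by (auto simp: indicator_def)
    then have "(\<integral>\<^sup>+s. ?S (n \<bullet> x - s - c) * q x \<partial>lborel) =
        (\<integral>\<^sup>+s. q x * indicator {n \<bullet> x - c - 1/2 .. n \<bullet> x - c + 1/2} s \<partial>lborel)"
      by (simp add: mult.commute)
    then show "(\<integral>\<^sup>+s. ?S (n \<bullet> x - s - c) * q x \<partial>lborel) = q x"
      by (simp add: nn_integral_cmult_indicator)
  qed
  finally show ?thesis by simp
qed

text \<open>Extend \<open>h\<close> constantly along the normal and integrate it over a slab of
  width \<open>r\<close> in two ways. Slicing gives \<open>r\<close> times the surface integral;
  dilating the space from the unit slab gives \<open>r ^ DIM('a)\<close> times the dilated one.
  Division by \<open>r\<close> leaves the exponent.\<close>

lemma nn_integral_hyp_dilation: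
  fixes h :: "'a::euclidean_space \<Rightarrow> ennreal"
  assumes n: "norm n = 1" and h[measurable]: "h \<in> borel_measurable borel" and z: "n \<bullet> z = c" and r: "r > 0"
  shows "(\<integral>\<^sup>+y. h y \<partial>hyp_measure n c) =
    ennreal (r ^ (DIM('a) - 1)) * (\<integral>\<^sup>+y. h (z + r *\<^sub>R (y - z)) \<partial>hyp_measure n c)"
proof -
  let ?pr = "\<lambda>x. x - (n \<bullet> x - c) *\<^sub>R n"
  define G where "G x = indicator {-r/2..r/2} (n \<bullet> x - c) * h (?pr x)" for x
  have [measurable]: "G \<in> borel_measurable borel"
    unfolding G_def[abs_def] by measurable
  have "(\<integral>\<^sup>+x. G x \<partial>lborel) = (\<integral>\<^sup>+s. \<integral>\<^sup>+y. G (y + s *\<^sub>R n) \<partial>hyp_measure n c \<partial>lborel)"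
    by (rule nn_integral_slices[OF n]) measurable
  also have "\<dots> = (\<integral>\<^sup>+s. \<integral>\<^sup>+y. indicator {-r/2..r/2} s * h y \<partial>hyp_measure n c \<partial>lborel)"
  proof (rule nn_integral_cong, rule hyp_measure_cong_on_hyperplane[OF n])
    fix s y assume "n \<bullet> y = c"
    then show "G (y + s *\<^sub>R n) = indicator {-r/2..r/2} s * h y"
      using n by (simp add: G_def inner_add_right dot_square_norm)
  qed measurable
  also have "\<dots> = (\<integral>\<^sup>+s. (\<integral>\<^sup>+y. h y \<partial>hyp_measure n c) * indicator {-r/2..r/2} s \<partial>lborel)"
    by (rule nn_integral_cong, subst nn_integral_cmult) (auto simp: mult.commute)
  also have "\<dots> = (\<integral>\<^sup>+y. h y \<partial>hyp_measure n c) * ennreal r"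
    using r by (simp add: nn_integral_cmult_indicator)
  finally have 1: "(\<integral>\<^sup>+x. G x \<partial>lborel) = (\<integral>\<^sup>+y. h y \<partial>hyp_measure n c) * ennreal r" .
  have "(\<integral>\<^sup>+x. G x \<partial>lborel) = ennreal (r ^ DIM('a)) * (\<integral>\<^sup>+x. G ((z - r *\<^sub>R z) + r *\<^sub>R x) \<partial>lborel)"
    by (rule nn_integral_lborel_scale) (use r in auto)
  also have "(\<integral>\<^sup>+x. G ((z - r *\<^sub>R z) + r *\<^sub>R x) \<partial>lborel) = (\<integral>\<^sup>+y. h (z + r *\<^sub>R (y - z)) \<partial>hyp_measure n c)"
  proof -
    have "G ((z - r *\<^sub>R z) + r *\<^sub>R x) = indicator {y. \<bar>n \<bullet> y - c\<bar> \<le> 1/2} x * h (z + r *\<^sub>R (?pr x - z))" for x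
    proof -
      have e: "n \<bullet> ((z - r *\<^sub>R z) + r *\<^sub>R x) - c = r * (n \<bullet> x - c)"
        using z by (simp add: inner_add_right inner_diff_right algebra_simps)
      have p: "(z - r *\<^sub>R z) + r *\<^sub>R x - (r * (n \<bullet> x - c)) *\<^sub>R n = z + r *\<^sub>R (?pr x - z)"
        by (simp add: algebra_simps)
      have "r * (n \<bullet> x - c) \<in> {-r/2..r/2} \<longleftrightarrow> \<bar>n \<bullet> x - c\<bar> \<le> 1/2"
      proof -
        have "\<bar>r * (n \<bullet> x - c)\<bar> \<le> r * (1/2) \<longleftrightarrow> \<bar>n \<bullet> x - c\<bar> \<le> 1/2"
          unfolding abs_mult using r by simp
        then show ?thesis by auto
      qed
      then show ?thesis
        unfolding G_def e p by (simp only: indicator_def mem_Collect_eq)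
    qed
    then show ?thesis
      by (subst nn_integral_hyp_measure) simp_all
  qed
  finally have "(\<integral>\<^sup>+y. h y \<partial>hyp_measure n c) * ennreal r =
      ennreal (r ^ (DIM('a) - 1)) * (\<integral>\<^sup>+y. h (z + r *\<^sub>R (y - z)) \<partial>hyp_measure n c) * ennreal r"
    using r power_Suc[of r "DIM('a) - 1"] unfolding 1 by (simp add: ennreal_mult mult_ac)
  then have "(\<integral>\<^sup>+y. h y \<partial>hyp_measure n c) * ennreal r * ennreal (1 / r) =
      ennreal (r ^ (DIM('a) - 1)) * (\<integral>\<^sup>+y. h (z + r *\<^sub>R (y - z)) \<partial>hyp_measure n c) * ennreal r * ennreal (1 / r)"
    by simp
  moreover have "ennreal r * ennreal (1 / r) = 1"
    using r by (simp flip: ennreal_mult)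
  ultimately show ?thesis
    by (simp only: mult.assoc mult_1_right)
qed

section \<open>Pyramids over a piece of a hyperplane\<close>

definition pyramid :: "'a::euclidean_space \<Rightarrow> 'a set \<Rightarrow> 'a set" where
  "pyramid p F = {p + r *\<^sub>R (y - p) | r y. 0 < r \<and> r < 1 \<and> y \<in> F}"

text \<open>With \<open>cone_base\<close> this inverts the parametrization
  \<open>p + r *\<^sub>R (y - p)\<close>. Both are given by formulas on the whole space, which
  yields measurability of pyramids and lets integrands depend on \<open>r\<close> and
  \<open>y\<close>.\<close>

definition cone_height :: "'a::euclidean_space \<Rightarrow> 'a \<Rightarrow> real \<Rightarrow> 'a \<Rightarrow> real" where
  "cone_height p n c x = (n \<bullet> (x - p)) / (c - n \<bullet> p)"

definition cone_base :: "'a::euclidean_space \<Rightarrow> 'a \<Rightarrow> real \<Rightarrow> 'a \<Rightarrow> 'a" where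
  "cone_base p n c x = p + (1 / cone_height p n c x) *\<^sub>R (x - p)"

lemma cone_height_measurable [measurable]: "cone_height p n c \<in> borel_measurable borel"
  unfolding cone_height_def[abs_def] by measurable

lemma cone_base_measurable [measurable]: "cone_base p n c \<in> borel_measurable borel"
  unfolding cone_base_def[abs_def] by measurable

lemma cone_coordinates:
  assumes "n \<bullet> p < c" "n \<bullet> y = c"
  shows "cone_height p n c (p + r *\<^sub>R (y - p)) = r" "r \<noteq> 0 \<Longrightarrow> cone_base p n c (p + r *\<^sub>R (y - p)) = y"
  using assms by (simp_all add: cone_height_def cone_base_def inner_diff_right)

lemma pyramid_iff:
  assumes "n \<bullet> p < c" "F \<subseteq> {x. n \<bullet> x = c}"
  shows "x \<in> pyramid p F \<longleftrightarrow> 0 < cone_height p n c x \<and> cone_height p n c x < 1 \<and> cone_base p n c x \<in> F"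
proof
  assume "x \<in> pyramid p F"
  then show "0 < cone_height p n c x \<and> cone_height p n c x < 1 \<and> cone_base p n c x \<in> F"
    using assms by (auto simp: pyramid_def cone_coordinates subset_iff)
next
  assume *: "0 < cone_height p n c x \<and> cone_height p n c x < 1 \<and> cone_base p n c x \<in> F"
  then have "x = p + cone_height p n c x *\<^sub>R (cone_base p n c x - p)"
    by (simp add: cone_base_def)
  then show "x \<in> pyramid p F"
    unfolding pyramid_def using * by blast
qed

lemma pyramid_sets:
  assumes "n \<bullet> p < c" "F \<subseteq> {x. n \<bullet> x = c}" and [measurable]: "F \<in> sets borel"
  shows "pyramid p F \<in> sets borel"
proof -
  have "pyramid p F = {x. 0 < cone_height p n c x \<and> cone_height p n c x < 1 \<and> cone_base p n c x \<in> F}"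
    using pyramid_iff[OF assms(1,2)] by blast
  also have "\<dots> \<in> sets borel"
    by measurable
  finally show ?thesis .
qed

text \<open>A slice parallel to the base is the base scaled by \<open>r\<close>, which contributes
  the power of \<open>r\<close>. The substitution \<open>s = - d + d * r\<close> for the signed
  distance to the base contributes the remaining factor.\<close>

lemma nn_integral_pyramid:
  fixes q :: "'a::euclidean_space \<Rightarrow> ennreal"
  assumes n: "norm n = 1" and q[measurable]: "q \<in> borel_measurable borel"
    and p: "n \<bullet> p < c" and F: "F \<subseteq> {x. n \<bullet> x = c}" and Fb[measurable]: "F \<in> sets borel"
  shows "(\<integral>\<^sup>+x. indicator (pyramid p F) x * q x \<partial>lborel) =
    (\<integral>\<^sup>+r. indicator {0<..<1} r * (ennreal ((c - n \<bullet> p) * r ^ (DIM('a) - 1)) *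
        (\<integral>\<^sup>+y. indicator F y * q (p + r *\<^sub>R (y - p)) \<partial>hyp_measure n c)) \<partial>lborel)"
proof -
  define d where "d = c - n \<bullet> p"
  have d: "d > 0" using p by (simp add: d_def)
  define Q where "Q x = indicator (pyramid p F) x * q x" for x
  have [measurable]: "pyramid p F \<in> sets borel"
    by (rule pyramid_sets[OF p F Fb])
  have [measurable]: "Q \<in> borel_measurable borel"
    unfolding Q_def[abs_def] by measurable
  define J where "J s = (\<integral>\<^sup>+y. Q (y + s *\<^sub>R n) \<partial>hyp_measure n c)" for s
  \<comment> \<open>The foot of \<open>p\<close> on the hyperplane: dilating the base about
    \<open>z\<close> and then shifting it by \<open>- d + d * r\<close> along the normal is the
    dilation about \<open>p\<close>.\<close>
  define z where "z = p + d *\<^sub>R n"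
  have z: "n \<bullet> z = c"
    using n by (simp add: z_def d_def inner_add_right dot_square_norm)
  have J: "J (- d + d * r) = indicator {0<..<1} r * (ennreal (r ^ (DIM('a) - 1)) *
        (\<integral>\<^sup>+y. indicator F y * q (p + r *\<^sub>R (y - p)) \<partial>hyp_measure n c))" for r
  proof -
    have height: "cone_height p n c (y + (- d + d * r) *\<^sub>R n) = r" if "n \<bullet> y = c" for y
      using that d n unfolding cone_height_def d_def[symmetric]
      by (simp add: inner_add_right inner_diff_right dot_square_norm d_def)
    show ?thesis
    proof (cases "0 < r \<and> r < 1")
      case False
      have "J (- d + d * r) = (\<integral>\<^sup>+y. 0 \<partial>hyp_measure n c)"
        unfolding J_def
      proof (rule hyp_measure_cong_on_hyperplane[OF n])
        fix y assume "n \<bullet> y = c"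
        then show "Q (y + (- d + d * r) *\<^sub>R n) = 0"
          using height[of y] False pyramid_iff[OF p F] by (auto simp: Q_def indicator_def)
      qed measurable
      then show ?thesis
        using False by simp
    next
      case True
      have "J (- d + d * r) = ennreal (r ^ (DIM('a) - 1)) *
          (\<integral>\<^sup>+y. Q (z + r *\<^sub>R (y - z) + (- d + d * r) *\<^sub>R n) \<partial>hyp_measure n c)"
        unfolding J_def
        by (rule nn_integral_hyp_dilation[OF n _ z, of "\<lambda>y. Q (y + (- d + d * r) *\<^sub>R n)"]) (use True in auto)
      also have "(\<integral>\<^sup>+y. Q (z + r *\<^sub>R (y - z) + (- d + d * r) *\<^sub>R n) \<partial>hyp_measure n c) =
          (\<integral>\<^sup>+y. indicator F y * q (p + r *\<^sub>R (y - p)) \<partial>hyp_measure n c)"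
      proof (rule hyp_measure_cong_on_hyperplane[OF n])
        fix y assume y: "n \<bullet> y = c"
        have e: "z + r *\<^sub>R (y - z) + (- d + d * r) *\<^sub>R n = p + r *\<^sub>R (y - p)"
          by (simp add: z_def algebra_simps)
        have "p + r *\<^sub>R (y - p) \<in> pyramid p F \<longleftrightarrow> y \<in> F"
          using True cone_coordinates[OF p y, of r] by (simp add: pyramid_iff[OF p F])
        then show "Q (z + r *\<^sub>R (y - z) + (- d + d * r) *\<^sub>R n) = indicator F y * q (p + r *\<^sub>R (y - p))"
          unfolding e by (simp add: Q_def indicator_def)
      qed measurable
      finally show ?thesis
        using True by simp
    qed
  qed
  have mJ: "J \<in> borel_measurable borel"
  proof -
    have "J s = (\<integral>\<^sup>+x. indicator {y. \<bar>n \<bullet> y - c\<bar> \<le> 1/2} x * Q (x - (n \<bullet> x - c) *\<^sub>R n + s *\<^sub>R n) \<partial>lborel)" for s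
      unfolding J_def by (subst nn_integral_hyp_measure) auto
    then have "J = (\<lambda>s. \<integral>\<^sup>+x. indicator {y. \<bar>n \<bullet> y - c\<bar> \<le> 1/2} x * Q (x - (n \<bullet> x - c) *\<^sub>R n + s *\<^sub>R n) \<partial>lborel)"
      by blast
    also have "\<dots> \<in> borel_measurable borel"
      by (rule lborel.borel_measurable_nn_integral) measurable
    finally show ?thesis .
  qed
  have "(\<integral>\<^sup>+x. Q x \<partial>lborel) = (\<integral>\<^sup>+s. J s \<partial>lborel)"
    unfolding J_def by (rule nn_integral_slices[OF n]) measurable
  also have "\<dots> = ennreal d * (\<integral>\<^sup>+r. J (- d + d * r) \<partial>lborel)"
    using nn_integral_real_affine[OF mJ, of d "- d"] d by simp
  also have "\<dots> = (\<integral>\<^sup>+r. ennreal d * J (- d + d * r) \<partial>lborel)"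
    using mJ by (subst nn_integral_cmult) auto
  also have "\<dots> = (\<integral>\<^sup>+r. indicator {0<..<1} r * (ennreal (d * r ^ (DIM('a) - 1)) *
        (\<integral>\<^sup>+y. indicator F y * q (p + r *\<^sub>R (y - p)) \<partial>hyp_measure n c)) \<partial>lborel)"
    unfolding J using d by (intro nn_integral_cong) (auto simp: indicator_def ennreal_mult mult_ac)
  finally show ?thesis
    by (simp add: Q_def d_def)
qed

section \<open>Relatively open pieces of a hyperplane and their measure\<close>

definition flat_face :: "'a::euclidean_space \<Rightarrow> real \<Rightarrow> 'a set \<Rightarrow> bool" where
  "flat_face n c F \<longleftrightarrow> norm n = 1 \<and> F \<noteq> {} \<and> bounded F \<and> openin (top_of_set {x. n \<bullet> x = c}) F"

lemma flat_faceD: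
  assumes "flat_face n c F"
  shows "norm n = 1" "F \<noteq> {}" "bounded F" "F \<subseteq> {x. n \<bullet> x = c}" "F \<in> sets borel"
proof -
  show "norm n = 1" "F \<noteq> {}" "bounded F" "F \<subseteq> {x. n \<bullet> x = c}"
    using assms by (auto simp: flat_face_def dest: openin_imp_subset)
  obtain U where "open U" "F = {x. n \<bullet> x = c} \<inter> U"
    using assms unfolding flat_face_def openin_open by blast
  then show "F \<in> sets borel"
    by (simp add: borel_closed closed_hyperplane borel_open sets.Int)
qed

lemma flat_face_ball:
  assumes "flat_face n c F" "y \<in> F"
  obtains e where "e > 0" "\<And>x. x \<in> ball y e \<Longrightarrow> n \<bullet> x = c \<Longrightarrow> x \<in> F"
proof -
  obtain U where U: "open U" "F = {x. n \<bullet> x = c} \<inter> U"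
    using assms unfolding flat_face_def openin_open by blast
  then obtain e where "e > 0" "ball y e \<subseteq> U"
    using assms(2) open_contains_ball by blast
  then show ?thesis
    using U that by blast
qed

text \<open>Short tangential steps from a point of \<open>F\<close> stay in \<open>F\<close>, so a
  vector with constant inner product on \<open>F\<close> is orthogonal to every tangential
  direction.\<close>

lemma normal_parallel:
  fixes a n :: "'a::euclidean_space"
  assumes a: "a \<noteq> 0" and F: "openin (top_of_set {x. a \<bullet> x = b}) F" "F \<noteq> {}"
    and n: "norm n = 1" "\<forall>x\<in>F. \<forall>y\<in>F. n \<bullet> x = n \<bullet> y"
  obtains k where "k \<noteq> 0" "n = k *\<^sub>R a"
proof -
  obtain y where y: "y \<in> F"
    using F(2) by blast
  obtain U where U: "open U" "F = {x. a \<bullet> x = b} \<inter> U"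
    using F(1) unfolding openin_open by blast
  then obtain e where e: "e > 0" "ball y e \<subseteq> U"
    using y open_contains_ball by blast
  have tang: "n \<bullet> \<tau> = 0" if "a \<bullet> \<tau> = 0" for \<tau>
  proof -
    define s where "s = e / (2 * (norm \<tau> + 1))"
    have s: "s > 0" using e by (simp add: s_def add_nonneg_pos)
    have "s * norm \<tau> \<le> s * (norm \<tau> + 1)"
      using s by simp
    also have "\<dots> = e / 2"
      by (simp add: s_def field_simps add_nonneg_eq_0_iff)
    finally have "s * norm \<tau> < e"
      using e by simp
    then have "y + s *\<^sub>R \<tau> \<in> ball y e"
      using s by (simp add: dist_norm)
    then have "y + s *\<^sub>R \<tau> \<in> F"
      using e U y that by (auto simp: inner_add_right)
    then have "n \<bullet> (y + s *\<^sub>R \<tau>) = n \<bullet> y"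
      using n(2) y by blast
    then show ?thesis
      using s by (simp add: inner_add_right)
  qed
  define \<tau> where "\<tau> = n - (n \<bullet> a / (a \<bullet> a)) *\<^sub>R a"
  have aa: "a \<bullet> a \<noteq> 0" using a by simp
  have "a \<bullet> \<tau> = 0"
    using aa by (simp add: \<tau>_def inner_diff_right inner_commute)
  then have "n \<bullet> \<tau> = 0" "a \<bullet> \<tau> = 0"
    using tang by auto
  then have "\<tau> \<bullet> \<tau> = 0"
    by (simp add: \<tau>_def inner_diff_left)
  then have eq: "n = (n \<bullet> a / (a \<bullet> a)) *\<^sub>R a"
    by (simp add: \<tau>_def)
  moreover have "n \<bullet> a / (a \<bullet> a) \<noteq> 0"
    using eq n(1) by (metis norm_zero scale_zero_left zero_neq_one)
  ultimately show ?thesis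
    using that by blast
qed

lemma flat_faceI:
  assumes "a \<noteq> 0" "openin (top_of_set {x. a \<bullet> x = b}) F" "bounded F" "norm n = 1" "\<forall>x\<in>F. \<forall>y\<in>F. n \<bullet> x = n \<bullet> y"
    and y: "y \<in> F"
  shows "flat_face n (n \<bullet> y) F"
proof -
  obtain k where k: "k \<noteq> 0" "n = k *\<^sub>R a"
    using normal_parallel[OF assms(1,2) _ assms(4,5)] y by blast
  have "a \<bullet> y = b"
    using y assms(2) openin_imp_subset by blast
  then have eq: "{x. n \<bullet> x = n \<bullet> y} = {x. a \<bullet> x = b}"
    using k by auto
  show ?thesis
    unfolding flat_face_def eq using assms(2-4) y by blast
qed

lemma flat_face_normal_unique:
  assumes "flat_face n c F" "norm n' = 1" "\<forall>x\<in>F. \<forall>y\<in>F. n' \<bullet> x = n' \<bullet> y"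
  shows "n' = n \<or> n' = - n"
proof -
  have n: "n \<noteq> 0"
    using flat_faceD(1)[OF assms(1)] by auto
  obtain k where k: "n' = k *\<^sub>R n"
    using normal_parallel[OF n, of c F n'] assms unfolding flat_face_def by blast
  then have "\<bar>k\<bar> = 1"
    using assms(2) flat_faceD(1)[OF assms(1)] by simp
  then have "k = 1 \<or> k = -1"
    by linarith
  then show ?thesis
    using k by auto
qed

lemma hyp_measure_uminus: "hyp_measure (- n) (- c) = hyp_measure n c"
proof -
  have "\<bar>(- n) \<bullet> y - - c\<bar> = \<bar>n \<bullet> y - c\<bar>" "((- n) \<bullet> y - - c) *\<^sub>R (- n) = (n \<bullet> y - c) *\<^sub>R n" for y
    by (simp_all add: algebra_simps)
  then show ?thesis
    by (simp only: hyp_measure_def)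
qed

text \<open>Only the sign of the normal is left to the choice operator, and reversing normal and
  offset together does not change the measure.\<close>

lemma surface_measure_flat_face:
  assumes F: "flat_face n c (F :: (real^'n::finite) set)"
  shows "surface_measure F = hyp_measure n c"
proof -
  define n' where "n' = (SOME n. norm n = 1 \<and> (\<forall>x\<in>F. \<forall>y\<in>F. n \<bullet> x = n \<bullet> y))"
  define z where "z = (SOME z. z \<in> F)"
  have "\<exists>n. norm n = 1 \<and> (\<forall>x\<in>F. \<forall>y\<in>F. n \<bullet> x = n \<bullet> y)"
    using flat_faceD[OF F] by (intro exI[of _ n]) auto
  then have n': "norm n' = 1 \<and> (\<forall>x\<in>F. \<forall>y\<in>F. n' \<bullet> x = n' \<bullet> y)"
    unfolding n'_def by (rule someI_ex)
  have z: "z \<in> F"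
    unfolding z_def using flat_faceD(2)[OF F] by (simp add: some_in_eq)
  have nz: "n \<bullet> z = c"
    using z flat_faceD(4)[OF F] by blast
  have eq: "surface_measure F = hyp_measure n' (n' \<bullet> z)"
    unfolding surface_measure_def Let_def n'_def[symmetric] z_def[symmetric] hyp_measure_def inner_diff_right ..
  have "n' = n \<or> n' = - n"
    using flat_face_normal_unique[OF F] n' by blast
  then show ?thesis
    using eq nz hyp_measure_uminus[of n c] by auto
qed

lemma emeasure_hyp_measure:
  assumes [measurable]: "A \<in> sets borel"
  shows "emeasure (hyp_measure n c) A = emeasure lborel {x. \<bar>n \<bullet> x - c\<bar> \<le> 1/2 \<and> x - (n \<bullet> x - c) *\<^sub>R n \<in> A}"
proof -
  have ind: "(indicator {y. \<bar>n \<bullet> y - c\<bar> \<le> 1/2} x :: ennreal) * indicator A (x - (n \<bullet> x - c) *\<^sub>R n) =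
      indicator {x. \<bar>n \<bullet> x - c\<bar> \<le> 1/2 \<and> x - (n \<bullet> x - c) *\<^sub>R n \<in> A} x" for x
    by (auto simp: indicator_def)
  have "emeasure (hyp_measure n c) A = (\<integral>\<^sup>+y. indicator A y \<partial>hyp_measure n c)"
    by simp
  also have "\<dots> = (\<integral>\<^sup>+x. indicator {x. \<bar>n \<bullet> x - c\<bar> \<le> 1/2 \<and> x - (n \<bullet> x - c) *\<^sub>R n \<in> A} x \<partial>lborel)"
    unfolding ind[symmetric] by (rule nn_integral_hyp_measure) measurable
  also have "\<dots> = emeasure lborel {x. \<bar>n \<bullet> x - c\<bar> \<le> 1/2 \<and> x - (n \<bullet> x - c) *\<^sub>R n \<in> A}"
    by (rule nn_integral_indicator) measurable
  finally show ?thesis .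
qed

lemma emeasure_hyp_measure_finite:
  assumes n: "norm n = 1" and A: "bounded A" "A \<in> sets borel"
  shows "emeasure (hyp_measure n c) A < \<infinity>"
proof -
  obtain a where a: "\<And>x. x \<in> A \<Longrightarrow> norm x \<le> a"
    using A(1) by (auto simp: bounded_iff)
  have "{x. \<bar>n \<bullet> x - c\<bar> \<le> 1/2 \<and> x - (n \<bullet> x - c) *\<^sub>R n \<in> A} \<subseteq> cball 0 (a + 1)"
  proof
    fix x assume x: "x \<in> {x. \<bar>n \<bullet> x - c\<bar> \<le> 1/2 \<and> x - (n \<bullet> x - c) *\<^sub>R n \<in> A}"
    have "norm x \<le> norm (x - (n \<bullet> x - c) *\<^sub>R n) + norm ((n \<bullet> x - c) *\<^sub>R n)"
      by (metis diff_add_cancel norm_triangle_ineq)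
    moreover have "norm ((n \<bullet> x - c) *\<^sub>R n) \<le> 1"
      using x n by simp
    moreover have "norm (x - (n \<bullet> x - c) *\<^sub>R n) \<le> a"
      using x a by blast
    ultimately show "x \<in> cball 0 (a + 1)"
      by simp
  qed
  then have "emeasure (hyp_measure n c) A \<le> emeasure lborel (cball (0::'a) (a + 1))"
    unfolding emeasure_hyp_measure[OF A(2)] by (intro emeasure_mono) auto
  then show ?thesis
    using emeasure_lborel_cball_finite by (rule order_le_less_trans)
qed

text \<open>A small ball around a point of \<open>F\<close> stays in the slab and projects into
  \<open>F\<close>, so the preimage of \<open>F\<close> has positive volume.\<close>

lemma hyp_measure_pos:
  assumes F: "flat_face n c F"
  shows "emeasure (hyp_measure n c) F > 0"
proof -
  note n = flat_faceD(1)[OF F]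
  obtain y where y: "y \<in> F"
    using flat_faceD(2)[OF F] by blast
  then obtain e where e: "e > 0" "\<And>x. x \<in> ball y e \<Longrightarrow> n \<bullet> x = c \<Longrightarrow> x \<in> F"
    using flat_face_ball[OF F] by blast
  have ny: "n \<bullet> y = c"
    using y flat_faceD(4)[OF F] by blast
  let ?S = "{x. \<bar>n \<bullet> x - c\<bar> \<le> 1/2 \<and> x - (n \<bullet> x - c) *\<^sub>R n \<in> F}"
  have "ball y (min (1/2) (e/2)) \<subseteq> ?S"
  proof
    fix x assume x: "x \<in> ball y (min (1/2) (e/2))"
    have d: "norm (x - y) < 1/2" "norm (x - y) < e/2"
      using x by (auto simp: dist_norm norm_minus_commute)
    have "\<bar>n \<bullet> x - c\<bar> = \<bar>n \<bullet> (x - y)\<bar>"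
      using ny by (simp add: inner_diff_right)
    also have "\<dots> \<le> norm (x - y)"
      using Cauchy_Schwarz_ineq2[of n "x - y"] n by simp
    finally have t: "\<bar>n \<bullet> x - c\<bar> \<le> norm (x - y)" .
    have "norm (y - (x - (n \<bullet> x - c) *\<^sub>R n)) = norm ((y - x) + (n \<bullet> x - c) *\<^sub>R n)"
      by (simp add: algebra_simps)
    also have "\<dots> \<le> norm (y - x) + \<bar>n \<bullet> x - c\<bar>"
      using norm_triangle_ineq[of "y - x" "(n \<bullet> x - c) *\<^sub>R n"] n by simp
    also have "\<dots> < e"
      using t d by (simp add: norm_minus_commute)
    finally have "x - (n \<bullet> x - c) *\<^sub>R n \<in> ball y e"
      by (simp add: dist_norm)
    moreover have "n \<bullet> (x - (n \<bullet> x - c) *\<^sub>R n) = c"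
      using n by (simp add: inner_diff_right dot_square_norm)
    ultimately show "x \<in> ?S"
      using e(2) t d(1) by auto
  qed
  moreover have "?S \<in> sets borel"
    using flat_faceD(5)[OF F] by measurable
  ultimately have "emeasure lborel (ball y (min (1/2) (e/2))) \<le> emeasure lborel ?S"
    by (intro emeasure_mono) auto
  moreover have "emeasure lborel (ball y (min (1/2) (e/2))) > 0"
  proof -
    have "\<not> negligible (ball y (min (1/2) (e/2)))"
      using e(1) by (intro open_not_negligible) auto
    then show ?thesis
      by (auto simp: negligible_iff_null_sets null_sets_completion_iff null_sets_def zero_less_iff_neq_zero)
  qed
  ultimately show ?thesis
    unfolding emeasure_hyp_measure[OF flat_faceD(5)[OF F]] by (rule order_less_le_trans[rotated])
qed

text \<open>\<open>m\<close> has a nonzero tangential part \<open>l\<close>, and the preimage of the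
  hyperplane under the projection lies in a hyperplane normal to \<open>l\<close>.\<close>

lemma hyp_measure_hyperplane_null:
  fixes m :: "'a::euclidean_space"
  assumes n: "norm n = 1" and m: "m \<noteq> (m \<bullet> n) *\<^sub>R n"
  shows "emeasure (hyp_measure n c) {x. m \<bullet> x = b} = 0"
proof -
  define l where "l = m - (m \<bullet> n) *\<^sub>R n"
  have l: "l \<noteq> 0"
    using m by (simp add: l_def)
  have "m \<bullet> (x - (n \<bullet> x - c) *\<^sub>R n) = l \<bullet> x + c * (m \<bullet> n)" for x
    by (simp add: l_def inner_diff_left inner_diff_right algebra_simps)
  then have sub: "{x. \<bar>n \<bullet> x - c\<bar> \<le> 1/2 \<and> x - (n \<bullet> x - c) *\<^sub>R n \<in> {x. m \<bullet> x = b}} \<subseteq>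
      {x. l \<bullet> x = b - c * (m \<bullet> n)}"
    by auto
  have null: "{x. l \<bullet> x = b - c * (m \<bullet> n)} \<in> null_sets lborel"
    using negligible_hyperplane[of l "b - c * (m \<bullet> n)"] l
    by (auto simp: negligible_iff_null_sets null_sets_completion_iff borel_closed closed_hyperplane)
  have "{x. \<bar>n \<bullet> x - c\<bar> \<le> 1/2 \<and> x - (n \<bullet> x - c) *\<^sub>R n \<in> {x. m \<bullet> x = b}} \<in> sets lborel"
    unfolding sets_lborel by measurable
  from null_sets_subset[OF null this sub]
  have "{x. \<bar>n \<bullet> x - c\<bar> \<le> 1/2 \<and> x - (n \<bullet> x - c) *\<^sub>R n \<in> {x. m \<bullet> x = b}} \<in> null_sets lborel" .
  moreover have "{x. m \<bullet> x = b} \<in> sets borel"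
    by (simp add: borel_closed closed_hyperplane)
  ultimately show ?thesis
    using null_setsD1 by (simp only: emeasure_hyp_measure)
qed

lemma flat_face_generic_point:
  assumes F: "flat_face n c F" and V: "open V" "V \<inter> F \<noteq> {}"
    and N: "finite N" "\<And>A. A \<in> N \<Longrightarrow> A \<in> null_sets (hyp_measure n c)"
  obtains y where "y \<in> V" "y \<in> F" "y \<notin> \<Union>N"
proof -
  have VF: "flat_face n c (V \<inter> F)"
    using F V unfolding flat_face_def by (auto intro: bounded_subset openin_Int_open simp: Int_commute)
  have "\<Union>N \<in> null_sets (hyp_measure n c)"
    using null_sets_UN'[of N "\<lambda>A. A" "hyp_measure n c"] N countable_finite[OF N(1)] by simp
  then have "V \<inter> F \<in> null_sets (hyp_measure n c)" if "V \<inter> F \<subseteq> \<Union>N"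
    by (rule null_sets_subset[OF _ _ that]) (use flat_faceD(5)[OF VF] \<open>\<Union>N \<in> _\<close> in simp_all)
  then have "emeasure (hyp_measure n c) (V \<inter> F) = 0" if "V \<inter> F \<subseteq> \<Union>N"
    using null_setsD1 that by blast
  then have "\<not> V \<inter> F \<subseteq> \<Union>N"
    using hyp_measure_pos[OF VF] by auto
  then obtain y where "y \<in> V" "y \<in> F" "y \<notin> \<Union>N"
    by blast
  then show ?thesis
    by (rule that)
qed

section \<open>Volumes of pyramids and of their shells\<close>

lemma nn_integral_power_Icc:
  assumes "0 \<le> a" "a \<le> b" "d \<ge> 0" "0 < D"
  shows "(\<integral>\<^sup>+r. indicator {a..b} r * ennreal (d * r ^ (D - 1)) \<partial>lborel) = ennreal (d * (b ^ D - a ^ D) / D)"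
proof -
  have d: "((\<lambda>r. d * r ^ D / D) has_real_derivative d * r ^ (D - 1)) (at r)" for r
    using assms(4) by (auto intro!: derivative_eq_intros)
  have n: "0 \<le> d * r ^ (D - 1)" if "a \<le> r" for r
    using assms that by simp
  have "(\<integral>\<^sup>+r. ennreal (d * r ^ (D - 1)) * indicator {a..b} r \<partial>lborel) = ennreal (d * b ^ D / D - d * a ^ D / D)"
    by (rule nn_integral_FTC_Icc[of "\<lambda>r. d * r ^ (D - 1)" a b "\<lambda>r. d * r ^ D / D"]) (use assms(2) d n in auto)
  then show ?thesis
    by (simp add: mult.commute diff_divide_distrib right_diff_distrib)
qed

lemma emeasure_pyramid:
  fixes F :: "'a::euclidean_space set"
  assumes F: "flat_face n c F" and p: "n \<bullet> p < c"
  shows "emeasure lborel (pyramid p F) = ennreal ((c - n \<bullet> p) / DIM('a)) * emeasure (hyp_measure n c) F"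
proof -
  note [measurable] = flat_faceD(5)[OF F]
  have ind: "(\<integral>\<^sup>+y. indicator F y * 1 \<partial>hyp_measure n c) = emeasure (hyp_measure n c) F"
    by simp
  have "emeasure lborel (pyramid p F) = (\<integral>\<^sup>+x. indicator (pyramid p F) x * 1 \<partial>lborel)"
    using pyramid_sets[OF p flat_faceD(4,5)[OF F]] by simp
  also have "\<dots> = (\<integral>\<^sup>+r. indicator {0<..<1} r * (ennreal ((c - n \<bullet> p) * r ^ (DIM('a) - 1)) *
        (\<integral>\<^sup>+y. indicator F y * 1 \<partial>hyp_measure n c)) \<partial>lborel)"
    by (rule nn_integral_pyramid[OF flat_faceD(1)[OF F] _ p flat_faceD(4,5)[OF F]]) simp
  also have "\<dots> = (\<integral>\<^sup>+r. (indicator {0..1} r * ennreal ((c - n \<bullet> p) * r ^ (DIM('a) - 1))) * emeasure (hyp_measure n c) F \<partial>lborel)"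
  proof (rule nn_integral_cong_AE)
    have "AE r in lborel. r \<noteq> (0::real)" "AE r in lborel. r \<noteq> (1::real)"
      by (rule AE_lborel_singleton)+
    then show "AE r in lborel. indicator {0<..<1} r * (ennreal ((c - n \<bullet> p) * r ^ (DIM('a) - 1)) *
        (\<integral>\<^sup>+y. indicator F y * 1 \<partial>hyp_measure n c)) =
        (indicator {0..1} r * ennreal ((c - n \<bullet> p) * r ^ (DIM('a) - 1))) * emeasure (hyp_measure n c) F"
      unfolding ind by eventually_elim (auto simp: indicator_def)
  qed
  also have "\<dots> = ennreal ((c - n \<bullet> p) / DIM('a)) * emeasure (hyp_measure n c) F"
    using nn_integral_power_Icc[of 0 1 "c - n \<bullet> p" "DIM('a)"] p by (subst nn_integral_multc) (auto simp: zero_power)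
  finally show ?thesis .
qed

text \<open>For functions constant along the rays from \<open>p\<close>: pushing the volume of the
  shell forward along \<open>cone_base\<close> gives a constant multiple of the surface measure of
  \<open>F\<close>. Comparing measures rather than integrals spares any integrability condition on
  \<open>H\<close>.\<close>

lemma integral_pyramid_shell:
  fixes F :: "'a::euclidean_space set" and H :: "'a \<Rightarrow> real"
  assumes F: "flat_face n c F" and p: "n \<bullet> p < c" and ab: "0 < a" "a \<le> b" "b < 1"
    and H[measurable]: "H \<in> borel_measurable borel"
  shows "(\<integral>x. indicator (pyramid p F \<inter> {x. a \<le> cone_height p n c x \<and> cone_height p n c x \<le> b}) x *
        H (cone_base p n c x) \<partial>lborel) =
    (c - n \<bullet> p) * (b ^ DIM('a) - a ^ DIM('a)) / DIM('a) * (\<integral>y. indicator F y * H y \<partial>hyp_measure n c)"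
proof -
  note n = flat_faceD(1)[OF F] and Fs = flat_faceD(4)[OF F] and [measurable] = flat_faceD(5)[OF F]
  let ?S = "pyramid p F \<inter> {x. a \<le> cone_height p n c x \<and> cone_height p n c x \<le> b}"
  define \<kappa> where "\<kappa> = (c - n \<bullet> p) * (b ^ DIM('a) - a ^ DIM('a)) / DIM('a)"
  have \<kappa>: "\<kappa> \<ge> 0"
    using p ab by (simp add: \<kappa>_def power_mono)
  have [measurable]: "pyramid p F \<in> sets borel"
    by (rule pyramid_sets[OF p Fs]) measurable
  have S[measurable]: "?S \<in> sets borel"
    by measurable
  have eq: "distr (density lborel (indicator ?S)) borel (cone_base p n c) =
      density (hyp_measure n c) (\<lambda>y. ennreal (\<kappa> * indicator F y))"
  proof (rule measure_eqI)
    fix A assume "A \<in> sets (distr (density lborel (indicator ?S)) borel (cone_base p n c))"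
    then have [measurable]: "A \<in> sets borel" by simp
    have [simp]: "cone_base p n c -` A \<in> sets borel"
      using measurable_sets[OF cone_base_measurable \<open>A \<in> sets borel\<close>] by simp
    have "emeasure (distr (density lborel (indicator ?S)) borel (cone_base p n c)) A =
        (\<integral>\<^sup>+x. indicator (pyramid p F) x * (indicator {a..b} (cone_height p n c x) * indicator A (cone_base p n c x)) \<partial>lborel)"
      by (subst emeasure_distr, simp, simp, subst emeasure_density, simp, simp)
        (auto intro!: nn_integral_cong simp: indicator_def)
    also have "\<dots> = (\<integral>\<^sup>+r. indicator {0<..<1} r * (ennreal ((c - n \<bullet> p) * r ^ (DIM('a) - 1)) *
        (\<integral>\<^sup>+y. indicator F y * (indicator {a..b} (cone_height p n c (p + r *\<^sub>R (y - p))) *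
          indicator A (cone_base p n c (p + r *\<^sub>R (y - p)))) \<partial>hyp_measure n c)) \<partial>lborel)"
      by (rule nn_integral_pyramid[OF n _ p Fs]) measurable
    also have "\<dots> = (\<integral>\<^sup>+r. (indicator {a..b} r * ennreal ((c - n \<bullet> p) * r ^ (DIM('a) - 1))) *
        emeasure (hyp_measure n c) (F \<inter> A) \<partial>lborel)"
    proof (rule nn_integral_cong)
      fix r :: real
      show "indicator {0<..<1} r * (ennreal ((c - n \<bullet> p) * r ^ (DIM('a) - 1)) *
        (\<integral>\<^sup>+y. indicator F y * (indicator {a..b} (cone_height p n c (p + r *\<^sub>R (y - p))) *
          indicator A (cone_base p n c (p + r *\<^sub>R (y - p)))) \<partial>hyp_measure n c)) =
        (indicator {a..b} r * ennreal ((c - n \<bullet> p) * r ^ (DIM('a) - 1))) * emeasure (hyp_measure n c) (F \<inter> A)"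
      proof (cases "r \<in> {0<..<1}")
        case True
        have "(\<integral>\<^sup>+y. indicator F y * (indicator {a..b} (cone_height p n c (p + r *\<^sub>R (y - p))) *
          indicator A (cone_base p n c (p + r *\<^sub>R (y - p)))) \<partial>hyp_measure n c) =
          (\<integral>\<^sup>+y. indicator {a..b} r * indicator (F \<inter> A) y \<partial>hyp_measure n c)"
          by (rule hyp_measure_cong_on_hyperplane[OF n])
            (use True in \<open>auto simp: cone_coordinates[OF p] indicator_def\<close>)
        also have "\<dots> = indicator {a..b} r * emeasure (hyp_measure n c) (F \<inter> A)"
          by (subst nn_integral_cmult) auto
        finally show ?thesis
          using True by (simp add: mult_ac)
      next
        case False
        then show ?thesis
          using ab by auto
      qed
    qed
    also have "\<dots> = ennreal \<kappa> * emeasure (hyp_measure n c) (F \<inter> A)"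
      using nn_integral_power_Icc[of a b "c - n \<bullet> p" "DIM('a)"] p ab
      by (subst nn_integral_multc) (auto simp: \<kappa>_def)
    also have "\<dots> = emeasure (density (hyp_measure n c) (\<lambda>y. ennreal (\<kappa> * indicator F y))) A"
    proof -
      have "emeasure (density (hyp_measure n c) (\<lambda>y. ennreal (\<kappa> * indicator F y))) A =
          (\<integral>\<^sup>+y. ennreal (\<kappa> * indicator F y) * indicator A y \<partial>hyp_measure n c)"
        by (rule emeasure_density) auto
      also have "\<dots> = (\<integral>\<^sup>+y. ennreal \<kappa> * indicator (F \<inter> A) y \<partial>hyp_measure n c)"
        by (intro nn_integral_cong) (auto simp: indicator_def)
      also have "\<dots> = ennreal \<kappa> * emeasure (hyp_measure n c) (F \<inter> A)"
        by (subst nn_integral_cmult) auto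
      finally show ?thesis by simp
    qed
    finally show "emeasure (distr (density lborel (indicator ?S)) borel (cone_base p n c)) A =
        emeasure (density (hyp_measure n c) (\<lambda>y. ennreal (\<kappa> * indicator F y))) A" .
  qed simp
  have "(\<integral>x. indicator ?S x * H (cone_base p n c x) \<partial>lborel) =
      (\<integral>x. H (cone_base p n c x) \<partial>density lborel (\<lambda>x. ennreal (indicator ?S x)))"
    by (subst integral_density) auto
  also have "\<dots> = (\<integral>y. H y \<partial>distr (density lborel (indicator ?S)) borel (cone_base p n c))"
    by (subst integral_distr) (auto simp: ennreal_indicator)
  also have "\<dots> = (\<integral>y. \<kappa> * indicator F y * H y \<partial>hyp_measure n c)"
    unfolding eq using \<kappa> by (subst integral_density) auto
  also have "\<dots> = \<kappa> * (\<integral>y. indicator F y * H y \<partial>hyp_measure n c)"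
    by (simp add: mult.assoc)
  finally show ?thesis
    by (simp add: \<kappa>_def)
qed

section \<open>Star-shaped cells\<close>

text \<open>\<open>Z\<close> is an exceptional set, later of codimension two, away from which a cell looks like a
  half-space at every point of its faces.\<close>

locale faced_cell =
  fixes T :: "(real^'n::finite) set" and \<F> :: "(real^'n) set set"
    and n :: "(real^'n) set \<Rightarrow> real^'n" and c :: "(real^'n) set \<Rightarrow> real" and Z :: "(real^'n) set"
  assumes T: "open T" "bounded T" "interior (closure T) = T"
    and fin: "finite \<F>" and disj: "pairwise disjnt \<F>"
    and flat: "\<And>F. F \<in> \<F> \<Longrightarrow> flat_face (n F) (c F) F"
    and front: "frontier T = (\<Union>F\<in>\<F>. closure F)" and face_front: "\<And>F. F \<in> \<F> \<Longrightarrow> F \<subseteq> frontier T"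
    and outward: "\<And>F. F \<in> \<F> \<Longrightarrow>
      F \<subseteq> closure {x\<in>F. \<exists>e>0. \<forall>t. 0 < t \<and> t < e \<longrightarrow> x - t *\<^sub>R n F \<in> T \<and> x + t *\<^sub>R n F \<notin> T}"
    and closure_face: "\<And>F. F \<in> \<F> \<Longrightarrow> closure F - Z \<subseteq> F"
begin

lemma face_hyperplane: "F \<in> \<F> \<Longrightarrow> y \<in> closure F \<Longrightarrow> n F \<bullet> y = c F"
  using closure_minimal[OF flat_faceD(4)[OF flat] closed_hyperplane] by blast

lemma norm_n: "F \<in> \<F> \<Longrightarrow> norm (n F) = 1"
  using flat_faceD(1)[OF flat] .

lemma frontier_T: "frontier T = closure T - T"
  using T(1) by (simp add: frontier_def interior_open)

text \<open>Off \<open>Z\<close> no other face meets a small ball around \<open>y\<close>. Its two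
  open halves are connected and miss the frontier, so each lies in \<open>T\<close> or avoids it,
  and one nearby point with a good normal decides which.\<close>

lemma half_ball:
  assumes F: "F \<in> \<F>" and y: "y \<in> F" "y \<notin> Z"
  obtains e where "e > 0" "\<And>x. x \<in> ball y e \<Longrightarrow> n F \<bullet> x < c F \<Longrightarrow> x \<in> T"
    "\<And>x. x \<in> ball y e \<Longrightarrow> n F \<bullet> x > c F \<Longrightarrow> x \<notin> closure T"
    "\<And>x. x \<in> ball y e \<Longrightarrow> n F \<bullet> x = c F \<Longrightarrow> x \<in> F"
proof -
  let ?K = "\<Union>F'\<in>\<F> - {F}. closure F'"
  have "y \<notin> closure F'" if "F' \<in> \<F>" "F' \<noteq> F" for F'
  proof
    assume "y \<in> closure F'"
    then have "y \<in> F'"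
      using closure_face[OF that(1)] y(2) by blast
    then show False
      using disj F y(1) that by (auto simp: pairwise_def disjnt_def)
  qed
  then have yK: "y \<in> - ?K"
    by blast
  have oK: "open (- ?K)"
    using fin by (intro open_Compl closed_UN) auto
  obtain e1 where e1: "e1 > 0" "ball y e1 \<subseteq> - ?K"
    by (rule openE[OF oK yK])
  obtain e2 where e2: "e2 > 0" "\<And>x. x \<in> ball y e2 \<Longrightarrow> n F \<bullet> x = c F \<Longrightarrow> x \<in> F"
    by (rule flat_face_ball[OF flat[OF F] y(1)]) (rule that, assumption+)
  define e where "e = min e1 e2"
  have e: "e > 0" "ball y e \<subseteq> - ?K" "ball y e \<subseteq> ball y e2"
    using e1 e2 by (auto simp: e_def)
  let ?Bm = "ball y e \<inter> {x. n F \<bullet> x < c F}" and ?Bp = "ball y e \<inter> {x. n F \<bullet> x > c F}"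
  have "frontier T \<subseteq> {x. n F \<bullet> x = c F} \<union> ?K"
    unfolding front using face_hyperplane[OF F] by blast
  then have fr: "frontier T \<inter> ball y e \<subseteq> {x. n F \<bullet> x = c F}"
    using e(2) by blast
  have cm: "connected ?Bm" and cp: "connected ?Bp"
    by (intro convex_connected convex_Int convex_halfspace_lt convex_halfspace_gt convex_ball)+
  have fm: "?Bm \<inter> frontier T = {}" and fp: "?Bp \<inter> frontier T = {}"
    using fr by auto
  \<comment> \<open>The normal condition holds on a dense subset of the face, possibly not at
    \<open>y\<close>; a point \<open>x\<close> of the face inside the same ball serves as
    well.\<close>
  have "y \<in> closure {x\<in>F. \<exists>e>0. \<forall>t. 0 < t \<and> t < e \<longrightarrow> x - t *\<^sub>R n F \<in> T \<and> x + t *\<^sub>R n F \<notin> T}"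
    using outward[OF F] y(1) by (rule subsetD)
  from closure_approachableD[OF this e(1)]
  obtain x e' where x: "x \<in> F" "dist x y < e" "e' > 0"
    and out: "\<And>t. 0 < t \<Longrightarrow> t < e' \<Longrightarrow> x - t *\<^sub>R n F \<in> T \<and> x + t *\<^sub>R n F \<notin> T"
    by (auto simp: dist_commute)
  define t where "t = min (e' / 2) ((e - dist x y) / 2)"
  have t: "0 < t" "t < e'" "t < e - dist x y"
    using x by (auto simp: t_def min_def)
  have nx: "n F \<bullet> x = c F" "n F \<bullet> n F = 1"
    using face_hyperplane[OF F] x(1) closure_subset norm_n[OF F] by (auto simp: dot_square_norm)
  have "dist y (x - t *\<^sub>R n F) \<le> dist x y + t" "dist y (x + t *\<^sub>R n F) \<le> dist x y + t"
    using norm_triangle_ineq[of "y - x" "t *\<^sub>R n F"] norm_triangle_ineq4[of "y - x" "t *\<^sub>R n F"] t(1) norm_n[OF F]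
    by (auto simp: dist_norm norm_minus_commute algebra_simps)
  then have "x - t *\<^sub>R n F \<in> ?Bm" "x + t *\<^sub>R n F \<in> ?Bp"
    using t nx by (auto simp: inner_diff_right inner_add_right)
  then have "?Bm \<inter> T \<noteq> {}" "\<not> ?Bp \<subseteq> T"
    using out[OF t(1,2)] by blast+
  then have m: "?Bm \<subseteq> T" and "?Bp \<inter> T = {}"
    using connected_Int_frontier[OF cm, of T] connected_Int_frontier[OF cp, of T] fm fp by blast+
  moreover have "open ?Bp"
    by (intro open_Int open_ball open_halfspace_gt)
  ultimately have "?Bp \<inter> closure T = {}"
    using open_Int_closure_eq_empty by blast
  then show ?thesis
    using that[OF e(1)] m e2(2) e(3) by blast
qed

end

text \<open>\<open>visible\<close> puts \<open>p\<close> on the inner side of every face.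
  \<open>Z_cone\<close> expresses codimension two as seen from any point \<open>q\<close>: almost
  every ray from \<open>q\<close> misses \<open>Z\<close>.\<close>

locale star_cell = faced_cell +
  fixes p :: "real^'n"
  assumes p: "p \<in> T" and visible: "\<And>F. F \<in> \<F> \<Longrightarrow> n F \<bullet> p < c F"
    and Z_cone: "\<And>q. \<exists>M. finite M \<and> 0 \<notin> M \<and> Z \<subseteq> (\<Union>m\<in>M. {x. m \<bullet> (x - q) = 0})"
begin

text \<open>At the last time off \<open>T\<close> the segment would cross a face at a point
  \<open>y\<close> outside \<open>Z\<close>. As \<open>q\<close> is on the inner side of that face,
  the segment runs outwards there, so the points right after \<open>y\<close> are outside the
  closure; but after the last bad time they are in \<open>T\<close>.\<close>

lemma generic_star:
  assumes q: "q \<in> T" "\<And>F. F \<in> \<F> \<Longrightarrow> n F \<bullet> q < c F"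
    and M: "Z \<subseteq> (\<Union>m\<in>M. {x. m \<bullet> (x - q) = 0})" and x: "x \<in> T" "x \<notin> (\<Union>m\<in>M. {x. m \<bullet> (x - q) = 0})"
    and t: "0 \<le> t" "t \<le> 1"
  shows "q + t *\<^sub>R (x - q) \<in> T"
proof (rule ccontr)
  assume not: "q + t *\<^sub>R (x - q) \<notin> T"
  let ?f = "\<lambda>t. q + t *\<^sub>R (x - q)"
  define S where "S = {0..1} \<inter> ?f -` (- T)"
  have cf: "continuous_on A ?f" for A
    by (intro continuous_intros)
  have "closed S"
    unfolding S_def using T(1) by (intro continuous_closed_preimage cf) (auto simp: closed_Compl)
  then have "compact S"
    by (auto simp: compact_eq_bounded_closed S_def intro: bounded_subset[of "{0..1}"])
  moreover have "S \<noteq> {}"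
    using not t by (auto simp: S_def)
  ultimately obtain t1 where t1: "t1 \<in> S" "\<And>s. s \<in> S \<Longrightarrow> s \<le> t1"
    using compact_attains_sup[of S] by blast
  define y where "y = ?f t1"
  have "t1 \<noteq> 1" "t1 \<noteq> 0"
    using t1(1) x(1) q(1) by (auto simp: S_def)
  then have t01: "0 < t1" "t1 < 1"
    using t1(1) by (auto simp: S_def)
  have inT: "?f s \<in> T" if "t1 < s" "s \<le> 1" for s
    using t1(2)[of s] that t01 by (auto simp: S_def)
  have "y \<in> closure T"
    unfolding closure_approachable
  proof (intro allI impI)
    fix e :: real assume e: "e > 0"
    define s where "s = min (1 - t1) (e / (2 * (norm (x - q) + 1)))"
    have "0 < e / (2 * (norm (x - q) + 1))"
      using e by (simp add: add_nonneg_pos)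
    then have s: "0 < s" "s \<le> 1 - t1" "s \<le> e / (2 * (norm (x - q) + 1))"
      using t01 by (auto simp: s_def)
    have "s * norm (x - q) \<le> s * (norm (x - q) + 1)"
      using s by simp
    also have "\<dots> \<le> e / (2 * (norm (x - q) + 1)) * (norm (x - q) + 1)"
      using s(3) by (rule mult_right_mono) simp
    also have "\<dots> = e / 2"
      by (simp add: field_simps add_nonneg_eq_0_iff)
    finally have "s * norm (x - q) < e"
      using e by linarith
    moreover have "?f (t1 + s) - y = s *\<^sub>R (x - q)"
      by (simp add: y_def algebra_simps)
    ultimately have "dist (?f (t1 + s)) y < e"
      using s by (simp add: dist_norm)
    then show "\<exists>z\<in>T. dist z y < e"
      using inT[of "t1 + s"] s by auto
  qed
  moreover have "y \<notin> T"
    using t1(1) by (auto simp: S_def y_def)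
  ultimately have "y \<in> frontier T"
    by (simp add: frontier_T)
  then obtain F where F: "F \<in> \<F>" "y \<in> closure F"
    using front by blast
  have "y \<notin> Z"
  proof
    assume "y \<in> Z"
    then obtain m where m: "m \<in> M" "m \<bullet> (y - q) = 0"
      using M by blast
    then have "m \<bullet> (x - q) = 0"
      using t01 by (simp add: y_def)
    then show False
      using x(2) m(1) by blast
  qed
  then have yF: "y \<in> F"
    using closure_face[OF F(1)] F(2) by blast
  obtain e where e: "e > 0" "\<And>x. x \<in> ball y e \<Longrightarrow> n F \<bullet> x > c F \<Longrightarrow> x \<notin> closure T"
    by (rule half_ball[OF F(1) yF \<open>y \<notin> Z\<close>]) (rule that, assumption+)
  have ny: "n F \<bullet> y = c F"
    using face_hyperplane[OF F] .
  then have "t1 * (n F \<bullet> (x - q)) = c F - n F \<bullet> q"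
    by (simp add: y_def inner_add_right)
  then have nxq: "n F \<bullet> (x - q) > 0"
    using q(2)[OF F(1)] t01 by (metis diff_gt_0_iff_gt zero_less_mult_pos)
  define s where "s = min (1 - t1) (e / (2 * (norm (x - q) + 1)))"
  have "0 < e / (2 * (norm (x - q) + 1))"
    using e by (simp add: add_nonneg_pos)
  then have s: "0 < s" "s \<le> 1 - t1" "s \<le> e / (2 * (norm (x - q) + 1))"
    using t01 by (auto simp: s_def)
  have "s * norm (x - q) \<le> s * (norm (x - q) + 1)"
    using s by simp
  also have "\<dots> \<le> e / (2 * (norm (x - q) + 1)) * (norm (x - q) + 1)"
    using s(3) by (rule mult_right_mono) simp
  also have "\<dots> = e / 2"
    by (simp add: field_simps add_nonneg_eq_0_iff)
  finally have "s * norm (x - q) < e"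
    using e by linarith
  moreover have f: "?f (t1 + s) = y + s *\<^sub>R (x - q)"
    by (simp add: y_def algebra_simps)
  ultimately have "?f (t1 + s) \<in> ball y e"
    using s by (simp add: dist_norm)
  moreover have "n F \<bullet> ?f (t1 + s) > c F"
    unfolding f using ny nxq s by (simp add: inner_add_right)
  ultimately have "?f (t1 + s) \<notin> closure T"
    using e(2) by blast
  then show False
    using inT[of "t1 + s"] s closure_subset by auto
qed

text \<open>Radius of a ball in the kernel of the star-shaped cell. Any such radius will do; its
  reciprocal becomes a Lipschitz constant of the gauge.\<close>

definition kernel_radius :: real where
  "kernel_radius = (SOME \<delta>. \<delta> > 0 \<and> ball p \<delta> \<subseteq> T \<and> (\<forall>q\<in>ball p \<delta>. \<forall>F\<in>\<F>. n F \<bullet> q < c F))"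

lemma kernel_radius:
  "kernel_radius > 0" "ball p kernel_radius \<subseteq> T"
  "q \<in> ball p kernel_radius \<Longrightarrow> F \<in> \<F> \<Longrightarrow> n F \<bullet> q < c F"
proof -
  have op: "open (T \<inter> (\<Inter>F\<in>\<F>. {q. n F \<bullet> q < c F}))"
    using T fin by (intro open_Int open_INT ballI open_halfspace_lt) auto
  have pin: "p \<in> T \<inter> (\<Inter>F\<in>\<F>. {q. n F \<bullet> q < c F})"
    using p visible by blast
  obtain \<delta> where "\<delta> > 0" "ball p \<delta> \<subseteq> T \<inter> (\<Inter>F\<in>\<F>. {q. n F \<bullet> q < c F})"
    by (rule openE[OF op pin])
  then have "\<exists>\<delta>. \<delta> > 0 \<and> ball p \<delta> \<subseteq> T \<and> (\<forall>q\<in>ball p \<delta>. \<forall>F\<in>\<F>. n F \<bullet> q < c F)"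
    by (intro exI[of _ \<delta>]) blast
  then have "kernel_radius > 0 \<and> ball p kernel_radius \<subseteq> T \<and> (\<forall>q\<in>ball p kernel_radius. \<forall>F\<in>\<F>. n F \<bullet> q < c F)"
    unfolding kernel_radius_def by (rule someI_ex)
  then show "kernel_radius > 0" "ball p kernel_radius \<subseteq> T"
    "q \<in> ball p kernel_radius \<Longrightarrow> F \<in> \<F> \<Longrightarrow> n F \<bullet> q < c F"
    by blast+
qed

lemma negligible_hyperplanes:
  assumes "finite M" "0 \<notin> M"
  shows "negligible (\<Union>m\<in>M. {x. m \<bullet> (x - q) = 0})"
proof (rule negligible_Union)
  show "finite ((\<lambda>m. {x. m \<bullet> (x - q) = 0}) ` M)"
    using assms(1) by simp
  fix A assume "A \<in> (\<lambda>m. {x. m \<bullet> (x - q) = 0}) ` M"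
  then obtain m where m: "m \<in> M" "A = {x. m \<bullet> x = m \<bullet> q}"
    by (auto simp: inner_diff_right)
  then show "negligible A"
    using assms(2) by (auto intro!: negligible_hyperplane)
qed

text \<open>Generic end points are dense, so the dilated cell lies in the closure of
  \<open>T\<close>. Being open, it lies in the interior of the closure, which is \<open>T\<close>.
  The case \<open>t = 0\<close> is apart because the dilated cell is then a point.\<close>

lemma star:
  assumes q: "q \<in> ball p kernel_radius" and x: "x \<in> T" and t: "0 \<le> t" "t \<le> 1"
  shows "q + t *\<^sub>R (x - q) \<in> T"
proof (cases "t = 0")
  case True
  then show ?thesis using q kernel_radius(2) by auto
next
  case False
  obtain M where M: "finite M" "0 \<notin> M" "Z \<subseteq> (\<Union>m\<in>M. {x. m \<bullet> (x - q) = 0})"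
    using Z_cone by blast
  have qT: "q \<in> T"
    using q kernel_radius(2) by blast
  have "(\<lambda>x. (q - t *\<^sub>R q) + t *\<^sub>R x) ` T \<subseteq> closure T"
  proof
    fix z assume "z \<in> (\<lambda>x. (q - t *\<^sub>R q) + t *\<^sub>R x) ` T"
    then obtain x where xz: "x \<in> T" "z = q + t *\<^sub>R (x - q)"
      by (auto simp: algebra_simps)
    show "z \<in> closure T"
      unfolding closure_approachable
    proof (intro allI impI)
      fix e :: real assume e: "e > 0"
      have "open (T \<inter> ball x e)" "T \<inter> ball x e \<noteq> {}"
        using T(1) xz(1) e by (auto simp: disjoint_iff)
      then have "\<not> negligible (T \<inter> ball x e)"
        by (intro open_not_negligible)
      then obtain x' where x': "x' \<in> T" "x' \<in> ball x e" "x' \<notin> (\<Union>m\<in>M. {x. m \<bullet> (x - q) = 0})"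
        using negligible_subset[OF negligible_hyperplanes[OF M(1,2)]] by blast
      have "q + t *\<^sub>R (x' - q) \<in> T"
        by (rule generic_star[OF qT kernel_radius(3)[OF q] M(3) x'(1,3) t])
      moreover have "dist (q + t *\<^sub>R (x' - q)) z < e"
      proof -
        have "dist (q + t *\<^sub>R (x' - q)) z = t * dist x' x"
          using t by (simp add: xz(2) dist_norm scaleR_diff_right[symmetric])
        also have "\<dots> \<le> 1 * dist x' x"
          using t by (intro mult_right_mono) auto
        finally show ?thesis
          using x'(2) by (simp add: dist_commute)
      qed
      ultimately show "\<exists>w\<in>T. dist w z < e"
        by blast
    qed
  qed
  moreover have "open ((\<lambda>x. (q - t *\<^sub>R q) + t *\<^sub>R x) ` T)"
    using T(1) False by (intro open_affinity)
  ultimately have "(\<lambda>x. (q - t *\<^sub>R q) + t *\<^sub>R x) ` T \<subseteq> T"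
    using T(3) interior_maximal by blast
  then have "(q - t *\<^sub>R q) + t *\<^sub>R x \<in> T"
    using x by blast
  moreover have "q + t *\<^sub>R (x - q) = (q - t *\<^sub>R q) + t *\<^sub>R x"
    by (simp add: algebra_simps)
  ultimately show ?thesis
    by (simp only:)
qed

lemma closure_star:
  assumes y: "y \<in> closure T" and t: "0 \<le> t" "t < 1"
  shows "p + t *\<^sub>R (y - p) \<in> T"
proof -
  have "kernel_radius * (1 - t) > 0"
    using kernel_radius(1) t by simp
  then obtain x where x: "x \<in> T" "dist x y < kernel_radius * (1 - t)"
    using y unfolding closure_approachable by blast
  \<comment> \<open>The error in replacing \<open>y\<close> by \<open>x\<close> is absorbed by
    moving the apex: \<open>q\<close> stays in the kernel ball and the point in question is
    unchanged.\<close>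
  define q where "q = p + (t / (1 - t)) *\<^sub>R (y - x)"
  have "norm (y - x) < kernel_radius * (1 - t)"
    using x(2) by (simp add: dist_norm norm_minus_commute)
  have "norm ((t / (1 - t)) *\<^sub>R (y - x)) = t * norm (y - x) / (1 - t)"
    using t by simp
  also have "\<dots> \<le> 1 * norm (y - x) / (1 - t)"
    using t by (intro divide_right_mono mult_right_mono) auto
  also have "\<dots> < kernel_radius"
    using \<open>norm (y - x) < _\<close> t by (simp add: divide_less_eq)
  finally have "q \<in> ball p kernel_radius"
    by (simp add: q_def dist_norm)
  from star[OF this x(1), of t] t have "q + t *\<^sub>R (x - q) \<in> T"
    by simp
  moreover have "q + t *\<^sub>R (x - q) = p + t *\<^sub>R (y - p)"
  proof -
    have "q + t *\<^sub>R (x - q) = (1 - t) *\<^sub>R q + t *\<^sub>R x"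
      by (simp add: algebra_simps)
    also have "(1 - t) *\<^sub>R q = (1 - t) *\<^sub>R p + t *\<^sub>R (y - x)"
      using t by (simp add: q_def scaleR_add_right)
    finally show ?thesis
      by (simp add: algebra_simps)
  qed
  ultimately show ?thesis by simp
qed

section \<open>Decomposition of a cell into pyramids\<close>

lemma p_ball: "p \<in> ball p kernel_radius"
  using kernel_radius(1) by simp

lemma face_closure: "F \<in> \<F> \<Longrightarrow> y \<in> F \<Longrightarrow> y \<in> closure T" "F \<in> \<F> \<Longrightarrow> y \<in> F \<Longrightarrow> y \<notin> T"
  using face_front frontier_T by blast+

lemma pyramid_subset: "F \<in> \<F> \<Longrightarrow> pyramid p F \<subseteq> T"
  unfolding pyramid_def using closure_star face_closure by auto

text \<open>If a ray from \<open>p\<close> met two faces at different points, the nearer one would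
  lie in the open cell by \<open>closure_star\<close>; at the same point, the faces would not be
  disjoint. The common apex is excluded from the pyramids.\<close>

lemma pyramid_disjoint:
  assumes "F \<in> \<F>" "F' \<in> \<F>" "F \<noteq> F'"
  shows "pyramid p F \<inter> pyramid p F' = {}"
proof -
  have False if "F \<in> \<F>" "F' \<in> \<F>" "F \<noteq> F'" "y \<in> F" "y' \<in> F'" "0 < r" "r \<le> r'"
    "p + r *\<^sub>R (y - p) = p + r' *\<^sub>R (y' - p)" for F F' y y' r r'
  proof -
    have "y' = p + (r / r') *\<^sub>R (y - p)"
    proof -
      have "(r / r') *\<^sub>R (y - p) = (1 / r') *\<^sub>R (r *\<^sub>R (y - p))" by simp
      also have "\<dots> = y' - p" using that by simp
      finally show ?thesis by simp
    qed
    show False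
    proof (cases "r = r'")
      case True
      then have "y' = y"
        using \<open>y' = _\<close> that by simp
      then show False
        using that disj by (auto simp: pairwise_def disjnt_def)
    next
      case False
      then have "y' \<in> T"
        using closure_star[OF face_closure(1)[OF that(1,4)], of "r / r'"] that \<open>y' = _\<close> by simp
      then show False
        using face_closure(2) that by blast
    qed
  qed
  note * = this
  show ?thesis
  proof (rule ccontr)
    assume "pyramid p F \<inter> pyramid p F' \<noteq> {}"
    then obtain r y r' y' where "0 < r" "0 < r'" "y \<in> F" "y' \<in> F'" "p + r *\<^sub>R (y - p) = p + r' *\<^sub>R (y' - p)"
      unfolding pyramid_def by blast
    then show False
      using *[OF assms, of y y' r r'] *[OF assms(2,1) assms(3)[symmetric], of y' y r' r]
      by (metis linear)
  qed
qed

text \<open>Follow the ray from \<open>p\<close> through \<open>x\<close> to its last point in the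
  closure. Unless the ray lies in one of finitely many hyperplanes, this point is off
  \<open>Z\<close>, hence in a face, and \<open>x\<close> is in the pyramid over it.\<close>

lemma negligible_outside_pyramids: "negligible (T - (\<Union>F\<in>\<F>. pyramid p F))"
proof -
  obtain M where M: "finite M" "0 \<notin> M" "Z \<subseteq> (\<Union>m\<in>M. {x. m \<bullet> (x - p) = 0})"
    using Z_cone by blast
  have "T - (\<Union>F\<in>\<F>. pyramid p F) \<subseteq> insert p (\<Union>m\<in>M. {x. m \<bullet> (x - p) = 0})"
  proof
    fix x assume x: "x \<in> T - (\<Union>F\<in>\<F>. pyramid p F)"
    show "x \<in> insert p (\<Union>m\<in>M. {x. m \<bullet> (x - p) = 0})"
    proof (rule ccontr)
      assume n: "x \<notin> insert p (\<Union>m\<in>M. {x. m \<bullet> (x - p) = 0})"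
      then have xp: "norm (x - p) > 0" by simp
      let ?f = "\<lambda>t. p + t *\<^sub>R (x - p)"
      define S where "S = {1..} \<inter> ?f -` closure T"
      have cf: "continuous_on A ?f" for A
        by (intro continuous_intros)
      have "closed S"
        unfolding S_def by (intro continuous_closed_preimage cf) auto
      moreover have "bounded S"
      proof -
        obtain B where B: "\<And>y. y \<in> closure T \<Longrightarrow> norm (y - p) \<le> B"
        proof -
          have "bounded ((\<lambda>y. y - p) ` closure T)"
            using T(2) by (simp add: bounded_closure bounded_translation_minus)
          then show ?thesis
            using that unfolding bounded_iff by (metis imageI)
        qed
        have "\<bar>t\<bar> \<le> B / norm (x - p)" if "t \<in> S" for t
          using B[of "?f t"] that xp by (simp add: S_def pos_le_divide_eq)
        then show ?thesis
          unfolding bounded_iff by auto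
      qed
      moreover have "1 \<in> S"
        using x closure_subset by (auto simp: S_def)
      ultimately obtain t where t: "t \<in> S" "\<And>s. s \<in> S \<Longrightarrow> s \<le> t"
        using compact_attains_sup[of S] by (auto simp: compact_eq_bounded_closed)
      have t1: "t \<ge> 1" using t(1) by (simp add: S_def)
      define y where "y = ?f t"
      have "y \<notin> T"
      proof
        assume "y \<in> T"
        then obtain e where e: "e > 0" "ball y e \<subseteq> T"
          using T(1) open_contains_ball by blast
        define s where "s = e / (2 * norm (x - p))"
        have s: "s > 0" "s * norm (x - p) < e"
          using e xp by (auto simp: s_def)
        have "?f (t + s) = y + s *\<^sub>R (x - p)"
          by (simp add: y_def algebra_simps)
        then have "?f (t + s) \<in> ball y e"
          using s by (simp add: dist_norm)
        then have "?f (t + s) \<in> closure T"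
          using e(2) closure_subset by blast
        then have "t + s \<in> S"
          using s(1) t1 by (simp add: S_def)
        then show False
          using t(2)[of "t + s"] s(1) by simp
      qed
      moreover have "y \<in> closure T"
        using t(1) by (simp add: S_def y_def)
      ultimately have "y \<in> frontier T"
        by (simp add: frontier_T)
      then obtain F where F: "F \<in> \<F>" "y \<in> closure F"
        using front by blast
      have "y \<notin> Z"
      proof
        assume "y \<in> Z"
        then obtain m where m: "m \<in> M" "m \<bullet> (y - p) = 0"
          using M(3) by blast
        then have "m \<bullet> (x - p) = 0"
          using t1 by (simp add: y_def)
        then show False
          using n m(1) by blast
      qed
      then have yF: "y \<in> F"
        using closure_face[OF F(1)] F(2) by blast
      have "t \<noteq> 1"
        using \<open>y \<notin> T\<close> x by (auto simp: y_def)
      then have "x = p + (1 / t) *\<^sub>R (y - p)" "0 < 1 / t" "1 / t < 1"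
        using t1 by (auto simp: y_def)
      then have "x \<in> pyramid p F"
        unfolding pyramid_def using yF by blast
      then show False
        using x F(1) by blast
    qed
  qed
  moreover have "negligible (insert p (\<Union>m\<in>M. {x. m \<bullet> (x - p) = 0}))"
    using negligible_hyperplanes[OF M(1,2)] by simp
  ultimately show ?thesis
    using negligible_subset by blast
qed

subsection \<open>The gauge of a cell\<close>

definition gauge :: "real^'n \<Rightarrow> real" where
  "gauge x = Inf {s. s > 0 \<and> p + (1 / s) *\<^sub>R (x - p) \<in> T}"

lemma gauge_nonempty: "\<exists>s. s > 0 \<and> p + (1 / s) *\<^sub>R (x - p) \<in> T"
proof -
  define s where "s = (norm (x - p) + 1) / kernel_radius"
  have s: "s > 0"
    using kernel_radius(1) by (simp add: s_def add_nonneg_pos)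
  have "norm (x - p) < s * kernel_radius"
    using kernel_radius(1) by (simp add: s_def)
  then have "norm ((1 / s) *\<^sub>R (x - p)) < kernel_radius"
    using s by (simp add: divide_less_eq mult.commute)
  then have "p + (1 / s) *\<^sub>R (x - p) \<in> ball p kernel_radius"
    by (simp add: dist_norm)
  then show ?thesis
    using s kernel_radius(2) by blast
qed

lemma gauge_bdd: "bdd_below {s. s > 0 \<and> p + (1 / s) *\<^sub>R (x - p) \<in> T}"
  by (intro bdd_belowI[of _ 0]) auto

lemma gauge_le: "s > 0 \<Longrightarrow> p + (1 / s) *\<^sub>R (x - p) \<in> T \<Longrightarrow> gauge x \<le> s"
  unfolding gauge_def by (rule cInf_lower[OF _ gauge_bdd]) simp

lemma gauge_less_iff: "gauge x < a \<longleftrightarrow> (\<exists>s. 0 < s \<and> s < a \<and> p + (1 / s) *\<^sub>R (x - p) \<in> T)"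
  unfolding gauge_def using gauge_nonempty by (subst cInf_less_iff[OF _ gauge_bdd]) auto

text \<open>Star-shapedness with respect to a ball replaces the convexity that usually makes a gauge
  subadditive: the point belonging to \<open>z\<close> and \<open>s + \<eta>\<close> lies on a
  segment from the kernel ball to the point belonging to \<open>x\<close> and
  \<open>s\<close>.\<close>

lemma gauge_diff_le: "gauge z \<le> gauge x + norm (z - x) / kernel_radius"
proof -
  have 1: "gauge z \<le> s + \<eta>" if s: "s > 0" "p + (1 / s) *\<^sub>R (x - p) \<in> T" and \<eta>: "\<eta> > norm (z - x) / kernel_radius" for s \<eta>
  proof (rule gauge_le)
    have "0 \<le> norm (z - x) / kernel_radius"
      using kernel_radius(1) by simp
    then have \<eta>0: "\<eta> > 0"
      using \<eta> by linarith
    then show "s + \<eta> > 0"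
      using s by simp
    define q where "q = p + (1 / \<eta>) *\<^sub>R (z - x)"
    have "norm (z - x) < \<eta> * kernel_radius"
      using \<eta> kernel_radius(1) by (simp add: divide_less_eq)
    then have "norm ((1 / \<eta>) *\<^sub>R (z - x)) < kernel_radius"
      using \<eta>0 by (simp add: divide_less_eq mult.commute)
    then have q: "q \<in> ball p kernel_radius"
      by (simp add: q_def dist_norm)
    have "q + (s / (s + \<eta>)) *\<^sub>R (p + (1 / s) *\<^sub>R (x - p) - q) \<in> T"
      by (rule star[OF q s(2)]) (use s \<eta>0 in auto)
    also have "q + (s / (s + \<eta>)) *\<^sub>R (p + (1 / s) *\<^sub>R (x - p) - q) = p + (1 / (s + \<eta>)) *\<^sub>R (z - p)"
    proof -
      have a: "s / (s + \<eta>) = 1 - \<eta> / (s + \<eta>)"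
        using s \<eta>0 by (simp add: field_simps)
      have "q + (s / (s + \<eta>)) *\<^sub>R (p + (1 / s) *\<^sub>R (x - p) - q) =
          p + (1 - s / (s + \<eta>)) *\<^sub>R (q - p) + (s / (s + \<eta>)) *\<^sub>R ((1 / s) *\<^sub>R (x - p))"
        by (simp add: algebra_simps)
      also have "(1 - s / (s + \<eta>)) *\<^sub>R (q - p) = (1 / (s + \<eta>)) *\<^sub>R (z - x)"
        unfolding a using \<eta>0 by (simp add: q_def)
      also have "(s / (s + \<eta>)) *\<^sub>R ((1 / s) *\<^sub>R (x - p)) = (1 / (s + \<eta>)) *\<^sub>R (x - p)"
        using s by simp
      finally show ?thesis
        by (simp add: algebra_simps)
    qed
    finally show "p + (1 / (s + \<eta>)) *\<^sub>R (z - p) \<in> T" .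
  qed
  have 2: "gauge z \<le> gauge x + \<eta>" if \<eta>: "\<eta> > norm (z - x) / kernel_radius" for \<eta>
  proof -
    have "gauge z - \<eta> \<le> gauge x"
      unfolding gauge_def[of x]
      by (rule cInf_greatest) (use gauge_nonempty 1[OF _ _ \<eta>] in \<open>force+\<close>)
    then show ?thesis by simp
  qed
  show ?thesis
  proof (rule field_le_epsilon)
    fix e :: real assume "e > 0"
    then show "gauge z \<le> gauge x + norm (z - x) / kernel_radius + e"
      using 2[of "norm (z - x) / kernel_radius + e"] by simp
  qed
qed

lemma gauge_lipschitz: "\<bar>gauge x - gauge y\<bar> \<le> 1 / kernel_radius * norm (x - y)"
  using gauge_diff_le[of x y] gauge_diff_le[of y x] by (simp add: norm_minus_commute abs_le_iff)

text \<open>Ties the gauge to the geometry: inside a pyramid it coincides with an affine function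
  whose gradient is normal to the face.\<close>

lemma gauge_cone:
  assumes F: "F \<in> \<F>" "y \<in> F" and r: "r > 0"
  shows "gauge (p + r *\<^sub>R (y - p)) = r"
proof -
  have "{s. s > 0 \<and> p + (1 / s) *\<^sub>R (p + r *\<^sub>R (y - p) - p) \<in> T} = {r<..}"
  proof (intro set_eqI iffI)
    fix s assume s: "s \<in> {r<..}"
    have "p + (r / s) *\<^sub>R (y - p) \<in> T"
      by (rule closure_star[OF face_closure(1)[OF F]]) (use s r in auto)
    then show "s \<in> {s. s > 0 \<and> p + (1 / s) *\<^sub>R (p + r *\<^sub>R (y - p) - p) \<in> T}"
      using s r by simp
  next
    fix s assume "s \<in> {s. s > 0 \<and> p + (1 / s) *\<^sub>R (p + r *\<^sub>R (y - p) - p) \<in> T}"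
    then have s: "s > 0" "p + (r / s) *\<^sub>R (y - p) \<in> T"
      by simp_all
    show "s \<in> {r<..}"
    proof (rule ccontr)
      assume "s \<notin> {r<..}"
      then have "p + (s / r) *\<^sub>R (p + (r / s) *\<^sub>R (y - p) - p) \<in> T"
        using s(1) r by (intro star[OF p_ball s(2)]) auto
      moreover have "p + (s / r) *\<^sub>R (p + (r / s) *\<^sub>R (y - p) - p) = y"
        using s(1) r by simp
      ultimately have "y \<in> T"
        by (simp only:)
      then show False
        using face_closure(2)[OF F] by blast
    qed
  qed
  then show ?thesis
    by (simp add: gauge_def)
qed

lemma gauge_less_1: "x \<in> T \<Longrightarrow> gauge x < 1"
proof -
  assume "x \<in> T"
  then obtain e where e: "e > 0" "ball x e \<subseteq> T"
    using T(1) open_contains_ball by blast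
  define k where "k = e / (2 * (norm (x - p) + 1))"
  have k: "k > 0"
    using e by (simp add: k_def add_nonneg_pos)
  define s where "s = 1 / (1 + k)"
  have s: "0 < s" "s < 1" "1 / s = 1 + k"
    using k by (auto simp: s_def)
  have "k * norm (x - p) \<le> k * (norm (x - p) + 1)"
    using k by (intro mult_left_mono) auto
  also have "\<dots> = e / 2"
    by (simp add: k_def field_simps add_nonneg_eq_0_iff)
  finally have "norm (k *\<^sub>R (x - p)) < e"
    using e k by simp
  moreover have "p + (1 / s) *\<^sub>R (x - p) = x + k *\<^sub>R (x - p)"
    unfolding s(3) by (simp add: scaleR_add_left)
  ultimately have "p + (1 / s) *\<^sub>R (x - p) \<in> ball x e"
    by (simp add: dist_norm)
  then have "p + (1 / s) *\<^sub>R (x - p) \<in> T"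
    using e(2) by blast
  then show "gauge x < 1"
    unfolding gauge_less_iff using s(1,2) by blast
qed

text \<open>Provides the compact support inside \<open>T\<close> that integration by parts requires
  of the cutoffs.\<close>

lemma gauge_sublevel:
  assumes "0 < a" "a < 1"
  shows "compact ((\<lambda>y. p + a *\<^sub>R (y - p)) ` closure T)" "(\<lambda>y. p + a *\<^sub>R (y - p)) ` closure T \<subseteq> T"
    "gauge x < a \<Longrightarrow> x \<in> (\<lambda>y. p + a *\<^sub>R (y - p)) ` closure T"
proof -
  show "compact ((\<lambda>y. p + a *\<^sub>R (y - p)) ` closure T)"
    using T(2) by (intro compact_continuous_image continuous_intros) (auto simp: compact_closure)
  show "(\<lambda>y. p + a *\<^sub>R (y - p)) ` closure T \<subseteq> T"
    using closure_star assms by auto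
  assume "gauge x < a"
  then obtain s where s: "0 < s" "s < a" "p + (1 / s) *\<^sub>R (x - p) \<in> T"
    by (auto simp: gauge_less_iff)
  have "p + (s / a) *\<^sub>R (p + (1 / s) *\<^sub>R (x - p) - p) \<in> T"
    by (rule star[OF p_ball s(3)]) (use s in auto)
  then have "p + (1 / a) *\<^sub>R (x - p) \<in> closure T"
    using s closure_subset by auto
  moreover have "x = p + a *\<^sub>R (p + (1 / a) *\<^sub>R (x - p) - p)"
    using assms by simp
  ultimately show "x \<in> (\<lambda>y. p + a *\<^sub>R (y - p)) ` closure T"
    by blast
qed

end

section \<open>The divergence theorem on a cell\<close>

text \<open>A combination of two difference quotients of \<open>(1 - t) ^ D\<close> at 0, with steps
  \<open>1 / real k\<close> and \<open>2 / real k\<close>; the limit is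
  \<open>(2 * D - D) / D\<close>.\<close>

lemma shell_factor_tendsto:
  assumes "0 < D"
  shows "(\<lambda>k. real k * ((1 - 1 / real k) ^ D - (1 - 2 / real k) ^ D) / D) \<longlonglongrightarrow> 1"
proof -
  have "((\<lambda>t. (1 - t) ^ D) has_real_derivative - real D) (at 0)"
    by (auto intro!: derivative_eq_intros)
  then have d: "((\<lambda>t. ((1 - t) ^ D - 1) / t) \<longlongrightarrow> - real D) (at 0)"
    by (simp add: DERIV_def)
  have l: "filterlim (\<lambda>k. m / real k) (at 0) sequentially" if "m \<noteq> 0" for m :: real
    unfolding filterlim_at
    using that eventually_gt_at_top[of 0] by (auto intro!: lim_const_over_n elim!: eventually_mono)
  have "(\<lambda>k. 1 * (((1 - 1 / real k) ^ D - 1) / (1 / real k)) - 2 * (((1 - 2 / real k) ^ D - 1) / (2 / real k)))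
      \<longlonglongrightarrow> 1 * (- real D) - 2 * (- real D)"
    by (intro tendsto_intros filterlim_compose[OF d l]) auto
  then have "(\<lambda>k. (1 * (((1 - 1 / real k) ^ D - 1) / (1 / real k)) - 2 * (((1 - 2 / real k) ^ D - 1) / (2 / real k))) / D)
      \<longlonglongrightarrow> (1 * (- real D) - 2 * (- real D)) / D"
    using assms by (intro tendsto_divide tendsto_const) auto
  moreover have "(1 * (- real D) - 2 * (- real D)) / D = 1"
    using assms by simp
  moreover have "1 * ((a - 1) / (1 / real k)) - 2 * ((b - 1) / (2 / real k)) = real k * (a - b)" for k and a b :: real
    by (cases "k = 0") (simp_all add: field_simps)
  ultimately show ?thesis
    by (simp only:)
qed

lemma cone_height_has_derivative:
  "(cone_height p n c has_derivative (\<lambda>h. (1 / (c - n \<bullet> p)) *\<^sub>R n \<bullet> h)) (at x)"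
proof -
  have "((\<lambda>x. (1 / (c - n \<bullet> p)) * (n \<bullet> (x - p))) has_derivative (\<lambda>h. (1 / (c - n \<bullet> p)) * (n \<bullet> (h - 0)))) (at x)"
    by (intro has_derivative_mult_right has_derivative_inner_right has_derivative_diff has_derivative_ident has_derivative_const)
  then show ?thesis
    by (simp add: cone_height_def[abs_def])
qed

lemma continuous_on_cone_height: "continuous_on A (cone_height p n c)"
  unfolding cone_height_def[abs_def] by (cases "c - n \<bullet> p = 0") (auto intro!: continuous_intros)

lemma open_pyramid:
  assumes F: "flat_face n c F" and p: "n \<bullet> p < c"
  shows "open (pyramid p F)"
proof -
  obtain U where U: "open U" "F = {x. n \<bullet> x = c} \<inter> U"
    using F unfolding flat_face_def openin_open by blast
  let ?P = "{x. 0 < cone_height p n c x} \<inter> {x. cone_height p n c x < 1}"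
  have o: "open ?P"
    by (intro open_Int open_Collect_less continuous_on_cone_height continuous_on_const)
  have "continuous_on ?P (cone_base p n c)"
    unfolding cone_base_def[abs_def]
    by (intro continuous_intros continuous_on_cone_height) auto
  then have "open (?P \<inter> cone_base p n c -` U)"
    using o U(1) by (rule continuous_open_preimage)
  moreover have "pyramid p F = ?P \<inter> cone_base p n c -` U"
  proof -
    have "n \<bullet> cone_base p n c x = c" if "0 < cone_height p n c x" for x
    proof -
      have "n \<bullet> (x - p) = cone_height p n c x * (c - n \<bullet> p)"
        using p by (simp add: cone_height_def)
      then show ?thesis
        using that by (simp add: cone_base_def inner_add_right)
    qed
    then show ?thesis
      using pyramid_iff[OF p flat_faceD(4)[OF F]] U(2) by auto
  qed
  ultimately show ?thesis
    by simp
qed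

section \<open>Cutoffs that concentrate along the faces\<close>

context star_cell
begin

definition height :: "(real^'n) set \<Rightarrow> real^'n \<Rightarrow> real" where
  "height F = cone_height p (n F) (c F)"

definition base :: "(real^'n) set \<Rightarrow> real^'n \<Rightarrow> real^'n" where
  "base F = cone_base p (n F) (c F)"

definition cdist :: "(real^'n) set \<Rightarrow> real" where
  "cdist F = c F - n F \<bullet> p"

lemma cdist_pos: "F \<in> \<F> \<Longrightarrow> cdist F > 0"
  using visible by (simp add: cdist_def)

text \<open>The part of a pyramid in which \<open>cutoff k\<close> descends from 1 to 0. It ends at
  height \<open>1 - 1 / real k\<close> rather than at 1, so that the cutoff has compact support in
  the open cell.\<close>

definition shell :: "nat \<Rightarrow> (real^'n) set \<Rightarrow> (real^'n) set" where
  "shell k F = pyramid p F \<inter> {x. 1 - 2 / real k \<le> height F x \<and> height F x \<le> 1 - 1 / real k}"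

text \<open>The gradient of this cutoff lives on shells along the faces. Integrating by parts against it
  and letting \<open>k\<close> tend to infinity gives the divergence theorem without any regularity theory
  for the boundary of the cell.\<close>

definition cutoff :: "nat \<Rightarrow> real^'n \<Rightarrow> real" where
  "cutoff k x = min 1 (max 0 (real k * (1 - gauge x) - 1))"

text \<open>At most one term is nonzero, the pyramids being disjoint. Written as a sum, the field is
  evidently Borel measurable, which is less clear for a derivative taken pointwise.\<close>

definition cutoff_grad :: "nat \<Rightarrow> real^'n \<Rightarrow> real^'n" where
  "cutoff_grad k x = (\<Sum>F\<in>\<F>. (indicator (shell k F) x * (- real k / cdist F)) *\<^sub>R n F)"

lemma pyramid_coordinates:
  assumes F: "F \<in> \<F>" and x: "x \<in> pyramid p F"
  shows "base F x \<in> F" "0 < height F x" "height F x < 1" "x = p + height F x *\<^sub>R (base F x - p)" "gauge x = height F x"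
proof -
  obtain r y where ry: "0 < r" "r < 1" "y \<in> F" "x = p + r *\<^sub>R (y - p)"
    using x by (auto simp: pyramid_def)
  have "n F \<bullet> y = c F"
    using face_hyperplane[OF F] ry(3) closure_subset by blast
  then have *: "height F x = r" "base F x = y"
    using cone_coordinates[OF visible[OF F], of y r] ry by (auto simp: height_def base_def)
  show "base F x \<in> F" "0 < height F x" "height F x < 1" "x = p + height F x *\<^sub>R (base F x - p)"
    using * ry by simp_all
  show "gauge x = height F x"
    using gauge_cone[OF F ry(3,1)] * ry by simp
qed

lemma shell_sets: "F \<in> \<F> \<Longrightarrow> shell k F \<in> sets borel"
proof -
  assume F: "F \<in> \<F>"
  have [measurable]: "pyramid p F \<in> sets borel"
    using pyramid_sets[OF visible[OF F] flat_faceD(4,5)[OF flat[OF F]]] .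
  have [measurable]: "height F \<in> borel_measurable borel"
    unfolding height_def by measurable
  show "shell k F \<in> sets borel"
    unfolding shell_def by measurable
qed

lemma shell_subset: "F \<in> \<F> \<Longrightarrow> shell k F \<subseteq> T"
  using pyramid_subset by (auto simp: shell_def)

lemma cutoff_bounds: "0 \<le> cutoff k x" "cutoff k x \<le> 1"
  by (auto simp: cutoff_def)

lemma cutoff_lipschitz: "\<bar>cutoff k x - cutoff k y\<bar> \<le> real k / kernel_radius * norm (x - y)"
proof -
  have "\<bar>cutoff k x - cutoff k y\<bar> \<le> \<bar>real k * (1 - gauge x) - real k * (1 - gauge y)\<bar>"
    by (auto simp: cutoff_def min_def max_def abs_if)
  also have "\<dots> = real k * \<bar>gauge x - gauge y\<bar>"
    by (simp add: right_diff_distrib[symmetric] abs_mult abs_minus_commute)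
  also have "\<dots> \<le> real k * (1 / kernel_radius * norm (x - y))"
    by (intro mult_left_mono gauge_lipschitz) simp
  finally show ?thesis by simp
qed

lemma cutoff_grad_pyramid:
  assumes F: "F \<in> \<F>" and x: "x \<in> pyramid p F"
  shows "cutoff_grad k x = (indicator (shell k F) x * (- real k / cdist F)) *\<^sub>R n F"
proof -
  have "indicator (shell k F') x = (0::real)" if "F' \<in> \<F> - {F}" for F'
  proof -
    have "x \<notin> pyramid p F'"
      using pyramid_disjoint[OF F, of F'] that x by blast
    then show ?thesis
      by (simp add: shell_def)
  qed
  then have "(\<Sum>F'\<in>\<F> - {F}. (indicator (shell k F') x * (- real k / cdist F')) *\<^sub>R n F') = 0"
    by (intro sum.neutral) simp
  then show ?thesis
    unfolding cutoff_grad_def using sum.remove[OF fin F, of "\<lambda>F. (indicator (shell k F) x * (- real k / cdist F)) *\<^sub>R n F"]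
    by simp
qed

text \<open>The two excluded heights are the kinks of the cutoff; together with the complement of
  the pyramids in \<open>T\<close> they form a null set.\<close>

lemma cutoff_has_derivative:
  assumes k: "k \<ge> 3" and F: "F \<in> \<F>" and x: "x \<in> pyramid p F"
    "height F x \<noteq> 1 - 2 / real k" "height F x \<noteq> 1 - 1 / real k"
  shows "(cutoff k has_derivative (\<lambda>h. cutoff_grad k x \<bullet> h)) (at x)"
proof -
  have k0: "real k > 0" using k by simp
  have ch: "continuous_on A (height F)" for A
    unfolding height_def by (rule continuous_on_cone_height)
  have op: "open (pyramid p F)"
    using open_pyramid[OF flat[OF F] visible[OF F]] .
  have eq: "cutoff k z = min 1 (max 0 (real k * (1 - height F z) - 1))" if "z \<in> pyramid p F" for z
    using pyramid_coordinates(5)[OF F that] by (simp add: cutoff_def)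
  consider "height F x < 1 - 2 / real k" | "1 - 2 / real k < height F x" "height F x < 1 - 1 / real k"
    | "1 - 1 / real k < height F x"
    using x(2,3) by linarith
  then show ?thesis
  proof cases
    case 1
    have "\<not> x \<in> shell k F"
      using 1 by (simp add: shell_def)
    then have g: "cutoff_grad k x = 0"
      by (simp add: cutoff_grad_pyramid[OF F x(1)])
    have o: "open (pyramid p F \<inter> {x. height F x < 1 - 2 / real k})"
      using op by (intro open_Int open_Collect_less ch continuous_on_const)
    have "((\<lambda>x. 1) has_derivative (\<lambda>h. cutoff_grad k x \<bullet> h)) (at x)"
      by (simp add: g)
    then show ?thesis
    proof (rule has_derivative_transform_within_open[OF _ o])
      fix z assume z: "z \<in> pyramid p F \<inter> {x. height F x < 1 - 2 / real k}"
      then have "real k * (1 - height F z) > 2"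
        using k0 by (auto simp: field_simps)
      then show "1 = cutoff k z"
        using eq[of z] z by simp
    qed (use 1 x in auto)
  next
    case 2
    have "x \<in> shell k F"
      using 2 x by (simp add: shell_def)
    then have g: "cutoff_grad k x = (- real k / cdist F) *\<^sub>R n F"
      by (simp add: cutoff_grad_pyramid[OF F x(1)])
    have o: "open (pyramid p F \<inter> ({x. 1 - 2 / real k < height F x} \<inter> {x. height F x < 1 - 1 / real k}))"
      using op by (intro open_Int open_Collect_less ch continuous_on_const)
    have "((\<lambda>x. real k * (1 - height F x) - 1) has_derivative
        (\<lambda>h. real k * (0 - (1 / cdist F) *\<^sub>R n F \<bullet> h) - 0)) (at x)"
      unfolding height_def cdist_def
      by (intro has_derivative_diff has_derivative_mult_right has_derivative_const cone_height_has_derivative)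
    moreover have "(\<lambda>h. real k * (0 - (1 / cdist F) *\<^sub>R n F \<bullet> h) - 0) = (\<lambda>h. cutoff_grad k x \<bullet> h)"
      by (auto simp: g)
    ultimately have "((\<lambda>x. real k * (1 - height F x) - 1) has_derivative (\<lambda>h. cutoff_grad k x \<bullet> h)) (at x)"
      by simp
    then show ?thesis
    proof (rule has_derivative_transform_within_open[OF _ o])
      fix z assume z: "z \<in> pyramid p F \<inter> ({x. 1 - 2 / real k < height F x} \<inter> {x. height F x < 1 - 1 / real k})"
      then have "1 < real k * (1 - height F z)" "real k * (1 - height F z) < 2"
        using k0 by (auto simp: field_simps)
      then show "real k * (1 - height F z) - 1 = cutoff k z"
        using eq[of z] z by simp
    qed (use 2 x in auto)
  next
    case 3
    have "\<not> x \<in> shell k F"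
      using 3 by (simp add: shell_def)
    then have g: "cutoff_grad k x = 0"
      by (simp add: cutoff_grad_pyramid[OF F x(1)])
    have o: "open (pyramid p F \<inter> {x. 1 - 1 / real k < height F x})"
      using op by (intro open_Int open_Collect_less ch continuous_on_const)
    have "((\<lambda>x. 0) has_derivative (\<lambda>h. cutoff_grad k x \<bullet> h)) (at x)"
      by (simp add: g)
    then show ?thesis
    proof (rule has_derivative_transform_within_open[OF _ o])
      fix z assume z: "z \<in> pyramid p F \<inter> {x. 1 - 1 / real k < height F x}"
      then have "real k * (1 - height F z) < 1"
        using k0 by (auto simp: field_simps)
      then show "0 = cutoff k z"
        using eq[of z] z by simp
    qed (use 3 x in auto)
  qed
qed

lemma cutoff_derivative_AE:
  assumes k: "k \<ge> 3"
  shows "AE x in lborel. x \<in> T \<longrightarrow> (cutoff k has_derivative (\<lambda>h. cutoff_grad k x \<bullet> h)) (at x)"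
proof -
  have null: "{x. height F x = t} \<in> null_sets lborel" if F: "F \<in> \<F>" for F t
  proof -
    have "{x. height F x = t} = {x. n F \<bullet> x = n F \<bullet> p + t * cdist F}"
      using cdist_pos[OF F] by (auto simp: height_def cone_height_def cdist_def inner_diff_right field_simps)
    moreover have "n F \<noteq> 0"
      using norm_n[OF F] by auto
    ultimately show ?thesis
      using negligible_hyperplane[of "n F" "n F \<bullet> p + t * cdist F"]
      by (auto simp: negligible_iff_null_sets null_sets_completion_iff borel_closed closed_hyperplane)
  qed
  have 1: "AE x in lborel. \<forall>F\<in>\<F>. height F x \<noteq> 1 - 2 / real k \<and> height F x \<noteq> 1 - 1 / real k"
  proof (rule AE_finite_allI[OF fin])
    fix F assume F: "F \<in> \<F>"
    show "AE x in lborel. height F x \<noteq> 1 - 2 / real k \<and> height F x \<noteq> 1 - 1 / real k"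
      using AE_not_in[OF null[OF F, of "1 - 2 / real k"]] AE_not_in[OF null[OF F, of "1 - 1 / real k"]]
      by eventually_elim simp
  qed
  have "open (\<Union>F\<in>\<F>. pyramid p F)"
    by (intro open_UN ballI open_pyramid[OF flat visible])
  then have "T - (\<Union>F\<in>\<F>. pyramid p F) \<in> sets borel"
    using T(1) by (intro sets.Diff) auto
  then have "T - (\<Union>F\<in>\<F>. pyramid p F) \<in> null_sets lborel"
    using negligible_outside_pyramids by (simp add: negligible_iff_null_sets null_sets_completion_iff)
  then have 2: "AE x in lborel. x \<notin> T - (\<Union>F\<in>\<F>. pyramid p F)"
    by (rule AE_not_in)
  from 1 2 show ?thesis
    by eventually_elim (use cutoff_has_derivative[OF k] in blast)
qed

lemma shell_volume:
  assumes k: "k \<ge> 3" and F: "F \<in> \<F>" and H: "H \<in> borel_measurable borel"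
  shows "(\<integral>x. indicator (shell k F) x * H (base F x) \<partial>lborel) =
    cdist F * ((1 - 1 / real k) ^ CARD('n) - (1 - 2 / real k) ^ CARD('n)) / CARD('n) *
      (\<integral>y. indicator F y * H y \<partial>hyp_measure (n F) (c F))"
proof -
  \<comment> \<open>From \<open>k = 3\<close> on, the inner height is positive and the shell stays
    away from the apex.\<close>
  have "0 < 1 - 2 / real k" "1 - 2 / real k \<le> 1 - 1 / real k" "1 - 1 / real k < 1"
    using k by (auto simp: field_simps)
  from integral_pyramid_shell[OF flat[OF F] visible[OF F] this H] show ?thesis
    by (simp add: shell_def base_def height_def cdist_def)
qed

lemma shell_near_face:
  assumes k: "k \<ge> 3" and F: "F \<in> \<F>" and x: "x \<in> shell k F"
  shows "norm (x - base F x) \<le> 2 / real k * diameter (closure T)"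
proof -
  have xp: "x \<in> pyramid p F" and h: "1 - 2 / real k \<le> height F x"
    using x by (auto simp: shell_def)
  note co = pyramid_coordinates[OF F xp]
  have "x - base F x = (height F x - 1) *\<^sub>R (base F x - p)"
    by (subst co(4)) (simp add: algebra_simps)
  then have "norm (x - base F x) = (1 - height F x) * norm (base F x - p)"
    using co(3) by simp
  also have "\<dots> \<le> 2 / real k * diameter (closure T)"
  proof (rule mult_mono)
    have "dist (base F x) p \<le> diameter (closure T)"
      using face_closure(1)[OF F co(1)] p closure_subset T(2)
      by (intro diameter_bounded_bound) (auto simp: bounded_closure)
    then show "norm (base F x - p) \<le> diameter (closure T)"
      by (simp add: dist_norm)
  qed (use h in auto)
  finally show ?thesis .
qed

text \<open>On the shell of \<open>F\<close> the gradient of the cutoff has size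
  \<open>real k / cdist F\<close>, while the shell has thickness \<open>cdist F / real k\<close>.
  The product tends to the surface measure, and uniform continuity of \<open>W\<close> replaces the
  field on the shell by its values on the face.\<close>

theorem divergence:
  fixes w W :: "real^'n \<Rightarrow> real^'n"
  assumes w: "\<And>i. bounded_C1 T (\<lambda>x. w x $ i)"
    and W: "continuous_on (closure T) W" "\<And>x. x \<in> T \<Longrightarrow> W x = w x"
  shows "(\<integral>x. (\<Sum>i\<in>UNIV. grad (\<lambda>y. w y $ i) x $ i) \<partial>lebesgue_on T) =
    (\<Sum>F\<in>\<F>. \<integral>y. indicator F y * (n F \<bullet> W y) \<partial>hyp_measure (n F) (c F))"
proof -
  define dw where "dw x = (\<Sum>i\<in>UNIV. grad (\<lambda>y. w y $ i) x $ i)" for x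
  define I where "I F = (\<integral>y. indicator F y * (n F \<bullet> W y) \<partial>hyp_measure (n F) (c F))" for F
  \<comment> \<open>The factor by which \<open>real k / cdist F\<close> times the shell integral
    differs from the face integral, for functions constant along the rays.\<close>
  define \<theta> where "\<theta> k = real k * ((1 - 1 / real k) ^ CARD('n) - (1 - 2 / real k) ^ CARD('n)) / CARD('n)" for k
  define area :: "(real^'n) set \<Rightarrow> real" where "area F = (\<integral>y. indicator F y * 1 \<partial>hyp_measure (n F) (c F))" for F
  have area: "area F \<ge> 0" for F
    unfolding area_def by (intro integral_nonneg_AE AE_I2) simp
  have \<theta>: "\<theta> \<longlonglongrightarrow> 1"
    unfolding \<theta>_def by (rule shell_factor_tendsto) simp
  have "\<forall>i. \<exists>B. \<forall>x\<in>T. \<bar>w x $ i\<bar> \<le> B \<and> norm (grad (\<lambda>x. w x $ i) x) \<le> B"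
    using w unfolding bounded_C1_def by blast
  then obtain B where B: "\<And>i x. x \<in> T \<Longrightarrow> \<bar>w x $ i\<bar> \<le> B i" "\<And>i x. x \<in> T \<Longrightarrow> norm (grad (\<lambda>x. w x $ i) x) \<le> B i"
    by metis
  have Tb[measurable]: "T \<in> sets borel"
    using T(1) by simp
  have cw: "continuous_on T w"
  proof -
    have "continuous_on T (\<lambda>x. \<chi> i. w x $ i)"
      by (intro continuous_on_vec_lambda bounded_C1_continuous w)
    then show ?thesis by simp
  qed
  have cdw: "continuous_on T dw"
    unfolding dw_def using w unfolding bounded_C1_def by (intro continuous_on_sum continuous_on_component) blast
  define BB where "BB = (\<Sum>i\<in>UNIV. B i)"
  have dwB: "\<bar>dw x\<bar> \<le> BB" if "x \<in> T" for x
    unfolding dw_def BB_def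
  proof (rule order_trans[OF sum_abs sum_mono])
    fix i
    show "\<bar>grad (\<lambda>y. w y $ i) x $ i\<bar> \<le> B i"
      using B(2)[OF that, of i] component_le_norm_cart[of "grad (\<lambda>y. w y $ i) x" i] by linarith
  qed
  have wB: "norm (w x) \<le> BB" if "x \<in> T" for x
    unfolding BB_def using norm_le_l1_cart[of "w x"] sum_mono[of UNIV "\<lambda>i. \<bar>w x $ i\<bar>" B] B(1)[OF that] by (smt (verit))
  have mdw: "(\<lambda>x. indicator T x * dw x) \<in> borel_measurable borel"
    using borel_measurable_continuous_on_indicator[OF Tb cdw] by simp
  have mw: "(\<lambda>x. indicator T x *\<^sub>R w x) \<in> borel_measurable borel"
    using borel_measurable_continuous_on_indicator[OF Tb cw] .
  have iT: "integrable lborel (\<lambda>x. indicator T x * dw x)"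
    by (rule lborel_integrable_bounded_support[OF mdw T(2), of "\<bar>BB\<bar>"])
      (use dwB in \<open>force simp: indicator_def\<close>)+
  have iS: "integrable lborel (\<lambda>x. indicator (shell k F) x * (n F \<bullet> w x))" if F: "F \<in> \<F>" for k F
  proof (rule lborel_integrable_bounded_support[OF _ T(2)])
    have [measurable]: "shell k F \<in> sets borel" by (rule shell_sets[OF F])
    have eq: "indicator (shell k F) x * (n F \<bullet> w x) = indicator (shell k F) x * (n F \<bullet> (indicator T x *\<^sub>R w x))" for x
      using shell_subset[OF F, of k] by (auto simp: indicator_def)
    show "(\<lambda>x. indicator (shell k F) x * (n F \<bullet> w x)) \<in> borel_measurable borel"
      unfolding eq using mw by measurable
    show "indicator (shell k F) x * (n F \<bullet> w x) = 0" if "x \<notin> T" for x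
      using that shell_subset[OF F, of k] by (auto simp: indicator_def)
    show "\<bar>indicator (shell k F) x * (n F \<bullet> w x)\<bar> \<le> \<bar>BB\<bar>" for x
    proof (cases "x \<in> shell k F")
      case True
      then have "x \<in> T" using shell_subset[OF F] by blast
      then show ?thesis
        using True Cauchy_Schwarz_ineq2[of "n F" "w x"] wB[of x] norm_n[OF F] by simp
    qed simp
  qed
  have eqk: "(\<Sum>F\<in>\<F>. real k / cdist F * (\<integral>x. indicator (shell k F) x * (n F \<bullet> w x) \<partial>lborel)) =
      (\<integral>x. indicator T x * (dw x * cutoff k x) \<partial>lborel)" if k: "k \<ge> 3" for k
  proof -
    \<comment> \<open>The cutoff vanishes where the gauge is at least \<open>a\<close>, which gives
      the compact support.\<close>
    define a where "a = 1 - 1 / real k"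
    have a: "0 < a" "a < 1" using k by (auto simp: a_def field_simps)
    note sub = gauge_sublevel[OF a]
    have supp: "cutoff k x = 0" if "x \<notin> (\<lambda>y. p + a *\<^sub>R (y - p)) ` closure T" for x
    proof -
      have "gauge x \<ge> a" using sub(3)[of x] that by linarith
      then have "real k * (1 - gauge x) \<le> 1"
        using k unfolding a_def by (auto simp: field_simps)
      then show ?thesis by (simp add: cutoff_def)
    qed
    have mg: "cutoff_grad k \<in> borel_measurable borel"
      unfolding cutoff_grad_def[abs_def]
    proof (rule borel_measurable_sum)
      fix F assume F: "F \<in> \<F>"
      have [measurable]: "shell k F \<in> sets borel" by (rule shell_sets[OF F])
      show "(\<lambda>x. (indicator (shell k F) x * (- real k / cdist F)) *\<^sub>R n F) \<in> borel_measurable borel"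
        by measurable
    qed
    have dq: "((\<lambda>x. w x $ i) has_derivative (\<lambda>h. grad (\<lambda>x. w x $ i) x \<bullet> h)) (at x)" if "x \<in> T" for i x
      using w[of i] that grad_has_derivative unfolding bounded_C1_def by blast
    have cq: "continuous_on T (grad (\<lambda>x. w x $ i))" for i
      using w[of i] unfolding bounded_C1_def by blast
    note ibp = integral_by_parts_compact_support[OF T(1) sub(1,2) dq cq B cutoff_lipschitz supp cutoff_derivative_AE[OF k] mg]
    have "(\<Sum>i\<in>UNIV. \<integral>x. indicator T x * (w x $ i * (cutoff_grad k x \<bullet> axis i 1)) \<partial>lborel) =
        (\<integral>x. (\<Sum>i\<in>UNIV. indicator T x * (w x $ i * (cutoff_grad k x \<bullet> axis i 1))) \<partial>lborel)"
      by (rule Bochner_Integration.integral_sum[symmetric]) (rule ibp(1))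
    also have "\<dots> = (\<integral>x. (\<Sum>F\<in>\<F>. - (real k / cdist F * (indicator (shell k F) x * (n F \<bullet> w x)))) \<partial>lborel)"
    proof (rule Bochner_Integration.integral_cong[OF refl])
      fix x
      have "(\<Sum>i\<in>UNIV. indicator T x * (w x $ i * (cutoff_grad k x \<bullet> axis i 1))) = indicator T x * (w x \<bullet> cutoff_grad k x)"
        by (simp add: inner_axis inner_vec_def[of "w x"] sum_distrib_left)
      also have "\<dots> = w x \<bullet> cutoff_grad k x"
      proof (cases "x \<in> T")
        case False
        then have "indicator (shell k F) x = (0::real)" if "F \<in> \<F>" for F
          using shell_subset[OF that, of k] by (auto simp: indicator_def)
        then have "cutoff_grad k x = 0"
          by (simp add: cutoff_grad_def)
        then show ?thesis by simp
      qed simp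
      also have "\<dots> = (\<Sum>F\<in>\<F>. - (real k / cdist F * (indicator (shell k F) x * (n F \<bullet> w x))))"
        unfolding cutoff_grad_def inner_sum_right by (intro sum.cong refl) (simp add: inner_commute)
      finally show "(\<Sum>i\<in>UNIV. indicator T x * (w x $ i * (cutoff_grad k x \<bullet> axis i 1))) =
          (\<Sum>F\<in>\<F>. - (real k / cdist F * (indicator (shell k F) x * (n F \<bullet> w x))))" .
    qed
    also have "\<dots> = (\<Sum>F\<in>\<F>. \<integral>x. - (real k / cdist F * (indicator (shell k F) x * (n F \<bullet> w x))) \<partial>lborel)"
      by (rule Bochner_Integration.integral_sum) (intro integrable_minus integrable_mult_right iS)
    also have "\<dots> = - (\<Sum>F\<in>\<F>. real k / cdist F * (\<integral>x. indicator (shell k F) x * (n F \<bullet> w x) \<partial>lborel))"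
      by (simp add: sum_negf)
    finally have 1: "(\<Sum>i\<in>UNIV. \<integral>x. indicator T x * (w x $ i * (cutoff_grad k x \<bullet> axis i 1)) \<partial>lborel) =
        - (\<Sum>F\<in>\<F>. real k / cdist F * (\<integral>x. indicator (shell k F) x * (n F \<bullet> w x) \<partial>lborel))" .
    have "(\<Sum>i\<in>UNIV. \<integral>x. indicator T x * (w x $ i * (cutoff_grad k x \<bullet> axis i 1)) \<partial>lborel) =
        (\<Sum>i\<in>UNIV. - (\<integral>x. indicator T x * ((grad (\<lambda>x. w x $ i) x \<bullet> axis i 1) * cutoff k x) \<partial>lborel))"
      by (intro sum.cong refl ibp(3))
    also have "\<dots> = - (\<integral>x. (\<Sum>i\<in>UNIV. indicator T x * ((grad (\<lambda>x. w x $ i) x \<bullet> axis i 1) * cutoff k x)) \<partial>lborel)"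
      unfolding sum_negf
      by (rule arg_cong[where f = uminus], rule Bochner_Integration.integral_sum[symmetric], rule ibp(2))
    also have "\<dots> = - (\<integral>x. indicator T x * (dw x * cutoff k x) \<partial>lborel)"
      by (simp add: dw_def inner_axis sum_distrib_left sum_distrib_right)
    finally show ?thesis
      using 1 by simp
  qed
  have R: "(\<lambda>k. \<integral>x. indicator T x * (dw x * cutoff k x) \<partial>lborel) \<longlonglongrightarrow> (\<integral>x. indicator T x * dw x \<partial>lborel)"
  proof (rule integral_dominated_convergence[where w = "\<lambda>x. \<bar>indicator T x * dw x\<bar>"])
    have mc: "cutoff k \<in> borel_measurable borel" for k
      by (rule borel_measurable_continuous_onI, rule lipschitz_on_continuous_on[of "real k / kernel_radius"])
        (use cutoff_lipschitz[of k] kernel_radius(1) in \<open>auto simp: lipschitz_on_def dist_norm\<close>)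
    have "(\<lambda>x. (indicator T x * dw x) * cutoff k x) \<in> borel_measurable borel" for k
      using mdw mc by measurable
    then show "(\<lambda>x. indicator T x * (dw x * cutoff k x)) \<in> borel_measurable lborel" for k
      by (simp add: mult.assoc)
    show "AE x in lborel. norm (indicator T x * (dw x * cutoff k x)) \<le> \<bar>indicator T x * dw x\<bar>" for k
      using cutoff_bounds[of k] by (intro AE_I2) (auto simp: abs_mult indicator_def intro: mult_left_le)
    show "AE x in lborel. (\<lambda>k. indicator T x * (dw x * cutoff k x)) \<longlonglongrightarrow> indicator T x * dw x"
    proof (rule AE_I2)
      fix x
      show "(\<lambda>k. indicator T x * (dw x * cutoff k x)) \<longlonglongrightarrow> indicator T x * dw x"
      proof (cases "x \<in> T")
        case True
        define e where "e = 1 - gauge x"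
        have e: "e > 0" using gauge_less_1[OF True] by (simp add: e_def)
        obtain N :: nat where N: "real N > 2 / e"
          using reals_Archimedean2 by blast
        have "cutoff k x = 1" if "k \<ge> N" for k
        proof -
          have "2 / e < real k" using N that by linarith
          then have "real k * e > 2" using e by (simp add: field_simps)
          then show ?thesis by (simp add: cutoff_def e_def)
        qed
        then have "\<forall>\<^sub>F k in sequentially. indicator T x * (dw x * cutoff k x) = indicator T x * dw x"
          by (intro eventually_mono[OF eventually_ge_at_top[of N]]) simp
        then show ?thesis
          by (rule tendsto_eventually)
      qed simp
    qed
  qed (use iT mdw in auto)
  have cW: "compact (closure T)"
    using T(2) by (simp add: compact_closure)
  have L: "(\<lambda>k. (\<Sum>F\<in>\<F>. real k / cdist F * (\<integral>x. indicator (shell k F) x * (n F \<bullet> w x) \<partial>lborel)) - (\<Sum>F\<in>\<F>. \<theta> k * I F)) \<longlonglongrightarrow> 0"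
  proof (rule LIMSEQ_I)
    fix r :: real assume r: "r > 0"
    define A where "A = (\<Sum>F\<in>\<F>. area F)"
    have A: "A \<ge> 0" unfolding A_def by (intro sum_nonneg area)
    \<comment> \<open>Together with \<open>\<theta> k < 2\<close> this keeps the total error at most
      \<open>r / 2\<close>; the summand 1 avoids division by zero.\<close>
    define e where "e = r / (4 * (A + 1))"
    have e: "e > 0" using r A by (simp add: e_def add_nonneg_pos)
    obtain d where d: "d > 0" "\<And>x y. x \<in> closure T \<Longrightarrow> y \<in> closure T \<Longrightarrow> dist x y < d \<Longrightarrow> dist (W x) (W y) < e"
      using compact_uniformly_continuous[OF W(1) cW] e unfolding uniformly_continuous_on_def by metis
    have "(\<lambda>k. 2 * diameter (closure T) / real k) \<longlonglongrightarrow> 0"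
      by (rule lim_const_over_n)
    then have "eventually (\<lambda>k. 2 * diameter (closure T) / real k < d) sequentially"
      using d(1) by (rule order_tendstoD)
    moreover have "eventually (\<lambda>k. \<theta> k < 2) sequentially"
      using \<theta> by (rule order_tendstoD) simp
    ultimately have "eventually (\<lambda>k. 2 * diameter (closure T) / real k < d \<and> \<theta> k < 2 \<and> k \<ge> 3) sequentially"
      using eventually_ge_at_top[of "3::nat"] by eventually_elim simp
    then obtain N where N: "\<And>k. k \<ge> N \<Longrightarrow> 2 * diameter (closure T) / real k < d \<and> \<theta> k < 2 \<and> k \<ge> 3"
      unfolding eventually_sequentially by blast
    have "norm ((\<Sum>F\<in>\<F>. real k / cdist F * (\<integral>x. indicator (shell k F) x * (n F \<bullet> w x) \<partial>lborel)) - (\<Sum>F\<in>\<F>. \<theta> k * I F) - 0) < r"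
      if "k \<ge> N" for k
    proof -
      have k: "k \<ge> 3" "2 * diameter (closure T) / real k < d" "\<theta> k < 2"
        using N[OF that] by auto
      have one: "\<bar>real k / cdist F * (\<integral>x. indicator (shell k F) x * (n F \<bullet> w x) \<partial>lborel) - \<theta> k * I F\<bar> \<le> e * (\<theta> k * area F)"
        if F: "F \<in> \<F>" for F
      proof -
        have [measurable]: "shell k F \<in> sets borel" "F \<in> sets borel" "base F \<in> borel_measurable borel"
          using shell_sets[OF F] flat_faceD(5)[OF flat[OF F]] by (auto simp: base_def)
        \<comment> \<open>Cutting \<open>W\<close> off outside the closure gives a Borel function on
          the whole space without changing it on the face.\<close>
        define H where "H y = n F \<bullet> (indicator (closure T) y *\<^sub>R W y)" for y
        have "(\<lambda>y. indicator (closure T) y *\<^sub>R W y) \<in> borel_measurable borel"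
          using W(1) by (intro borel_measurable_continuous_on_indicator) auto
        then have H[measurable]: "H \<in> borel_measurable borel"
          unfolding H_def[abs_def] by measurable
        have IH: "I F = (\<integral>y. indicator F y * H y \<partial>hyp_measure (n F) (c F))"
          unfolding I_def H_def using face_closure(1)[OF F]
          by (intro Bochner_Integration.integral_cong) (auto simp: indicator_def)
        have S1: "(\<integral>x. indicator (shell k F) x * H (base F x) \<partial>lborel) = cdist F / real k * (\<theta> k * I F)"
          unfolding shell_volume[OF k(1) F H] IH \<theta>_def using k(1) by (simp add: field_simps)
        have S2: "(\<integral>x. indicator (shell k F) x * 1 \<partial>lborel) = cdist F / real k * (\<theta> k * area F)"
          unfolding shell_volume[OF k(1) F borel_measurable_const] area_def[symmetric] \<theta>_def
          using k(1) by (simp add: field_simps)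
        have iS1: "integrable lborel (\<lambda>x. indicator (shell k F) x * 1 :: real)"
          by (rule lborel_integrable_bounded_support[OF _ T(2), where B = 1])
            (use shell_subset[OF F, of k] in \<open>auto simp: indicator_def\<close>)
        have bd: "\<bar>indicator (shell k F) x * (n F \<bullet> w x) - indicator (shell k F) x * H (base F x)\<bar> \<le> e * (indicator (shell k F) x * 1)" for x
        proof (cases "x \<in> shell k F")
          case True
          then have xT: "x \<in> T" "x \<in> closure T" using shell_subset[OF F, of k] closure_subset by blast+
          have xp: "x \<in> pyramid p F" using True by (simp add: shell_def)
          have bT: "base F x \<in> closure T"
            using face_closure(1)[OF F pyramid_coordinates(1)[OF F xp]] .
          have "dist x (base F x) < d"
            using shell_near_face[OF k(1) F True] k(2) by (simp add: dist_norm)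
          then have "norm (W x - W (base F x)) < e"
            using d(2)[OF xT(2) bT] by (simp add: dist_norm)
          then have "\<bar>n F \<bullet> (W x - W (base F x))\<bar> \<le> e"
            using Cauchy_Schwarz_ineq2[of "n F" "W x - W (base F x)"] norm_n[OF F] by simp
          then show ?thesis
            using True bT W(2)[OF xT(1)] by (simp add: H_def inner_diff_right)
        qed simp
        have iSH: "integrable lborel (\<lambda>x. indicator (shell k F) x * (n F \<bullet> w x) - indicator (shell k F) x * H (base F x))"
          by (rule Bochner_Integration.integrable_bound[OF integrable_mult_right[OF iS1, of e]])
            (use borel_measurable_integrable[OF iS[OF F, of k]] bd in \<open>auto intro!: AE_I2 intro: order_trans[OF _ abs_ge_self]\<close>)
        have iH: "integrable lborel (\<lambda>x. indicator (shell k F) x * H (base F x))"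
          using Bochner_Integration.integrable_diff[OF iS[OF F, of k] iSH] by simp
        have "\<bar>(\<integral>x. indicator (shell k F) x * (n F \<bullet> w x) \<partial>lborel) - (\<integral>x. indicator (shell k F) x * H (base F x) \<partial>lborel)\<bar>
            = \<bar>\<integral>x. indicator (shell k F) x * (n F \<bullet> w x) - indicator (shell k F) x * H (base F x) \<partial>lborel\<bar>"
          using iS[OF F, of k] iH by simp
        also have "\<dots> \<le> (\<integral>x. \<bar>indicator (shell k F) x * (n F \<bullet> w x) - indicator (shell k F) x * H (base F x)\<bar> \<partial>lborel)"
          by (rule integral_abs_bound)
        also have "\<dots> \<le> (\<integral>x. e * (indicator (shell k F) x * 1) \<partial>lborel)"
          by (rule integral_mono) (use iSH iS1 bd in auto)
        also have "\<dots> = e * (cdist F / real k * (\<theta> k * area F))"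
          using S2 by simp
        finally have fin1: "\<bar>(\<integral>x. indicator (shell k F) x * (n F \<bullet> w x) \<partial>lborel) - cdist F / real k * (\<theta> k * I F)\<bar>
            \<le> e * (cdist F / real k * (\<theta> k * area F))"
          unfolding S1 .
        have pos: "real k / cdist F > 0"
          using k(1) cdist_pos[OF F] by simp
        have "\<bar>real k / cdist F * (\<integral>x. indicator (shell k F) x * (n F \<bullet> w x) \<partial>lborel) - \<theta> k * I F\<bar> =
            real k / cdist F * \<bar>(\<integral>x. indicator (shell k F) x * (n F \<bullet> w x) \<partial>lborel) - cdist F / real k * (\<theta> k * I F)\<bar>"
        proof -
          have "real k / cdist F * (\<integral>x. indicator (shell k F) x * (n F \<bullet> w x) \<partial>lborel) - \<theta> k * I F = real k / cdist F * ((\<integral>x. indicator (shell k F) x * (n F \<bullet> w x) \<partial>lborel) - cdist F / real k * (\<theta> k * I F))"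
            using k(1) cdist_pos[OF F] by (simp add: right_diff_distrib)
          then show ?thesis
            by (simp only: abs_mult abs_of_pos[OF pos])
        qed
        also have "\<dots> \<le> real k / cdist F * (e * (cdist F / real k * (\<theta> k * area F)))"
          using fin1 pos by (intro mult_left_mono) auto
        also have "\<dots> = e * (\<theta> k * area F)"
          using k(1) cdist_pos[OF F] by simp
        finally show ?thesis .
      qed
      have "\<bar>(\<Sum>F\<in>\<F>. real k / cdist F * (\<integral>x. indicator (shell k F) x * (n F \<bullet> w x) \<partial>lborel)) - (\<Sum>F\<in>\<F>. \<theta> k * I F)\<bar>
          \<le> (\<Sum>F\<in>\<F>. \<bar>real k / cdist F * (\<integral>x. indicator (shell k F) x * (n F \<bullet> w x) \<partial>lborel) - \<theta> k * I F\<bar>)"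
        unfolding sum_subtractf[symmetric] by (rule sum_abs)
      also have "\<dots> \<le> (\<Sum>F\<in>\<F>. e * (\<theta> k * area F))"
        by (rule sum_mono) (rule one)
      also have "\<dots> = e * (\<theta> k * A)"
        by (simp add: A_def sum_distrib_left)
      also have "\<dots> \<le> e * (2 * A)"
        using k(3) e A by (intro mult_left_mono mult_right_mono) auto
      also have "\<dots> \<le> e * (2 * (A + 1))"
        using e by simp
      also have "\<dots> = r / 2"
        using A by (simp add: e_def field_simps)
      also have "\<dots> < r"
        using r by simp
      finally show ?thesis
        by simp
    qed
    then show "\<exists>no. \<forall>k\<ge>no. norm ((\<Sum>F\<in>\<F>. real k / cdist F * (\<integral>x. indicator (shell k F) x * (n F \<bullet> w x) \<partial>lborel)) - (\<Sum>F\<in>\<F>. \<theta> k * I F) - 0) < r"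
      by blast
  qed
  have "(\<lambda>k. \<Sum>F\<in>\<F>. \<theta> k * I F) \<longlonglongrightarrow> (\<Sum>F\<in>\<F>. 1 * I F)"
    by (intro tendsto_sum tendsto_mult \<theta> tendsto_const)
  from tendsto_add[OF L this]
  have L2: "(\<lambda>k. \<Sum>F\<in>\<F>. real k / cdist F * (\<integral>x. indicator (shell k F) x * (n F \<bullet> w x) \<partial>lborel)) \<longlonglongrightarrow> (\<Sum>F\<in>\<F>. I F)"
    by simp
  have "eventually (\<lambda>k. (\<Sum>F\<in>\<F>. real k / cdist F * (\<integral>x. indicator (shell k F) x * (n F \<bullet> w x) \<partial>lborel)) =
      (\<integral>x. indicator T x * (dw x * cutoff k x) \<partial>lborel)) sequentially"
    using eventually_ge_at_top[of "3::nat"] by (rule eventually_mono) (rule eqk)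
  from Lim_transform_eventually[OF L2 this] have "(\<Sum>F\<in>\<F>. I F) = (\<integral>x. indicator T x * dw x \<partial>lborel)"
    using R LIMSEQ_unique by blast
  also have "\<dots> = (\<integral>x. dw x \<partial>lebesgue_on T)"
    using lebesgue_on_lborel(2)[OF Tb mdw] by simp
  finally show ?thesis
    by (simp add: I_def dw_def)
qed

text \<open>Each summand is \<open>CARD('n)\<close> times the volume of a pyramid, and the pyramids
  are disjoint subsets of \<open>T\<close>.\<close>

lemma sum_pyramid_volumes:
  "(\<Sum>F\<in>\<F>. measure (hyp_measure (n F) (c F)) F * cdist F) \<le> CARD('n) * measure lebesgue T"
proof -
  have P: "emeasure lborel (pyramid p F) = ennreal (cdist F / CARD('n) * measure (hyp_measure (n F) (c F)) F)" if F: "F \<in> \<F>" for F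
  proof -
    have "emeasure (hyp_measure (n F) (c F)) F = ennreal (measure (hyp_measure (n F) (c F)) F)"
      using emeasure_hyp_measure_finite[OF flat_faceD(1,3,5)[OF flat[OF F]], of "c F"]
      by (intro emeasure_eq_ennreal_measure) simp
    then show ?thesis
      using emeasure_pyramid[OF flat[OF F] visible[OF F]] cdist_pos[OF F]
      by (simp add: cdist_def ennreal_mult[symmetric])
  qed
  have sets: "pyramid p F \<in> sets lborel" if "F \<in> \<F>" for F
    using open_pyramid[OF flat visible] that by simp
  have fT: "emeasure lborel T < \<infinity>"
    using T(2) emeasure_bounded_finite by blast
  have "(\<Sum>F\<in>\<F>. ennreal (cdist F / CARD('n) * measure (hyp_measure (n F) (c F)) F)) = (\<Sum>F\<in>\<F>. emeasure lborel (pyramid p F))"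
    by (intro sum.cong refl P[symmetric])
  also have "\<dots> = emeasure lborel (\<Union>F\<in>\<F>. pyramid p F)"
    using fin sets pyramid_disjoint by (intro sum_emeasure) (auto simp: disjoint_family_on_def)
  also have "\<dots> \<le> emeasure lborel T"
    using pyramid_subset T(1) by (intro emeasure_mono) auto
  also have "\<dots> = ennreal (measure lborel T)"
    using fT by (intro emeasure_eq_ennreal_measure) auto
  finally have "(\<Sum>F\<in>\<F>. cdist F / CARD('n) * measure (hyp_measure (n F) (c F)) F) \<le> measure lborel T"
    using cdist_pos by (subst (asm) sum_ennreal) (auto intro!: mult_nonneg_nonneg simp: less_imp_le)
  then have "CARD('n) * (\<Sum>F\<in>\<F>. cdist F / CARD('n) * measure (hyp_measure (n F) (c F)) F) \<le> CARD('n) * measure lborel T"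
    by (intro mult_left_mono) auto
  then show ?thesis
    using T(1) by (simp add: sum_distrib_left mult.commute measure_completion)
qed

end

section \<open>Polytopal meshes\<close>

text \<open>The last fact holds because the interior of a closed set is a regular open set.\<close>

lemma polytopal_facts:
  assumes "polytopal (D :: (real^'n::finite) set)"
  shows "open D" "bounded D" "D \<noteq> {}" "connected D" "interior (closure D) = D"
proof -
  obtain \<S> where \<S>: "finite \<S>" "\<And>S. S \<in> \<S> \<Longrightarrow> int CARD('n) simplex S" "D = interior (\<Union>\<S>)"
    using assms unfolding polytopal_def by blast
  have c: "compact (\<Union>\<S>)"
    using \<S> by (intro compact_Union) (auto intro: polytope_imp_compact simplex_imp_polytope)
  show "open D" "D \<noteq> {}" "connected D"
    using assms \<S>(3) by (auto simp: polytopal_def)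
  show "bounded D"
    unfolding \<S>(3) using c compact_imp_bounded bounded_subset interior_subset by blast
  have "closure D \<subseteq> \<Union>\<S>"
    unfolding \<S>(3) using c by (intro closure_minimal interior_subset compact_imp_closed)
  then have "interior (closure D) \<subseteq> D"
    using interior_mono[of "closure D" "\<Union>\<S>"] \<S>(3) by blast
  moreover have "D \<subseteq> interior (closure D)"
    using \<open>open D\<close> closure_subset by (intro interior_maximal)
  ultimately show "interior (closure D) = D"
    by blast
qed

text \<open>Adjoining \<open>q\<close> raises the dimension by at most one, which still leaves the
  set within a hyperplane.\<close>

lemma codim2_in_hyperplane:
  fixes A :: "'a::euclidean_space set"
  assumes "aff_dim A + 2 \<le> DIM('a)"
  obtains a where "a \<noteq> 0" "A \<subseteq> {x. a \<bullet> (x - q) = 0}"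
proof -
  have "aff_dim (insert q A) < DIM('a)"
    using assms by (auto simp: aff_dim_insert split: if_splits)
  then obtain a b where ab: "a \<noteq> 0" "insert q A \<subseteq> {x. a \<bullet> x = b}"
    by (rule aff_lowdim_subset_hyperplane)
  then have "A \<subseteq> {x. a \<bullet> (x - q) = 0}"
    by (auto simp: inner_diff_right)
  then show ?thesis
    using that ab(1) by blast
qed

lemma codim2_hyp_null:
  fixes A :: "'a::euclidean_space set"
  assumes A: "aff_dim A + 2 \<le> DIM('a)" and n: "norm n = 1"
  obtains N where "A \<subseteq> N" "N \<in> null_sets (hyp_measure n c)"
proof (cases "A = {}")
  case True
  then show ?thesis using that[of "{}"] by simp
next
  case False
  then obtain x0 where x0: "x0 \<in> A" by blast
  \<comment> \<open>Passing the hyperplane also through \<open>x0 + n\<close> forces it to contain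
    the direction \<open>n\<close>, hence to cut the given hyperplane transversally.\<close>
  obtain a where a: "a \<noteq> 0" "A \<subseteq> {x. a \<bullet> (x - (x0 + n)) = 0}"
    by (rule codim2_in_hyperplane[OF A])
  have "a \<bullet> n = 0"
    using a(2) x0 by auto
  then have "A \<subseteq> {x. a \<bullet> x = a \<bullet> x0}" "a \<noteq> (a \<bullet> n) *\<^sub>R n"
    using a by (auto simp: inner_diff_right inner_add_right)
  moreover have "{x. a \<bullet> x = a \<bullet> x0} \<in> null_sets (hyp_measure n c)"
    using hyp_measure_hyperplane_null[OF n calculation(2)] by (intro null_setsI) (auto simp: borel_closed closed_hyperplane)
  ultimately show ?thesis
    using that by blast
qed

text \<open>The codimension-two faces of the simplices. Off their union, every boundary point of a
  simplex is in the relative interior of some facet. In dimension one there are none.\<close>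

definition ridges :: "(real^'n::finite) set set \<Rightarrow> (real^'n) set set" where
  "ridges \<S> = {\<tau>. \<exists>S\<in>\<S>. \<exists>\<sigma>. \<sigma> facet_of S \<and> \<tau> facet_of \<sigma>}"

lemma ridges_facts:
  assumes \<S>: "finite \<S>" "\<forall>S\<in>\<S>. int CARD('n) simplex (S :: (real^'n::finite) set)"
  shows "finite (ridges \<S>)" "\<And>\<tau>. \<tau> \<in> ridges \<S> \<Longrightarrow> aff_dim \<tau> + 2 \<le> DIM(real^'n)"
    "\<And>S x. S \<in> \<S> \<Longrightarrow> x \<in> S \<Longrightarrow> x \<notin> interior S \<Longrightarrow> x \<notin> \<Union>(ridges \<S>) \<Longrightarrow>
      \<exists>\<sigma>. \<sigma> facet_of S \<and> x \<in> rel_interior \<sigma>"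
    "\<And>S \<sigma>. S \<in> \<S> \<Longrightarrow> \<sigma> facet_of S \<Longrightarrow> closed \<sigma> \<and> \<sigma> - \<Union>(ridges \<S>) \<subseteq> rel_interior \<sigma>"
    "finite {\<sigma>. \<exists>S\<in>\<S>. \<sigma> facet_of S}"
proof -
  have poly: "polytope S" if "S \<in> \<S>" for S
    using \<S>(2) that simplex_imp_polytope by blast
  have fpoly: "polytope \<sigma>" if "S \<in> \<S>" "\<sigma> facet_of S" for S \<sigma>
    using face_of_polytope_polytope[OF poly[OF that(1)]] that(2) unfolding facet_of_def by blast
  have ff: "finite {\<sigma>. \<sigma> facet_of S}" if "polytope S" for S :: "(real^'n) set"
    using finite_polyhedron_facets[OF polytope_imp_polyhedron[OF that]] .
  have "{\<sigma>. \<exists>S\<in>\<S>. \<sigma> facet_of S} = (\<Union>S\<in>\<S>. {\<sigma>. \<sigma> facet_of S})"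
    by blast
  then show fin: "finite {\<sigma>. \<exists>S\<in>\<S>. \<sigma> facet_of S}"
    using \<S>(1) ff poly by simp
  have "ridges \<S> = (\<Union>\<sigma>\<in>{\<sigma>. \<exists>S\<in>\<S>. \<sigma> facet_of S}. {\<tau>. \<tau> facet_of \<sigma>})"
    by (auto simp: ridges_def)
  moreover have "finite {\<tau>. \<tau> facet_of \<sigma>}" if "\<sigma> \<in> {\<sigma>. \<exists>S\<in>\<S>. \<sigma> facet_of S}" for \<sigma>
    using that ff fpoly by blast
  ultimately show "finite (ridges \<S>)"
    using fin by simp
  have dim: "aff_dim S = CARD('n)" if "S \<in> \<S>" for S
    using \<S>(2) that aff_dim_simplex by blast
  show "aff_dim \<tau> + 2 \<le> DIM(real^'n)" if "\<tau> \<in> ridges \<S>" for \<tau>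
    using that dim unfolding ridges_def facet_of_def by auto
  have *: "closed \<sigma> \<and> \<sigma> - \<Union>(ridges \<S>) \<subseteq> rel_interior \<sigma>" if S: "S \<in> \<S>" "\<sigma> facet_of S" for S \<sigma>
  proof
    have p: "polytope \<sigma>" using fpoly[OF S] .
    show c: "closed \<sigma>" using p polytope_imp_closed by blast
    have "rel_frontier \<sigma> = \<Union>{\<tau>. \<tau> facet_of \<sigma>}"
      using rel_frontier_of_polyhedron[OF polytope_imp_polyhedron[OF p]] .
    also have "\<dots> \<subseteq> \<Union>(ridges \<S>)"
      using S by (auto simp: ridges_def)
    finally show "\<sigma> - \<Union>(ridges \<S>) \<subseteq> rel_interior \<sigma>"
      using c by (auto simp: rel_frontier_def)
  qed
  then show "\<And>S \<sigma>. S \<in> \<S> \<Longrightarrow> \<sigma> facet_of S \<Longrightarrow> closed \<sigma> \<and> \<sigma> - \<Union>(ridges \<S>) \<subseteq> rel_interior \<sigma>"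
    by blast
  show "\<exists>\<sigma>. \<sigma> facet_of S \<and> x \<in> rel_interior \<sigma>"
    if S: "S \<in> \<S>" and x: "x \<in> S" "x \<notin> interior S" "x \<notin> \<Union>(ridges \<S>)" for S x
  proof -
    have "affine hull S = UNIV"
      using dim[OF S] by (simp add: aff_dim_eq_full[symmetric])
    then have "rel_interior S = interior S"
      by (rule rel_interior_interior)
    then have "x \<in> rel_frontier S"
      using x closure_subset by (auto simp: rel_frontier_def)
    then obtain \<sigma> where \<sigma>: "\<sigma> facet_of S" "x \<in> \<sigma>"
      using rel_frontier_of_polyhedron[OF polytope_imp_polyhedron[OF poly[OF S]]] by blast
    then show ?thesis
      using *[OF S \<sigma>(1)] x(3) by blast
  qed
qed

section \<open>Area and center of mass of a face\<close>

lemma face_area_facts: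
  assumes F: "flat_face n c (F :: (real^'n::finite) set)"
  shows "face_area F = measure (hyp_measure n c) F" "face_area F > 0"
    "emeasure (hyp_measure n c) F < \<infinity>"
proof -
  show eq: "face_area F = measure (hyp_measure n c) F"
    by (simp add: face_area_def surface_measure_flat_face[OF F])
  show fin: "emeasure (hyp_measure n c) F < \<infinity>"
    by (rule emeasure_hyp_measure_finite[OF flat_faceD(1,3,5)[OF F]])
  show "face_area F > 0"
    using hyp_measure_pos[OF F] fin unfolding eq measure_def by (simp add: enn2real_positive_iff)
qed

lemma face_integrable:
  fixes h :: "real^'n::finite \<Rightarrow> 'b::euclidean_space"
  assumes F: "flat_face n c F" and h: "(\<lambda>y. indicator F y *\<^sub>R h y) \<in> borel_measurable borel"
    and B: "\<And>y. y \<in> F \<Longrightarrow> norm (h y) \<le> B"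
  shows "integrable (hyp_measure n c) (\<lambda>y. indicator F y *\<^sub>R h y)"
proof (rule integrableI_bounded_set[where A = F and B = "\<bar>B\<bar>"])
  show "F \<in> sets (hyp_measure n c)"
    using flat_faceD(5)[OF F] by simp
  show "emeasure (hyp_measure n c) F < \<infinity>"
    by (rule face_area_facts(3)[OF F])
  show "(\<lambda>y. indicator F y *\<^sub>R h y) \<in> borel_measurable (hyp_measure n c)"
    using h by simp
qed (use B in \<open>force intro!: AE_I2\<close>)+

lemma face_integral_const:
  assumes F: "flat_face n c (F :: (real^'n::finite) set)"
  shows "(\<integral>y. indicator F y * a \<partial>hyp_measure n c) = a * face_area F"
  using flat_faceD(5)[OF F] by (simp add: face_area_facts(1)[OF F])

lemma face_center_inner:
  assumes F: "flat_face n c (F :: (real^'n::finite) set)"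
  shows "v \<bullet> face_center F * face_area F = (\<integral>y. indicator F y * (v \<bullet> y) \<partial>hyp_measure n c)"
    "n \<bullet> face_center F = c"
proof -
  have [measurable]: "F \<in> sets borel" by (rule flat_faceD(5)[OF F])
  obtain B where B: "\<And>y. y \<in> F \<Longrightarrow> norm y \<le> B"
    using flat_faceD(3)[OF F] by (auto simp: bounded_iff)
  have i: "integrable (hyp_measure n c) (\<lambda>y. indicator F y *\<^sub>R y)"
    by (rule face_integrable[OF F _ B]) auto
  have "v \<bullet> face_center F * face_area F = v \<bullet> (\<integral>y. indicator F y *\<^sub>R y \<partial>hyp_measure n c)" for v
    using face_area_facts(2)[OF F]
    by (simp add: face_center_def surface_measure_flat_face[OF F] set_lebesgue_integral_def)
  also have "v \<bullet> (\<integral>y. indicator F y *\<^sub>R y \<partial>hyp_measure n c) = (\<integral>y. v \<bullet> (indicator F y *\<^sub>R y) \<partial>hyp_measure n c)" for v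
    by (rule integral_inner_right[symmetric]) (rule i)
  finally show eq: "v \<bullet> face_center F * face_area F = (\<integral>y. indicator F y * (v \<bullet> y) \<partial>hyp_measure n c)" for v
    by simp
  have "(\<integral>y. indicator F y * (n \<bullet> y) \<partial>hyp_measure n c) = (\<integral>y. indicator F y * c \<partial>hyp_measure n c)"
    using flat_faceD(4)[OF F] by (intro Bochner_Integration.integral_cong) (auto simp: indicator_def)
  also have "\<dots> = c * face_area F"
    by (rule face_integral_const[OF F])
  finally show "n \<bullet> face_center F = c"
    using eq[of n] face_area_facts(2)[OF F] by simp
qed

section \<open>A mesh and its exceptional set\<close>

locale mesh =
  fixes \<Omega> :: "(real^'n::finite) set" and \<T> \<F> :: "(real^'n) set set" and \<S> :: "(real^'n) set set"
  assumes mesh: "polytopal_mesh \<Omega> \<T> \<F>" and sub: "matching_simplicial_submesh \<T> \<F> \<S>"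
begin

definition Z :: "(real^'n) set" where "Z = \<Union>(ridges \<S>)"

lemma finite_\<S>: "finite \<S>" and simplices: "\<forall>S\<in>\<S>. int CARD('n) simplex S"
  using sub by (auto simp: matching_simplicial_submesh_def)

lemmas ridge = ridges_facts[OF finite_\<S> simplices]

lemma cells: "finite \<T>" "T \<in> \<T> \<Longrightarrow> polytopal T" "T \<in> \<T> \<Longrightarrow> T \<subseteq> \<Omega>" "pairwise disjnt \<T>"
    "closure \<Omega> = (\<Union>T\<in>\<T>. closure T)"
  using mesh by (auto simp: polytopal_mesh_def polytopal_partition_def)

lemma faces: "finite \<F>" "pairwise disjnt \<F>"
    "F \<in> \<F> \<Longrightarrow> F \<noteq> {} \<and> (\<exists>n c. n \<noteq> 0 \<and> openin (top_of_set {x. n \<bullet> x = c}) F)"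
    "T \<in> \<T> \<Longrightarrow> frontier T = (\<Union>F\<in>faces_of_cell \<F> T. closure F)"
    "T \<in> \<T> \<Longrightarrow> F \<in> faces_of_cell \<F> T \<Longrightarrow> \<exists>n. outward_normal T F n"
    "F \<in> \<F> \<Longrightarrow> card (cells_of_face \<T> F) = 2 \<or> card (cells_of_face \<T> F) = 1"
  using mesh unfolding polytopal_mesh_def by blast+

lemma face_cell: "F \<in> faces_of_cell \<F> T \<longleftrightarrow> F \<in> \<F> \<and> F \<subseteq> frontier T"
  by (simp add: faces_of_cell_def)

lemma cell_face: "T \<in> cells_of_face \<T> F \<longleftrightarrow> T \<in> \<T> \<and> F \<subseteq> frontier T"
  by (simp add: cells_of_face_def)

lemma face_has_cell:
  assumes "F \<in> \<F>"
  obtains T where "T \<in> \<T>" "F \<in> faces_of_cell \<F> T"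
proof -
  have "cells_of_face \<T> F \<noteq> {}"
    using faces(6)[OF assms] by auto
  then show ?thesis
    using that assms by (auto simp: cell_face face_cell)
qed

lemma flat_if_outward:
  assumes "T \<in> \<T>" "F \<in> faces_of_cell \<F> T" "outward_normal T F n" "y \<in> F"
  shows "flat_face n (n \<bullet> y) F"
proof -
  obtain a b where ab: "a \<noteq> 0" "openin (top_of_set {x. a \<bullet> x = b}) F"
    using faces(3)[of F] assms(2) by (auto simp: face_cell)
  have "bounded F"
    using bounded_subset[OF bounded_closure[OF polytopal_facts(2)[OF cells(2)[OF assms(1)]]]] assms(2)
    by (auto simp: face_cell frontier_def)
  moreover have "norm n = 1" "\<forall>x\<in>F. \<forall>y\<in>F. n \<bullet> x = n \<bullet> y"
    using assms(3) unfolding outward_normal_def by blast+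
  ultimately show ?thesis
    by (rule flat_faceI[OF ab _ _ _ assms(4)])
qed

lemma outward_center:
  assumes "T \<in> \<T>" "F \<in> faces_of_cell \<F> T" "outward_normal T F n"
  shows "flat_face n (n \<bullet> face_center F) F"
proof -
  obtain y where y: "y \<in> F"
    using faces(3)[of F] assms(2) by (auto simp: face_cell)
  show ?thesis
    using flat_if_outward[OF assms y] face_center_inner(2) by metis
qed

lemma Z_null:
  assumes n: "norm n = 1"
  obtains N where "Z \<subseteq> N" "N \<in> null_sets (hyp_measure n c)"
proof -
  have "\<forall>\<tau>\<in>ridges \<S>. \<exists>N. \<tau> \<subseteq> N \<and> N \<in> null_sets (hyp_measure n c)"
    using codim2_hyp_null[OF ridge(2) n] by metis
  then obtain N where N: "\<And>\<tau>. \<tau> \<in> ridges \<S> \<Longrightarrow> \<tau> \<subseteq> N \<tau> \<and> N \<tau> \<in> null_sets (hyp_measure n c)"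
    by metis
  have "(\<Union>\<tau>\<in>ridges \<S>. N \<tau>) \<in> null_sets (hyp_measure n c)"
    by (rule null_sets_UN'[OF countable_finite[OF ridge(1)]]) (simp add: N)
  moreover have "Z \<subseteq> (\<Union>\<tau>\<in>ridges \<S>. N \<tau>)"
    unfolding Z_def using N by blast
  ultimately show ?thesis
    using that by blast
qed

lemma Z_cone: "\<exists>M. finite M \<and> 0 \<notin> M \<and> Z \<subseteq> (\<Union>m\<in>M. {x. m \<bullet> (x - q) = 0})"
proof -
  have "\<forall>\<tau>\<in>ridges \<S>. \<exists>a. a \<noteq> 0 \<and> \<tau> \<subseteq> {x. a \<bullet> (x - q) = 0}"
    using codim2_in_hyperplane[OF ridge(2)] by metis
  then obtain a where a: "\<And>\<tau>. \<tau> \<in> ridges \<S> \<Longrightarrow> a \<tau> \<noteq> 0 \<and> \<tau> \<subseteq> {x. a \<tau> \<bullet> (x - q) = 0}"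
    by metis
  show ?thesis
    by (rule exI[of _ "a ` ridges \<S>"]) (use a ridge(1) in \<open>fastforce simp: Z_def\<close>)
qed

text \<open>A nonempty relatively open part of a face has positive surface measure, whereas
  \<open>Z\<close> is contained in a null set.\<close>

lemma generic_face_point:
  assumes F: "F \<in> \<F>" and V: "open V" "V \<inter> F \<noteq> {}"
  obtains y where "y \<in> V" "y \<in> F" "y \<notin> Z"
proof -
  obtain T where T: "T \<in> \<T>" "F \<in> faces_of_cell \<F> T"
    by (rule face_has_cell[OF F])
  then obtain n where "outward_normal T F n"
    using faces(5) by blast
  then have ff: "flat_face n (n \<bullet> face_center F) F"
    using outward_center T by blast
  obtain N where N: "Z \<subseteq> N" "N \<in> null_sets (hyp_measure n (n \<bullet> face_center F))"
    by (rule Z_null[OF flat_faceD(1)[OF ff]])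
  obtain y where "y \<in> V" "y \<in> F" "y \<notin> \<Union>{N}"
    by (rule flat_face_generic_point[OF ff V, of "{N}"]) (use N in auto)
  then show ?thesis
    using N(1) that by blast
qed

text \<open>This is where the matching submesh enters. Off \<open>Z\<close>, a face is covered by
  the finitely many facets whose relative interior it contains. Their union is closed and so
  contains the closure of the face, and a point of such a facet off \<open>Z\<close> is in the
  relative interior, hence in the face.\<close>

lemma closure_face:
  assumes F: "F \<in> \<F>"
  shows "closure F - Z \<subseteq> F"
proof
  fix x assume x: "x \<in> closure F - Z"
  obtain T where T: "T \<in> \<T>" "F \<in> faces_of_cell \<F> T"
    by (rule face_has_cell[OF F])
  note pT = polytopal_facts[OF cells(2)[OF T(1)]]
  define \<Sigma> where "\<Sigma> = {\<sigma>. (\<exists>S\<in>\<S>. \<sigma> facet_of S) \<and> rel_interior \<sigma> \<subseteq> F}"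
  have \<Sigma>: "finite \<Sigma>"
    unfolding \<Sigma>_def by (rule finite_subset[OF _ ridge(5)]) blast
  have cl\<Sigma>: "closed (\<Union>\<Sigma>)"
    using \<Sigma> ridge(4) by (intro closed_Union) (auto simp: \<Sigma>_def)
  have gen: "F - Z \<subseteq> \<Union>\<Sigma>"
  proof
    fix y assume y: "y \<in> F - Z"
    have yf: "y \<in> frontier T"
      using y T(2) by (auto simp: face_cell)
    have "closure T = \<Union>{S\<in>\<S>. S \<subseteq> closure T}"
      using sub T(1) by (auto simp: matching_simplicial_submesh_def)
    then obtain S where S: "S \<in> \<S>" "S \<subseteq> closure T" "y \<in> S"
      using yf by (auto simp: frontier_def)
    have "interior S \<subseteq> T"
      using interior_mono[OF S(2)] pT(5) by simp
    then have "y \<notin> interior S"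
      using yf pT(1) by (auto simp: frontier_def interior_open)
    then obtain \<sigma> where \<sigma>: "\<sigma> facet_of S" "y \<in> rel_interior \<sigma>"
      using ridge(3)[OF S(1,3)] y by (auto simp: Z_def)
    then have "rel_interior \<sigma> \<subseteq> F"
      using sub S(1) F y unfolding matching_simplicial_submesh_def by blast
    then show "y \<in> \<Union>\<Sigma>"
      using \<sigma> S(1) rel_interior_subset unfolding \<Sigma>_def by blast
  qed
  have "x \<in> closure (F - Z)"
    unfolding closure_approachable
  proof (intro allI impI)
    fix e :: real assume "e > 0"
    then have V: "open (ball x e)" "ball x e \<inter> F \<noteq> {}"
      using x by (auto simp: closure_approachable dist_commute disjoint_iff)
    obtain y where "y \<in> ball x e" "y \<in> F" "y \<notin> Z"
      by (rule generic_face_point[OF F V])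
    then show "\<exists>y\<in>F - Z. dist y x < e"
      by (auto simp: dist_commute)
  qed
  then have "x \<in> \<Union>\<Sigma>"
    using closure_minimal[OF gen cl\<Sigma>] by blast
  then obtain \<sigma> S where \<sigma>: "x \<in> \<sigma>" "rel_interior \<sigma> \<subseteq> F" "S \<in> \<S>" "\<sigma> facet_of S"
    unfolding \<Sigma>_def by blast
  then show "x \<in> F"
    using ridge(4)[OF \<sigma>(3,4)] x by (auto simp: Z_def)
qed

lemma faced:
  assumes T: "T \<in> \<T>" and n: "\<And>F. F \<in> faces_of_cell \<F> T \<Longrightarrow> outward_normal T F (n F)"
  shows "faced_cell T (faces_of_cell \<F> T) n (\<lambda>F. n F \<bullet> face_center F) Z"
proof
  note pT = polytopal_facts[OF cells(2)[OF T]]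
  show "open T" "bounded T" "interior (closure T) = T"
    using pT by auto
  show "finite (faces_of_cell \<F> T)"
    using faces(1) by (simp add: faces_of_cell_def)
  show "pairwise disjnt (faces_of_cell \<F> T)"
    using faces(2) by (rule pairwise_subset) (auto simp: faces_of_cell_def)
  show "frontier T = (\<Union>F\<in>faces_of_cell \<F> T. closure F)"
    by (rule faces(4)[OF T])
  fix F assume F: "F \<in> faces_of_cell \<F> T"
  show "flat_face (n F) (n F \<bullet> face_center F) F"
    by (rule outward_center[OF T F n[OF F]])
  show "F \<subseteq> frontier T" "closure F - Z \<subseteq> F"
    using F closure_face by (auto simp: face_cell)
  show "F \<subseteq> closure {x \<in> F. \<exists>e>0. \<forall>t. 0 < t \<and> t < e \<longrightarrow> x - t *\<^sub>R n F \<in> T \<and> x + t *\<^sub>R n F \<notin> T}"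
    using n[OF F] unfolding outward_normal_def by blast
qed

text \<open>Justifies the definite description in \<open>normal\<close>. A second outward normal
  could only be the opposite one, and then a point just behind the face would be both in
  \<open>T\<close> and outside its closure.\<close>

lemma outward_normal_unique:
  assumes T: "T \<in> \<T>" and F: "F \<in> faces_of_cell \<F> T" and n: "outward_normal T F n1" "outward_normal T F n2"
  shows "n1 = n2"
proof -
  have "\<exists>n. \<forall>F\<in>faces_of_cell \<F> T. outward_normal T F (n F)"
    using faces(5)[OF T] by metis
  then obtain n where nn: "\<And>F. F \<in> faces_of_cell \<F> T \<Longrightarrow> outward_normal T F (n F)"
    by blast
  have F\<F>: "F \<in> \<F>" "UNIV \<inter> F \<noteq> {}"
    using F faces(3) by (auto simp: face_cell)
  obtain y where y: "y \<in> F" "y \<notin> Z"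
    by (rule generic_face_point[OF F\<F>(1) open_UNIV F\<F>(2)])
  have flat: "flat_face n1 (n1 \<bullet> face_center F) F" "flat_face n2 (n2 \<bullet> face_center F) F"
    using outward_center[OF T F] n by auto
  have "norm n2 = 1" "\<forall>x\<in>F. \<forall>y\<in>F. n2 \<bullet> x = n2 \<bullet> y"
    using n(2) unfolding outward_normal_def by blast+
  then have "n2 = n1 \<or> n2 = - n1"
    by (rule flat_face_normal_unique[OF flat(1)])
  moreover have False if "n2 = - n1"
  proof -
    \<comment> \<open>The half-ball lemma wants a normal for every face of the cell, so each
      candidate is inserted into one fixed family of normals.\<close>
    have m: "\<And>F'. F' \<in> faces_of_cell \<F> T \<Longrightarrow> outward_normal T F' ((n(F := n1)) F')"
      "\<And>F'. F' \<in> faces_of_cell \<F> T \<Longrightarrow> outward_normal T F' ((n(F := n2)) F')"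
      using nn n by auto
    interpret f1: faced_cell T "faces_of_cell \<F> T" "n(F := n1)" "\<lambda>F'. (n(F := n1)) F' \<bullet> face_center F'" Z
      by (rule faced[OF T m(1)])
    interpret f2: faced_cell T "faces_of_cell \<F> T" "n(F := n2)" "\<lambda>F'. (n(F := n2)) F' \<bullet> face_center F'" Z
      by (rule faced[OF T m(2)])
    obtain e1 where e1: "e1 > 0" "\<And>x. x \<in> ball y e1 \<Longrightarrow> (n(F := n1)) F \<bullet> x < (n(F := n1)) F \<bullet> face_center F \<Longrightarrow> x \<in> T"
      by (rule f1.half_ball[OF F y]) (rule that, assumption+)
    obtain e2 where e2: "e2 > 0" "\<And>x. x \<in> ball y e2 \<Longrightarrow> (n(F := n2)) F \<bullet> x > (n(F := n2)) F \<bullet> face_center F \<Longrightarrow> x \<notin> closure T"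
      by (rule f2.half_ball[OF F y]) (rule that, assumption+)
    have n1: "n1 \<bullet> y = n1 \<bullet> face_center F" "norm n1 = 1"
      using flat_faceD(1,4)[OF flat(1)] y by auto
    define t where "t = min e1 e2 / 2"
    have t: "t > 0" "t < e1" "t < e2"
      using e1(1) e2(1) by (auto simp: t_def)
    have "y - t *\<^sub>R n1 \<in> T"
      by (rule e1(2)) (use t n1 in \<open>auto simp: dist_norm inner_diff_right dot_square_norm\<close>)
    moreover have "y - t *\<^sub>R n1 \<notin> closure T"
      by (rule e2(2)) (use t n1 that in \<open>auto simp: dist_norm inner_diff_right dot_square_norm\<close>)
    ultimately show False
      using closure_subset by blast
  qed
  ultimately show ?thesis by blast
qed

lemma normal:
  assumes "T \<in> \<T>" "F \<in> faces_of_cell \<F> T"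
  shows "outward_normal T F (normal T F)"
proof -
  have "\<exists>!n. outward_normal T F n"
    using faces(5)[OF assms] outward_normal_unique[OF assms] by blast
  then show ?thesis
    unfolding normal_def by (rule theI')
qed

lemma faced_normal: "T \<in> \<T> \<Longrightarrow> faced_cell T (faces_of_cell \<F> T) (normal T) (\<lambda>F. normal T F \<bullet> face_center F) Z"
  using faced normal by blast

lemma flat: "T \<in> \<T> \<Longrightarrow> F \<in> faces_of_cell \<F> T \<Longrightarrow> flat_face (normal T F) (normal T F \<bullet> face_center F) F"
  by (rule outward_center[OF _ _ normal])

lemma negligible_outside_cells: "negligible (\<Omega> - \<Union>\<T>)"
proof -
  have "negligible (frontier T)" if T: "T \<in> \<T>" for T
  proof -
    have "negligible (\<Union>((\<lambda>F. closure F) ` faces_of_cell \<F> T))"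
    proof (rule negligible_Union)
      show "finite (closure ` faces_of_cell \<F> T)"
        using faces(1) by (simp add: faces_of_cell_def)
      fix A assume "A \<in> closure ` faces_of_cell \<F> T"
      then obtain F where F: "F \<in> faces_of_cell \<F> T" "A = closure F" by blast
      have "closure F \<subseteq> {x. normal T F \<bullet> x = normal T F \<bullet> face_center F}"
        by (rule closure_minimal[OF flat_faceD(4)[OF flat[OF T F(1)]] closed_hyperplane])
      moreover have "normal T F \<noteq> 0"
        using flat_faceD(1)[OF flat[OF T F(1)]] by auto
      ultimately show "negligible A"
        using F(2) negligible_hyperplane negligible_subset by blast
    qed
    then show ?thesis
      using faces(4)[OF T] by simp
  qed
  then have "negligible (\<Union>(frontier ` \<T>))"
    using cells(1) by (intro negligible_Union) auto
  moreover have "\<Omega> - \<Union>\<T> \<subseteq> \<Union>(frontier ` \<T>)"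
  proof
    fix x assume x: "x \<in> \<Omega> - \<Union>\<T>"
    then obtain T where T: "T \<in> \<T>" "x \<in> closure T"
      using cells(5) closure_subset by blast
    then have "x \<in> frontier T"
      using x polytopal_facts(1)[OF cells(2)[OF T(1)]] by (auto simp: frontier_def interior_open)
    then show "x \<in> \<Union>(frontier ` \<T>)"
      using T(1) by blast
  qed
  ultimately show ?thesis
    using negligible_subset by blast
qed

end

section \<open>Symmetric matrices\<close>

lemma symmetric_matrix_inner_commute:
  "transpose A = A \<Longrightarrow> (A *v x) \<bullet> y = (A *v y) \<bullet> (x :: real^'n::finite)"
  by (metis dot_lmul_matrix inner_commute vector_transpose_matrix)

text \<open>Makes the \<open>Min\<close> in \<open>min_eigenvalue\<close> meaningful. Eigenvectors
  of distinct eigenvalues are orthogonal, so there are finitely many eigenvalues; a minimizer of the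
  Rayleigh quotient is an eigenvector, so there is at least one.\<close>

lemma symmetric_eigenvalues:
  fixes A :: "real^'n::finite^'n"
  assumes sym: "transpose A = A"
  defines "S \<equiv> {l. \<exists>v. v \<noteq> 0 \<and> A *v v = l *\<^sub>R v}"
  shows "finite S" "S \<noteq> {}"
proof -
  note comm = symmetric_matrix_inner_commute[OF sym]
  define v where "v l = (SOME v. v \<noteq> 0 \<and> A *v v = l *\<^sub>R v)" for l
  have v: "v l \<noteq> 0" "A *v v l = l *\<^sub>R v l" if "l \<in> S" for l
    using someI_ex[of "\<lambda>v. v \<noteq> 0 \<and> A *v v = l *\<^sub>R v"] that by (auto simp: S_def v_def)
  have orth: "v l \<bullet> v m = 0" if "l \<in> S" "m \<in> S" "l \<noteq> m" for l m
  proof -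
    have "l * (v l \<bullet> v m) = m * (v l \<bullet> v m)"
      using comm[of "v l" "v m"] v(2)[OF that(1)] v(2)[OF that(2)] by (simp add: inner_commute)
    then show ?thesis using that(3) by simp
  qed
  have inj: "inj_on v S"
  proof (rule inj_onI, rule ccontr)
    fix l m assume lm: "l \<in> S" "m \<in> S" "v l = v m" "l \<noteq> m"
    then have "v l \<bullet> v l = 0" using orth[OF lm(1,2,4)] by simp
    then show False using v(1)[OF lm(1)] by simp
  qed
  have "pairwise orthogonal (v ` S)"
    unfolding pairwise_def orthogonal_def using orth by (metis imageE)
  moreover have "0 \<notin> v ` S" using v(1) by (metis imageE)
  ultimately have "independent (v ` S)"
    by (rule pairwise_orthogonal_independent)
  then have "finite (v ` S)"
    by (rule finiteI_independent)
  then show "finite S" using inj by (rule finite_imageD)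
  define Q where "Q x = (A *v x) \<bullet> x" for x
  have cQ: "continuous_on (sphere 0 1) Q"
    unfolding Q_def[abs_def] by (intro continuous_intros matrix_vector_mult_linear_continuous_on)
  have ne: "sphere (0 :: real^'n) 1 \<noteq> {}"
    by simp
  obtain x where x: "x \<in> sphere 0 1" "\<And>y. y \<in> sphere 0 1 \<Longrightarrow> Q x \<le> Q y"
    using continuous_attains_inf[OF compact_sphere ne cQ] by blast
  have x1: "norm x = 1" using x(1) by simp
  have low: "Q x * (norm y)\<^sup>2 \<le> Q y" for y
  proof (cases "y = 0")
    case False
    then have "Q x \<le> Q (y /\<^sub>R norm y)"
      by (intro x(2)) simp
    also have "\<dots> = Q y / (norm y)\<^sup>2"
      by (simp add: Q_def matrix_vector_mult_scaleR power2_eq_square divide_inverse)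
    finally show ?thesis
      using False by (simp add: field_simps)
  qed (simp add: Q_def)
  define z where "z = A *v x - Q x *\<^sub>R x"
  have "z = 0"
  proof (rule ccontr)
    assume "z \<noteq> 0"
    then have z: "z \<bullet> z > 0" by simp
    define R where "R = Q z - Q x * (z \<bullet> z)"
    have R: "R \<ge> 0" using low[of z] by (simp add: R_def dot_square_norm)
    have quad: "0 \<le> - 2 * t * (z \<bullet> z) + t\<^sup>2 * R" for t
    proof -
      have e: "A *v x = z + Q x *\<^sub>R x" by (simp add: z_def)
      have xx: "x \<bullet> x = 1" using x1 by (simp add: dot_square_norm)
      have zx: "z \<bullet> x = 0" using xx by (simp add: z_def inner_diff_left Q_def)
      have Az: "(A *v x) \<bullet> z = z \<bullet> z" unfolding e using zx by (simp add: inner_add_left inner_add_right inner_commute)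
      have Az': "(A *v z) \<bullet> x = z \<bullet> z" using Az comm[of z x] by simp
      have "Q (x - t *\<^sub>R z) = Q x - t * ((A *v x) \<bullet> z) - t * ((A *v z) \<bullet> x) + t\<^sup>2 * Q z"
        by (simp add: Q_def matrix_vector_mult_diff_distrib matrix_vector_mult_scaleR
            inner_diff_left inner_diff_right power2_eq_square algebra_simps)
      then have "Q (x - t *\<^sub>R z) = Q x - 2 * t * (z \<bullet> z) + t\<^sup>2 * Q z"
        unfolding Az Az' by simp
      moreover have "(norm (x - t *\<^sub>R z))\<^sup>2 = 1 + t\<^sup>2 * (z \<bullet> z)"
        unfolding power2_norm_eq_inner using zx xx by (simp add: inner_diff_left inner_diff_right inner_commute power2_eq_square)
      ultimately show ?thesis
        using low[of "x - t *\<^sub>R z"] by (simp add: R_def algebra_simps)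
    qed
    \<comment> \<open>A step of this length along \<open>- z\<close> would lower the quotient: the
      linear term outweighs the quadratic one because \<open>t * R < z \<bullet> z\<close>.\<close>
    define t where "t = z \<bullet> z / (R + 1)"
    have t: "t > 0" "t * (R + 1) = z \<bullet> z" using z R by (auto simp: t_def)
    have "0 \<le> t * (- 2 * (z \<bullet> z) + t * R)"
      using quad[of t] by (simp add: power2_eq_square algebra_simps)
    then have "2 * (z \<bullet> z) \<le> t * R"
      using t(1) by (simp add: zero_le_mult_iff)
    then show False
      using t z by (simp add: algebra_simps)
  qed
  then have "A *v x = Q x *\<^sub>R x" by (simp add: z_def)
  moreover have "x \<noteq> 0" using x1 by auto
  ultimately show "S \<noteq> {}" by (auto simp: S_def)
qed

text \<open>Turns the ellipticity bound, which concerns a quadratic form, into an operator bound by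
  polarization, without diagonalizing \<open>A\<close>.\<close>

lemma psd_norm_le:
  fixes A :: "real^'n::finite^'n"
  assumes sym: "transpose A = A" and "\<And>x. 0 \<le> (A *v x) \<bullet> x" "\<And>x. (A *v x) \<bullet> x \<le> L * (norm x)\<^sup>2"
  shows "norm (A *v x) \<le> L * norm x"
proof (cases "A *v x = 0")
  case True
  have "0 \<le> L * (norm x)\<^sup>2" using assms(2,3)[of x] by linarith
  then show ?thesis using True by (cases "x = 0") (auto simp: zero_le_mult_iff)
next
  case False
  define z where "z = A *v x"
  have x: "norm x > 0" and z: "norm z > 0" using False by (auto simp: z_def)
  \<comment> \<open>Scaling \<open>x\<close> to the norm of \<open>z\<close> makes the triangle
    inequality for \<open>y + z\<close> cheap enough to keep the constant \<open>L\<close>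
    itself.\<close>
  define s where "s = norm z / norm x"
  define y where "y = s *\<^sub>R x"
  have s: "s > 0" using x z by (simp add: s_def)
  have ny: "norm y = norm z" using x z by (simp add: y_def s_def)
  have Ay: "A *v y = s *\<^sub>R z" by (simp add: y_def z_def matrix_vector_mult_scaleR)
  have "(A *v (y + z)) \<bullet> (y + z) - (A *v (y - z)) \<bullet> (y - z) = 4 * ((A *v y) \<bullet> z)"
    using symmetric_matrix_inner_commute[OF sym, of z y]
    by (simp add: matrix_vector_mult_diff_distrib matrix_vector_right_distrib inner_diff_left inner_diff_right inner_add_left inner_add_right)
  then have "4 * ((A *v y) \<bullet> z) \<le> (A *v (y + z)) \<bullet> (y + z)"
    using assms(2)[of "y - z"] by linarith
  also have "\<dots> \<le> L * (norm (y + z))\<^sup>2" by (rule assms(3))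
  also have "\<dots> \<le> L * (2 * norm z)\<^sup>2"
  proof (rule mult_left_mono)
    show "(norm (y + z))\<^sup>2 \<le> (2 * norm z)\<^sup>2"
      using norm_triangle_ineq[of y z] ny by (intro power_mono) auto
    show "0 \<le> L" using assms(2,3)[of x] x by (smt (verit) zero_le_mult_iff zero_less_power)
  qed
  finally have "s * (norm z)\<^sup>2 \<le> L * (norm z)\<^sup>2"
    by (simp add: Ay dot_square_norm)
  then have "s \<le> L" using z by simp
  then show ?thesis using x by (simp add: s_def z_def field_simps)
qed

lemma norm_le_sum_of_components:
  fixes x :: "real^'n::finite"
  assumes "\<And>i. \<bar>x $ i\<bar> \<le> b"
  shows "norm x \<le> real CARD('n) * b"
proof -
  have "norm x \<le> (\<Sum>i\<in>UNIV. \<bar>x $ i\<bar>)" by (rule norm_le_l1_cart)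
  also have "\<dots> \<le> (\<Sum>i\<in>(UNIV :: 'n set). b)" by (intro sum_mono assms)
  finally show ?thesis by simp
qed

section \<open>The exact solution on the faces of the mesh\<close>

text \<open>The upper bound that \<open>normal_jump_eq_0\<close> asks for. The power comes from
  rescaling the bump, and the constant depends on neither \<open>r\<close> nor
  \<open>z\<close>.\<close>

lemma bump_integral_bound:
  fixes h :: "real^'n::finite \<Rightarrow> real"
  assumes D: "D \<in> sets borel" and h: "h \<in> borel_measurable (lebesgue_on D)"
    and B: "AE x in lebesgue_on D. \<bar>h x\<bar> \<le> B" and r: "r > 0"
  shows "\<bar>\<integral>x. h x * bump 1 z r x \<partial>lebesgue_on D\<bar> \<le> \<bar>B\<bar> * (\<integral>\<xi>. bump 1 0 1 (\<xi> :: real^'n) \<partial>lborel) * r ^ CARD('n)"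
proof -
  have bm: "bump 1 z r \<in> borel_measurable borel"
    using elem_smooth_continuous[OF elem_smooth_bump] by (rule borel_measurable_continuous_onI)
  have bi: "integrable lborel (bump 1 z r)"
    by (rule lborel_integrable_bounded_support[OF bm bounded_cball[of z r], where B = 1])
      (use r in \<open>auto simp: bump_bounds abs_of_nonneg dist_norm norm_minus_commute intro!: bump_eq_0\<close>)
  have m: "(\<lambda>x. indicator D x * bump 1 z r x) \<in> borel_measurable borel"
    using bm D by measurable
  have iD: "integrable lborel (\<lambda>x. indicator D x * bump 1 z r x)"
    using integrable_mult_indicator[OF _ bi, of D] D by simp
  have iL: "integrable (lebesgue_on D) (bump 1 z r)"
    using lebesgue_on_lborel(1)[OF D m] iD by simp
  have iB: "integrable (lebesgue_on D) (\<lambda>x. \<bar>B\<bar> * bump 1 z r x)"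
    using iL by simp
  have mb: "bump 1 z r \<in> borel_measurable (lebesgue_on D)"
    using iL by blast
  have bnd: "AE x in lebesgue_on D. norm (h x * bump 1 z r x) \<le> \<bar>B\<bar> * bump 1 z r x"
    using B by eventually_elim (auto simp: abs_mult bump_bounds abs_of_nonneg intro!: mult_right_mono)
  have ih: "integrable (lebesgue_on D) (\<lambda>x. h x * bump 1 z r x)"
    by (rule Bochner_Integration.integrable_bound[OF iB])
      (use h mb bnd in \<open>auto elim!: eventually_mono intro: order_trans[OF _ abs_ge_self]\<close>)
  have "\<bar>\<integral>x. h x * bump 1 z r x \<partial>lebesgue_on D\<bar> \<le> (\<integral>x. \<bar>h x * bump 1 z r x\<bar> \<partial>lebesgue_on D)"
    by (rule integral_abs_bound)
  also have "\<dots> \<le> (\<integral>x. \<bar>B\<bar> * bump 1 z r x \<partial>lebesgue_on D)"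
    by (rule integral_mono_AE) (use ih iB bnd in auto)
  also have "\<dots> = \<bar>B\<bar> * (\<integral>x. indicator D x * bump 1 z r x \<partial>lborel)"
    using lebesgue_on_lborel(2)[OF D m] by simp
  also have "\<dots> \<le> \<bar>B\<bar> * (\<integral>x. bump 1 z r x \<partial>lborel)"
    by (intro mult_left_mono integral_mono iD bi) (auto simp: indicator_def bump_bounds)
  also have "(\<integral>x. bump 1 z r x \<partial>lborel) = r ^ CARD('n) * (\<integral>\<xi>. bump 1 0 1 (\<xi> :: real^'n) \<partial>lborel)"
  proof -
    have "bump 1 z r (z + r *\<^sub>R \<xi>) = bump 1 0 1 \<xi>" for \<xi> :: "real^'n"
      using r by (simp add: bump_def power_mult_distrib)
    then show ?thesis
      using lborel_integral_scale[OF r bm, of z] by simp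
  qed
  finally show ?thesis
    by (simp add: mult_ac)
qed

lemma Ck_on_2_bounded_C1:
  assumes "Ck_on 2 T u" and B: "\<And>is x. length is \<le> 2 \<Longrightarrow> x \<in> T \<Longrightarrow> \<bar>iter_partial is u x\<bar> \<le> B"
  shows "bounded_C1 T u" "bounded_C1 T (\<lambda>x. grad u x $ i)"
proof -
  have d: "iter_partial is u differentiable at x" if "length is < 2" "x \<in> T" for "is" x
    using assms(1) that unfolding Ck_on_def by blast
  have c: "continuous_on T (iter_partial is u)" if "length is \<le> 2" for "is"
    using assms(1) that unfolding Ck_on_def by blast
  have gi: "grad (iter_partial is u) = (\<lambda>x. \<chi> j. iter_partial (j # is) u x)" for "is"
    by (simp add: grad_def fun_eq_iff)
  have *: "bounded_C1 T (iter_partial is u)" if len: "length is < 2" for "is"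
    unfolding bounded_C1_def
  proof (intro conjI ballI)
    show "iter_partial is u differentiable at x" if "x \<in> T" for x
      using d len that by blast
    show "continuous_on T (grad (iter_partial is u))"
      unfolding gi using len by (intro continuous_on_vec_lambda c) simp
    have "\<bar>iter_partial is u x\<bar> \<le> \<bar>B\<bar> * (CARD('a) + 1) \<and> norm (grad (iter_partial is u) x) \<le> \<bar>B\<bar> * (CARD('a) + 1)" if x: "x \<in> T" for x
    proof
      have "\<bar>iter_partial is u x\<bar> \<le> \<bar>B\<bar> * 1"
        using B[of "is" x] len x by simp
      also have "\<dots> \<le> \<bar>B\<bar> * (CARD('a) + 1)"
        by (intro mult_left_mono) auto
      finally show "\<bar>iter_partial is u x\<bar> \<le> \<bar>B\<bar> * (CARD('a) + 1)" .
      have "norm (grad (iter_partial is u) x) \<le> (\<Sum>j\<in>UNIV. \<bar>grad (iter_partial is u) x $ j\<bar>)"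
        by (rule norm_le_l1_cart)
      also have "\<dots> \<le> (\<Sum>j\<in>(UNIV::'a set). \<bar>B\<bar>)"
      proof (rule sum_mono)
        fix j :: 'a
        have "length (j # is) \<le> 2" using len by simp
        from B[OF this x] show "\<bar>grad (iter_partial is u) x $ j\<bar> \<le> \<bar>B\<bar>"
          unfolding gi vec_lambda_beta by linarith
      qed
      also have "\<dots> \<le> \<bar>B\<bar> * (CARD('a) + 1)"
        by (simp add: algebra_simps)
      finally show "norm (grad (iter_partial is u) x) \<le> \<bar>B\<bar> * (CARD('a) + 1)" .
    qed
    then show "\<exists>B. \<forall>x\<in>T. \<bar>iter_partial is u x\<bar> \<le> B \<and> norm (grad (iter_partial is u) x) \<le> B"
      by blast
  qed
  show "bounded_C1 T u"
    using *[of "[]"] by simp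
  show "bounded_C1 T (\<lambda>x. grad u x $ i)"
    using *[of "[i]"] by (simp add: grad_def)
qed

section \<open>The discrete and the exact problem\<close>

locale mpfa_problem = mesh \<Omega> "cells M" "faces M" \<S>
  for \<Omega> :: "(real^'n::finite) set" and M :: "'n mpfa" and \<S> :: "(real^'n) set set" +
  fixes \<P> :: "(real^'n) set set" and K :: "real^'n \<Rightarrow> real^'n^'n" and f u :: "real^'n \<Rightarrow> real"
    and \<rho> l \<Lambda> :: real
  assumes domain: "polytopal \<Omega>" and partition: "polytopal_partition \<Omega> \<P>"
    and K_const: "\<And>P. P \<in> \<P> \<Longrightarrow> \<exists>A. \<forall>x\<in>P. K x = A"
    and K_sym: "\<And>x. x \<in> \<Omega> \<Longrightarrow> transpose (K x) = K x"
    and K_ell: "0 < l" "\<And>x \<xi>. x \<in> \<Omega> \<Longrightarrow> l * (norm \<xi>)\<^sup>2 \<le> (K x *v \<xi>) \<bullet> \<xi>"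
      "\<And>x \<xi>. x \<in> \<Omega> \<Longrightarrow> (K x *v \<xi>) \<bullet> \<xi> \<le> \<Lambda> * (norm \<xi>)\<^sup>2"
    and data: "mpfa_data \<rho> \<Omega> \<P> K M"
    and source: "L2_on \<Omega> f" and solution: "weak_solution \<Omega> K f u"
    and u_cont: "continuous_on (closure \<Omega>) u" and u_C2: "\<And>P. P \<in> \<P> \<Longrightarrow> Ck_closure 2 P u"
begin

abbreviation \<T> where "\<T> \<equiv> cells M"
abbreviation \<F> where "\<F> \<equiv> faces M"
abbreviation FT where "FT \<equiv> faces_of_cell \<F>"
abbreviation U where "U \<equiv> C2_norm \<P> u"
abbreviation A where "A \<equiv> cell_tensor K"
abbreviation xT where "xT \<equiv> cell_point M"

lemma \<Omega>_facts: "open \<Omega>" "bounded \<Omega>" "interior (closure \<Omega>) = \<Omega>"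
  using polytopal_facts[OF domain] by auto

lemma cell_open: "T \<in> \<T> \<Longrightarrow> open T" and cell_bounded: "T \<in> \<T> \<Longrightarrow> bounded T" and cell_nonempty: "T \<in> \<T> \<Longrightarrow> T \<noteq> {}"
  using polytopal_facts[OF cells(2)] by auto

lemma cell_part:
  assumes "T \<in> \<T>"
  obtains P where "P \<in> \<P>" "T \<subseteq> P"
proof -
  have "\<forall>T\<in>\<T>. \<exists>!P. P \<in> \<P> \<and> T \<subseteq> P" using data unfolding mpfa_data_def by (elim conjE)
  then show thesis using assms that by (meson bspec)
qed

lemma part: "P \<in> \<P> \<Longrightarrow> P \<subseteq> \<Omega>" "P \<in> \<P> \<Longrightarrow> polytopal P" "finite \<P>"
  using partition by (auto simp: polytopal_partition_def)

lemma K_cell: "T \<in> \<T> \<Longrightarrow> x \<in> T \<Longrightarrow> K x = A T"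
proof -
  assume T: "T \<in> \<T>" and x: "x \<in> T"
  obtain P where P: "P \<in> \<P>" "T \<subseteq> P" by (rule cell_part[OF T])
  obtain B where "\<forall>x\<in>P. K x = B" using K_const[OF P(1)] by blast
  then have B: "\<forall>x\<in>T. K x = B" using P(2) by blast
  have "A T = B"
    unfolding cell_tensor_def
  proof (rule the_equality)
    show "\<forall>x\<in>T. K x = B" by (rule B)
    show "C = B" if "\<forall>x\<in>T. K x = C" for C
      using that B x by metis
  qed
  then show ?thesis using B x by simp
qed

lemma A_facts:
  assumes T: "T \<in> \<T>"
  shows "transpose (A T) = A T" "l * (norm \<xi>)\<^sup>2 \<le> (A T *v \<xi>) \<bullet> \<xi>" "(A T *v \<xi>) \<bullet> \<xi> \<le> \<Lambda> * (norm \<xi>)\<^sup>2"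
proof -
  obtain x where x: "x \<in> T" using cell_nonempty[OF T] by blast
  then have x\<Omega>: "x \<in> \<Omega>" using cells(3)[OF T] by blast
  show "transpose (A T) = A T" "l * (norm \<xi>)\<^sup>2 \<le> (A T *v \<xi>) \<bullet> \<xi>" "(A T *v \<xi>) \<bullet> \<xi> \<le> \<Lambda> * (norm \<xi>)\<^sup>2"
    using K_sym[OF x\<Omega>] K_ell(2,3)[OF x\<Omega>] K_cell[OF T x] by simp_all
qed

lemma A_inner_commute: "T \<in> \<T> \<Longrightarrow> (A T *v x) \<bullet> y = (A T *v y) \<bullet> x"
  by (rule symmetric_matrix_inner_commute[OF A_facts(1)])

text \<open>\<open>Ck_norm\<close> is a supremum of reals and bounds its elements only if they are
  bounded above. This follows from the continuous extensions to the compact closure of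
  \<open>P\<close> and from there being finitely many multi-indices.\<close>

lemma Ck_norm_bdd:
  assumes "P \<in> \<P>"
  shows "bdd_above {\<bar>iter_partial is u x\<bar> | is x. length is \<le> 2 \<and> x \<in> P}"
proof -
  have cP: "compact (closure P)"
    using polytopal_facts(2)[OF part(2)[OF assms]] by (simp add: compact_closure)
  have "\<exists>B. \<forall>x\<in>P. \<bar>iter_partial is u x\<bar> \<le> B" if len: "length is \<le> 2" for "is"
  proof -
    obtain g where g: "continuous_on (closure P) g" "\<And>x. x \<in> P \<Longrightarrow> g x = iter_partial is u x"
      using u_C2[OF assms] len unfolding Ck_closure_def by blast
    have "bounded (g ` closure P)"
      by (intro compact_imp_bounded compact_continuous_image g(1) cP)
    then obtain B where "\<And>x. x \<in> closure P \<Longrightarrow> \<bar>g x\<bar> \<le> B"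
      by (auto simp: bounded_iff)
    then show ?thesis
      using g(2) closure_subset by (metis subsetD)
  qed
  then obtain B where B: "\<And>is x. length is \<le> 2 \<Longrightarrow> x \<in> P \<Longrightarrow> \<bar>iter_partial is u x\<bar> \<le> B is"
    by metis
  have fin: "finite {is :: 'n list. length is \<le> 2}"
    using finite_lists_length_le[of "UNIV :: 'n set" 2] by simp
  show ?thesis
  proof (rule bdd_aboveI[of _ "Max (B ` {is. length is \<le> 2})"])
    fix y assume "y \<in> {\<bar>iter_partial is u x\<bar> | is x. length is \<le> 2 \<and> x \<in> P}"
    then obtain "is" x where y: "y = \<bar>iter_partial is u x\<bar>" "length is \<le> 2" "x \<in> P" by blast
    then have "y \<le> B is" using B by simp
    also have "\<dots> \<le> Max (B ` {is. length is \<le> 2})"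
      using fin y(2) by (intro Max_ge) auto
    finally show "y \<le> Max (B ` {is. length is \<le> 2})" .
  qed
qed

lemma U_bound:
  assumes T: "T \<in> \<T>" and x: "x \<in> T" and len: "length is \<le> 2"
  shows "\<bar>iter_partial is u x\<bar> \<le> U"
proof -
  obtain P where P: "P \<in> \<P>" "T \<subseteq> P" by (rule cell_part[OF T])
  have "\<bar>iter_partial is u x\<bar> \<le> Ck_norm 2 P u"
    unfolding Ck_norm_def using x P(2) len by (intro cSup_upper Ck_norm_bdd[OF P(1)]) blast
  also have "\<dots> \<le> U"
    unfolding C2_norm_def using part(3) P(1) by (intro Max_ge) auto
  finally show ?thesis .
qed

lemma U_nonneg: "T \<in> \<T> \<Longrightarrow> U \<ge> 0"
  using cell_nonempty U_bound[of T _ "[]"] abs_ge_zero order_trans by (metis all_not_in_conv le0 list.size(3))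

lemma u_Ck_cell: "T \<in> \<T> \<Longrightarrow> Ck_on 2 T u"
proof -
  assume T: "T \<in> \<T>"
  obtain P where P: "P \<in> \<P>" "T \<subseteq> P" by (rule cell_part[OF T])
  have "Ck_on 2 P u" using u_C2[OF P(1)] by (simp add: Ck_closure_def)
  then show ?thesis
    using P(2) unfolding Ck_on_def by (meson continuous_on_subset subsetD)
qed

lemma u_bounded_C1: "T \<in> \<T> \<Longrightarrow> bounded_C1 T u" "T \<in> \<T> \<Longrightarrow> bounded_C1 T (\<lambda>x. grad u x $ i)"
  using Ck_on_2_bounded_C1[OF u_Ck_cell, of T U] U_bound[of T] by simp_all

sublocale cellwise_solution \<Omega> K f u \<T> A
proof
  show "open \<Omega>" "bounded \<Omega>" using \<Omega>_facts by auto
  show "finite \<T>" "pairwise disjnt \<T>" using cells by auto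
  show "negligible (\<Omega> - \<Union>\<T>)" by (rule negligible_outside_cells)
  show "L2_on \<Omega> f" "weak_solution \<Omega> K f u" using source solution by auto
qed (fact cell_open cells(3) K_cell u_bounded_C1)+

text \<open>One-sided trace of the gradient: on a common face the extensions from its two cells
  differ in general.\<close>

definition G :: "(real^'n) set \<Rightarrow> real^'n \<Rightarrow> real^'n" where
  "G T = (SOME g. continuous_on (closure T) g \<and> (\<forall>x\<in>T. g x = grad u x))"

lemma G: "T \<in> \<T> \<Longrightarrow> continuous_on (closure T) (G T)" "T \<in> \<T> \<Longrightarrow> x \<in> T \<Longrightarrow> G T x = grad u x"
proof -
  have "continuous_on (closure T) (G T) \<and> (\<forall>x\<in>T. G T x = grad u x)" if T: "T \<in> \<T>"
  proof -
    obtain P where P: "P \<in> \<P>" "T \<subseteq> P" by (rule cell_part[OF T])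
    have "\<exists>g. continuous_on (closure P) g \<and> (\<forall>x\<in>P. g x = iter_partial [i] u x)" for i
    proof -
      have "length [i] \<le> 2" by simp
      then show ?thesis
        using u_C2[OF P(1)] unfolding Ck_closure_def by blast
    qed
    then obtain g where g: "\<And>i. continuous_on (closure P) (g i)" "\<And>i x. x \<in> P \<Longrightarrow> g i x = iter_partial [i] u x"
      by metis
    have "continuous_on (closure T) (\<lambda>x. \<chi> i. g i x)"
      by (intro continuous_on_vec_lambda continuous_on_subset[OF g(1)] closure_mono P(2))
    moreover have "\<forall>x\<in>T. (\<chi> i. g i x) = grad u x"
      using g(2) P(2) by (auto simp: grad_def vec_eq_iff simp del: iter_partial.simps)
    ultimately have "\<exists>g. continuous_on (closure T) g \<and> (\<forall>x\<in>T. g x = grad u x)"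
      by blast
    then show ?thesis
      unfolding G_def by (rule someI_ex)
  qed
  then show "T \<in> \<T> \<Longrightarrow> continuous_on (closure T) (G T)" "T \<in> \<T> \<Longrightarrow> x \<in> T \<Longrightarrow> G T x = grad u x"
    by blast+
qed

lemma wG: "T \<in> \<T> \<Longrightarrow> continuous_on (closure T) (\<lambda>x. A T *v G T x)" "T \<in> \<T> \<Longrightarrow> x \<in> T \<Longrightarrow> A T *v G T x = w T x"
  using G by (auto intro: continuous_on_compose2[OF matrix_vector_mult_linear_continuous_on] simp: w_def)

section \<open>Transmission and boundary conditions on the faces\<close>

lemma face_in: "F \<in> FT T \<Longrightarrow> F \<in> \<F>" "F \<in> FT T \<Longrightarrow> y \<in> F \<Longrightarrow> y \<in> closure T" "T \<in> \<T> \<Longrightarrow> F \<in> FT T \<Longrightarrow> y \<in> F \<Longrightarrow> y \<notin> T"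
  using cell_open by (auto simp: face_cell frontier_def interior_open)

lemma plane: "T \<in> \<T> \<Longrightarrow> F \<in> FT T \<Longrightarrow> y \<in> F \<Longrightarrow> normal T F \<bullet> y = normal T F \<bullet> face_center F"
  using flat_faceD(4)[OF flat] by blast

lemma norm_normal: "T \<in> \<T> \<Longrightarrow> F \<in> FT T \<Longrightarrow> norm (normal T F) = 1"
  using flat_faceD(1)[OF flat] .

lemma half_ball_cell:
  assumes T: "T \<in> \<T>" and F: "F \<in> FT T" and y: "y \<in> F" "y \<notin> Z"
  obtains e where "e > 0" "\<And>x. x \<in> ball y e \<Longrightarrow> normal T F \<bullet> (x - y) < 0 \<Longrightarrow> x \<in> T"
    "\<And>x. x \<in> ball y e \<Longrightarrow> normal T F \<bullet> (x - y) > 0 \<Longrightarrow> x \<notin> closure T"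
    "\<And>x. x \<in> ball y e \<Longrightarrow> normal T F \<bullet> (x - y) = 0 \<Longrightarrow> x \<in> F"
proof -
  interpret c: faced_cell T "FT T" "normal T" "\<lambda>F. normal T F \<bullet> face_center F" Z
    by (rule faced_normal[OF T])
  obtain e where e: "e > 0" "\<And>x. x \<in> ball y e \<Longrightarrow> normal T F \<bullet> x < normal T F \<bullet> face_center F \<Longrightarrow> x \<in> T"
    "\<And>x. x \<in> ball y e \<Longrightarrow> normal T F \<bullet> x > normal T F \<bullet> face_center F \<Longrightarrow> x \<notin> closure T"
    "\<And>x. x \<in> ball y e \<Longrightarrow> normal T F \<bullet> x = normal T F \<bullet> face_center F \<Longrightarrow> x \<in> F"
    by (rule c.half_ball[OF F y]) (rule that, assumption+)
  show ?thesis
    by (rule that[OF e(1)]) (use e(2-4) plane[OF T F y(1)] in \<open>auto simp: inner_diff_right\<close>)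
qed

text \<open>Carries pointwise identities from the points off \<open>Z\<close>, which are dense in
  the face, to the whole face.\<close>

lemma generic_extend:
  fixes h :: "real^'n \<Rightarrow> real"
  assumes F: "F \<in> \<F>" and h: "continuous_on F h" and 0: "\<And>y. y \<in> F \<Longrightarrow> y \<notin> Z \<Longrightarrow> h y = 0" and y: "y \<in> F"
  shows "h y = 0"
proof (rule ccontr)
  assume "h y \<noteq> 0"
  have "openin (top_of_set F) (F \<inter> h -` (- {0}))"
    using h by (intro continuous_openin_preimage_gen) auto
  then obtain V where V: "open V" "F \<inter> h -` (- {0}) = F \<inter> V"
    unfolding openin_open by blast
  then have "V \<inter> F \<noteq> {}"
    using y \<open>h y \<noteq> 0\<close> by blast
  then obtain z where "z \<in> V" "z \<in> F" "z \<notin> Z"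
    by (rule generic_face_point[OF F V(1)])
  then show False
    using V(2) 0 by blast
qed

lemma cells_disjoint: "T \<in> \<T> \<Longrightarrow> T' \<in> \<T> \<Longrightarrow> T \<noteq> T' \<Longrightarrow> x \<in> T \<Longrightarrow> x \<notin> T'"
  using cells(4) by (auto simp: pairwise_def disjnt_def)

lemma cells_disjoint_closure: "T \<in> \<T> \<Longrightarrow> T' \<in> \<T> \<Longrightarrow> T \<noteq> T' \<Longrightarrow> x \<in> closure T \<Longrightarrow> x \<notin> T'"
proof
  assume T: "T \<in> \<T>" "T' \<in> \<T>" "T \<noteq> T'" and x: "x \<in> closure T" "x \<in> T'"
  then have "T' \<inter> closure T \<noteq> {}" by blast
  then have "T' \<inter> T \<noteq> {}"
    using open_Int_closure_eq_empty[OF cell_open[OF T(2)]] by blast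
  then show False
    using cells_disjoint[OF T] by blast
qed

text \<open>Equal normals would put a point just behind the face into both cells.\<close>

lemma opposite_normals:
  assumes T: "T \<in> \<T>" "T' \<in> \<T>" "T \<noteq> T'" and F: "F \<in> FT T" "F \<in> FT T'"
  shows "normal T' F = - normal T F"
proof -
  have F': "F \<in> \<F>" "UNIV \<inter> F \<noteq> {}"
    using F faces(3) by (auto simp: face_cell)
  obtain y where y: "y \<in> F" "y \<notin> Z"
    by (rule generic_face_point[OF F'(1) open_UNIV F'(2)])
  have "norm (normal T' F) = 1" "\<forall>x\<in>F. \<forall>y\<in>F. normal T' F \<bullet> x = normal T' F \<bullet> y"
    using normal[OF T(2) F(2)] unfolding outward_normal_def by blast+
  then have "normal T' F = normal T F \<or> normal T' F = - normal T F"
    by (rule flat_face_normal_unique[OF flat[OF T(1) F(1)]])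
  moreover have False if eq: "normal T' F = normal T F"
  proof -
    obtain e where e: "e > 0" "\<And>x. x \<in> ball y e \<Longrightarrow> normal T F \<bullet> (x - y) < 0 \<Longrightarrow> x \<in> T"
      by (rule half_ball_cell[OF T(1) F(1) y]) (rule that, assumption+)
    obtain e' where e': "e' > 0" "\<And>x. x \<in> ball y e' \<Longrightarrow> normal T' F \<bullet> (x - y) < 0 \<Longrightarrow> x \<in> T'"
      by (rule half_ball_cell[OF T(2) F(2) y]) (rule that, assumption+)
    define t where "t = min e e' / 2"
    have t: "0 < t" "t < e" "t < e'" using e(1) e'(1) by (auto simp: t_def)
    have n: "norm (normal T F) = 1" using norm_normal[OF T(1) F(1)] .
    have "y - t *\<^sub>R normal T F \<in> T"
      by (rule e(2)) (use t n in \<open>auto simp: dist_norm dot_square_norm\<close>)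
    moreover have "y - t *\<^sub>R normal T F \<in> T'"
      by (rule e'(2)) (use t n eq in \<open>auto simp: dist_norm dot_square_norm\<close>)
    ultimately show False using cells_disjoint[OF T] by blast
  qed
  ultimately show ?thesis by blast
qed

text \<open>Near \<open>y\<close> there are only the two cells and the face, so small bumps test the
  fluxes of these cells alone. The right-hand side is of order \<open>r ^ CARD('n)\<close> because
  the source is bounded, and the blow-up lemma excludes a jump.\<close>

lemma flux_continuous_generic:
  assumes T: "T \<in> \<T>" "T' \<in> \<T>" "T \<noteq> T'" and F: "F \<in> FT T" "F \<in> FT T'" and y: "y \<in> F" "y \<notin> Z"
  shows "normal T F \<bullet> (A T *v G T y) = normal T F \<bullet> (A T' *v G T' y)"
proof -
  define n where "n = normal T F"
  have n': "normal T' F = - n" using opposite_normals[OF T F] by (simp add: n_def)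
  obtain e1 where e1: "e1 > 0" "\<And>x. x \<in> ball y e1 \<Longrightarrow> n \<bullet> (x - y) < 0 \<Longrightarrow> x \<in> T"
    "\<And>x. x \<in> ball y e1 \<Longrightarrow> n \<bullet> (x - y) = 0 \<Longrightarrow> x \<in> F"
    by (rule half_ball_cell[OF T(1) F(1) y, folded n_def]) (rule that, assumption+)
  obtain e2 where e2: "e2 > 0" "\<And>x. x \<in> ball y e2 \<Longrightarrow> - n \<bullet> (x - y) < 0 \<Longrightarrow> x \<in> T'"
    by (rule half_ball_cell[OF T(2) F(2) y, unfolded n']) (rule that, assumption+)
  define e where "e = min e1 e2"
  have e: "e > 0" "\<And>x. x \<in> ball y e \<Longrightarrow> n \<bullet> (x - y) < 0 \<Longrightarrow> x \<in> T"
    "\<And>x. x \<in> ball y e \<Longrightarrow> n \<bullet> (x - y) > 0 \<Longrightarrow> x \<in> T'" "\<And>x. x \<in> ball y e \<Longrightarrow> n \<bullet> (x - y) = 0 \<Longrightarrow> x \<in> F"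
    using e1 e2 by (auto simp: e_def)
  have cl: "closure T \<subseteq> closure \<Omega>" "closure T' \<subseteq> closure \<Omega>"
    using cells(5) T by blast+
  have "ball y e \<subseteq> closure \<Omega>"
  proof
    fix x assume x: "x \<in> ball y e"
    consider "n \<bullet> (x - y) < 0" | "n \<bullet> (x - y) > 0" | "n \<bullet> (x - y) = 0" by linarith
    then show "x \<in> closure \<Omega>"
      using e(2-4)[OF x] cl closure_subset face_in(2)[OF F(1)] by cases blast+
  qed
  \<comment> \<open>That the face is interior to the domain is not part of the mesh definition; it
    follows since the domain is the interior of its closure.\<close>
  then have ball\<Omega>: "ball y e \<subseteq> \<Omega>"
    using interior_maximal[of "ball y e"] \<Omega>_facts(3) by blast
  define V where "V x = indicator T x *\<^sub>R w T x + indicator T' x *\<^sub>R w T' x" for x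
  have VT: "V x = w T x" if "x \<in> T" for x
    using that cells_disjoint[OF T that] by (simp add: V_def)
  have VT': "V x = w T' x" if "x \<in> T'" for x
    using that cells_disjoint[OF T(2,1) T(3)[symmetric] that] by (simp add: V_def)
  have mV: "V \<in> borel_measurable borel"
    unfolding V_def[abs_def] using cell_open T w_continuous
    by (intro borel_measurable_add borel_measurable_continuous_on_indicator) auto
  obtain B where B: "AE x in lebesgue_on \<Omega>. \<bar>f x\<bar> \<le> B"
    by (rule f_AE_bounded)
  have mf: "f \<in> borel_measurable (lebesgue_on \<Omega>)"
    using source by (simp add: L2_on_def)
  have \<Omega>b: "\<Omega> \<in> sets borel" using \<Omega>_facts(1) by simp
  have "n \<bullet> (A T *v G T y) = n \<bullet> (A T' *v G T' y)"
  proof (rule normal_jump_eq_0[where z = y and V = V and ?r0.0 = e])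
    show "norm n = 1" using norm_normal[OF T(1) F(1)] by (simp add: n_def)
    show "V \<in> borel_measurable borel" by (rule mV)
    show "e > 0" by (rule e(1))
    show "\<exists>d>0. \<forall>x\<in>ball y d. n \<bullet> (x - y) < 0 \<longrightarrow> norm (V x - A T *v G T y) < \<epsilon>" if "\<epsilon> > 0" for \<epsilon>
    proof -
      obtain d where d: "d > 0" "\<And>x. x \<in> closure T \<Longrightarrow> dist x y < d \<Longrightarrow> dist (A T *v G T x) (A T *v G T y) < \<epsilon>"
        using wG(1)[OF T(1)] face_in(2)[OF F(1) y(1)] \<open>\<epsilon> > 0\<close> unfolding continuous_on_iff by metis
      have "norm (V x - A T *v G T y) < \<epsilon>" if x: "x \<in> ball y (min d e)" "n \<bullet> (x - y) < 0" for x
      proof -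
        have "x \<in> T" using e(2)[of x] x by simp
        moreover have "x \<in> closure T" using calculation closure_subset by blast
        ultimately show ?thesis
          using d(2)[of x] x(1) VT[of x] wG(2)[OF T(1), of x] by (simp add: dist_norm norm_minus_commute)
      qed
      then show ?thesis
        using d(1) e(1) by (intro exI[of _ "min d e"]) auto
    qed
    show "\<exists>d>0. \<forall>x\<in>ball y d. n \<bullet> (x - y) > 0 \<longrightarrow> norm (V x - A T' *v G T' y) < \<epsilon>" if "\<epsilon> > 0" for \<epsilon>
    proof -
      obtain d where d: "d > 0" "\<And>x. x \<in> closure T' \<Longrightarrow> dist x y < d \<Longrightarrow> dist (A T' *v G T' x) (A T' *v G T' y) < \<epsilon>"
        using wG(1)[OF T(2)] face_in(2)[OF F(2) y(1)] \<open>\<epsilon> > 0\<close> unfolding continuous_on_iff by metis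
      have "norm (V x - A T' *v G T' y) < \<epsilon>" if x: "x \<in> ball y (min d e)" "n \<bullet> (x - y) > 0" for x
      proof -
        have "x \<in> T'" using e(3)[of x] x by simp
        moreover have "x \<in> closure T'" using calculation closure_subset by blast
        ultimately show ?thesis
          using d(2)[of x] x(1) VT'[of x] wG(2)[OF T(2), of x] by (simp add: dist_norm norm_minus_commute)
      qed
      then show ?thesis
        using d(1) e(1) by (intro exI[of _ "min d e"]) auto
    qed
    fix r :: real assume r: "0 < r" "r < e"
    let ?\<phi> = "bump 1 y r"
    have cb: "cball y r \<subseteq> ball y e" using r by (auto simp: dist_norm)
    have t: "test_function \<Omega> ?\<phi>"
      by (rule test_function_bump) (use r cb ball\<Omega> in auto)
    have off: "grad ?\<phi> x = 0" if "x \<notin> ball y r" for x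
      using that r(1) power_mono[of r "norm (x - y)" 2] by (simp add: grad_bump flat_eq_0 dist_norm norm_minus_commute)
    have "bounded_C1 UNIV ?\<phi>"
      by (rule test_function_facts[OF t])
    then have mg: "grad ?\<phi> \<in> borel_measurable borel"
      unfolding bounded_C1_def by (blast intro: borel_measurable_continuous_onI)
    have m1: "(\<lambda>x. V x \<bullet> grad ?\<phi> x) \<in> borel_measurable borel"
      using mV mg by measurable
    have eq: "(\<integral>x. V x \<bullet> grad ?\<phi> x \<partial>lebesgue_on \<Omega>) = (\<integral>x. f x * ?\<phi> x \<partial>lebesgue_on \<Omega>)"
    proof (rule test_equation[OF t])
      show "(\<lambda>x. V x \<bullet> grad ?\<phi> x) \<in> borel_measurable (lebesgue_on \<Omega>)"
        using m1 by (intro measurable_restrict_space1 measurable_completion) simp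
      fix T'' x assume T'': "T'' \<in> \<T>" "x \<in> T''"
      show "V x \<bullet> grad ?\<phi> x = w T'' x \<bullet> grad ?\<phi> x"
      proof (cases "x \<in> ball y r")
        case True
        then have x: "x \<in> ball y e" using r by simp
        consider "n \<bullet> (x - y) < 0" | "n \<bullet> (x - y) > 0" | "n \<bullet> (x - y) = 0" by linarith
        then show ?thesis
        proof cases
          case 1
          then have "x \<in> T" by (rule e(2)[OF x])
          then show ?thesis using cells_disjoint[OF T(1) T''(1) _ \<open>x \<in> T\<close>] T''(2) VT by auto
        next
          case 2
          then have "x \<in> T'" by (rule e(3)[OF x])
          then show ?thesis using cells_disjoint[OF T(2) T''(1) _ \<open>x \<in> T'\<close>] T''(2) VT' by auto
        next
          case 3
          then have "x \<in> F" by (rule e(4)[OF x])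
          \<comment> \<open>Points of the face lie in no cell at all, so this case is
            contradictory.\<close>
          then have "x \<in> closure T" "x \<notin> T" using face_in(2,3) T(1) F(1) by blast+
          then show ?thesis using cells_disjoint_closure[OF T(1) T''(1)] T''(2) by blast
        qed
      qed (simp add: off)
    qed
    have ind: "indicator \<Omega> x * (V x \<bullet> grad ?\<phi> x) = V x \<bullet> grad ?\<phi> x" for x
    proof (cases "x \<in> \<Omega>")
      case False
      then have "x \<notin> ball y e" using ball\<Omega> by blast
      then have "x \<notin> ball y r" using r by simp
      then show ?thesis by (simp add: off)
    qed simp
    then have "(\<integral>x. V x \<bullet> grad ?\<phi> x \<partial>lborel) = (\<integral>x. V x \<bullet> grad ?\<phi> x \<partial>lebesgue_on \<Omega>)"
      using lebesgue_on_lborel(2)[OF \<Omega>b, of "\<lambda>x. V x \<bullet> grad ?\<phi> x", unfolded ind] m1 by simp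
    then show "\<bar>\<integral>x. V x \<bullet> grad ?\<phi> x \<partial>lborel\<bar> \<le> (\<bar>B\<bar> * (\<integral>\<xi>. bump 1 0 1 (\<xi> :: real^'n) \<partial>lborel)) * r ^ CARD('n)"
      unfolding eq using bump_integral_bound[OF \<Omega>b mf B r(1), of y] by simp
  qed
  then show ?thesis
    by (simp add: n_def)
qed

lemma flux_continuous:
  assumes T: "T \<in> \<T>" "T' \<in> \<T>" "T \<noteq> T'" and F: "F \<in> FT T" "F \<in> FT T'" and y: "y \<in> F"
  shows "normal T F \<bullet> (A T *v G T y) = normal T F \<bullet> (A T' *v G T' y)"
proof -
  have "normal T F \<bullet> (A T *v G T y) - normal T F \<bullet> (A T' *v G T' y) = 0"
  proof (rule generic_extend[OF face_in(1)[OF F(1)] _ _ y])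
    show "continuous_on F (\<lambda>y. normal T F \<bullet> (A T *v G T y) - normal T F \<bullet> (A T' *v G T' y))"
      using face_in(2)[OF F(1)] face_in(2)[OF F(2)]
      by (intro continuous_intros continuous_on_subset[OF wG(1)[OF T(1)]] continuous_on_subset[OF wG(1)[OF T(2)]]) auto
  qed (use flux_continuous_generic[OF T F] in auto)
  then show ?thesis by simp
qed

lemma closure_cell_subset: "T \<in> \<T> \<Longrightarrow> closure T \<subseteq> closure \<Omega>"
  using cells(5) by blast

text \<open>On the half ball in the cell, \<open>u\<close> minus a linear function is
  \<epsilon>-Lipschitz by the mean value inequality. Pushing two face points slightly into the cell
  and using continuity of \<open>u\<close> transfers the estimate to the face.\<close>

lemma tangential_derivative:
  assumes T: "T \<in> \<T>" and F: "F \<in> FT T" and y: "y \<in> F" "y \<notin> Z" and \<epsilon>: "\<epsilon> > 0"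
  obtains d where "d > 0" "\<And>x. x \<in> ball y d \<Longrightarrow> normal T F \<bullet> (x - y) = 0 \<Longrightarrow>
      \<bar>u x - u y - G T y \<bullet> (x - y)\<bar> \<le> \<epsilon> * norm (x - y)"
proof -
  define n where "n = normal T F"
  have n1: "norm n = 1" using norm_normal[OF T F] by (simp add: n_def)
  obtain e where e: "e > 0" "\<And>x. x \<in> ball y e \<Longrightarrow> n \<bullet> (x - y) < 0 \<Longrightarrow> x \<in> T"
    "\<And>x. x \<in> ball y e \<Longrightarrow> n \<bullet> (x - y) = 0 \<Longrightarrow> x \<in> F"
    by (rule half_ball_cell[OF T F y, folded n_def]) (rule that, assumption+)
  obtain d where d: "d > 0" "\<And>x. x \<in> closure T \<Longrightarrow> dist x y < d \<Longrightarrow> dist (G T x) (G T y) < \<epsilon>"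
    using G(1)[OF T] face_in(2)[OF F y(1)] \<epsilon> unfolding continuous_on_iff by metis
  define r where "r = min d e"
  have r: "r > 0" "r \<le> d" "r \<le> e" using d e by (auto simp: r_def)
  let ?B = "ball y r \<inter> {x. n \<bullet> x < n \<bullet> y}"
  have BT: "?B \<subseteq> T" using e(2) r by (auto simp: inner_diff_right)
  have cB: "convex ?B" by (intro convex_Int convex_ball convex_halfspace_lt)
  have lip: "\<bar>u a - u b - G T y \<bullet> (a - b)\<bar> \<le> \<epsilon> * norm (a - b)" if ab: "a \<in> ?B" "b \<in> ?B" for a b
  proof -
    have "norm ((u a - G T y \<bullet> a) - (u b - G T y \<bullet> b)) \<le> \<epsilon> * norm (a - b)"
    proof (rule differentiable_bound[OF cB _ _ ab])
      fix x assume x: "x \<in> ?B"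
      then have xT: "x \<in> T" using BT by blast
      have "(u has_derivative (\<lambda>h. grad u x \<bullet> h)) (at x)"
        using u_bounded_C1(1)[OF T] xT grad_has_derivative unfolding bounded_C1_def by blast
      then have "((\<lambda>x. u x - G T y \<bullet> x) has_derivative (\<lambda>h. grad u x \<bullet> h - G T y \<bullet> h)) (at x)"
        by (intro has_derivative_diff has_derivative_inner_right has_derivative_ident)
      then show "((\<lambda>x. u x - G T y \<bullet> x) has_derivative (\<lambda>h. (grad u x - G T y) \<bullet> h)) (at x within ?B)"
        by (simp add: inner_diff_left has_derivative_at_withinI)
      have "dist (G T x) (G T y) < \<epsilon>"
        using d(2)[of x] x r xT closure_subset by (auto simp: dist_commute)
      then have g: "norm (grad u x - G T y) \<le> \<epsilon>"
        using G(2)[OF T xT] by (simp add: dist_norm)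
      show "onorm (\<lambda>h. (grad u x - G T y) \<bullet> h) \<le> \<epsilon>"
      proof (rule onorm_bound)
        show "norm ((grad u x - G T y) \<bullet> h) \<le> \<epsilon> * norm h" for h
          using Cauchy_Schwarz_ineq2[of "grad u x - G T y" h] mult_right_mono[OF g, of "norm h"] by simp
      qed (use \<epsilon> in simp)
    qed
    then show ?thesis by (simp add: inner_diff_right algebra_simps)
  qed
  show ?thesis
  proof (rule that[of r])
    show "r > 0" by (rule r(1))
    fix x assume x: "x \<in> ball y r" "normal T F \<bullet> (x - y) = 0"
    then have nx: "n \<bullet> (x - y) = 0" by (simp add: n_def)
    have xF: "x \<in> F" using e(3)[of x] x r nx by simp
    have lim: "((\<lambda>t. u (z - t *\<^sub>R n)) \<longlongrightarrow> u z) (at_right 0)" if z: "z \<in> F" "z \<in> ball y r" "n \<bullet> (z - y) = 0" for z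
    proof -
      have ev: "\<forall>\<^sub>F t in at_right 0. z - t *\<^sub>R n \<in> ?B"
        unfolding eventually_at_right_field
      proof (intro exI[of _ "r - dist y z"] conjI allI impI)
        show "0 < r - dist y z" using z(2) by simp
        fix t :: real assume t: "0 < t" "t < r - dist y z"
        have "dist y (z - t *\<^sub>R n) \<le> dist y z + t"
          using dist_triangle[of y "z - t *\<^sub>R n" z] t n1 by (simp add: dist_norm)
        then show "z - t *\<^sub>R n \<in> ?B"
          using t z(3) n1 by (simp add: inner_diff_right dot_square_norm)
      qed
      have "((\<lambda>t. z - t *\<^sub>R n) \<longlongrightarrow> z - 0 *\<^sub>R n) (at_right 0)"
        by (intro tendsto_intros)
      then have l: "((\<lambda>t. z - t *\<^sub>R n) \<longlongrightarrow> z) (at_right 0)" by simp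
      have "z \<in> closure \<Omega>" using face_in(2)[OF F z(1)] closure_cell_subset[OF T] by blast
      moreover have "\<forall>\<^sub>F t in at_right 0. z - t *\<^sub>R n \<in> closure \<Omega>"
        using ev by (rule eventually_mono) (use BT cells(3)[OF T] closure_subset in blast)
      ultimately show ?thesis
        by (rule continuous_on_tendsto_compose[OF u_cont l])
    qed
    have limx: "((\<lambda>t. u (x - t *\<^sub>R n) - u (y - t *\<^sub>R n) - G T y \<bullet> (x - y)) \<longlongrightarrow> u x - u y - G T y \<bullet> (x - y)) (at_right 0)"
      using lim[OF xF x(1) nx] lim[OF y(1)] r(1) by (intro tendsto_diff tendsto_const) simp_all
    have "\<forall>\<^sub>F t in at_right 0. \<bar>u (x - t *\<^sub>R n) - u (y - t *\<^sub>R n) - G T y \<bullet> (x - y)\<bar> \<le> \<epsilon> * norm (x - y)"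
      unfolding eventually_at_right_field
    proof (intro exI[of _ "r - dist y x"] conjI allI impI)
      show "0 < r - dist y x" using x(1) by simp
      fix t :: real assume t: "0 < t" "t < r - dist y x"
      have tr: "t < r" using t(2) zero_le_dist[of y x] by linarith
      have "dist y (x - t *\<^sub>R n) \<le> dist y x + t"
        using dist_triangle[of y "x - t *\<^sub>R n" x] t n1 by (simp add: dist_norm)
      then have "x - t *\<^sub>R n \<in> ?B" "y - t *\<^sub>R n \<in> ?B"
        using t tr nx n1 by (auto simp: inner_diff_right dot_square_norm dist_norm)
      from lip[OF this] show "\<bar>u (x - t *\<^sub>R n) - u (y - t *\<^sub>R n) - G T y \<bullet> (x - y)\<bar> \<le> \<epsilon> * norm (x - y)"
        by simp
    qed
    then show "\<bar>u x - u y - G T y \<bullet> (x - y)\<bar> \<le> \<epsilon> * norm (x - y)"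
      by (rule tendsto_upperbound[OF tendsto_rabs[OF limx]]) simp
  qed
qed

text \<open>Both one-sided gradients describe the same function \<open>u\<close> along the face, so
  their tangential parts agree.\<close>

lemma tangential_gradient_continuous:
  assumes T: "T \<in> \<T>" "T' \<in> \<T>" "T \<noteq> T'" and F: "F \<in> FT T" "F \<in> FT T'" and y: "y \<in> F" "y \<notin> Z"
  shows "G T y - G T' y = (normal T F \<bullet> (G T y - G T' y)) *\<^sub>R normal T F"
proof -
  define n where "n = normal T F"
  define g where "g = G T y - G T' y"
  have n1: "norm n = 1" using norm_normal[OF T(1) F(1)] by (simp add: n_def)
  have n': "normal T' F = - n" using opposite_normals[OF T F] by (simp add: n_def)
  define \<tau> where "\<tau> = g - (n \<bullet> g) *\<^sub>R n"
  have n\<tau>: "n \<bullet> \<tau> = 0" using n1 by (simp add: \<tau>_def inner_diff_right dot_square_norm)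
  have "\<tau> = 0"
  proof (rule ccontr)
    assume "\<tau> \<noteq> 0"
    then have \<tau>0: "norm \<tau> > 0" by simp
    \<comment> \<open>The two errors then sum to half of \<open>norm \<tau> * norm \<tau>\<close>,
      which is the value of the jump in direction \<tau>.\<close>
    define \<epsilon> where "\<epsilon> = norm \<tau> / 4"
    have \<epsilon>: "\<epsilon> > 0" using \<tau>0 by (simp add: \<epsilon>_def)
    obtain d where d: "d > 0" "\<And>x. x \<in> ball y d \<Longrightarrow> normal T F \<bullet> (x - y) = 0 \<Longrightarrow>
      \<bar>u x - u y - G T y \<bullet> (x - y)\<bar> \<le> \<epsilon> * norm (x - y)"
      by (rule tangential_derivative[OF T(1) F(1) y \<epsilon>]) (rule that, assumption+)
    obtain d' where d': "d' > 0" "\<And>x. x \<in> ball y d' \<Longrightarrow> normal T' F \<bullet> (x - y) = 0 \<Longrightarrow>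
      \<bar>u x - u y - G T' y \<bullet> (x - y)\<bar> \<le> \<epsilon> * norm (x - y)"
      by (rule tangential_derivative[OF T(2) F(2) y \<epsilon>]) (rule that, assumption+)
    define s where "s = min d d' / (2 * norm \<tau>)"
    have s: "s > 0" "s * norm \<tau> < d" "s * norm \<tau> < d'"
      using d(1) d'(1) \<tau>0 by (auto simp: s_def)
    let ?x = "y + s *\<^sub>R \<tau>"
    have "\<bar>u ?x - u y - G T y \<bullet> (?x - y)\<bar> \<le> \<epsilon> * norm (?x - y)"
      by (rule d(2)) (use s n\<tau> in \<open>auto simp: dist_norm n_def\<close>)
    moreover have "\<bar>u ?x - u y - G T' y \<bullet> (?x - y)\<bar> \<le> \<epsilon> * norm (?x - y)"
      by (rule d'(2)) (use s n\<tau> n' in \<open>auto simp: dist_norm\<close>)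
    ultimately have "\<bar>G T y \<bullet> (?x - y) - G T' y \<bullet> (?x - y)\<bar> \<le> 2 * (\<epsilon> * norm (?x - y))"
      by linarith
    then have "s * \<bar>g \<bullet> \<tau>\<bar> \<le> s * (2 * \<epsilon> * norm \<tau>)"
      using s(1) by (simp add: g_def inner_diff_left right_diff_distrib[symmetric] abs_mult)
    then have "\<bar>g \<bullet> \<tau>\<bar> \<le> 2 * \<epsilon> * norm \<tau>"
      using s(1) by simp
    moreover have "g \<bullet> \<tau> = norm \<tau> * norm \<tau>"
    proof -
      have "g \<bullet> \<tau> = (\<tau> + (n \<bullet> g) *\<^sub>R n) \<bullet> \<tau>" by (simp add: \<tau>_def)
      also have "\<dots> = \<tau> \<bullet> \<tau>" using n\<tau> by (simp add: inner_add_left)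
      finally show ?thesis by (simp add: dot_square_norm power2_eq_square)
    qed
    ultimately have "norm \<tau> * norm \<tau> \<le> (norm \<tau> / 2) * norm \<tau>"
      by (simp add: \<epsilon>_def)
    moreover have "norm \<tau> * norm \<tau> > 0" using \<tau>0 by (intro mult_pos_pos)
    ultimately show False by linarith
  qed
  then show ?thesis
    by (simp add: \<tau>_def g_def n_def)
qed

text \<open>Extend \<open>u\<close> by zero and multiply it by a coordinate vector. Against bumps
  that reach across the boundary, which \<open>in_H10_by_parts\<close> admits, this field is
  controlled by the bounded weak gradient. The blow-up lemma then equates its inner limit with the
  outer one, giving \<open>u y * n $ i = 0\<close> for every \<open>i\<close>.\<close>

lemma boundary_value_generic:
  assumes F: "F \<in> \<F>" "cells_of_face \<T> F = {T}" and y: "y \<in> F" "y \<notin> Z"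
  shows "u y = 0"
proof -
  have T: "T \<in> \<T>" "F \<in> FT T"
    using F by (auto simp: cells_of_face_def face_cell)
  have F\<Omega>: "F \<subseteq> frontier \<Omega>"
    using mesh F unfolding polytopal_mesh_def by force
  define n where "n = normal T F"
  have n1: "norm n = 1" using norm_normal[OF T] by (simp add: n_def)
  obtain e1 where e1: "e1 > 0" "\<And>x. x \<in> ball y e1 \<Longrightarrow> n \<bullet> (x - y) < 0 \<Longrightarrow> x \<in> T"
    "\<And>x. x \<in> ball y e1 \<Longrightarrow> n \<bullet> (x - y) > 0 \<Longrightarrow> x \<notin> closure T"
    "\<And>x. x \<in> ball y e1 \<Longrightarrow> n \<bullet> (x - y) = 0 \<Longrightarrow> x \<in> F"
    by (rule half_ball_cell[OF T y, folded n_def]) (rule that, assumption+)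
  let ?K = "\<Union>T'\<in>\<T> - {T}. closure T'"
  \<comment> \<open>Another cell touching \<open>y\<close> would have a face through
    \<open>y\<close>, which off \<open>Z\<close> can only be \<open>F\<close>; but \<open>F\<close>
    belongs to \<open>T\<close> alone.\<close>
  have "y \<notin> closure T'" if T': "T' \<in> \<T>" "T' \<noteq> T" for T'
  proof
    assume yT': "y \<in> closure T'"
    have "y \<notin> T'"
      using cells_disjoint_closure[OF T(1) T'(1)] T'(2) face_in(2)[OF T(2) y(1)] by blast
    then have "y \<in> frontier T'"
      using yT' cell_open[OF T'(1)] by (simp add: frontier_def interior_open)
    then obtain F' where F': "F' \<in> FT T'" "y \<in> closure F'"
      using faces(4)[OF T'(1)] by blast
    then have "y \<in> F'"
      using closure_face[OF face_in(1)[OF F'(1)]] y(2) by blast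
    then have "F' = F"
      using faces(2) F(1) face_in(1)[OF F'(1)] y(1) by (auto simp: pairwise_def disjnt_def)
    then have "T' \<in> cells_of_face \<T> F"
      using F'(1) T'(1) by (auto simp: cells_of_face_def face_cell)
    then show False
      using F(2) T'(2) by blast
  qed
  then have yK: "y \<in> - ?K" by blast
  have oK: "open (- ?K)"
    using cells(1) by (intro open_Compl closed_UN) auto
  obtain e2 where e2: "e2 > 0" "ball y e2 \<subseteq> - ?K"
    by (rule openE[OF oK yK])
  define e where "e = min e1 e2"
  have e: "e > 0" "\<And>x. x \<in> ball y e \<Longrightarrow> n \<bullet> (x - y) < 0 \<Longrightarrow> x \<in> T"
    "\<And>x. x \<in> ball y e \<Longrightarrow> n \<bullet> (x - y) > 0 \<Longrightarrow> x \<notin> closure T"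
    "\<And>x. x \<in> ball y e \<Longrightarrow> n \<bullet> (x - y) = 0 \<Longrightarrow> x \<in> F"
    using e1 e2 by (auto simp: e_def)
  \<comment> \<open>Near \<open>y\<close> the domain coincides with the cell, so extending
    \<open>u\<close> by zero from the cell or from the domain is the same.\<close>
  have inT: "x \<in> T" if x: "x \<in> ball y e" "x \<in> \<Omega>" for x
  proof -
    have "x \<notin> ?K" using e2(2) x(1) by (auto simp: e_def)
    moreover have "x \<in> (\<Union>T\<in>\<T>. closure T)" using x(2) cells(5) closure_subset by blast
    ultimately have "x \<in> closure T" by blast
    then have "\<not> n \<bullet> (x - y) > 0" using e(3)[OF x(1)] by blast
    moreover have "\<not> n \<bullet> (x - y) = 0"
    proof
      assume "n \<bullet> (x - y) = 0"
      then have "x \<in> F" by (rule e(4)[OF x(1)])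
      then have "x \<in> frontier \<Omega>" using F\<Omega> by blast
      then show False using x(2) \<Omega>_facts(1) by (simp add: frontier_def interior_open)
    qed
    ultimately show ?thesis using e(2)[OF x(1)] by linarith
  qed
  have mu: "(\<lambda>x. indicator T x * u x) \<in> borel_measurable borel"
    using borel_measurable_continuous_on_indicator[OF _ bounded_C1_continuous[OF u_bounded_C1(1)[OF T(1)]]] cell_open[OF T(1)]
    by simp
  have \<Omega>b: "\<Omega> \<in> sets borel" using \<Omega>_facts(1) by simp
  have yc: "y \<in> closure \<Omega>" using face_in(2)[OF T(2) y(1)] closure_cell_subset[OF T(1)] by blast
  have "u y * n $ i = 0" for i
  proof -
    define V where "V x = (indicator T x * u x) *\<^sub>R (axis i 1 :: real^'n)" for x
    have mV: "V \<in> borel_measurable borel"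
      unfolding V_def[abs_def] using mu by measurable
    have mw: "(\<lambda>x. weak_grad \<Omega> u x $ i) \<in> borel_measurable (lebesgue_on \<Omega>)"
    proof -
      have [measurable]: "weak_grad \<Omega> u \<in> borel_measurable (lebesgue_on \<Omega>)"
        using weak_grad_of_H1(1)[OF H1] by (simp add: L2_on_def)
      have "(\<lambda>x. weak_grad \<Omega> u x \<bullet> axis i 1) \<in> borel_measurable (lebesgue_on \<Omega>)"
        by measurable
      then show ?thesis by (simp add: inner_axis)
    qed
    have Bw: "AE x in lebesgue_on \<Omega>. \<bar>weak_grad \<Omega> u x $ i\<bar> \<le> U"
      using weak_grad_u
    proof eventually_elim
      case (elim x)
      then obtain T where "T \<in> \<T>" "x \<in> T" "weak_grad \<Omega> u x = grad u x" by blast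
      then show ?case
        using U_bound[of T x "[i]"] by (simp add: grad_def)
    qed
    have "n \<bullet> (u y *\<^sub>R axis i 1) = n \<bullet> 0"
    proof (rule normal_jump_eq_0[where z = y and V = V and ?r0.0 = e])
      show "norm n = 1" "V \<in> borel_measurable borel" "e > 0" by (fact n1 mV e(1))+
      show "\<exists>d>0. \<forall>x\<in>ball y d. n \<bullet> (x - y) < 0 \<longrightarrow> norm (V x - u y *\<^sub>R axis i 1) < \<epsilon>" if "\<epsilon> > 0" for \<epsilon>
      proof -
        obtain d where d: "d > 0" "\<And>x. x \<in> closure \<Omega> \<Longrightarrow> dist x y < d \<Longrightarrow> dist (u x) (u y) < \<epsilon>"
          using u_cont yc \<open>\<epsilon> > 0\<close> unfolding continuous_on_iff by metis
        have "norm (V x - u y *\<^sub>R axis i 1) < \<epsilon>" if x: "x \<in> ball y (min d e)" "n \<bullet> (x - y) < 0" for x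
        proof -
          have xT: "x \<in> T" using e(2)[of x] x by simp
          then have "x \<in> closure \<Omega>" using cells(3)[OF T(1)] closure_subset by blast
          then have "\<bar>u x - u y\<bar> < \<epsilon>" using d(2)[of x] x(1) by (simp add: dist_norm norm_minus_commute)
          moreover have "V x - u y *\<^sub>R axis i 1 = (u x - u y) *\<^sub>R axis i 1"
            using xT by (simp add: V_def scaleR_diff_left)
          ultimately show ?thesis by (simp add: norm_axis_1)
        qed
        then show ?thesis using d(1) e(1) by (intro exI[of _ "min d e"]) auto
      qed
      show "\<exists>d>0. \<forall>x\<in>ball y d. n \<bullet> (x - y) > 0 \<longrightarrow> norm (V x - 0) < \<epsilon>" if "\<epsilon> > 0" for \<epsilon>
      proof (intro exI[of _ e] conjI ballI impI)
        fix x assume "x \<in> ball y e" "n \<bullet> (x - y) > 0"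
        then have "x \<notin> T" using e(3)[of x] closure_subset by blast
        then show "norm (V x - 0) < \<epsilon>" using \<open>\<epsilon> > 0\<close> by (simp add: V_def)
      qed (rule e(1))
      fix r :: real assume r: "0 < r" "r < e"
      let ?\<phi> = "bump 1 y r"
      have t: "test_function UNIV ?\<phi>"
        by (rule test_function_bump) (use r in auto)
      have off: "grad ?\<phi> x = 0" if "x \<notin> ball y r" for x
        using that r(1) power_mono[of r "norm (x - y)" 2] by (simp add: grad_bump flat_eq_0 dist_norm norm_minus_commute)
      have C1: "bounded_C1 UNIV ?\<phi>"
        by (rule test_function_facts[OF t])
      then have mg: "grad ?\<phi> \<in> borel_measurable borel"
        unfolding bounded_C1_def by (blast intro: borel_measurable_continuous_onI)
      have m1: "(\<lambda>x. V x \<bullet> grad ?\<phi> x) \<in> borel_measurable borel"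
        using mV mg by measurable
      have pt: "indicator \<Omega> x * ((grad ?\<phi> x \<bullet> axis i 1) * u x) = V x \<bullet> grad ?\<phi> x" for x
      proof (cases "x \<in> ball y r")
        case True
        then have "x \<in> ball y e" using r by simp
        then have "x \<in> \<Omega> \<longleftrightarrow> x \<in> T" using inT cells(3)[OF T(1)] by blast
        then show ?thesis by (simp add: V_def indicator_def inner_commute)
      qed (simp add: off)
      have "(\<integral>x. V x \<bullet> grad ?\<phi> x \<partial>lborel) = (\<integral>x. (grad ?\<phi> x \<bullet> axis i 1) * u x \<partial>lebesgue_on \<Omega>)"
        using lebesgue_on_lborel(2)[OF \<Omega>b, of "\<lambda>x. (grad ?\<phi> x \<bullet> axis i 1) * u x"] m1 by (simp add: pt)
      also have "\<dots> = - (\<integral>x. weak_grad \<Omega> u x $ i * ?\<phi> x \<partial>lebesgue_on \<Omega>)"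
        using in_H10_by_parts[OF \<Omega>_facts(1,2) H10 C1, of i] by (simp add: mult.commute)
      finally show "\<bar>\<integral>x. V x \<bullet> grad ?\<phi> x \<partial>lborel\<bar> \<le> (\<bar>U\<bar> * (\<integral>\<xi>. bump 1 0 1 (\<xi> :: real^'n) \<partial>lborel)) * r ^ CARD('n)"
        using bump_integral_bound[OF \<Omega>b mw Bw r(1), of y] by simp
    qed
    then show ?thesis by (simp add: inner_axis)
  qed
  moreover have "n \<noteq> 0" using n1 by auto
  ultimately show ?thesis
    by (metis mult_eq_0_iff vec_eq_iff zero_index)
qed

lemma boundary_value:
  assumes F: "F \<in> \<F>" "cells_of_face \<T> F = {T}" and y: "y \<in> F"
  shows "u y = 0"
proof (rule generic_extend[OF F(1) _ _ y])
  have T: "T \<in> \<T>" "F \<in> FT T"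
    using F by (auto simp: cells_of_face_def face_cell)
  show "continuous_on F u"
    using face_in(2)[OF T(2)] closure_cell_subset[OF T(1)] by (intro continuous_on_subset[OF u_cont]) blast
qed (use boundary_value_generic[OF F] in auto)

end

section \<open>Balance over a cell and Taylor expansion\<close>

lemma face_integral_near_const:
  fixes g :: "real^'n::finite \<Rightarrow> real"
  assumes F: "flat_face n c F" and g: "continuous_on F g" and B: "\<And>y. y \<in> F \<Longrightarrow> \<bar>g y - a\<bar> \<le> B"
  shows "\<bar>(\<integral>y. indicator F y * g y \<partial>hyp_measure n c) - a * face_area F\<bar> \<le> B * face_area F"
proof -
  have Fb: "F \<in> sets borel" by (rule flat_faceD[OF F])
  have m: "(\<lambda>y. indicator F y *\<^sub>R h y) \<in> borel_measurable borel" if "continuous_on F h" for h :: "real^'n \<Rightarrow> real"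
    by (rule borel_measurable_continuous_on_indicator[OF Fb that])
  have i1: "integrable (hyp_measure n c) (\<lambda>y. indicator F y *\<^sub>R (g y - a))"
    by (rule face_integrable[OF F m]) (use g B in \<open>auto intro!: continuous_intros\<close>)
  have i2: "integrable (hyp_measure n c) (\<lambda>y. indicator F y *\<^sub>R b)" for b :: real
    by (rule face_integrable[OF F m, where B = "\<bar>b\<bar>"]) auto
  have "(\<integral>y. indicator F y *\<^sub>R (g y - a) + indicator F y *\<^sub>R a \<partial>hyp_measure n c) =
      (\<integral>y. indicator F y *\<^sub>R (g y - a) \<partial>hyp_measure n c) + (\<integral>y. indicator F y *\<^sub>R a \<partial>hyp_measure n c)"
    by (rule Bochner_Integration.integral_add[OF i1 i2])
  then have "(\<integral>y. indicator F y * g y \<partial>hyp_measure n c) - a * face_area F = (\<integral>y. indicator F y * (g y - a) \<partial>hyp_measure n c)"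
    using face_integral_const[OF F, of a] by (simp add: algebra_simps)
  also have "\<bar>\<dots>\<bar> \<le> (\<integral>y. \<bar>indicator F y * (g y - a)\<bar> \<partial>hyp_measure n c)"
    by (rule integral_abs_bound)
  also have "\<dots> \<le> (\<integral>y. indicator F y * B \<partial>hyp_measure n c)"
  proof (rule integral_mono)
    show "\<bar>indicator F y * (g y - a)\<bar> \<le> indicator F y * B" for y
      using B[of y] by (auto simp: indicator_def)
  qed (use integrable_abs[OF i1] i2[of B] in simp_all)
  also have "\<dots> = B * face_area F" by (rule face_integral_const[OF F])
  finally show ?thesis by simp
qed

context mpfa_problem
begin

lemma data_facts:
  "T \<in> \<T> \<Longrightarrow> xT T \<in> T" "T \<in> \<T> \<Longrightarrow> F \<in> FT T \<Longrightarrow> cell_dist M T F > 0"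
  "face_group \<T> \<F> g \<Longrightarrow> group_cell M g \<in> \<T>" "face_group \<T> \<F> g \<Longrightarrow> g \<subseteq> FT (group_cell M g)"
  "F \<in> \<F> \<Longrightarrow> (\<Sum>g\<in>groups_of_face M K F. weight M F g) = 1"
  "F \<in> \<F> \<Longrightarrow> g \<in> groups_of_face M K F \<Longrightarrow> weight M F g \<ge> 0"
  using data unfolding mpfa_data_def by (blast+)

lemma star_cell: "T \<in> \<T> \<Longrightarrow> star_cell T (FT T) (normal T) (\<lambda>F. normal T F \<bullet> face_center F) Z (xT T)"
proof -
  assume T: "T \<in> \<T>"
  interpret c: faced_cell T "FT T" "normal T" "\<lambda>F. normal T F \<bullet> face_center F" Z
    by (rule faced_normal[OF T])
  show ?thesis
  proof
    show "xT T \<in> T" by (rule data_facts(1)[OF T])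
    show "normal T F \<bullet> xT T < normal T F \<bullet> face_center F" if "F \<in> FT T" for F
      using data_facts(2)[OF T that] by (simp add: cell_dist_def inner_diff_right inner_diff_left inner_commute)
    show "\<exists>M. finite M \<and> 0 \<notin> M \<and> Z \<subseteq> (\<Union>m\<in>M. {x. m \<bullet> (x - q) = 0})" for q
      by (rule Z_cone)
  qed
qed

abbreviation hyp where "hyp T F \<equiv> hyp_measure (normal T F) (normal T F \<bullet> face_center F)"

text \<open>There is no minus sign, unlike in the fluxes of the scheme; consistency therefore bounds
  the sum of \<open>flux\<close> and \<Phi>.\<close>

definition \<Phi> :: "(real^'n) set \<Rightarrow> (real^'n) set \<Rightarrow> real" where
  "\<Phi> T F = (\<integral>y. indicator F y * (normal T F \<bullet> (A T *v G T y)) \<partial>hyp T F)"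

lemma cell_balance:
  assumes T: "T \<in> \<T>"
  shows "(\<integral>x. f x \<partial>lebesgue_on T) = - (\<Sum>F\<in>FT T. \<Phi> T F)"
proof -
  interpret c: star_cell T "FT T" "normal T" "\<lambda>F. normal T F \<bullet> face_center F" Z "xT T"
    by (rule star_cell[OF T])
  have "(\<integral>x. f x \<partial>lebesgue_on T) = (\<integral>x. - dw T x \<partial>lebesgue_on T)"
  proof (rule lebesgue_on_cong_AE[OF cell_sets[OF T] _ strong_equation[OF T]])
    show "f \<in> borel_measurable (lebesgue_on T)"
      using source cells(3)[OF T] measurable_restrict_mono unfolding L2_on_def by blast
  qed
  also have "\<dots> = - (\<Sum>F\<in>FT T. \<Phi> T F)"
    using c.divergence[OF w_C1[OF T] wG(1)[OF T] wG(2)[OF T]] by (simp add: dw_def \<Phi>_def)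
  finally show ?thesis .
qed

lemma \<Phi>_opposite:
  assumes T: "T \<in> \<T>" "T' \<in> \<T>" "T \<noteq> T'" and F: "F \<in> FT T" "F \<in> FT T'"
  shows "\<Phi> T' F = - \<Phi> T F"
proof -
  have n: "normal T' F = - normal T F" by (rule opposite_normals[OF T F])
  have h: "hyp T' F = hyp T F"
  proof -
    have "\<bar>c - a\<bar> = \<bar>a - c\<bar>" "y - (c - a) *\<^sub>R (- m) = y - (a - c) *\<^sub>R m" for a c :: real and y m :: "real^'n"
      by (simp_all add: algebra_simps)
    then show ?thesis unfolding n hyp_measure_def by (simp add: algebra_simps)
  qed
  have "indicator F y * (normal T' F \<bullet> (A T' *v G T' y)) = - (indicator F y * (normal T F \<bullet> (A T *v G T y)))" for y
    using flux_continuous[OF T F, of y] n by (cases "y \<in> F") auto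
  then show ?thesis
    unfolding \<Phi>_def h by simp
qed

lemma norm_A_le: "T \<in> \<T> \<Longrightarrow> norm (A T *v x) \<le> \<Lambda> * norm x"
proof (rule psd_norm_le)
  assume T: "T \<in> \<T>"
  show "transpose (A T) = A T" "(A T *v x) \<bullet> x \<le> \<Lambda> * (norm x)\<^sup>2" for x by (fact A_facts[OF T])+
  show "0 \<le> (A T *v x) \<bullet> x" for x
    using A_facts(2)[OF T, of x] mult_nonneg_nonneg[OF less_imp_le[OF K_ell(1)] zero_le_power2[of "norm x"]] by linarith
qed

lemma \<Lambda>_pos:
  assumes "T \<in> \<T>"
  shows "\<Lambda> > 0"
proof -
  obtain x :: "real^'n" where "norm x = 1" using vector_choose_size[of 1] by auto
  then show ?thesis using A_facts(2,3)[OF assms, of x] K_ell(1) by simp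
qed

lemma face_eigenvalue_ge:
  assumes F: "F \<in> \<F>"
  shows "face_eigenvalue M K F \<ge> l"
proof -
  have "min_eigenvalue (A T) \<ge> l" if T: "T \<in> \<T>" for T
    unfolding min_eigenvalue_def
  proof (subst Min_ge_iff)
    show "finite {l. \<exists>v. v \<noteq> 0 \<and> A T *v v = l *\<^sub>R v}" "{l. \<exists>v. v \<noteq> 0 \<and> A T *v v = l *\<^sub>R v} \<noteq> {}"
      by (fact symmetric_eigenvalues[OF A_facts(1)[OF T]])+
    show "\<forall>a\<in>{l. \<exists>v. v \<noteq> 0 \<and> A T *v v = l *\<^sub>R v}. l \<le> a"
    proof
      fix a assume "a \<in> {l. \<exists>v. v \<noteq> 0 \<and> A T *v v = l *\<^sub>R v}"
      then obtain v where v: "v \<noteq> 0" "A T *v v = a *\<^sub>R v" by blast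
      have "l * (norm v)\<^sup>2 \<le> a * (norm v)\<^sup>2"
        using A_facts(2)[OF T, of v] v(2) by (simp add: dot_square_norm)
      then show "l \<le> a" using v(1) by simp
    qed
  qed
  moreover have "finite (cells_of_face \<T> F)" "cells_of_face \<T> F \<noteq> {}"
    using faces(6)[OF F] by (auto intro: card_ge_0_finite)
  ultimately show ?thesis
    unfolding face_eigenvalue_def by (subst Min_ge_iff) (auto simp: cell_face)
qed

section \<open>Taylor expansion in a cell\<close>

abbreviation h where "h \<equiv> mesh_size \<T>"

lemma dist_le_diameter: "T \<in> \<T> \<Longrightarrow> x \<in> closure T \<Longrightarrow> y \<in> closure T \<Longrightarrow> norm (x - y) \<le> diameter T"
  using diameter_bounded_bound[OF bounded_closure[OF cell_bounded], of T x y] diameter_closure[OF cell_bounded, of T]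
  by (simp add: dist_norm)

lemma diameter_le: "T \<in> \<T> \<Longrightarrow> diameter T \<le> h"
  unfolding mesh_size_def using cells(1) by simp

text \<open>Second derivatives are bounded by \<open>U\<close>, and each of the two passages from
  components to a Euclidean norm costs a factor \<open>CARD('n)\<close>.\<close>

definition L :: real where "L = real CARD('n) ^ 2 * U"

lemma L_nonneg: "T \<in> \<T> \<Longrightarrow> L \<ge> 0"
  using U_nonneg by (simp add: L_def)

text \<open>Cells may be nonconvex; the expansions about the cell point rely on
  star-shapedness.\<close>

lemma segment_in_cell:
  assumes T: "T \<in> \<T>" and x: "x \<in> T"
  shows "closed_segment (xT T) x \<subseteq> T"
proof -
  interpret c: star_cell T "FT T" "normal T" "\<lambda>F. normal T F \<bullet> face_center F" Z "xT T"
    by (rule star_cell[OF T])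
  have "(1 - t) *\<^sub>R xT T + t *\<^sub>R x \<in> T" if "0 \<le> t" "t \<le> 1" for t
    using c.star[OF c.p_ball x that] by (simp add: algebra_simps)
  then show ?thesis by (auto simp: closed_segment_def)
qed

lemma grad_taylor_cell:
  assumes T: "T \<in> \<T>" and x: "x \<in> T"
  shows "norm (grad u x - grad u (xT T)) \<le> L * norm (x - xT T)"
proof -
  have "\<bar>(grad u x - grad u (xT T)) $ i\<bar> \<le> (real CARD('n) * U) * norm (x - xT T)" for i
  proof -
    have "norm (grad u x $ i - grad u (xT T) $ i) \<le> (real CARD('n) * U) * norm (x - xT T)"
    proof (rule differentiable_bound[OF convex_closed_segment])
      fix z assume "z \<in> closed_segment (xT T) x"
      then have z: "z \<in> T" using segment_in_cell[OF T x] by blast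
      have "((\<lambda>x. grad u x $ i) has_derivative (\<lambda>h. grad (\<lambda>x. grad u x $ i) z \<bullet> h)) (at z)"
        using u_bounded_C1(2)[OF T, of i] z grad_has_derivative unfolding bounded_C1_def by blast
      then show "((\<lambda>x. grad u x $ i) has_derivative (\<lambda>h. grad (\<lambda>x. grad u x $ i) z \<bullet> h)) (at z within closed_segment (xT T) x)"
        by (rule has_derivative_at_withinI)
      have g: "norm (grad (\<lambda>x. grad u x $ i) z) \<le> real CARD('n) * U"
      proof (rule norm_le_sum_of_components)
        fix j
        have "grad (\<lambda>x. grad u x $ i) z $ j = iter_partial [j, i] u z" by (simp add: grad_def)
        then show "\<bar>grad (\<lambda>x. grad u x $ i) z $ j\<bar> \<le> U"
          using U_bound[OF T z, of "[j, i]"] by simp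
      qed
      show "onorm (\<lambda>h. grad (\<lambda>x. grad u x $ i) z \<bullet> h) \<le> real CARD('n) * U"
      proof (rule onorm_bound)
        show "norm (grad (\<lambda>x. grad u x $ i) z \<bullet> h) \<le> (real CARD('n) * U) * norm h" for h
          using Cauchy_Schwarz_ineq2[of "grad (\<lambda>x. grad u x $ i) z" h] mult_right_mono[OF g, of "norm h"] by simp
      qed (use U_nonneg[OF T] in simp)
    qed auto
    then show ?thesis by simp
  qed
  from norm_le_sum_of_components[OF this] show ?thesis
    by (simp add: L_def power2_eq_square mult_ac)
qed

lemma u_taylor_cell:
  assumes T: "T \<in> \<T>" and x: "x \<in> T"
  shows "\<bar>u x - u (xT T) - grad u (xT T) \<bullet> (x - xT T)\<bar> \<le> L * (norm (x - xT T))\<^sup>2"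
proof -
  define a where "a = grad u (xT T)"
  have "norm ((u x - a \<bullet> x) - (u (xT T) - a \<bullet> xT T)) \<le> (L * norm (x - xT T)) * norm (x - xT T)"
  proof (rule differentiable_bound[OF convex_closed_segment])
    fix z assume zs: "z \<in> closed_segment (xT T) x"
    then have z: "z \<in> T" using segment_in_cell[OF T x] by blast
    have "(u has_derivative (\<lambda>h. grad u z \<bullet> h)) (at z)"
      using u_bounded_C1(1)[OF T] z grad_has_derivative unfolding bounded_C1_def by blast
    then have "((\<lambda>x. u x - a \<bullet> x) has_derivative (\<lambda>h. grad u z \<bullet> h - a \<bullet> h)) (at z)"
      by (intro has_derivative_diff has_derivative_inner_right has_derivative_ident)
    then show "((\<lambda>x. u x - a \<bullet> x) has_derivative (\<lambda>h. (grad u z - a) \<bullet> h)) (at z within closed_segment (xT T) x)"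
      by (simp add: inner_diff_left has_derivative_at_withinI)
    have "norm (grad u z - a) \<le> L * norm (z - xT T)"
      unfolding a_def by (rule grad_taylor_cell[OF T z])
    also have "\<dots> \<le> L * norm (x - xT T)"
      using segment_bound1[OF zs] L_nonneg[OF T] by (intro mult_left_mono) (auto simp: norm_minus_commute)
    finally have g: "norm (grad u z - a) \<le> L * norm (x - xT T)" .
    show "onorm (\<lambda>h. (grad u z - a) \<bullet> h) \<le> L * norm (x - xT T)"
    proof (rule onorm_bound)
      show "norm ((grad u z - a) \<bullet> h) \<le> (L * norm (x - xT T)) * norm h" for h
        using Cauchy_Schwarz_ineq2[of "grad u z - a" h] mult_right_mono[OF g, of "norm h"] by simp
    qed (use L_nonneg[OF T] in simp)
  qed auto
  then show ?thesis
    by (simp add: a_def inner_diff_right power2_eq_square algebra_simps)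
qed

lemma grad_taylor:
  assumes T: "T \<in> \<T>" and y: "y \<in> closure T"
  shows "norm (G T y - grad u (xT T)) \<le> L * norm (y - xT T)"
proof -
  have "norm (G T y - grad u (xT T)) - L * norm (y - xT T) \<le> 0"
  proof (rule continuous_le_on_closure[OF _ y, where f = "\<lambda>y. norm (G T y - grad u (xT T)) - L * norm (y - xT T)"])
    show "continuous_on (closure T) (\<lambda>y. norm (G T y - grad u (xT T)) - L * norm (y - xT T))"
      by (intro continuous_intros G(1)[OF T])
  qed (use grad_taylor_cell[OF T] G(2)[OF T] in simp)
  then show ?thesis by simp
qed

lemma u_continuous_closure: "T \<in> \<T> \<Longrightarrow> continuous_on (closure T) u"
  using continuous_on_subset[OF u_cont closure_cell_subset] .

lemma u_taylor:
  assumes T: "T \<in> \<T>" and y: "y \<in> closure T"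
  shows "\<bar>u y - u (xT T) - grad u (xT T) \<bullet> (y - xT T)\<bar> \<le> L * (norm (y - xT T))\<^sup>2"
proof -
  have "\<bar>u y - u (xT T) - grad u (xT T) \<bullet> (y - xT T)\<bar> - L * (norm (y - xT T))\<^sup>2 \<le> 0"
  proof (rule continuous_le_on_closure[OF _ y, where f = "\<lambda>y. \<bar>u y - u (xT T) - grad u (xT T) \<bullet> (y - xT T)\<bar> - L * (norm (y - xT T))\<^sup>2"])
    show "continuous_on (closure T) (\<lambda>y. \<bar>u y - u (xT T) - grad u (xT T) \<bullet> (y - xT T)\<bar> - L * (norm (y - xT T))\<^sup>2)"
      by (intro continuous_intros u_continuous_closure[OF T])
  qed (use u_taylor_cell[OF T] in simp)
  then show ?thesis by simp
qed

lemma xT_closure: "T \<in> \<T> \<Longrightarrow> xT T \<in> closure T"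
  using data_facts(1) closure_subset by blast

lemma \<Phi>_estimate:
  assumes T: "T \<in> \<T>" and F: "F \<in> FT T"
  shows "\<bar>\<Phi> T F - normal T F \<bullet> (A T *v grad u (xT T)) * face_area F\<bar> \<le> (\<Lambda> * (L * h)) * face_area F"
  unfolding \<Phi>_def
proof (rule face_integral_near_const[OF flat[OF T F]])
  show "continuous_on F (\<lambda>y. normal T F \<bullet> (A T *v G T y))"
    using face_in(2)[OF F] by (intro continuous_intros continuous_on_subset[OF wG(1)[OF T]]) blast
  fix y assume "y \<in> F"
  then have y: "y \<in> closure T" by (rule face_in(2)[OF F])
  have "normal T F \<bullet> (A T *v G T y) - normal T F \<bullet> (A T *v grad u (xT T)) = normal T F \<bullet> (A T *v (G T y - grad u (xT T)))"
    by (simp add: inner_diff_right matrix_vector_mult_diff_distrib)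
  also have "\<bar>\<dots>\<bar> \<le> norm (A T *v (G T y - grad u (xT T)))"
    using Cauchy_Schwarz_ineq2[of "normal T F"] norm_normal[OF T F] by (metis mult_1)
  also have "\<dots> \<le> \<Lambda> * norm (G T y - grad u (xT T))" by (rule norm_A_le[OF T])
  also have "\<dots> \<le> \<Lambda> * (L * h)"
  proof (rule mult_left_mono)
    have "L * norm (y - xT T) \<le> L * h"
      using dist_le_diameter[OF T y xT_closure[OF T]] diameter_le[OF T] L_nonneg[OF T] by (intro mult_left_mono) auto
    then show "norm (G T y - grad u (xT T)) \<le> L * h"
      using grad_taylor[OF T y] by linarith
  qed (use \<Lambda>_pos[OF T] in simp)
  finally show "\<bar>normal T F \<bullet> (A T *v G T y) - normal T F \<bullet> (A T *v grad u (xT T))\<bar> \<le> \<Lambda> * (L * h)" .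
qed

text \<open>The center of mass of a nonconvex face need not lie on the face, so the boundary
  condition cannot be used there directly. Averaging the expansion over the face uses it at face
  points only, and the mean of a linear function is its value at the center of mass.\<close>

lemma boundary_center_estimate:
  assumes F: "F \<in> \<F>" "cells_of_face \<T> F = {T}"
  shows "\<bar>u (xT T) + grad u (xT T) \<bullet> (face_center F - xT T)\<bar> \<le> L * (diameter T)\<^sup>2"
proof -
  have T: "T \<in> \<T>" "F \<in> FT T"
    using F by (auto simp: cells_of_face_def face_cell)
  define a where "a = grad u (xT T)"
  note fl = flat[OF T]
  have "\<bar>(\<integral>y. indicator F y * (a \<bullet> y) \<partial>hyp T F) - (a \<bullet> xT T - u (xT T)) * face_area F\<bar> \<le> (L * (diameter T)\<^sup>2) * face_area F"
  proof (rule face_integral_near_const[OF fl])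
    fix y assume y: "y \<in> F"
    have yc: "y \<in> closure T" by (rule face_in(2)[OF T(2) y])
    have "\<bar>u y - u (xT T) - a \<bullet> (y - xT T)\<bar> \<le> L * (norm (y - xT T))\<^sup>2"
      unfolding a_def by (rule u_taylor[OF T(1) yc])
    also have "\<dots> \<le> L * (diameter T)\<^sup>2"
      using dist_le_diameter[OF T(1) yc xT_closure[OF T(1)]] L_nonneg[OF T(1)] by (intro mult_left_mono power_mono) auto
    finally show "\<bar>a \<bullet> y - (a \<bullet> xT T - u (xT T))\<bar> \<le> L * (diameter T)\<^sup>2"
      using boundary_value[OF F y] by (simp add: inner_diff_right abs_minus_commute algebra_simps)
  qed (intro continuous_intros)
  then have "\<bar>(a \<bullet> face_center F - (a \<bullet> xT T - u (xT T))) * face_area F\<bar> \<le> (L * (diameter T)\<^sup>2) * face_area F"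
    unfolding left_diff_distrib[of "a \<bullet> face_center F"] face_center_inner(1)[OF fl, of a] .
  then have "\<bar>a \<bullet> face_center F - (a \<bullet> xT T - u (xT T))\<bar> * face_area F \<le> (L * (diameter T)\<^sup>2) * face_area F"
    using face_area_facts(2)[OF fl] by (simp only: abs_mult abs_of_pos)
  then show ?thesis
    using face_area_facts(2)[OF fl] by (simp add: a_def inner_diff_right algebra_simps)
qed

text \<open>Splitting \<open>face_dist\<close> and regrouping by cells leaves, for each cell, a
  multiple of the volumes of its pyramids.\<close>

lemma volume_bound:
  "(\<Sum>F\<in>\<F>. face_area F * face_dist M F) \<le> CARD('n) * measure lebesgue \<Omega>"
proof -
  have cell: "(\<Sum>F\<in>FT T. face_area F * cell_dist M T F) \<le> CARD('n) * measure lebesgue T" if T: "T \<in> \<T>" for T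
  proof -
    interpret c: star_cell T "FT T" "normal T" "\<lambda>F. normal T F \<bullet> face_center F" Z "xT T"
      by (rule star_cell[OF T])
    have "face_area F * cell_dist M T F = measure (hyp T F) F * c.cdist F" if F: "F \<in> FT T" for F
      unfolding face_area_facts(1)[OF flat[OF T F]] c.cdist_def cell_dist_def
      by (simp add: inner_diff_right inner_commute[of _ "normal T F"])
    then show ?thesis
      using c.sum_pyramid_volumes by simp
  qed
  have "(\<Sum>F\<in>\<F>. face_area F * face_dist M F) = (\<Sum>F\<in>\<F>. \<Sum>T\<in>{T\<in>\<T>. F \<subseteq> frontier T}. face_area F * cell_dist M T F)"
    by (simp add: face_dist_def cells_of_face_def sum_distrib_left)
  also have "\<dots> = (\<Sum>T\<in>\<T>. \<Sum>F\<in>{F\<in>\<F>. F \<subseteq> frontier T}. face_area F * cell_dist M T F)"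
    by (rule sum.swap_restrict[OF faces(1) cells(1)])
  also have "\<dots> \<le> (\<Sum>T\<in>\<T>. CARD('n) * measure lebesgue T)"
    using cell by (intro sum_mono) (simp add: faces_of_cell_def)
  also have "\<dots> = CARD('n) * (\<Sum>T\<in>\<T>. measure lebesgue T)"
    by (simp add: sum_distrib_left)
  also have "(\<Sum>T\<in>\<T>. measure lebesgue T) = measure lebesgue (\<Union>\<T>)"
  proof (rule measure_Union'[symmetric, OF cells(1)])
    show "T \<in> lmeasurable" if "T \<in> \<T>" for T
      using cell_open[OF that] cell_bounded[OF that] by (simp add: lmeasurable_open)
    show "pairwise disjnt \<T>" by (rule cells(4))
  qed
  also have "measure lebesgue (\<Union>\<T>) \<le> measure lebesgue \<Omega>"
  proof (rule measure_mono_fmeasurable)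
    show "\<Union>\<T> \<subseteq> \<Omega>" using cells(3) by blast
    show "\<Union>\<T> \<in> sets lebesgue" using open_Union[of \<T>] cell_open by (simp add: borel_open)
    show "\<Omega> \<in> lmeasurable" using \<Omega>_facts(1,2) by (simp add: lmeasurable_open)
  qed
  finally show ?thesis by (simp add: mult_left_mono)
qed

end

section \<open>Consistency and convergence of the scheme\<close>

locale mpfa_estimate = mpfa_problem \<Omega> M \<S> \<P> K f u \<rho> l \<Lambda>
  for \<Omega> :: "(real^'n::finite) set" and M \<S> \<P> K f u \<rho> l \<Lambda> +
  fixes \<eta> :: real
  assumes diameter_ratio: "\<And>T F. T \<in> cells M \<Longrightarrow> F \<in> faces_of_cell (faces M) T \<Longrightarrow> diameter T / cell_dist M T F \<le> \<eta>"
    and dist_ratio: "\<And>F T T'. F \<in> inner_faces (cells M) (faces M) \<Longrightarrow> T \<in> cells_of_face (cells M) F \<Longrightarrow>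
      T' \<in> cells_of_face (cells M) F \<Longrightarrow> T \<noteq> T' \<Longrightarrow> cell_dist M T F / cell_dist M T' F \<le> \<eta>"
    and inverse_bound: "\<And>F. F \<in> faces M \<Longrightarrow> (\<Sum>g\<in>groups_of_face M K F.
      weight M F g * onorm ((*v) (matrix_inv (group_matrix M K g)))) \<le> \<eta>"
begin

abbreviation Iu where "Iu \<equiv> (\<lambda>T. u (xT T))"

lemma diameter_le_dist: "T \<in> \<T> \<Longrightarrow> F \<in> FT T \<Longrightarrow> diameter T \<le> \<eta> * cell_dist M T F"
  using diameter_ratio[of T F] data_facts(2)[of T F] by (simp add: field_simps)

lemma \<eta>_nonneg: "T \<in> \<T> \<Longrightarrow> F \<in> FT T \<Longrightarrow> \<eta> \<ge> 0"
  using diameter_ratio[of T F] data_facts(2)[of T F] diameter_ge_0[OF cell_bounded, of T]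
  by (meson divide_nonneg_pos order_trans)

lemma h_nonneg: "T \<in> \<T> \<Longrightarrow> h \<ge> 0"
  using diameter_ge_0[OF cell_bounded] diameter_le by (meson order_trans)

lemma inner_face_cells:
  assumes F: "F \<in> inner_faces \<T> \<F>" and T: "T \<in> \<T>" "F \<in> FT T"
  defines "T' \<equiv> other_cell \<T> F T"
  shows "T' \<in> \<T>" "F \<in> FT T'" "T' \<noteq> T" "cells_of_face \<T> F = {T, T'}" "other_cell \<T> F T' = T"
proof -
  have TF: "T \<in> cells_of_face \<T> F" using T by (simp add: cell_face face_cell)
  have "card (cells_of_face \<T> F) = 2" using F by (simp add: inner_faces_def)
  then obtain a b where ab: "cells_of_face \<T> F = {a, b}" "a \<noteq> b" by (auto simp: card_2_iff)
  obtain S where S: "cells_of_face \<T> F = {T, S}" "S \<noteq> T"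
  proof (cases "T = a")
    case True
    then show ?thesis using ab that by metis
  next
    case False
    then have "T = b" using TF ab by blast
    then show ?thesis using ab that[of a] by blast
  qed
  have "T' = S" unfolding T'_def other_cell_def by (rule the_equality) (use S in blast)+
  then show "T' \<noteq> T" "cells_of_face \<T> F = {T, T'}" using S by auto
  then have "T' \<in> cells_of_face \<T> F" by simp
  then show "T' \<in> \<T>" "F \<in> FT T'" using F by (auto simp: cell_face face_cell inner_faces_def)
  show "other_cell \<T> F T' = T"
    unfolding other_cell_def by (rule the_equality) (use S \<open>T' = S\<close> in blast)+
qed

lemma boundary_face_cells:
  assumes F: "F \<in> \<F>" "F \<notin> inner_faces \<T> \<F>" and T: "T \<in> \<T>" "F \<in> FT T"
  shows "cells_of_face \<T> F = {T}"
proof -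
  have "card (cells_of_face \<T> F) = 1" using faces(6)[OF F(1)] F by (auto simp: inner_faces_def)
  then obtain S where "cells_of_face \<T> F = {S}" by (auto simp: card_1_singleton_iff)
  moreover have "T \<in> cells_of_face \<T> F" using T by (simp add: cell_face face_cell)
  ultimately show ?thesis by blast
qed

text \<open>Residual of one row. For an inner face, \<open>3 * \<eta>\<close> comes from the two
  gradient differences and the Taylor remainder in the far cell, \<open>\<eta>\<^sup>2\<close> from
  the remainder in \<open>group_cell\<close>, and 2 from using the gradient at the cell point
  instead of its trace in the flux part. A boundary face costs only one \<eta>.\<close>

definition R :: real where "R = \<Lambda> * ((\<eta>\<^sup>2 + 3 * \<eta> + 2) * (L * h))"

lemma conductivity_bounds:
  assumes T: "T \<in> \<T>" and F: "F \<in> FT T"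
  shows "0 \<le> (A T *v normal T F) \<bullet> normal T F" "(A T *v normal T F) \<bullet> normal T F \<le> \<Lambda>"
  using A_facts(2,3)[OF T, of "normal T F"] norm_normal[OF T F] K_ell(1) by simp_all

text \<open>Both sides are expanded at a point \<open>y\<close> of the face where the tangential gradient and the normal
  flux of \<open>u\<close> are continuous; the jump of the normal derivative then cancels between the
  value part and the flux part of the row.\<close>

lemma inner_row_consistency:
  assumes T: "T \<in> \<T>" "T0 \<in> \<T>" "T \<noteq> T0" and F: "F \<in> FT T" "F \<in> FT T0"
  shows "\<bar>normal_conductivity M K T F * (grad u (xT T0) \<bullet> (xT T - xT T0) - (u (xT T) - u (xT T0)))
     + (A T0 *v normal T0 F + A T *v normal T F) \<bullet> grad u (xT T0)\<bar> \<le> R"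
proof -
  have F': "F \<in> \<F>" "UNIV \<inter> F \<noteq> {}" using F(1) faces(3) by (auto simp: face_cell)
  obtain y where y: "y \<in> F" "y \<notin> Z" by (rule generic_face_point[OF F'(1) open_UNIV F'(2)])
  have yc: "y \<in> closure T" "y \<in> closure T0" using face_in(2) F y(1) by blast+
  define n where "n = normal T F"
  have n0: "normal T0 F = - n" using opposite_normals[OF T F] by (simp add: n_def)
  have n1: "norm n = 1" using norm_normal[OF T(1) F(1)] by (simp add: n_def)
  define d where "d = cell_dist M T F"
  have d: "d > 0" using data_facts(2)[OF T(1) F(1)] by (simp add: d_def)
  have nd: "n \<bullet> (y - xT T) = d"
    using plane[OF T(1) F(1) y(1)] by (simp add: d_def n_def cell_dist_def inner_diff_right inner_diff_left inner_commute)
  define \<kappa> where "\<kappa> = (A T *v n) \<bullet> n"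
  have \<kappa>: "0 \<le> \<kappa>" "\<kappa> \<le> \<Lambda>" using conductivity_bounds[OF T(1) F(1)] by (simp_all add: \<kappa>_def n_def)
  define a0 a1 G0 G1 where "a0 = grad u (xT T0)" and "a1 = grad u (xT T)" and "G0 = G T0 y" and "G1 = G T y"
  define r0 r1 where "r0 = u y - u (xT T0) - a0 \<bullet> (y - xT T0)" and "r1 = u y - u (xT T) - a1 \<bullet> (y - xT T)"
  define \<beta> where "\<beta> = n \<bullet> (G1 - G0)"
  have jump: "G1 = G0 + \<beta> *\<^sub>R n"
    using tangential_gradient_continuous[OF T F y] by (simp add: \<beta>_def n_def G0_def G1_def algebra_simps)
  have flux: "(A T *v n) \<bullet> G1 = (A T0 *v n) \<bullet> G0"
    using flux_continuous[OF T F y(1)] A_inner_commute[OF T(1), of G1 n] A_inner_commute[OF T(2), of G0 n]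
    by (simp add: n_def G0_def G1_def inner_commute)
  \<comment> \<open>Collects all Taylor remainders; the jump of the gradient is kept apart as
    \<open>\<beta> * d\<close>, to be cancelled by the flux part.\<close>
  define X where "X = (a1 - G1 + (G0 - a0)) \<bullet> (y - xT T) + r1 - r0"
  have "a0 \<bullet> (xT T - xT T0) - (u (xT T) - u (xT T0)) = (a1 - a0) \<bullet> (y - xT T) + r1 - r0"
    by (simp add: r0_def r1_def inner_diff_left inner_diff_right)
  also have "\<dots> = X + (G1 - G0) \<bullet> (y - xT T)"
    by (simp add: X_def inner_diff_left inner_add_left)
  also have "(G1 - G0) \<bullet> (y - xT T) = \<beta> * d"
    using nd by (simp add: jump)
  finally have value_part: "a0 \<bullet> (xT T - xT T0) - (u (xT T) - u (xT T0)) = X + \<beta> * d" .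
  have "(A T *v n) \<bullet> G1 = (A T *v n) \<bullet> G0 + \<beta> * \<kappa>"
    by (simp add: jump inner_add_right \<kappa>_def)
  then have normal_part: "(A T0 *v - n + A T *v n) \<bullet> a0 = (A T0 *v - n + A T *v n) \<bullet> (a0 - G0) - \<beta> * \<kappa>"
    using flux linear_neg[OF matrix_vector_mul_linear, of "A T0" n] by (simp add: inner_add_left inner_diff_left inner_diff_right)
  have eq: "normal_conductivity M K T F * (a0 \<bullet> (xT T - xT T0) - (u (xT T) - u (xT T0)))
     + (A T0 *v normal T0 F + A T *v n) \<bullet> a0 = \<kappa> * (X / d) + (A T0 *v - n + A T *v n) \<bullet> (a0 - G0)"
    unfolding value_part n0 normal_part normal_conductivity_def n_def[symmetric] \<kappa>_def[symmetric] d_def[symmetric]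
    using d by (simp add: field_simps)
  define s0 s1 where "s0 = norm (y - xT T0)" and "s1 = norm (y - xT T)"
  have L0: "L \<ge> 0" by (rule L_nonneg[OF T(1)])
  have \<eta>0: "\<eta> \<ge> 0" by (rule \<eta>_nonneg[OF T(1) F(1)])
  have \<Lambda>0: "\<Lambda> \<ge> 0" using \<Lambda>_pos[OF T(1)] by simp
  have s: "0 \<le> s0" "0 \<le> s1" by (simp_all add: s0_def s1_def)
  have sh: "s0 \<le> h" "s1 \<le> h"
    using dist_le_diameter[OF T(1) yc(1) xT_closure] dist_le_diameter[OF T(2) yc(2) xT_closure] diameter_le T(1,2)
    unfolding s0_def s1_def by (meson order_trans)+
  have s1d: "s1 \<le> \<eta> * d"
    using dist_le_diameter[OF T(1) yc(1) xT_closure[OF T(1)]] diameter_le_dist[OF T(1) F(1)] by (simp add: s1_def d_def)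
  have inner: "F \<in> inner_faces \<T> \<F>"
  proof (rule ccontr)
    assume "F \<notin> inner_faces \<T> \<F>"
    from boundary_face_cells[OF F'(1) this T(1) F(1)] boundary_face_cells[OF F'(1) this T(2) F(2)]
    show False using T(3) by simp
  qed
  \<comment> \<open>The remainder of the group cell is divided by the distance in the other cell, so
    the ratio of the two distances brings in a second factor \<eta>.\<close>
  have s0d: "s0 \<le> \<eta> * (\<eta> * d)"
  proof -
    have "cell_dist M T0 F / d \<le> \<eta>"
      unfolding d_def using T F F'(1) by (intro dist_ratio[OF inner]) (auto simp: cell_face face_cell)
    then have "cell_dist M T0 F \<le> \<eta> * d" using d by (simp add: field_simps)
    then have "\<eta> * cell_dist M T0 F \<le> \<eta> * (\<eta> * d)" by (rule mult_left_mono[OF _ \<eta>0])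
    then show ?thesis
      using dist_le_diameter[OF T(2) yc(2) xT_closure[OF T(2)]] diameter_le_dist[OF T(2) F(2)] by (simp add: s0_def)
  qed
  have g1: "norm (a1 - G1) \<le> L * s1" and g0: "norm (G0 - a0) \<le> L * s0"
    using grad_taylor[OF T(1) yc(1)] grad_taylor[OF T(2) yc(2)]
    by (simp_all add: a0_def a1_def G0_def G1_def s0_def s1_def norm_minus_commute)
  have r: "\<bar>r0\<bar> \<le> L * s0\<^sup>2" "\<bar>r1\<bar> \<le> L * s1\<^sup>2"
    using u_taylor[OF T(1) yc(1)] u_taylor[OF T(2) yc(2)] by (simp_all add: r0_def r1_def s0_def s1_def a0_def a1_def)
  have "\<bar>(a1 - G1 + (G0 - a0)) \<bullet> (y - xT T)\<bar> \<le> norm (a1 - G1 + (G0 - a0)) * s1"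
    unfolding s1_def by (rule Cauchy_Schwarz_ineq2)
  also have "\<dots> \<le> (L * s1 + L * s0) * s1"
    using g0 g1 norm_triangle_ineq[of "a1 - G1" "G0 - a0"] s by (intro mult_right_mono) auto
  also have "\<dots> \<le> (L * h + L * h) * (\<eta> * d)"
    using sh s s1d L0 by (intro mult_mono add_mono) auto
  finally have X1: "\<bar>(a1 - G1 + (G0 - a0)) \<bullet> (y - xT T)\<bar> \<le> (L * h + L * h) * (\<eta> * d)" .
  have "L * (s1 * s1) \<le> L * (h * (\<eta> * d))" "L * (s0 * s0) \<le> L * (h * (\<eta> * (\<eta> * d)))"
    using s sh s1d s0d L0 by (intro mult_left_mono mult_mono; simp)+
  then have "\<bar>X\<bar> \<le> (L * h + L * h) * (\<eta> * d) + L * (h * (\<eta> * d)) + L * (h * (\<eta> * (\<eta> * d)))"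
    using X1 r unfolding X_def power2_eq_square by linarith
  then have "\<bar>X\<bar> / d \<le> ((\<eta>\<^sup>2 + 3 * \<eta>) * (L * h))"
    using d by (simp add: field_simps power2_eq_square)
  then have "\<kappa> * (\<bar>X\<bar> / d) \<le> \<Lambda> * ((\<eta>\<^sup>2 + 3 * \<eta>) * (L * h))"
    using \<kappa> d \<Lambda>0 by (intro mult_mono) auto
  then have b1: "\<bar>\<kappa> * (X / d)\<bar> \<le> \<Lambda> * ((\<eta>\<^sup>2 + 3 * \<eta>) * (L * h))"
    using \<kappa> d by (simp add: abs_mult)
  have "\<bar>(A T0 *v - n + A T *v n) \<bullet> (a0 - G0)\<bar> \<le> norm (A T0 *v - n + A T *v n) * norm (a0 - G0)"
    by (rule Cauchy_Schwarz_ineq2)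
  also have "\<dots> \<le> (\<Lambda> + \<Lambda>) * (L * h)"
  proof (rule mult_mono)
    show "norm (A T0 *v - n + A T *v n) \<le> \<Lambda> + \<Lambda>"
      using norm_triangle_ineq[of "A T0 *v - n" "A T *v n"] norm_A_le[OF T(1), of n] norm_A_le[OF T(2), of "- n"] n1 by simp
    show "norm (a0 - G0) \<le> L * h"
      using g0 mult_left_mono[OF sh(1) L0] by (simp add: norm_minus_commute)
  qed (use \<Lambda>0 in auto)
  finally have b2: "\<bar>(A T0 *v - n + A T *v n) \<bullet> (a0 - G0)\<bar> \<le> \<Lambda> * (2 * (L * h))"
    by simp
  have "\<bar>\<kappa> * (X / d) + (A T0 *v - n + A T *v n) \<bullet> (a0 - G0)\<bar> \<le> R"
  proof -
    have "R = \<Lambda> * ((\<eta>\<^sup>2 + 3 * \<eta>) * (L * h)) + \<Lambda> * (2 * (L * h))"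
      by (simp add: R_def algebra_simps)
    then show ?thesis using b1 b2 by linarith
  qed
  then show ?thesis
    using eq unfolding a0_def n_def by simp
qed

lemma row_consistency:
  assumes g: "face_group \<T> \<F> g" and F: "F \<in> g"
  defines "T0 \<equiv> group_cell M g"
  shows "\<bar>group_row M K g F \<bullet> grad u (xT T0) - group_entry M K Iu g F\<bar> \<le> R"
proof -
  have T0: "T0 \<in> \<T>" "F \<in> FT T0"
    using data_facts(3,4)[OF g] F by (auto simp: T0_def)
  have F': "F \<in> \<F>" using face_in(1)[OF T0(2)] .
  show ?thesis
  proof (cases "F \<in> inner_faces \<T> \<F>")
    case True
    note T = inner_face_cells[OF True T0]
    have "group_row M K g F \<bullet> grad u (xT T0) - group_entry M K Iu g F =
      normal_conductivity M K (other_cell \<T> F T0) F * (grad u (xT T0) \<bullet> (xT (other_cell \<T> F T0) - xT T0) -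
        (u (xT (other_cell \<T> F T0)) - u (xT T0)))
      + (A T0 *v normal T0 F + A (other_cell \<T> F T0) *v normal (other_cell \<T> F T0) F) \<bullet> grad u (xT T0)"
      using True by (simp add: group_row_def group_entry_def Let_def T0_def[symmetric] inner_add_left inner_commute algebra_simps)
    then show ?thesis
      using inner_row_consistency[OF T(1) T0(1) T(3) T(2) T0(2)] by simp
  next
    case False
    define d where "d = cell_dist M T0 F"
    have d: "d > 0" using data_facts(2)[OF T0] by (simp add: d_def)
    define \<kappa> where "\<kappa> = (A T0 *v normal T0 F) \<bullet> normal T0 F"
    have \<kappa>: "0 \<le> \<kappa>" "\<kappa> \<le> \<Lambda>" using conductivity_bounds[OF T0] by (simp_all add: \<kappa>_def)
    have \<eta>0: "\<eta> \<ge> 0" by (rule \<eta>_nonneg[OF T0])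
    have L0: "L \<ge> 0" and h0: "h \<ge> 0" by (fact L_nonneg[OF T0(1)] h_nonneg[OF T0(1)])+
    have \<Lambda>0: "\<Lambda> \<ge> 0" using \<Lambda>_pos[OF T0(1)] by simp
    define X where "X = u (xT T0) + grad u (xT T0) \<bullet> (face_center F - xT T0)"
    have "\<bar>X\<bar> \<le> L * (diameter T0)\<^sup>2"
      unfolding X_def by (rule boundary_center_estimate[OF F' boundary_face_cells[OF F' False T0]])
    \<comment> \<open>One diameter gives the order \<open>h\<close>; the other compensates the
      division by \<open>d\<close>.\<close>
    also have "\<dots> \<le> L * (h * (\<eta> * d))"
      unfolding power2_eq_square using diameter_le[OF T0(1)] diameter_le_dist[OF T0] diameter_ge_0[OF cell_bounded[OF T0(1)]] L0 h0
      by (intro mult_left_mono mult_mono) (auto simp: d_def)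
    finally have "\<bar>X\<bar> / d \<le> \<eta> * (L * h)"
      using d by (simp add: field_simps)
    then have "\<kappa> * (\<bar>X\<bar> / d) \<le> \<Lambda> * (\<eta> * (L * h))"
      using \<kappa> d \<Lambda>0 by (intro mult_mono) auto
    then have "\<bar>\<kappa> * (X / d)\<bar> \<le> \<Lambda> * (\<eta> * (L * h))"
      using \<kappa> d by (simp add: abs_mult)
    also have "\<dots> \<le> R"
      unfolding R_def using \<eta>0 L0 h0 \<Lambda>0 by (intro mult_left_mono mult_right_mono) auto
    finally have "\<bar>\<kappa> * (X / d)\<bar> \<le> R" .
    moreover have "group_row M K g F \<bullet> grad u (xT T0) - group_entry M K Iu g F = \<kappa> * (X / d)"
      using False by (simp add: group_row_def group_entry_def Let_def T0_def[symmetric] X_def normal_conductivity_def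
          \<kappa>_def d_def inner_commute add_divide_distrib diff_divide_distrib algebra_simps)
    ultimately show ?thesis by simp
  qed
qed

text \<open>The exact gradient at the cell point solves the group system up to the row residuals,
  and the inverse matrix carries these over to the error. The factor \<open>CARD('n)\<close> bounds
  the Euclidean norm of the residual by its components.\<close>

lemma main_gradient_estimate:
  assumes g: "face_group \<T> \<F> g" and inv: "invertible (group_matrix M K g)"
  shows "norm (main_gradient M K Iu g - grad u (xT (group_cell M g))) \<le>
    onorm ((*v) (matrix_inv (group_matrix M K g))) * (real CARD('n) * R)"
proof -
  define B where "B = group_matrix M K g"
  define a where "a = grad u (xT (group_cell M g))"
  have card: "card g = CARD('n)" using g by (simp add: face_group_def)
  then have "finite g" by (metis card.infinite finite_UNIV_card_ge_0 finite less_irrefl)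
  then have "\<exists>e. bij_betw e (UNIV :: 'n set) g"
    using card by (simp add: finite_same_card_bij)
  then have "bij_betw (group_enum g) UNIV g"
    unfolding group_enum_def by (rule someI_ex)
  then have enum: "group_enum g i \<in> g" for i by (auto simp: bij_betw_def)
  have "matrix_inv B ** B = mat 1"
    using inv unfolding B_def invertible_def matrix_inv_def by (metis (mono_tags, lifting) someI_ex)
  then have "a = matrix_inv B *v (B *v a)"
    by (simp add: matrix_vector_mul_assoc)
  then have "main_gradient M K Iu g - a = matrix_inv B *v (group_rhs M K Iu g - B *v a)"
    by (simp add: main_gradient_def B_def matrix_vector_mult_diff_distrib)
  then have "norm (main_gradient M K Iu g - a) \<le> onorm ((*v) (matrix_inv B)) * norm (group_rhs M K Iu g - B *v a)"
    using onorm[OF matrix_vector_mul_bounded_linear, of "matrix_inv B"] by simp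
  also have "\<dots> \<le> onorm ((*v) (matrix_inv B)) * (real CARD('n) * R)"
  proof (rule mult_left_mono)
    show "norm (group_rhs M K Iu g - B *v a) \<le> real CARD('n) * R"
    proof (rule norm_le_sum_of_components)
      fix i
      have "(group_rhs M K Iu g - B *v a) $ i = group_entry M K Iu g (group_enum g i) - group_row M K g (group_enum g i) \<bullet> a"
        by (simp add: group_rhs_def B_def group_matrix_def matrix_vector_mul_component)
      then show "\<bar>(group_rhs M K Iu g - B *v a) $ i\<bar> \<le> R"
        using row_consistency[OF g enum[of i]] by (simp add: a_def abs_minus_commute)
    qed
  qed (rule onorm_pos_le[OF matrix_vector_mul_bounded_linear])
  finally show ?thesis by (simp add: a_def B_def)
qed

section \<open>Consistency of the fluxes\<close>

abbreviation group_flux where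
  "group_flux v g T F \<equiv> - face_area F * ((A T *v group_gradient M K v g T F) \<bullet> normal T F)"

lemma group_flux_opposite:
  assumes g: "g \<in> groups_of_face M K F" and T: "T \<in> \<T>" "F \<in> FT T" "T \<noteq> group_cell M g"
  shows "group_flux v g T F = - group_flux v g (group_cell M g) F" "\<Phi> T F = - \<Phi> (group_cell M g) F"
proof -
  have g': "face_group \<T> \<F> g" "F \<in> g" "invertible (group_matrix M K g)"
    using g by (auto simp: groups_of_face_def)
  have T0: "group_cell M g \<in> \<T>" "F \<in> FT (group_cell M g)"
    using data_facts(3,4)[OF g'(1)] g'(2) by auto
  have card: "card g = CARD('n)" using g'(1) by (simp add: face_group_def)
  have F': "F \<in> \<F>" using face_in(1)[OF T(2)] .
  have inner: "F \<in> inner_faces \<T> \<F>"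
  proof (rule ccontr)
    assume "F \<notin> inner_faces \<T> \<F>"
    from boundary_face_cells[OF F' this T(1,2)] boundary_face_cells[OF F' this T0]
    show False using T(3) by simp
  qed
  have "T \<in> cells_of_face \<T> F" using T F' by (simp add: cell_face face_cell)
  then have other: "T = other_cell \<T> F (group_cell M g)"
    using inner_face_cells(4)[OF inner T0] T(3) by blast
  have "(A T *v group_gradient M K v g T F) \<bullet> normal T F
      + (A (group_cell M g) *v group_gradient M K v g (group_cell M g) F) \<bullet> normal (group_cell M g) F = 0"
    by (rule group_gradient_flux[OF card g'(2,3) inner refl other T(3) A_facts(1)[OF T(1)] A_facts(1)[OF T0(1)]])
  then have "(A T *v group_gradient M K v g T F) \<bullet> normal T F =
      - ((A (group_cell M g) *v group_gradient M K v g (group_cell M g) F) \<bullet> normal (group_cell M g) F)"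
    by linarith
  then show "group_flux v g T F = - group_flux v g (group_cell M g) F" by simp
  show "\<Phi> T F = - \<Phi> (group_cell M g) F"
    by (rule \<Phi>_opposite[OF T0(1) T(1) T(3)[symmetric] T0(2) T(2)])
qed

text \<open>The estimate is made in \<open>group_cell\<close>, where the gradient is the solution of
  the linear system. In the other cell of the face both terms change sign, so the same bound
  holds.\<close>

lemma group_flux_consistency:
  assumes g: "g \<in> groups_of_face M K F" and T: "T \<in> \<T>" "F \<in> FT T"
  shows "\<bar>group_flux Iu g T F + \<Phi> T F\<bar> \<le>
    face_area F * (\<Lambda> * (onorm ((*v) (matrix_inv (group_matrix M K g))) * (real CARD('n) * R)) + \<Lambda> * (L * h))"
proof -
  have g': "face_group \<T> \<F> g" "F \<in> g" "invertible (group_matrix M K g)"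
    using g by (auto simp: groups_of_face_def)
  define T0 where "T0 = group_cell M g"
  have T0: "T0 \<in> \<T>" "F \<in> FT T0"
    using data_facts(3,4)[OF g'(1)] g'(2) by (auto simp: T0_def)
  define m where "m = main_gradient M K Iu g"
  define a where "a = grad u (xT T0)"
  let ?B = "onorm ((*v) (matrix_inv (group_matrix M K g))) * (real CARD('n) * R)"
  have area: "face_area F > 0" by (rule face_area_facts(2)[OF flat[OF T0]])
  have "\<bar>normal T0 F \<bullet> (A T0 *v (m - a))\<bar> \<le> norm (A T0 *v (m - a))"
    using Cauchy_Schwarz_ineq2[of "normal T0 F"] norm_normal[OF T0] by (metis mult_1)
  also have "\<dots> \<le> \<Lambda> * norm (m - a)" by (rule norm_A_le[OF T0(1)])
  also have "\<dots> \<le> \<Lambda> * ?B"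
    using main_gradient_estimate[OF g'(1,3)] \<Lambda>_pos[OF T0(1)] by (intro mult_left_mono) (auto simp: m_def a_def T0_def)
  finally have 1: "face_area F * \<bar>normal T0 F \<bullet> (A T0 *v (m - a))\<bar> \<le> face_area F * (\<Lambda> * ?B)"
    using area by (intro mult_left_mono) auto
  have "group_flux Iu g T0 F + \<Phi> T0 F =
     - (face_area F * (normal T0 F \<bullet> (A T0 *v (m - a)))) + (\<Phi> T0 F - normal T0 F \<bullet> (A T0 *v a) * face_area F)"
    by (simp add: group_gradient_def Let_def T0_def[symmetric] m_def[symmetric] matrix_vector_mult_diff_distrib
        inner_diff_right inner_commute algebra_simps)
  also have "\<bar>\<dots>\<bar> \<le> face_area F * \<bar>normal T0 F \<bullet> (A T0 *v (m - a))\<bar> + \<bar>\<Phi> T0 F - normal T0 F \<bullet> (A T0 *v a) * face_area F\<bar>"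
    using area abs_triangle_ineq[of "- (face_area F * (normal T0 F \<bullet> (A T0 *v (m - a))))"] by (simp add: abs_mult)
  also have "\<dots> \<le> face_area F * (\<Lambda> * ?B) + (\<Lambda> * (L * h)) * face_area F"
    using 1 \<Phi>_estimate[OF T0] by (simp add: a_def)
  finally have main: "\<bar>group_flux Iu g T0 F + \<Phi> T0 F\<bar> \<le> face_area F * (\<Lambda> * ?B + \<Lambda> * (L * h))"
    by (simp add: algebra_simps)
  show ?thesis
  proof (cases "T = T0")
    case False
    then have "T \<noteq> group_cell M g" by (simp add: T0_def)
    note opp = group_flux_opposite[OF g T this, folded T0_def]
    have "group_flux Iu g T F + \<Phi> T F = - (group_flux Iu g T0 F + \<Phi> T0 F)"
      using opp(1)[of Iu] opp(2) by linarith
    then show ?thesis using main by linarith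
  qed (use main in simp)
qed

definition E :: real where "E = \<Lambda> * (real CARD('n) * R) * \<eta> + \<Lambda> * (L * h)"

text \<open>The bounds for single groups are affine in the norms of the inverse matrices, so the
  weights average these norms, and \<eta> controls exactly this average. As the weights sum to 1,
  \<Phi> can be distributed over the groups.\<close>

lemma flux_consistency:
  assumes T: "T \<in> \<T>" "F \<in> FT T"
  shows "\<bar>flux M K Iu T F + \<Phi> T F\<bar> \<le> face_area F * E"
proof -
  have F: "F \<in> \<F>" using face_in(1)[OF T(2)] .
  note w = data_facts(5,6)[OF F]
  let ?G = "groups_of_face M K F"
  let ?o = "\<lambda>g. onorm ((*v) (matrix_inv (group_matrix M K g)))"
  have area: "face_area F > 0" by (rule face_area_facts(2)[OF flat[OF T]])
  have R0: "R \<ge> 0"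
    unfolding R_def using \<eta>_nonneg[OF T] L_nonneg[OF T(1)] h_nonneg[OF T(1)] \<Lambda>_pos[OF T(1)] by simp
  have "flux M K Iu T F + \<Phi> T F = (\<Sum>g\<in>?G. weight M F g * group_flux Iu g T F) + (\<Sum>g\<in>?G. weight M F g) * \<Phi> T F"
    using w(1) by (simp add: flux_def)
  also have "\<dots> = (\<Sum>g\<in>?G. weight M F g * (group_flux Iu g T F + \<Phi> T F))"
    by (simp only: sum_distrib_right sum.distrib[symmetric] distrib_left)
  also have "\<bar>\<dots>\<bar> \<le> (\<Sum>g\<in>?G. \<bar>weight M F g * (group_flux Iu g T F + \<Phi> T F)\<bar>)"
    by (rule sum_abs)
  also have "\<dots> \<le> (\<Sum>g\<in>?G. weight M F g * (face_area F * (\<Lambda> * (?o g * (real CARD('n) * R)) + \<Lambda> * (L * h))))"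
    unfolding abs_mult using w(2) group_flux_consistency[OF _ T] by (intro sum_mono mult_mono) auto
  also have "\<dots> = face_area F * (\<Lambda> * (real CARD('n) * R) * (\<Sum>g\<in>?G. weight M F g * ?o g) + \<Lambda> * (L * h) * (\<Sum>g\<in>?G. weight M F g))"
    by (simp add: sum_distrib_left sum.distrib[symmetric] algebra_simps)
  also have "\<dots> \<le> face_area F * (\<Lambda> * (real CARD('n) * R) * \<eta> + \<Lambda> * (L * h) * 1)"
    unfolding w(1) using inverse_bound[OF F] area \<Lambda>_pos[OF T(1)] R0 by (intro mult_left_mono add_right_mono) auto
  finally show ?thesis by (simp add: E_def)
qed

section \<open>Conservation, summation by parts and the error equation\<close>

lemma flux_opposite:
  assumes F: "F \<in> inner_faces \<T> \<F>" and T: "T \<in> \<T>" "F \<in> FT T"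
  shows "flux M K v (other_cell \<T> F T) F = - flux M K v T F"
proof -
  define T' where "T' = other_cell \<T> F T"
  note T' = inner_face_cells[OF F T, folded T'_def]
  have "group_flux v g T' F = - group_flux v g T F" if g: "g \<in> groups_of_face M K F" for g
  proof -
    have g': "face_group \<T> \<F> g" "F \<in> g" using g by (auto simp: groups_of_face_def)
    have "group_cell M g \<in> \<T>" "F \<in> FT (group_cell M g)"
      using data_facts(3,4)[OF g'(1)] g'(2) by blast+
    then have "group_cell M g \<in> cells_of_face \<T> F" by (simp add: cell_face face_cell)
    then consider "group_cell M g = T" | "group_cell M g = T'" using T'(4) by blast
    then show ?thesis
    proof cases
      case 1
      then show ?thesis using group_flux_opposite(1)[OF g T'(1,2)] T'(3) by simp
    next
      case 2
      then have "group_flux v g T F = - group_flux v g T' F"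
        using group_flux_opposite(1)[OF g T] T'(3) by simp
      then show ?thesis by linarith
    qed
  qed
  then have "flux M K v T' F = (\<Sum>g\<in>groups_of_face M K F. - (weight M F g * group_flux v g T F))"
    unfolding flux_def by (intro sum.cong) (auto simp del: mult_minus_left)
  then show ?thesis
    by (simp add: T'_def[symmetric] flux_def sum_negf)
qed

lemma flux_diff: "flux M K (\<lambda>T. v T - v' T) T F = flux M K v T F - flux M K v' T F"
proof -
  have "group_rhs M K (\<lambda>T. v T - v' T) g = group_rhs M K v g - group_rhs M K v' g" for g
    by (simp add: group_rhs_def group_entry_def Let_def vec_eq_iff algebra_simps)
  then have m: "main_gradient M K (\<lambda>T. v T - v' T) g = main_gradient M K v g - main_gradient M K v' g" for g
    by (simp add: main_gradient_def matrix_vector_mult_diff_distrib)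
  have "group_gradient M K (\<lambda>T. v T - v' T) g T F = group_gradient M K v g T F - group_gradient M K v' g T F" for g
  proof -
    have "((a - b) \<bullet> x - ((s - s') - (t - t'))) / c = (a \<bullet> x - (s - t)) / c - (b \<bullet> x - (s' - t')) / c"
      for a b x :: "real^'n" and s s' t t' c :: real
      by (simp add: inner_diff_left diff_divide_distrib[symmetric])
    then show ?thesis
      by (simp add: group_gradient_def Let_def m scaleR_left_diff_distrib)
  qed
  then have "group_flux (\<lambda>T. v T - v' T) g T F = group_flux v g T F - group_flux v' g T F" for g
    by (simp only: matrix_vector_mult_diff_distrib inner_diff_left right_diff_distrib)
  then show ?thesis
    unfolding flux_def by (simp only: right_diff_distrib sum_subtractf)
qed

lemma first_cell_in:
  assumes "F \<in> \<F>"
  shows "first_cell \<T> F \<in> \<T>" "F \<in> FT (first_cell \<T> F)"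
proof -
  obtain T where "T \<in> \<T>" "F \<in> FT T" by (rule face_has_cell[OF assms])
  then have "T \<in> cells_of_face \<T> F" by (simp add: cell_face face_cell)
  then have "first_cell \<T> F \<in> cells_of_face \<T> F"
    unfolding first_cell_def by (rule someI)
  then show "first_cell \<T> F \<in> \<T>" "F \<in> FT (first_cell \<T> F)"
    using assms by (auto simp: cell_face face_cell)
qed

text \<open>Stated for any conservative family \<open>q\<close> because it is used twice: for the
  fluxes of the error and for the consistency errors.\<close>

lemma summation_by_parts:
  assumes q: "\<And>F T. F \<in> inner_faces \<T> \<F> \<Longrightarrow> T \<in> \<T> \<Longrightarrow> F \<in> FT T \<Longrightarrow> q (other_cell \<T> F T) F = - q T F"
  shows "(\<Sum>T\<in>\<T>. v T * (\<Sum>F\<in>FT T. q T F)) = (\<Sum>F\<in>\<F>. q (first_cell \<T> F) F * jump M v F)"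
proof -
  have "(\<Sum>T\<in>\<T>. v T * (\<Sum>F\<in>FT T. q T F)) = (\<Sum>T\<in>\<T>. \<Sum>F\<in>{F\<in>\<F>. F \<subseteq> frontier T}. v T * q T F)"
    by (simp add: faces_of_cell_def sum_distrib_left)
  also have "\<dots> = (\<Sum>F\<in>\<F>. \<Sum>T\<in>{T\<in>\<T>. F \<subseteq> frontier T}. v T * q T F)"
    by (rule sum.swap_restrict[OF cells(1) faces(1)])
  also have "\<dots> = (\<Sum>F\<in>\<F>. q (first_cell \<T> F) F * jump M v F)"
  proof (rule sum.cong[OF refl])
    fix F assume F: "F \<in> \<F>"
    define T where "T = first_cell \<T> F"
    have T: "T \<in> \<T>" "F \<in> FT T" using first_cell_in[OF F] by (simp_all add: T_def)
    have "(\<Sum>T\<in>cells_of_face \<T> F. v T * q T F) = q T F * jump M v F"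
    proof (cases "F \<in> inner_faces \<T> \<F>")
      case True
      note T' = inner_face_cells[OF True T]
      have "(\<Sum>T\<in>cells_of_face \<T> F. v T * q T F) = v T * q T F + v (other_cell \<T> F T) * q (other_cell \<T> F T) F"
        unfolding T'(4) using T'(3) by simp
      then show ?thesis
        using True q[OF True T] by (simp add: jump_def T_def[symmetric] algebra_simps)
    next
      case False
      then show ?thesis
        unfolding boundary_face_cells[OF F False T] by (simp add: jump_def T_def[symmetric])
    qed
    then show "(\<Sum>T\<in>{T\<in>\<T>. F \<subseteq> frontier T}. v T * q T F) = q (first_cell \<T> F) F * jump M v F"
      by (simp add: cells_of_face_def T_def)
  qed
  finally show ?thesis .
qed

lemma error_estimate:
  assumes \<gamma>: "\<gamma> > 0" and coercive: "coercive_fluxes \<gamma> M K" and uh: "mpfa_solution M K f uh"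
  shows "discrete_norm M K (\<lambda>T. uh T - Iu T) \<le> inverse \<gamma> * (E * sqrt (real CARD('n) * measure lebesgue \<Omega> / l))"
proof -
  define e where "e = (\<lambda>T. uh T - Iu T)"
  define \<epsilon> where "\<epsilon> = (\<lambda>T F. flux M K Iu T F + \<Phi> T F)"
  have \<Omega>ne: "\<T> \<noteq> {}"
    using cells(5) polytopal_facts(3)[OF domain] closure_subset[of \<Omega>] by auto
  then obtain T1 where T1: "T1 \<in> \<T>" by blast
  have face: "face_area F > 0" "face_dist M F > 0" if F: "F \<in> \<F>" for F
  proof -
    note T = first_cell_in[OF F]
    show "face_area F > 0" by (rule face_area_facts(2)[OF flat[OF T]])
    have fin: "finite (cells_of_face \<T> F)" "cells_of_face \<T> F \<noteq> {}"
      using faces(6)[OF F] by (auto intro: card_ge_0_finite)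
    show "face_dist M F > 0"
      unfolding face_dist_def using F data_facts(2) by (intro sum_pos fin) (auto simp: cell_face face_cell)
  qed
  \<comment> \<open>Together with \<open>k\<close> below, this prepares Cauchy-Schwarz:
    \<open>k F * g F\<close> is the face area times the jump, the norm of \<open>g\<close> is the
    discrete norm of the error, and that of \<open>k\<close> is bounded through the volume of the
    domain.\<close>
  define g where "g = (\<lambda>F. sqrt (face_eigenvalue M K F * face_area F * face_dist M F) * (jump M e F / face_dist M F))"
  define k where "k = (\<lambda>F. sqrt (face_area F * face_dist M F / face_eigenvalue M K F))"
  have pos: "face_eigenvalue M K F > 0" if "F \<in> \<F>" for F
    using face_eigenvalue_ge[OF that] K_ell(1) by linarith
  have norm: "discrete_norm M K e = L2_set g \<F>"
    unfolding discrete_norm_def L2_set_def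
  proof (intro arg_cong[where f = sqrt] sum.cong refl)
    fix F assume F: "F \<in> \<F>"
    have "(g F)\<^sup>2 = (sqrt (face_eigenvalue M K F * face_area F * face_dist M F))\<^sup>2 * (jump M e F / face_dist M F)\<^sup>2"
      unfolding g_def by (rule power_mult_distrib)
    also have "(sqrt (face_eigenvalue M K F * face_area F * face_dist M F))\<^sup>2 = face_eigenvalue M K F * face_area F * face_dist M F"
      using face[OF F] pos[OF F] by simp
    finally show "face_eigenvalue M K F * face_area F * face_dist M F * (jump M e F / face_dist M F)\<^sup>2 = (g F)\<^sup>2" by simp
  qed
  have gk: "k F * g F = face_area F * jump M e F" if F: "F \<in> \<F>" for F
  proof -
    have "k F * sqrt (face_eigenvalue M K F * face_area F * face_dist M F) = sqrt ((face_area F * face_dist M F)\<^sup>2)"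
    proof -
      have "face_area F * face_dist M F / face_eigenvalue M K F * (face_eigenvalue M K F * face_area F * face_dist M F) =
          (face_area F * face_dist M F)\<^sup>2"
        using pos[OF F] by (simp add: power2_eq_square)
      then show ?thesis
        unfolding k_def real_sqrt_mult[symmetric] by (rule arg_cong)
    qed
    also have "\<dots> = face_area F * face_dist M F" using face[OF F] by simp
    finally show ?thesis
      using face(2)[OF F] by (simp add: g_def mult.assoc[symmetric])
  qed
  have "L2_set k \<F> \<le> sqrt (real CARD('n) * measure lebesgue \<Omega> / l)"
    unfolding L2_set_def
  proof (rule real_sqrt_le_mono)
    have "(\<Sum>F\<in>\<F>. (k F)\<^sup>2) \<le> (\<Sum>F\<in>\<F>. (face_area F * face_dist M F) / l)"
    proof (rule sum_mono)
      fix F assume F: "F \<in> \<F>"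
      have "(k F)\<^sup>2 = face_area F * face_dist M F / face_eigenvalue M K F"
        unfolding k_def using face[OF F] pos[OF F] by simp
      also have "\<dots> \<le> face_area F * face_dist M F / l"
        using face[OF F] face_eigenvalue_ge[OF F] K_ell(1) by (intro divide_left_mono) auto
      finally show "(k F)\<^sup>2 \<le> face_area F * face_dist M F / l" .
    qed
    also have "\<dots> = (\<Sum>F\<in>\<F>. face_area F * face_dist M F) / l" by (simp add: sum_divide_distrib)
    also have "\<dots> \<le> real CARD('n) * measure lebesgue \<Omega> / l"
      using volume_bound K_ell(1) by (intro divide_right_mono) auto
    finally show "(\<Sum>F\<in>\<F>. (k F)\<^sup>2) \<le> real CARD('n) * measure lebesgue \<Omega> / l" .
  qed
  \<comment> \<open>The sign of \<open>E\<close> is read off at a face, and there is one: a bounded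
    nonempty cell has a nonempty frontier.\<close>
  moreover have E0: "E \<ge> 0"
  proof (cases "\<F> = {}")
    case True
    then have "frontier T1 = {}" using faces(4)[OF T1] by (simp add: faces_of_cell_def)
    then show ?thesis
      using cell_bounded[OF T1] cell_nonempty[OF T1] by (metis frontier_eq_empty not_bounded_UNIV)
  next
    case False
    then obtain F where F: "F \<in> \<F>" by blast
    have "0 \<le> face_area F * E"
      using flux_consistency[OF first_cell_in[OF F]] by (meson abs_ge_zero order_trans)
    then show ?thesis using face(1)[OF F] by (simp add: zero_le_mult_iff)
  qed
  ultimately have kE: "E * L2_set k \<F> \<le> E * sqrt (real CARD('n) * measure lebesgue \<Omega> / l)"
    by (intro mult_left_mono)
  have \<epsilon>_opp: "\<epsilon> (other_cell \<T> F T) F = - \<epsilon> T F" if F: "F \<in> inner_faces \<T> \<F>" and T: "T \<in> \<T>" "F \<in> FT T" for F T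
    using flux_opposite[OF F T, of Iu] \<Phi>_opposite[OF T(1) inner_face_cells(1)[OF F T] inner_face_cells(3)[OF F T, symmetric] T(2) inner_face_cells(2)[OF F T]]
    by (simp add: \<epsilon>_def)
  \<comment> \<open>The scheme and the exact balance share the source, so on each cell the fluxes of
    the error sum to minus the consistency errors.\<close>
  have cell: "(\<Sum>F\<in>FT T. flux M K e T F) = - (\<Sum>F\<in>FT T. \<epsilon> T F)" if T: "T \<in> \<T>" for T
  proof -
    have "(\<Sum>F\<in>FT T. flux M K uh T F) = - (\<Sum>F\<in>FT T. \<Phi> T F)"
      using uh T cell_balance[OF T] unfolding mpfa_solution_def by simp
    then show ?thesis
      unfolding e_def flux_diff \<epsilon>_def by (simp add: sum_subtractf sum.distrib)
  qed
  have split: "(\<Sum>F\<in>inner_faces \<T> \<F>. p F) + (\<Sum>F\<in>boundary_faces \<T> \<F>. p F) = sum p \<F>" for p :: "(real^'n) set \<Rightarrow> real"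
  proof -
    have "inner_faces \<T> \<F> \<union> boundary_faces \<T> \<F> = \<F>" "inner_faces \<T> \<F> \<inter> boundary_faces \<T> \<F> = {}"
      using faces(6) by (auto simp: inner_faces_def boundary_faces_def)
    moreover have "finite (inner_faces \<T> \<F>)" "finite (boundary_faces \<T> \<F>)"
      using faces(1) by (auto simp: inner_faces_def boundary_faces_def)
    ultimately show ?thesis by (metis sum.union_disjoint)
  qed
  have "\<gamma> * (discrete_norm M K e)\<^sup>2 \<le>
      (\<Sum>F\<in>inner_faces \<T> \<F>. flux M K e (first_cell \<T> F) F * jump M e F) +
      (\<Sum>F\<in>boundary_faces \<T> \<F>. flux M K e (first_cell \<T> F) F * jump M e F)"
  proof -
    have "F \<notin> inner_faces \<T> \<F>" if "F \<in> boundary_faces \<T> \<F>" for F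
      using that by (simp add: inner_faces_def boundary_faces_def)
    then show ?thesis
      using coercive unfolding coercive_fluxes_def by (simp add: jump_def Let_def)
  qed
  also have "\<dots> = (\<Sum>F\<in>\<F>. flux M K e (first_cell \<T> F) F * jump M e F)"
    by (rule split)
  also have "\<dots> = (\<Sum>T\<in>\<T>. e T * (\<Sum>F\<in>FT T. flux M K e T F))"
    by (rule summation_by_parts[symmetric]) (rule flux_opposite)
  also have "\<dots> = - (\<Sum>T\<in>\<T>. e T * (\<Sum>F\<in>FT T. \<epsilon> T F))"
    by (simp add: cell sum_negf)
  also have "\<dots> = - (\<Sum>F\<in>\<F>. \<epsilon> (first_cell \<T> F) F * jump M e F)"
    by (simp add: summation_by_parts[where q = \<epsilon>, OF \<epsilon>_opp])
  also have "\<dots> \<le> (\<Sum>F\<in>\<F>. \<bar>\<epsilon> (first_cell \<T> F) F * jump M e F\<bar>)"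
    using sum_abs[of "\<lambda>F. \<epsilon> (first_cell \<T> F) F * jump M e F" \<F>] by linarith
  also have "\<dots> \<le> (\<Sum>F\<in>\<F>. E * (\<bar>k F\<bar> * \<bar>g F\<bar>))"
  proof (rule sum_mono)
    fix F assume F: "F \<in> \<F>"
    have "\<bar>\<epsilon> (first_cell \<T> F) F\<bar> * \<bar>jump M e F\<bar> \<le> (face_area F * E) * \<bar>jump M e F\<bar>"
      unfolding \<epsilon>_def by (intro mult_right_mono flux_consistency first_cell_in[OF F]) simp
    also have "\<dots> = E * (\<bar>k F * g F\<bar>)"
      unfolding gk[OF F] using face(1)[OF F] by (simp add: abs_mult)
    finally show "\<bar>\<epsilon> (first_cell \<T> F) F * jump M e F\<bar> \<le> E * (\<bar>k F\<bar> * \<bar>g F\<bar>)"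
      by (simp add: abs_mult)
  qed
  also have "\<dots> = E * (\<Sum>F\<in>\<F>. \<bar>k F\<bar> * \<bar>g F\<bar>)" by (simp add: sum_distrib_left)
  also have "\<dots> \<le> E * (L2_set k \<F> * L2_set g \<F>)"
    by (intro mult_left_mono L2_set_mult_ineq E0)
  also have "\<dots> \<le> (E * sqrt (real CARD('n) * measure lebesgue \<Omega> / l)) * discrete_norm M K e"
    unfolding norm mult.assoc[symmetric] by (intro mult_right_mono kE) simp
  finally have main: "\<gamma> * (discrete_norm M K e)\<^sup>2 \<le> (E * sqrt (real CARD('n) * measure lebesgue \<Omega> / l)) * discrete_norm M K e" .
  \<comment> \<open>One power of the discrete norm is divided out; where the norm vanishes,
    nonnegativity of \<open>E\<close> suffices.\<close>
  have "\<gamma> * discrete_norm M K e \<le> E * sqrt (real CARD('n) * measure lebesgue \<Omega> / l)"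
  proof (cases "discrete_norm M K e = 0")
    case True
    then show ?thesis using E0 K_ell(1) by simp
  next
    case False
    then have "discrete_norm M K e > 0" using norm by (simp add: less_le)
    then show ?thesis using main by (simp add: power2_eq_square)
  qed
  then show ?thesis
    using \<gamma> unfolding e_def by (simp add: field_simps)
qed

end

theorem theorem35:
  fixes \<Omega> :: "(real^'n::finite) set" and K :: "real^'n \<Rightarrow> real^'n^'n" and \<eta> \<rho> :: real
  assumes "polytopal \<Omega>" and "elliptic_tensor \<Omega> K" and "0 < \<rho>" and "\<rho> < 1"
  shows "\<exists>C::real. \<forall>(\<P> :: (real^'n) set set) (M :: 'n mpfa) (f :: real^'n \<Rightarrow> real)
           (u :: real^'n \<Rightarrow> real) (\<gamma> :: real) (uh :: (real^'n) set \<Rightarrow> real).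
     polytopal_partition \<Omega> \<P> \<and> (\<forall>P\<in>\<P>. \<exists>A. \<forall>x\<in>P. K x = A) \<and>
     mpfa_data \<rho> \<Omega> \<P> K M \<and>
     (\<forall>T\<in>cells M. \<forall>F\<in>faces_of_cell (faces M) T. \<eta> \<ge> diameter T / cell_dist M T F) \<and>
     (\<forall>F\<in>inner_faces (cells M) (faces M).
        \<forall>T\<in>cells_of_face (cells M) F. \<forall>T'\<in>cells_of_face (cells M) F.
          T \<noteq> T' \<longrightarrow> \<eta> \<ge> cell_dist M T F / cell_dist M T' F) \<and>
     (\<forall>F\<in>faces M. \<eta> \<ge> (\<Sum>G\<in>groups_of_face M K F.
        weight M F G * onorm ((*v) (matrix_inv (group_matrix M K G))))) \<and>
     L2_on \<Omega> f \<and> weak_solution \<Omega> K f u \<and>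
     continuous_on (closure \<Omega>) u \<and> (\<forall>P\<in>\<P>. Ck_closure 2 P u) \<and>
     \<gamma> > 0 \<and> coercive_fluxes \<gamma> M K \<and> mpfa_solution M K f uh
     \<longrightarrow> discrete_norm M K (\<lambda>T. uh T - u (cell_point M T))
           \<le> C * inverse \<gamma> * C2_norm \<P> u * mesh_size (cells M)"
proof -
  \<comment> \<open>The ellipticity constants are fixed before partition, mesh and solution, so that
    \<open>C\<close> may depend on them.\<close>
  obtain l \<Lambda> where l: "l > 0" "\<forall>x\<in>\<Omega>. \<forall>\<xi>. l * (norm \<xi>)\<^sup>2 \<le> (K x *v \<xi>) \<bullet> \<xi> \<and> (K x *v \<xi>) \<bullet> \<xi> \<le> \<Lambda> * (norm \<xi>)\<^sup>2"
    using assms(2) unfolding elliptic_tensor_def by metis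
  define D where "D = real CARD('n)"
  \<comment> \<open>This is \<open>E\<close> divided by \<open>C2_norm\<close> and
    \<open>mesh_size\<close>, which enter it through the common factor \<open>L * h\<close>, times
    the square root that bounds the norm of \<open>k\<close> in the error estimate.\<close>
  define C where "C = (\<Lambda> * (D * (\<Lambda> * (\<eta>\<^sup>2 + 3 * \<eta> + 2))) * \<eta> + \<Lambda>) * D\<^sup>2 * sqrt (D * measure lebesgue \<Omega> / l)"
  show ?thesis
  proof (intro exI[of _ C] allI impI, elim conjE)
    fix \<P> :: "(real^'n) set set" and M :: "'n mpfa" and f u :: "real^'n \<Rightarrow> real" and \<gamma> :: real and uh :: "(real^'n) set \<Rightarrow> real"
    assume \<P>: "polytopal_partition \<Omega> \<P>" "\<forall>P\<in>\<P>. \<exists>A. \<forall>x\<in>P. K x = A" and data: "mpfa_data \<rho> \<Omega> \<P> K M"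
      and \<eta>1: "\<forall>T\<in>cells M. \<forall>F\<in>faces_of_cell (faces M) T. \<eta> \<ge> diameter T / cell_dist M T F"
      and \<eta>2: "\<forall>F\<in>inner_faces (cells M) (faces M). \<forall>T\<in>cells_of_face (cells M) F. \<forall>T'\<in>cells_of_face (cells M) F.
          T \<noteq> T' \<longrightarrow> \<eta> \<ge> cell_dist M T F / cell_dist M T' F"
      and \<eta>3: "\<forall>F\<in>faces M. \<eta> \<ge> (\<Sum>G\<in>groups_of_face M K F.
        weight M F G * onorm ((*v) (matrix_inv (group_matrix M K G))))"
      and fu: "L2_on \<Omega> f" "weak_solution \<Omega> K f u" "continuous_on (closure \<Omega>) u" "\<forall>P\<in>\<P>. Ck_closure 2 P u"
      and \<gamma>: "\<gamma> > 0" "coercive_fluxes \<gamma> M K" and uh: "mpfa_solution M K f uh"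
    obtain \<S> where \<S>: "matching_simplicial_submesh (cells M) (faces M) \<S>"
      using data unfolding mpfa_data_def regular_mesh_def by (elim conjE exE)
    have mesh: "polytopal_mesh \<Omega> (cells M) (faces M)"
      using data unfolding mpfa_data_def by (elim conjE)
    interpret mpfa_estimate \<Omega> M \<S> \<P> K f u \<rho> l \<Lambda> \<eta>
    proof
      show "transpose (K x) = K x" if "x \<in> \<Omega>" for x
        using assms(2) that unfolding elliptic_tensor_def by blast
      show "\<exists>A. \<forall>x\<in>P. K x = A" "Ck_closure 2 P u" if "P \<in> \<P>" for P
        by (rule bspec[OF \<P>(2) that], rule bspec[OF fu(4) that])
      show "l * (norm \<xi>)\<^sup>2 \<le> (K x *v \<xi>) \<bullet> \<xi>" "(K x *v \<xi>) \<bullet> \<xi> \<le> \<Lambda> * (norm \<xi>)\<^sup>2" if "x \<in> \<Omega>" for x \<xi>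
        using l(2) that by blast+
      show "diameter T / cell_dist M T F \<le> \<eta>" if "T \<in> cells M" "F \<in> faces_of_cell (faces M) T" for T F
        by (rule bspec[OF bspec[OF \<eta>1 that(1)] that(2)])
      show "cell_dist M T F / cell_dist M T' F \<le> \<eta>"
        if "F \<in> inner_faces (cells M) (faces M)" "T \<in> cells_of_face (cells M) F" "T' \<in> cells_of_face (cells M) F" "T \<noteq> T'" for F T T'
        by (rule mp[OF bspec[OF bspec[OF bspec[OF \<eta>2 that(1)] that(2)] that(3)] that(4)])
      show "(\<Sum>g\<in>groups_of_face M K F. weight M F g * onorm ((*v) (matrix_inv (group_matrix M K g)))) \<le> \<eta>"
        if "F \<in> faces M" for F
        by (rule bspec[OF \<eta>3 that])
    qed (fact \<S> mesh assms(1) \<P>(1) data fu(1-3) l(1))+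
    have "discrete_norm M K (\<lambda>T. uh T - u (cell_point M T)) \<le>
        inverse \<gamma> * (E * sqrt (real CARD('n) * measure lebesgue \<Omega> / l))"
      by (rule error_estimate[OF \<gamma> uh])
    also have "\<dots> = C * inverse \<gamma> * C2_norm \<P> u * mesh_size (cells M)"
      by (simp add: C_def E_def R_def L_def D_def algebra_simps)
    finally show "discrete_norm M K (\<lambda>T. uh T - u (cell_point M T)) \<le> C * inverse \<gamma> * C2_norm \<P> u * mesh_size (cells M)" .
  qed
qed

end
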